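(* Let $\mathcal{C}$ be a finite tensor category over $k$ with integration functor $I: \mathcal{C} \to \mathcal{C}$. Then for every $X \in \mathcal{C}$ the object $I(X)$ is trivial, i.e. isomorphic to a direct sum of finitely many (possibly zero) copies of the unit object $\mathbf{1}$.
   Context: Setting. $k$ is an algebraically closed field of arbitrary characteristic. A finite abelian category over $k$ is a $k$-linear category equivalent to the category of finite-dimensional left modules over a finite-dimensional $k$-algebra. A finite tensor category over $k$ is a rigid monoidal category $\mathcal{C}$ (taken to be strict, with unit object $\mathbf{1}$) that is a finite abelian category over $k$, whose tensor product is $k$-linear in each variable, and whose unit object is simple. The left dual of $X$ is $(X^*, \mathrm{ev}_X: X^* \otimes X \to \mathbf{1}, \mathrm{coev}_X: \mathbf{1} \to X \otimes X^* )$. Central Hopf comonad. For $V \in \mathcal{C}$ the end $\mathsf{Z}(V) = \int_{X \in \mathcal{C}} X \otimes V \otimes X^*$ exists; let $\pi_{V;X}: \mathsf{Z}(V) \to X \otimes V \otimes X^*$ be its universal dinatural transformation, natural in $V$. Put $\varepsilon_V := \pi_{V;\mathbf{1}}: \mathsf{Z}(V) \to V$ and let $\mathsf{m}_{V,W}: \mathsf{Z}(V) \otimes \mathsf{Z}(W) \to \mathsf{Z}(V \otimes W)$ be determined by $\pi_{V \otimes W;X} \circ \mathsf{m}_{V,W} = (\mathrm{id}_X \otimes \mathrm{id}_V \otimes \mathrm{ev}_X \otimes \mathrm{id}_W \otimes \mathrm{id}_{X^*}) \circ (\pi_{V;X} \otimes \pi_{W;X})$ for all $V,W,X \in \mathcal{C}$.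 Modular object. Let $\mathsf{R}: \mathcal{C} \to \mathcal{Z}(\mathcal{C})$ be a right adjoint of the forgetful functor $\mathsf{U}$ from the Drinfeld center $\mathcal{Z}(\mathcal{C})$ to $\mathcal{C}$ (one has $\mathsf{Z} = \mathsf{U}\mathsf{R}$). The modular object $\alpha$ of $\mathcal{C}$ is the unique (up to isomorphism) simple object of $\mathcal{C}$ with $\mathrm{Hom}_{\mathcal{Z}(\mathcal{C})}(\mathsf{R}(\alpha), \mathbf{1}) \neq 0$; it is invertible. Integration functor. A categorical left integral is a morphism $\Lambda: \mathbf{1} \to \mathsf{Z}(\alpha)$ in $\mathcal{C}$ with $\mathsf{m}_{\mathbf{1},\alpha} \circ (\mathrm{id}_{\mathsf{Z}(\mathbf{1})} \otimes \Lambda) = \varepsilon_{\mathbf{1}} \otimes \Lambda$; the space of these is one-dimensional. Fix a non-zero categorical left integral $\Lambda$ and let $\widetilde{\Lambda}_X := (\mathrm{id}_X \otimes \mathrm{id}_{\alpha} \otimes \mathrm{ev}_X) \circ (\pi_{\alpha;X} \otimes \mathrm{id}_X) \circ (\Lambda \otimes \mathrm{id}_X): X \to X \otimes \alpha$, a natural transformation in $X \in \mathcal{C}$. Then $I(X) \subset X$ is the image of the morphism $(\mathrm{id}_X \otimes \mathrm{coev}_{\alpha}^{-1}) \circ (\widetilde{\Lambda}_X \otimes \mathrm{id}_{\alpha^*}): X \otimes \alpha^* \to X$; $I$ is a $k$-linear endofunctor of $\mathcal{C}$ for which the inclusion $I(X) \hookrightarrow X$ is natural, and it does not depend on the choice of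 $\Lambda$. *)

theory Defs
  imports "HOL-Algebra.Algebraic_Closure" "HOL-Algebra.Module"
begin

no_notation var (\<open>X\<index>\<close>)

section \<open>Categories and functors\<close>

record ('o, 'm) cat =
  Obj :: "'o set"
  Arr :: "'m set"
  Dom :: "'m \<Rightarrow> 'o"
  Cod :: "'m \<Rightarrow> 'o"
  Ident :: "'o \<Rightarrow> 'm" (\<open>ident\<index>\<close>)
  Comp :: "'m \<Rightarrow> 'm \<Rightarrow> 'm" (infixr \<open>\<cdot>\<index>\<close> 70)

definition Hom :: "('o, 'm, 'z) cat_scheme \<Rightarrow> 'o \<Rightarrow> 'o \<Rightarrow> 'm set" where
  "Hom C X Y = {f \<in> Arr C. Dom C f = X \<and> Cod C f = Y}"

locale category =
  fixes C :: "('o, 'm, 'z) cat_scheme" (structure)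
  assumes Dom_Obj: "f \<in> Arr C \<Longrightarrow> Dom C f \<in> Obj C"
    and Cod_Obj: "f \<in> Arr C \<Longrightarrow> Cod C f \<in> Obj C"
    and ident_Hom: "X \<in> Obj C \<Longrightarrow> ident X \<in> Hom C X X"
    and Comp_Hom: "\<lbrakk>f \<in> Hom C X Y; g \<in> Hom C Y W\<rbrakk> \<Longrightarrow> g \<cdot> f \<in> Hom C X W"
    and ident_left: "f \<in> Hom C X Y \<Longrightarrow> ident Y \<cdot> f = f"
    and ident_right: "f \<in> Hom C X Y \<Longrightarrow> f \<cdot> ident X = f"
    and Comp_assoc: "\<lbrakk>f \<in> Hom C X Y; g \<in> Hom C Y W; h \<in> Hom C W V\<rbrakk>
          \<Longrightarrow> (h \<cdot> g) \<cdot> f = h \<cdot> (g \<cdot> f)"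

context
  fixes C :: "('o, 'm, 'z) cat_scheme" (structure)
begin

definition inverse_arrows :: "'o \<Rightarrow> 'o \<Rightarrow> 'm \<Rightarrow> 'm \<Rightarrow> bool" where
  "inverse_arrows X Y f g \<longleftrightarrow> f \<in> Hom C X Y \<and> g \<in> Hom C Y X \<and> g \<cdot> f = ident X \<and> f \<cdot> g = ident Y"

definition iso_arrow :: "'o \<Rightarrow> 'o \<Rightarrow> 'm \<Rightarrow> bool" where
  "iso_arrow X Y f \<longleftrightarrow> (\<exists>g. inverse_arrows X Y f g)"

definition isomorphic :: "'o \<Rightarrow> 'o \<Rightarrow> bool" where
  "isomorphic X Y \<longleftrightarrow> (\<exists>f. iso_arrow X Y f)"

definition mono_arrow :: "'o \<Rightarrow> 'o \<Rightarrow> 'm \<Rightarrow> bool" where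
  "mono_arrow X Y f \<longleftrightarrow> f \<in> Hom C X Y \<and>
     (\<forall>W\<in>Obj C. \<forall>g\<in>Hom C W X. \<forall>h\<in>Hom C W X. f \<cdot> g = f \<cdot> h \<longrightarrow> g = h)"

definition zero_object :: "'o \<Rightarrow> bool" where
  "zero_object X \<longleftrightarrow> X \<in> Obj C \<and>
     (\<forall>Y\<in>Obj C. (\<exists>!f. f \<in> Hom C X Y) \<and> (\<exists>!f. f \<in> Hom C Y X))"

definition simple_object :: "'o \<Rightarrow> bool" where
  "simple_object X \<longleftrightarrow> X \<in> Obj C \<and> \<not> zero_object X \<and>
     (\<forall>Y\<in>Obj C. \<forall>i. mono_arrow Y X i \<longrightarrow> zero_object Y \<or> iso_arrow Y X i)"

text \<open>The image of \<open>f : X \<rightarrow> Y\<close> is the smallest subobject of \<open>Y\<close> through which \<open>f\<close> factors.\<close>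

definition is_image :: "'o \<Rightarrow> 'o \<Rightarrow> 'm \<Rightarrow> 'o \<Rightarrow> 'm \<Rightarrow> bool" where
  "is_image X Y f J i \<longleftrightarrow> f \<in> Hom C X Y \<and> J \<in> Obj C \<and> mono_arrow J Y i \<and>
     (\<exists>e\<in>Hom C X J. f = i \<cdot> e) \<and>
     (\<forall>J'\<in>Obj C. \<forall>i'. mono_arrow J' Y i' \<and> (\<exists>e\<in>Hom C X J'. f = i' \<cdot> e) \<longrightarrow>
        (\<exists>u\<in>Hom C J J'. i = i' \<cdot> u))"

end

record ('o, 'm, 'p, 'n) fctr =
  OMap :: "'o \<Rightarrow> 'p"
  AMap :: "'m \<Rightarrow> 'n"

definition is_functor ::
    "('o, 'm, 'y) cat_scheme \<Rightarrow> ('p, 'n, 'z) cat_scheme \<Rightarrow> ('o, 'm, 'p, 'n) fctr \<Rightarrow> bool" where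
  "is_functor C D F \<longleftrightarrow> category C \<and> category D \<and>
     (\<forall>X\<in>Obj C. OMap F X \<in> Obj D) \<and>
     (\<forall>X\<in>Obj C. \<forall>Y\<in>Obj C. \<forall>f\<in>Hom C X Y. AMap F f \<in> Hom D (OMap F X) (OMap F Y)) \<and>
     (\<forall>X\<in>Obj C. AMap F (ident\<^bsub>C\<^esub> X) = ident\<^bsub>D\<^esub> (OMap F X)) \<and>
     (\<forall>X\<in>Obj C. \<forall>Y\<in>Obj C. \<forall>W\<in>Obj C. \<forall>f\<in>Hom C X Y. \<forall>g\<in>Hom C Y W.
        AMap F (g \<cdot>\<^bsub>C\<^esub> f) = AMap F g \<cdot>\<^bsub>D\<^esub> AMap F f)"

definition id_functor :: "('o, 'm, 'o, 'm) fctr" where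
  "id_functor = \<lparr>OMap = (\<lambda>X. X), AMap = (\<lambda>f. f)\<rparr>"

definition comp_functor ::
    "('p, 'n, 'q, 'l) fctr \<Rightarrow> ('o, 'm, 'p, 'n) fctr \<Rightarrow> ('o, 'm, 'q, 'l) fctr" where
  "comp_functor G F = \<lparr>OMap = OMap G \<circ> OMap F, AMap = AMap G \<circ> AMap F\<rparr>"

definition nat_transformation :: "('o, 'm, 'y) cat_scheme \<Rightarrow> ('p, 'n, 'z) cat_scheme
    \<Rightarrow> ('o, 'm, 'p, 'n) fctr \<Rightarrow> ('o, 'm, 'p, 'n) fctr \<Rightarrow> ('o \<Rightarrow> 'n) \<Rightarrow> bool" where
  "nat_transformation C D F G \<eta> \<longleftrightarrow>
     (\<forall>X\<in>Obj C. \<eta> X \<in> Hom D (OMap F X) (OMap G X)) \<and>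
     (\<forall>X\<in>Obj C. \<forall>Y\<in>Obj C. \<forall>f\<in>Hom C X Y. AMap G f \<cdot>\<^bsub>D\<^esub> \<eta> X = \<eta> Y \<cdot>\<^bsub>D\<^esub> AMap F f)"

definition naturally_isomorphic :: "('o, 'm, 'y) cat_scheme \<Rightarrow> ('p, 'n, 'z) cat_scheme
    \<Rightarrow> ('o, 'm, 'p, 'n) fctr \<Rightarrow> ('o, 'm, 'p, 'n) fctr \<Rightarrow> bool" where
  "naturally_isomorphic C D F G \<longleftrightarrow> (\<exists>\<eta>. nat_transformation C D F G \<eta> \<and>
     (\<forall>X\<in>Obj C. iso_arrow D (OMap F X) (OMap G X) (\<eta> X)))"

definition right_adjoint :: "('p, 'n, 'y) cat_scheme \<Rightarrow> ('o, 'm, 'z) cat_scheme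
    \<Rightarrow> ('p, 'n, 'o, 'm) fctr \<Rightarrow> ('o, 'm, 'p, 'n) fctr \<Rightarrow> bool" where
  "right_adjoint D C U R \<longleftrightarrow> is_functor D C U \<and> is_functor C D R \<and>
     (\<exists>\<Phi>. (\<forall>A\<in>Obj D. \<forall>X\<in>Obj C. bij_betw (\<Phi> A X) (Hom C (OMap U A) X) (Hom D A (OMap R X))) \<and>
       (\<forall>A\<in>Obj D. \<forall>A'\<in>Obj D. \<forall>X\<in>Obj C. \<forall>X'\<in>Obj C.
         \<forall>a\<in>Hom D A' A. \<forall>g\<in>Hom C (OMap U A) X. \<forall>x\<in>Hom C X X'.
           \<Phi> A' X' (x \<cdot>\<^bsub>C\<^esub> g \<cdot>\<^bsub>C\<^esub> AMap U a) = AMap R x \<cdot>\<^bsub>D\<^esub> \<Phi> A X g \<cdot>\<^bsub>D\<^esub> a))"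


section \<open>Linear categories\<close>

record ('k, 'o, 'm) lcat = "('o, 'm) cat" +
  Zer :: "'o \<Rightarrow> 'o \<Rightarrow> 'm"
  Add :: "'m \<Rightarrow> 'm \<Rightarrow> 'm"
  Scal :: "'k \<Rightarrow> 'm \<Rightarrow> 'm"

text \<open>The fields \<open>mult\<close> and \<open>one\<close> play no role in the library's notion of a module.\<close>

definition hom_space :: "('k, 'o, 'm, 'z) lcat_scheme \<Rightarrow> 'o \<Rightarrow> 'o \<Rightarrow> ('k, 'm) module" where
  "hom_space C X Y = \<lparr>carrier = Hom C X Y, monoid.mult = undefined, one = undefined,
     zero = Zer C X Y, add = Add C, smult = Scal C\<rparr>"

locale linear_category = K?: field K + category C
  for K :: "('k, 'x) ring_scheme" and C :: "('k, 'o, 'm, 'z) lcat_scheme" (structure) +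
  assumes hom_space: "\<lbrakk>X \<in> Obj C; Y \<in> Obj C\<rbrakk> \<Longrightarrow> module K (hom_space C X Y)"
    and Comp_Add_right: "\<lbrakk>f \<in> Hom C X Y; f' \<in> Hom C X Y; g \<in> Hom C Y W\<rbrakk>
          \<Longrightarrow> g \<cdot> Add C f f' = Add C (g \<cdot> f) (g \<cdot> f')"
    and Comp_Add_left: "\<lbrakk>f \<in> Hom C X Y; g \<in> Hom C Y W; g' \<in> Hom C Y W\<rbrakk>
          \<Longrightarrow> Add C g g' \<cdot> f = Add C (g \<cdot> f) (g' \<cdot> f)"
    and Comp_Scal_right: "\<lbrakk>c \<in> carrier K; f \<in> Hom C X Y; g \<in> Hom C Y W\<rbrakk>
          \<Longrightarrow> g \<cdot> Scal C c f = Scal C c (g \<cdot> f)"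
    and Comp_Scal_left: "\<lbrakk>c \<in> carrier K; f \<in> Hom C X Y; g \<in> Hom C Y W\<rbrakk>
          \<Longrightarrow> Scal C c g \<cdot> f = Scal C c (g \<cdot> f)"

definition linear_functor :: "('k, 'x) ring_scheme \<Rightarrow> ('k, 'o, 'm, 'y) lcat_scheme
    \<Rightarrow> ('k, 'p, 'n, 'z) lcat_scheme \<Rightarrow> ('o, 'm, 'p, 'n) fctr \<Rightarrow> bool" where
  "linear_functor K C D F \<longleftrightarrow> is_functor C D F \<and>
     (\<forall>X\<in>Obj C. \<forall>Y\<in>Obj C. \<forall>f\<in>Hom C X Y.
        (\<forall>g\<in>Hom C X Y. AMap F (Add C f g) = Add D (AMap F f) (AMap F g)) \<and>
        (\<forall>c\<in>carrier K. AMap F (Scal C c f) = Scal D c (AMap F f)))"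

definition linearly_equivalent :: "('k, 'x) ring_scheme \<Rightarrow> ('k, 'o, 'm, 'y) lcat_scheme
    \<Rightarrow> ('k, 'p, 'n, 'z) lcat_scheme \<Rightarrow> bool" where
  "linearly_equivalent K C D \<longleftrightarrow> (\<exists>F G. linear_functor K C D F \<and> linear_functor K D C G \<and>
     naturally_isomorphic C C id_functor (comp_functor G F) \<and>
     naturally_isomorphic D D (comp_functor F G) id_functor)"

context
  fixes C :: "('k, 'o, 'm, 'z) lcat_scheme" (structure)
begin

definition is_direct_sum :: "nat \<Rightarrow> (nat \<Rightarrow> 'o) \<Rightarrow> 'o \<Rightarrow> bool" where
  "is_direct_sum n Y S \<longleftrightarrow> S \<in> Obj C \<and>
     (\<exists>i p. (\<forall>j<n. i j \<in> Hom C (Y j) S \<and> p j \<in> Hom C S (Y j)) \<and>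
        (\<forall>j<n. \<forall>l<n. p j \<cdot> i l = (if j = l then ident (Y j) else Zer C (Y l) (Y j))) \<and>
        (\<Oplus>\<^bsub>hom_space C S S\<^esub>j\<in>{..<n}. i j \<cdot> p j) = ident S)"

end


section \<open>Finite abelian categories\<close>

definition finite_dim :: "('k, 'x) ring_scheme \<Rightarrow> ('k, 'v, 'z) module_scheme \<Rightarrow> bool" where
  "finite_dim K M \<longleftrightarrow> (\<exists>B. finite B \<and> B \<subseteq> carrier M \<and>
     (\<forall>v\<in>carrier M. \<exists>a\<in>B \<rightarrow> carrier K. v = (\<Oplus>\<^bsub>M\<^esub>b\<in>B. a b \<odot>\<^bsub>M\<^esub> b)))"

text \<open>The library's locales \<^locale>\<open>algebra\<close> and \<^locale>\<open>module\<close> are about commutative algebras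
  and about modules over commutative rings, hence the next two definitions.\<close>

definition fd_algebra :: "('k, 'x) ring_scheme \<Rightarrow> ('k, 'a, 'z) module_scheme \<Rightarrow> bool" where
  "fd_algebra K A \<longleftrightarrow> module K A \<and> ring A \<and>
     (\<forall>c\<in>carrier K. \<forall>x\<in>carrier A. \<forall>y\<in>carrier A.
        (c \<odot>\<^bsub>A\<^esub> x) \<otimes>\<^bsub>A\<^esub> y = c \<odot>\<^bsub>A\<^esub> (x \<otimes>\<^bsub>A\<^esub> y) \<and>
        x \<otimes>\<^bsub>A\<^esub> (c \<odot>\<^bsub>A\<^esub> y) = c \<odot>\<^bsub>A\<^esub> (x \<otimes>\<^bsub>A\<^esub> y)) \<and>
     finite_dim K A"

definition left_module :: "('a, 'y) ring_scheme \<Rightarrow> ('a, 'v, 'z) module_scheme \<Rightarrow> bool" where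
  "left_module A M \<longleftrightarrow> ring A \<and> abelian_group M \<and>
     (\<forall>a\<in>carrier A. \<forall>v\<in>carrier M. a \<odot>\<^bsub>M\<^esub> v \<in> carrier M) \<and>
     (\<forall>a\<in>carrier A. \<forall>b\<in>carrier A. \<forall>v\<in>carrier M.
        (a \<oplus>\<^bsub>A\<^esub> b) \<odot>\<^bsub>M\<^esub> v = a \<odot>\<^bsub>M\<^esub> v \<oplus>\<^bsub>M\<^esub> b \<odot>\<^bsub>M\<^esub> v \<and>
        (a \<otimes>\<^bsub>A\<^esub> b) \<odot>\<^bsub>M\<^esub> v = a \<odot>\<^bsub>M\<^esub> (b \<odot>\<^bsub>M\<^esub> v)) \<and>
     (\<forall>a\<in>carrier A. \<forall>v\<in>carrier M. \<forall>w\<in>carrier M.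
        a \<odot>\<^bsub>M\<^esub> (v \<oplus>\<^bsub>M\<^esub> w) = a \<odot>\<^bsub>M\<^esub> v \<oplus>\<^bsub>M\<^esub> a \<odot>\<^bsub>M\<^esub> w) \<and>
     (\<forall>v\<in>carrier M. \<one>\<^bsub>A\<^esub> \<odot>\<^bsub>M\<^esub> v = v)"

definition restrict_scalars :: "('k, 'a, 'y) module_scheme \<Rightarrow> ('a, 'v, 'z) module_scheme
    \<Rightarrow> ('k, 'v) module" where
  "restrict_scalars A M = \<lparr>carrier = carrier M, monoid.mult = monoid.mult M, one = one M,
     zero = zero M, add = add M, smult = (\<lambda>c v. (c \<odot>\<^bsub>A\<^esub> \<one>\<^bsub>A\<^esub>) \<odot>\<^bsub>M\<^esub> v)\<rparr>"

definition fd_left_modules ::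
    "('k, 'x) ring_scheme \<Rightarrow> ('k, 'a, 'y) module_scheme \<Rightarrow> ('a, 'v) module set" where
  "fd_left_modules K A = {M. left_module A M \<and> finite_dim K (restrict_scalars A M)}"

definition module_homs ::
    "('a, 'y) ring_scheme \<Rightarrow> ('a, 'v) module \<Rightarrow> ('a, 'v) module \<Rightarrow> ('v \<Rightarrow> 'v) set" where
  "module_homs A M N = {f \<in> carrier M \<rightarrow>\<^sub>E carrier N.
     (\<forall>v\<in>carrier M. \<forall>w\<in>carrier M. f (v \<oplus>\<^bsub>M\<^esub> w) = f v \<oplus>\<^bsub>N\<^esub> f w) \<and>
     (\<forall>a\<in>carrier A. \<forall>v\<in>carrier M. f (a \<odot>\<^bsub>M\<^esub> v) = a \<odot>\<^bsub>N\<^esub> f v)}"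

text \<open>The category of finite-dimensional left \<open>A\<close>-modules whose underlying sets lie in the type
  \<open>'v\<close>. An arrow is a homomorphism together with its source and target.\<close>

definition module_category :: "('k, 'x) ring_scheme \<Rightarrow> ('k, 'a, 'y) module_scheme
    \<Rightarrow> ('k, ('a, 'v) module, ('a, 'v) module \<times> ('v \<Rightarrow> 'v) \<times> ('a, 'v) module) lcat" where
  "module_category K A = \<lparr>
     Obj = fd_left_modules K A,
     Arr = {(M, f, N). M \<in> fd_left_modules K A \<and> N \<in> fd_left_modules K A \<and> f \<in> module_homs A M N},
     Dom = (\<lambda>(M, f, N). M),
     Cod = (\<lambda>(M, f, N). N),
     Ident = (\<lambda>M. (M, restrict (\<lambda>v. v) (carrier M), M)),
     Comp = (\<lambda>(N, g, P) (M, f, N'). (M, compose (carrier M) g f, P)),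
     Zer = (\<lambda>M N. (M, (\<lambda>v\<in>carrier M. \<zero>\<^bsub>N\<^esub>), N)),
     Add = (\<lambda>(M, f, N) (M', g, N'). (M, (\<lambda>v\<in>carrier M. f v \<oplus>\<^bsub>N\<^esub> g v), N)),
     Scal = (\<lambda>c (M, f, N). (M, (\<lambda>v\<in>carrier M. (c \<odot>\<^bsub>A\<^esub> \<one>\<^bsub>A\<^esub>) \<odot>\<^bsub>N\<^esub> f v), N))\<rparr>"

text \<open>Every finite-dimensional algebra and every finite-dimensional module is isomorphic to one
  whose underlying set is a subset of \<^typ>\<open>nat \<Rightarrow> 'k\<close> (the sequences in the field that vanish from
  the dimension on), so fixing this type as the universe loses no algebra and, up to equivalence,
  does not change the module categories.\<close>

definition finite_abelian_category ::
    "('k, 'x) ring_scheme \<Rightarrow> ('k, 'o, 'm, 'z) lcat_scheme \<Rightarrow> bool" where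
  "finite_abelian_category K C \<longleftrightarrow> linear_category K C \<and>
     (\<exists>A :: ('k, nat \<Rightarrow> 'k) module. fd_algebra K A \<and>
        linearly_equivalent K C
          (module_category K A :: ('k, (nat \<Rightarrow> 'k, nat \<Rightarrow> 'k) module,
             (nat \<Rightarrow> 'k, nat \<Rightarrow> 'k) module \<times> ((nat \<Rightarrow> 'k) \<Rightarrow> (nat \<Rightarrow> 'k))
               \<times> (nat \<Rightarrow> 'k, nat \<Rightarrow> 'k) module) lcat))"


section \<open>Finite tensor categories\<close>

record ('k, 'o, 'm) tcat = "('k, 'o, 'm) lcat" +
  Unit :: "'o" (\<open>\<I>\<index>\<close>)
  TObj :: "'o \<Rightarrow> 'o \<Rightarrow> 'o" (infixl \<open>\<otimes>\<^sub>o\<index>\<close> 75)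
  TArr :: "'m \<Rightarrow> 'm \<Rightarrow> 'm" (infixl \<open>\<otimes>\<^sub>a\<index>\<close> 75)
  Dual :: "'o \<Rightarrow> 'o"
  Ev :: "'o \<Rightarrow> 'm"
  Coev :: "'o \<Rightarrow> 'm"

locale strict_monoidal_category = category C
  for C :: "('k, 'o, 'm, 'z) tcat_scheme" (structure) +
  assumes Unit_Obj: "\<I> \<in> Obj C"
    and TObj_Obj: "\<lbrakk>X \<in> Obj C; Y \<in> Obj C\<rbrakk> \<Longrightarrow> X \<otimes>\<^sub>o Y \<in> Obj C"
    and TArr_Hom: "\<lbrakk>f \<in> Hom C X Y; g \<in> Hom C X' Y'\<rbrakk> \<Longrightarrow> f \<otimes>\<^sub>a g \<in> Hom C (X \<otimes>\<^sub>o X') (Y \<otimes>\<^sub>o Y')"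
    and TArr_ident: "\<lbrakk>X \<in> Obj C; Y \<in> Obj C\<rbrakk> \<Longrightarrow> ident X \<otimes>\<^sub>a ident Y = ident (X \<otimes>\<^sub>o Y)"
    and TArr_Comp: "\<lbrakk>f \<in> Hom C X Y; g \<in> Hom C Y W; f' \<in> Hom C X' Y'; g' \<in> Hom C Y' W'\<rbrakk>
          \<Longrightarrow> (g \<cdot> f) \<otimes>\<^sub>a (g' \<cdot> f') = (g \<otimes>\<^sub>a g') \<cdot> (f \<otimes>\<^sub>a f')"
    and TObj_assoc: "\<lbrakk>X \<in> Obj C; Y \<in> Obj C; W \<in> Obj C\<rbrakk>
          \<Longrightarrow> (X \<otimes>\<^sub>o Y) \<otimes>\<^sub>o W = X \<otimes>\<^sub>o (Y \<otimes>\<^sub>o W)"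
    and TArr_assoc: "\<lbrakk>f \<in> Arr C; g \<in> Arr C; h \<in> Arr C\<rbrakk> \<Longrightarrow> (f \<otimes>\<^sub>a g) \<otimes>\<^sub>a h = f \<otimes>\<^sub>a (g \<otimes>\<^sub>a h)"
    and TObj_Unit: "X \<in> Obj C \<Longrightarrow> \<I> \<otimes>\<^sub>o X = X" "X \<in> Obj C \<Longrightarrow> X \<otimes>\<^sub>o \<I> = X"
    and TArr_Unit: "f \<in> Arr C \<Longrightarrow> ident \<I> \<otimes>\<^sub>a f = f" "f \<in> Arr C \<Longrightarrow> f \<otimes>\<^sub>a ident \<I> = f"

definition is_left_dual ::
    "('k, 'o, 'm, 'z) tcat_scheme \<Rightarrow> 'o \<Rightarrow> 'o \<Rightarrow> 'm \<Rightarrow> 'm \<Rightarrow> bool" where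
  "is_left_dual C X X' e c \<longleftrightarrow> X \<in> Obj C \<and> X' \<in> Obj C \<and>
     e \<in> Hom C (X' \<otimes>\<^sub>o\<^bsub>C\<^esub> X) \<I>\<^bsub>C\<^esub> \<and> c \<in> Hom C \<I>\<^bsub>C\<^esub> (X \<otimes>\<^sub>o\<^bsub>C\<^esub> X') \<and>
     (ident\<^bsub>C\<^esub> X \<otimes>\<^sub>a\<^bsub>C\<^esub> e) \<cdot>\<^bsub>C\<^esub> (c \<otimes>\<^sub>a\<^bsub>C\<^esub> ident\<^bsub>C\<^esub> X) = ident\<^bsub>C\<^esub> X \<and>
     (e \<otimes>\<^sub>a\<^bsub>C\<^esub> ident\<^bsub>C\<^esub> X') \<cdot>\<^bsub>C\<^esub> (ident\<^bsub>C\<^esub> X' \<otimes>\<^sub>a\<^bsub>C\<^esub> c) = ident\<^bsub>C\<^esub> X'"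

text \<open>\<open>Dual\<close>, \<open>Ev\<close>, \<open>Coev\<close> are an arbitrary choice of left duals. An object \<open>Y\<close> is a right dual
  of \<open>X\<close> iff \<open>X\<close> is a left dual of \<open>Y\<close>.\<close>

locale finite_tensor_category = strict_monoidal_category C
  for K :: "('k, 'x) ring_scheme" and C :: "('k, 'o, 'm, 'z) tcat_scheme" (structure) +
  assumes finite_abelian: "finite_abelian_category K C"
    and left_dual: "X \<in> Obj C \<Longrightarrow> is_left_dual C X (Dual C X) (Ev C X) (Coev C X)"
    and right_dual: "X \<in> Obj C \<Longrightarrow> \<exists>Y e c. is_left_dual C Y X e c"
    and TArr_Add_left: "\<lbrakk>f \<in> Hom C X Y; f' \<in> Hom C X Y; g \<in> Hom C X' Y'\<rbrakk>
          \<Longrightarrow> Add C f f' \<otimes>\<^sub>a g = Add C (f \<otimes>\<^sub>a g) (f' \<otimes>\<^sub>a g)"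
    and TArr_Add_right: "\<lbrakk>f \<in> Hom C X Y; g \<in> Hom C X' Y'; g' \<in> Hom C X' Y'\<rbrakk>
          \<Longrightarrow> f \<otimes>\<^sub>a Add C g g' = Add C (f \<otimes>\<^sub>a g) (f \<otimes>\<^sub>a g')"
    and TArr_Scal_left: "\<lbrakk>c \<in> carrier K; f \<in> Hom C X Y; g \<in> Hom C X' Y'\<rbrakk>
          \<Longrightarrow> Scal C c f \<otimes>\<^sub>a g = Scal C c (f \<otimes>\<^sub>a g)"
    and TArr_Scal_right: "\<lbrakk>c \<in> carrier K; f \<in> Hom C X Y; g \<in> Hom C X' Y'\<rbrakk>
          \<Longrightarrow> f \<otimes>\<^sub>a Scal C c g = Scal C c (f \<otimes>\<^sub>a g)"
    and simple_Unit: "simple_object C \<I>"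


section \<open>The Drinfeld center\<close>

context
  fixes C :: "('k, 'o, 'm, 'z) tcat_scheme" (structure)
begin

text \<open>Extensionality only makes half-braidings that agree on objects equal. The condition on the
  unit object follows from the one on tensor products and invertibility.\<close>

definition half_braiding :: "'o \<Rightarrow> ('o \<Rightarrow> 'm) \<Rightarrow> bool" where
  "half_braiding V \<sigma> \<longleftrightarrow> V \<in> Obj C \<and> \<sigma> \<in> extensional (Obj C) \<and>
     (\<forall>X\<in>Obj C. iso_arrow C (V \<otimes>\<^sub>o X) (X \<otimes>\<^sub>o V) (\<sigma> X)) \<and>
     (\<forall>X\<in>Obj C. \<forall>Y\<in>Obj C. \<forall>f\<in>Hom C X Y.
        (f \<otimes>\<^sub>a ident V) \<cdot> \<sigma> X = \<sigma> Y \<cdot> (ident V \<otimes>\<^sub>a f)) \<and>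
     (\<forall>X\<in>Obj C. \<forall>Y\<in>Obj C. \<sigma> (X \<otimes>\<^sub>o Y) = (ident X \<otimes>\<^sub>a \<sigma> Y) \<cdot> (\<sigma> X \<otimes>\<^sub>a ident Y))"

definition center_homs :: "'o \<times> ('o \<Rightarrow> 'm) \<Rightarrow> 'o \<times> ('o \<Rightarrow> 'm) \<Rightarrow> 'm set" where
  "center_homs A B = {f \<in> Hom C (fst A) (fst B).
     \<forall>X\<in>Obj C. (ident X \<otimes>\<^sub>a f) \<cdot> snd A X = snd B X \<cdot> (f \<otimes>\<^sub>a ident X)}"

definition drinfeld_center :: "('k, 'o \<times> ('o \<Rightarrow> 'm),
    ('o \<times> ('o \<Rightarrow> 'm)) \<times> 'm \<times> ('o \<times> ('o \<Rightarrow> 'm))) lcat" where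
  "drinfeld_center = \<lparr>
     Obj = {(V, \<sigma>). half_braiding V \<sigma>},
     Arr = {(A, f, B). half_braiding (fst A) (snd A) \<and> half_braiding (fst B) (snd B) \<and>
              f \<in> center_homs A B},
     Dom = (\<lambda>(A, f, B). A),
     Cod = (\<lambda>(A, f, B). B),
     Ident = (\<lambda>A. (A, ident (fst A), A)),
     Comp = (\<lambda>(B, g, D) (A, f, B'). (A, g \<cdot> f, D)),
     Zer = (\<lambda>A B. (A, Zer C (fst A) (fst B), B)),
     Add = (\<lambda>(A, f, B) (A', g, B'). (A, Add C f g, B)),
     Scal = (\<lambda>c (A, f, B). (A, Scal C c f, B))\<rparr>"

definition center_unit :: "'o \<times> ('o \<Rightarrow> 'm)" where
  "center_unit = (\<I>, \<lambda>X\<in>Obj C. ident X)"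

definition center_forget :: "('o \<times> ('o \<Rightarrow> 'm),
    ('o \<times> ('o \<Rightarrow> 'm)) \<times> 'm \<times> ('o \<times> ('o \<Rightarrow> 'm)), 'o, 'm) fctr" where
  "center_forget = \<lparr>OMap = fst, AMap = (\<lambda>(A, f, B). f)\<rparr>"


section \<open>The central Hopf comonad\<close>

definition dual_arrow :: "'o \<Rightarrow> 'o \<Rightarrow> 'm \<Rightarrow> 'm" where
  "dual_arrow X Y f = (Ev C Y \<otimes>\<^sub>a ident (Dual C X)) \<cdot>
     (ident (Dual C Y) \<otimes>\<^sub>a f \<otimes>\<^sub>a ident (Dual C X)) \<cdot> (ident (Dual C Y) \<otimes>\<^sub>a Coev C X)"

definition dinatural_from :: "'o \<Rightarrow> 'o \<Rightarrow> ('o \<Rightarrow> 'm) \<Rightarrow> bool" where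
  "dinatural_from V W \<rho> \<longleftrightarrow> W \<in> Obj C \<and>
     (\<forall>X\<in>Obj C. \<rho> X \<in> Hom C W (X \<otimes>\<^sub>o V \<otimes>\<^sub>o Dual C X)) \<and>
     (\<forall>X\<in>Obj C. \<forall>Y\<in>Obj C. \<forall>f\<in>Hom C X Y.
        (f \<otimes>\<^sub>a ident V \<otimes>\<^sub>a ident (Dual C X)) \<cdot> \<rho> X =
        (ident Y \<otimes>\<^sub>a ident V \<otimes>\<^sub>a dual_arrow X Y f) \<cdot> \<rho> Y)"

text \<open>\<open>\<pi> V X\<close> is the component \<open>Z V \<rightarrow> X \<otimes> V \<otimes> X\<^sup>*\<close>.\<close>

definition central_comonad :: "('o, 'm, 'o, 'm) fctr \<Rightarrow> ('o \<Rightarrow> 'o \<Rightarrow> 'm) \<Rightarrow> bool" where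
  "central_comonad Z \<pi> \<longleftrightarrow> is_functor C C Z \<and>
     (\<forall>V\<in>Obj C. dinatural_from V (OMap Z V) (\<pi> V) \<and>
        (\<forall>W \<rho>. dinatural_from V W \<rho> \<longrightarrow>
           (\<exists>!h. h \<in> Hom C W (OMap Z V) \<and> (\<forall>X\<in>Obj C. \<pi> V X \<cdot> h = \<rho> X)))) \<and>
     (\<forall>V\<in>Obj C. \<forall>V'\<in>Obj C. \<forall>v\<in>Hom C V V'. \<forall>X\<in>Obj C.
        \<pi> V' X \<cdot> AMap Z v = (ident X \<otimes>\<^sub>a v \<otimes>\<^sub>a ident (Dual C X)) \<cdot> \<pi> V X)"

text \<open>As the chosen dual of the unit object need not be the unit object itself, the identification
  of \<open>V \<otimes> \<I>\<^sup>*\<close> with \<open>V\<close> along \<open>Ev C \<I> : \<I>\<^sup>* = \<I>\<^sup>* \<otimes> \<I> \<rightarrow> \<I>\<close> is made explicit.\<close>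

definition comonad_counit :: "('o \<Rightarrow> 'o \<Rightarrow> 'm) \<Rightarrow> 'o \<Rightarrow> 'm" where
  "comonad_counit \<pi> V = (ident V \<otimes>\<^sub>a Ev C \<I>) \<cdot> \<pi> V \<I>"

definition comonad_mult ::
    "('o, 'm, 'o, 'm) fctr \<Rightarrow> ('o \<Rightarrow> 'o \<Rightarrow> 'm) \<Rightarrow> 'o \<Rightarrow> 'o \<Rightarrow> 'm" where
  "comonad_mult Z \<pi> V W =
     (THE m. m \<in> Hom C (OMap Z V \<otimes>\<^sub>o OMap Z W) (OMap Z (V \<otimes>\<^sub>o W)) \<and>
        (\<forall>X\<in>Obj C. \<pi> (V \<otimes>\<^sub>o W) X \<cdot> m =
           (ident X \<otimes>\<^sub>a ident V \<otimes>\<^sub>a Ev C X \<otimes>\<^sub>a ident W \<otimes>\<^sub>a ident (Dual C X)) \<cdot>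
           (\<pi> V X \<otimes>\<^sub>a \<pi> W X)))"


section \<open>Modular object, categorical integrals and the integration functor\<close>

definition modular_object :: "('o, 'm, 'o \<times> ('o \<Rightarrow> 'm),
    ('o \<times> ('o \<Rightarrow> 'm)) \<times> 'm \<times> ('o \<times> ('o \<Rightarrow> 'm))) fctr \<Rightarrow> 'o \<Rightarrow> bool" where
  "modular_object R \<alpha> \<longleftrightarrow> simple_object C \<alpha> \<and>
     Hom drinfeld_center (OMap R \<alpha>) center_unit \<noteq> {Zer drinfeld_center (OMap R \<alpha>) center_unit}"

definition left_integral ::
    "('o, 'm, 'o, 'm) fctr \<Rightarrow> ('o \<Rightarrow> 'o \<Rightarrow> 'm) \<Rightarrow> 'o \<Rightarrow> 'm \<Rightarrow> bool" where
  "left_integral Z \<pi> \<alpha> \<Lambda> \<longleftrightarrow> \<Lambda> \<in> Hom C \<I> (OMap Z \<alpha>) \<and>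
     comonad_mult Z \<pi> \<I> \<alpha> \<cdot> (ident (OMap Z \<I>) \<otimes>\<^sub>a \<Lambda>) = comonad_counit \<pi> \<I> \<otimes>\<^sub>a \<Lambda>"

definition integral_action :: "('o \<Rightarrow> 'o \<Rightarrow> 'm) \<Rightarrow> 'o \<Rightarrow> 'm \<Rightarrow> 'o \<Rightarrow> 'm" where
  "integral_action \<pi> \<alpha> \<Lambda> X =
     (ident X \<otimes>\<^sub>a ident \<alpha> \<otimes>\<^sub>a Ev C X) \<cdot> (\<pi> \<alpha> X \<otimes>\<^sub>a ident X) \<cdot> (\<Lambda> \<otimes>\<^sub>a ident X)"

text \<open>The arrow \<open>c\<close> below is the inverse of \<open>Coev C \<alpha>\<close>, and \<open>j X : I X \<rightarrow> X\<close> is the inclusion.\<close>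

definition integration_functor :: "('o \<Rightarrow> 'o \<Rightarrow> 'm) \<Rightarrow> 'o \<Rightarrow> 'm
    \<Rightarrow> ('o, 'm, 'o, 'm) fctr \<Rightarrow> ('o \<Rightarrow> 'm) \<Rightarrow> bool" where
  "integration_functor \<pi> \<alpha> \<Lambda> I j \<longleftrightarrow> is_functor C C I \<and> nat_transformation C C I id_functor j \<and>
     (\<exists>c. inverse_arrows C \<I> (\<alpha> \<otimes>\<^sub>o Dual C \<alpha>) (Coev C \<alpha>) c \<and>
        (\<forall>X\<in>Obj C. is_image C (X \<otimes>\<^sub>o Dual C \<alpha>) X
           ((ident X \<otimes>\<^sub>a c) \<cdot> (integral_action \<pi> \<alpha> \<Lambda> X \<otimes>\<^sub>a ident (Dual C \<alpha>)))
           (OMap I X) (j X)))"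

definition trivial_object :: "'o \<Rightarrow> bool" where
  "trivial_object Y \<longleftrightarrow> (\<exists>n S. is_direct_sum C n (\<lambda>_. \<I>) S \<and> isomorphic C Y S)"

end

end

(* The end Z(1) of X (x) X* acts through its counit on the image of an integral: the integral condition
   says this for the arrow whose image is taken, and an equalizer transports it to the image.
   Natural transformations W (x) X -> X correspond to arrows W -> Z(1), so on an object Y with this
   property every such transformation is its component at the unit object tensored with Y.
   Identify the category with the modules over a finite-dimensional algebra A, let P represent the
   fibre functor V and E its dual. Dual bases of the spaces V X give a natural transformation
   P (x) E* (x) X -> X, because the canonical element of V X (x) (V X)* does not depend on the basis.
   At Y it is a sum of q_b (x) x_b with arrows q_b : P -> Y and linearly independent
   x_b : E* (x) Y -> 1. If an element a of A annihilates V(1), then composition with a kills the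
   component at the unit object, hence the one at Y. The unit object is simple and has only scalar
   endomorphisms, so the summands can be separated, and a annihilates V Y. By the density theorem
   V Y is then a direct sum of copies of V(1). *)

theory Submission
  imports Defs
begin

section \<open>Linear algebra over a field\<close>

text \<open>The functor \<open>V\<close> is not monoidal, so the space \<open>V X\<close> and its
  dual cannot appear as tensor factors in the category. Representability turns a vector into an
  arrow out of \<open>P\<close>, and a functional into an arrow to \<open>E\<close>. Rigidity then
  moves \<open>E\<close> to the source, so that only the unit object remains as target and the
  functional leaves no trace there. This is why the canonical element becomes a transformation to
  \<open>X\<close> itself. An element \<open>a\<close> of the algebra enters through right
  multiplication, an endomorphism of \<open>P\<close>. It acts on all components of the
  transformation at once and thereby links the unit object with \<open>Y\<close>. Two obstacles
  shape the rest. The integral relation lives on Z(1) (x) X, whereas minimality of the image speaks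
  of subobjects of \<open>X\<close>; an object that has Z(1) as its left dual moves Z(1) from the
  source to the target. And arrows that are independent over \<open>K\<close> need not be
  independent over the endomorphisms of the unit object. Schur's lemma removes the difference; over
  an algebraically closed field it follows from the existence of eigenvectors, which is proved by
  Horner division.\<close>

lemma (in abelian_group) minus_eq_zero_iff:
  assumes "x \<in> carrier G" "y \<in> carrier G"
  shows "x \<ominus> y = \<zero> \<longleftrightarrow> x = y"
proof
  assume "x \<ominus> y = \<zero>"
  then have "x \<ominus> y \<oplus> y = y" using assms by simp
  then show "x = y" using assms by (simp add: minus_eq a_assoc l_neg)
qed (use assms in \<open>simp add: minus_eq r_neg\<close>)

text \<open>Monoids have no cancellation, so preservation of zero is a premise of its own. It also
  settles an infinite index set, over which a sum is zero by convention.\<close>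

lemma finsum_additive:
  assumes "abelian_monoid G" "abelian_monoid H" "f \<in> S \<rightarrow> carrier G"
    and "h \<in> carrier G \<rightarrow> carrier H" "h \<zero>\<^bsub>G\<^esub> = \<zero>\<^bsub>H\<^esub>"
    and "\<And>x y. x \<in> carrier G \<Longrightarrow> y \<in> carrier G \<Longrightarrow> h (x \<oplus>\<^bsub>G\<^esub> y) = h x \<oplus>\<^bsub>H\<^esub> h y"
  shows "h (finsum G f S) = finsum H (\<lambda>i. h (f i)) S"
proof -
  interpret G: abelian_monoid G by fact
  interpret H: abelian_monoid H by fact
  show ?thesis
    using assms(3)
  proof (induction S rule: infinite_finite_induct)
    case (insert x S)
    then have "f \<in> S \<rightarrow> carrier G" "f x \<in> carrier G" by auto
    moreover from this have "(\<lambda>i. h (f i)) \<in> S \<rightarrow> carrier H" "h (f x) \<in> carrier H"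
      using assms(4) by auto
    ultimately show ?case using insert assms(6) by simp
  qed (use assms(5) in simp_all)
qed

lemma additive_zero:
  assumes "abelian_group G" "abelian_group H"
    and "h \<in> carrier G \<rightarrow> carrier H"
    and "\<And>x y. x \<in> carrier G \<Longrightarrow> y \<in> carrier G \<Longrightarrow> h (x \<oplus>\<^bsub>G\<^esub> y) = h x \<oplus>\<^bsub>H\<^esub> h y"
  shows "h \<zero>\<^bsub>G\<^esub> = \<zero>\<^bsub>H\<^esub>"
proof -
  interpret G: abelian_group G by fact
  interpret H: abelian_group H by fact
  have "h \<zero>\<^bsub>G\<^esub> \<in> carrier H" "h \<zero>\<^bsub>G\<^esub> \<oplus>\<^bsub>H\<^esub> h \<zero>\<^bsub>G\<^esub> = h \<zero>\<^bsub>G\<^esub>"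
    using assms(3) assms(4)[of "\<zero>\<^bsub>G\<^esub>" "\<zero>\<^bsub>G\<^esub>"] by auto
  then show ?thesis by (metis H.add.r_cancel_one')
qed

lemma (in abelian_monoid) finsum_swap:
  assumes "finite S" "finite T" "\<And>i j. i \<in> S \<Longrightarrow> j \<in> T \<Longrightarrow> f i j \<in> carrier G"
  shows "(\<Oplus>i\<in>S. \<Oplus>j\<in>T. f i j) = (\<Oplus>j\<in>T. \<Oplus>i\<in>S. f i j)"
  using assms(1,3)
proof (induction S)
  case empty
  then show ?case by simp
next
  case (insert x S)
  have inner: "(\<lambda>i. \<Oplus>j\<in>T. f i j) \<in> S \<rightarrow> carrier G" "(\<Oplus>j\<in>T. f x j) \<in> carrier G"
    using insert.prems by (auto intro!: finsum_closed)
  have "(\<Oplus>i\<in>insert x S. \<Oplus>j\<in>T. f i j) = (\<Oplus>j\<in>T. f x j) \<oplus> (\<Oplus>i\<in>S. \<Oplus>j\<in>T. f i j)"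
    using insert.hyps inner by (intro finsum_insert)
  also have "\<dots> = (\<Oplus>j\<in>T. f x j) \<oplus> (\<Oplus>j\<in>T. \<Oplus>i\<in>S. f i j)"
    using insert.IH insert.prems by simp
  also have "\<dots> = (\<Oplus>j\<in>T. f x j \<oplus> (\<Oplus>i\<in>S. f i j))"
    using insert.prems by (intro finsum_addf[symmetric]) (auto intro!: finsum_closed)
  also have "\<dots> = (\<Oplus>j\<in>T. \<Oplus>i\<in>insert x S. f i j)"
    using insert.hyps insert.prems by (intro finsum_cong') (auto intro!: finsum_closed)
  finally show ?case .
qed

text \<open>Values off the carrier are left free, so functionals are compared pointwise on the
  carrier. Where equality of functions matters, \<open>dual_set\<close> adds extensionality.\<close>

definition functionals ::
    "('k, 'x) ring_scheme \<Rightarrow> ('k, 'v, 'z) module_scheme \<Rightarrow> ('v \<Rightarrow> 'k) set" where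
  "functionals K M = {f \<in> carrier M \<rightarrow> carrier K.
     (\<forall>v\<in>carrier M. \<forall>w\<in>carrier M. f (v \<oplus>\<^bsub>M\<^esub> w) = f v \<oplus>\<^bsub>K\<^esub> f w) \<and>
     (\<forall>c\<in>carrier K. \<forall>v\<in>carrier M. f (c \<odot>\<^bsub>M\<^esub> v) = c \<otimes>\<^bsub>K\<^esub> f v)}"

lemma functionalsD:
  assumes "f \<in> functionals K M"
  shows "v \<in> carrier M \<Longrightarrow> f v \<in> carrier K"
    and "\<lbrakk>v \<in> carrier M; w \<in> carrier M\<rbrakk> \<Longrightarrow> f (v \<oplus>\<^bsub>M\<^esub> w) = f v \<oplus>\<^bsub>K\<^esub> f w"
    and "\<lbrakk>c \<in> carrier K; v \<in> carrier M\<rbrakk> \<Longrightarrow> f (c \<odot>\<^bsub>M\<^esub> v) = c \<otimes>\<^bsub>K\<^esub> f v"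
  using assms by (auto simp: functionals_def)

lemma functionalsI:
  assumes "\<And>v. v \<in> carrier M \<Longrightarrow> f v \<in> carrier K"
    and "\<And>v w. \<lbrakk>v \<in> carrier M; w \<in> carrier M\<rbrakk> \<Longrightarrow> f (v \<oplus>\<^bsub>M\<^esub> w) = f v \<oplus>\<^bsub>K\<^esub> f w"
    and "\<And>c v. \<lbrakk>c \<in> carrier K; v \<in> carrier M\<rbrakk> \<Longrightarrow> f (c \<odot>\<^bsub>M\<^esub> v) = c \<otimes>\<^bsub>K\<^esub> f v"
  shows "f \<in> functionals K M"
  using assms by (auto simp: functionals_def)

section \<open>Functionals, minimal spanning sets and dual bases\<close>

locale lin_space = R?: field K + module K M
  for K :: "('k, 'x) ring_scheme" (structure) and M :: "('k, 'v, 'z) module_scheme" (structure)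
begin

lemma functional_zero: "f \<in> functionals K M \<Longrightarrow> f \<zero>\<^bsub>M\<^esub> = \<zero>"
  by (rule additive_zero[OF M.abelian_group_axioms R.abelian_group_axioms])
    (auto simp: functionals_def)

lemma functional_finsum:
  assumes "f \<in> functionals K M" "g \<in> S \<rightarrow> carrier M"
  shows "f (\<Oplus>\<^bsub>M\<^esub>i\<in>S. g i) = (\<Oplus>i\<in>S. f (g i))"
  using assms functionalsD[OF assms(1)] functional_zero
  by (intro finsum_additive M.abelian_monoid_axioms R.abelian_monoid_axioms) auto

lemma functional_minus:
  assumes "f \<in> functionals K M" "v \<in> carrier M" "w \<in> carrier M"
  shows "f (v \<ominus>\<^bsub>M\<^esub> w) = f v \<ominus> f w"
proof -
  have "v \<ominus>\<^bsub>M\<^esub> w = v \<oplus>\<^bsub>M\<^esub> (\<ominus> \<one>) \<odot>\<^bsub>M\<^esub> w"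
    using assms by (simp add: M.minus_eq smult_l_minus)
  then show ?thesis
    using assms by (simp add: functionalsD[OF assms(1)] R.minus_eq R.l_minus)
qed

lemma finsum_coeffs_add:
  assumes "a \<in> B \<rightarrow> carrier K" "a' \<in> B \<rightarrow> carrier K" "B \<subseteq> carrier M"
  shows "(\<Oplus>\<^bsub>M\<^esub>b\<in>B. (a b \<oplus> a' b) \<odot>\<^bsub>M\<^esub> b) = (\<Oplus>\<^bsub>M\<^esub>b\<in>B. a b \<odot>\<^bsub>M\<^esub> b) \<oplus>\<^bsub>M\<^esub> (\<Oplus>\<^bsub>M\<^esub>b\<in>B. a' b \<odot>\<^bsub>M\<^esub> b)"
proof -
  have "(\<Oplus>\<^bsub>M\<^esub>b\<in>B. (a b \<oplus> a' b) \<odot>\<^bsub>M\<^esub> b) = (\<Oplus>\<^bsub>M\<^esub>b\<in>B. a b \<odot>\<^bsub>M\<^esub> b \<oplus>\<^bsub>M\<^esub> a' b \<odot>\<^bsub>M\<^esub> b)"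
    using assms by (intro M.finsum_cong') (auto simp: Pi_iff subset_iff smult_l_distr)
  also have "\<dots> = (\<Oplus>\<^bsub>M\<^esub>b\<in>B. a b \<odot>\<^bsub>M\<^esub> b) \<oplus>\<^bsub>M\<^esub> (\<Oplus>\<^bsub>M\<^esub>b\<in>B. a' b \<odot>\<^bsub>M\<^esub> b)"
    using assms by (intro M.finsum_addf) (auto simp: Pi_iff subset_iff)
  finally show ?thesis .
qed

lemma finsum_coeffs_smult:
  assumes "a \<in> B \<rightarrow> carrier K" "c \<in> carrier K" "B \<subseteq> carrier M" "finite B"
  shows "(\<Oplus>\<^bsub>M\<^esub>b\<in>B. (c \<otimes> a b) \<odot>\<^bsub>M\<^esub> b) = c \<odot>\<^bsub>M\<^esub> (\<Oplus>\<^bsub>M\<^esub>b\<in>B. a b \<odot>\<^bsub>M\<^esub> b)"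
proof -
  have "c \<odot>\<^bsub>M\<^esub> (\<Oplus>\<^bsub>M\<^esub>b\<in>B. a b \<odot>\<^bsub>M\<^esub> b) = (\<Oplus>\<^bsub>M\<^esub>b\<in>B. c \<odot>\<^bsub>M\<^esub> (a b \<odot>\<^bsub>M\<^esub> b))"
    using assms by (intro finsum_smult_ldistr) (auto simp: Pi_iff subset_iff)
  also have "\<dots> = (\<Oplus>\<^bsub>M\<^esub>b\<in>B. (c \<otimes> a b) \<odot>\<^bsub>M\<^esub> b)"
    using assms by (intro M.finsum_cong') (auto simp: Pi_iff subset_iff smult_assoc1)
  finally show ?thesis ..
qed

lemma functional_coeffs:
  assumes "f \<in> functionals K M" "c \<in> B \<rightarrow> carrier K" "B \<subseteq> carrier M"
  shows "f (\<Oplus>\<^bsub>M\<^esub>b\<in>B. c b \<odot>\<^bsub>M\<^esub> b) = (\<Oplus>b\<in>B. c b \<otimes> f b)"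
proof -
  have "f (\<Oplus>\<^bsub>M\<^esub>b\<in>B. c b \<odot>\<^bsub>M\<^esub> b) = (\<Oplus>b\<in>B. f (c b \<odot>\<^bsub>M\<^esub> b))"
    using assms by (intro functional_finsum) auto
  also have "\<dots> = (\<Oplus>b\<in>B. c b \<otimes> f b)"
    using assms functionalsD[OF assms(1)] by (intro R.finsum_cong') (auto simp: Pi_iff subset_iff)
  finally show ?thesis .
qed

lemma finsum_delta:
  assumes "finite B" "b \<in> B" "c \<in> B \<rightarrow> carrier K"
  shows "(\<Oplus>n\<in>B. c n \<otimes> (if b = n then \<one> else \<zero>)) = c b"
proof -
  have "(\<Oplus>n\<in>B. c n \<otimes> (if b = n then \<one> else \<zero>)) = (\<Oplus>n\<in>B. if b = n then c n else \<zero>)"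
    using assms by (intro R.finsum_cong') (auto simp: Pi_iff)
  also have "\<dots> = c b" using assms by (intro R.add.finprod_singleton) auto
  finally show ?thesis .
qed

lemma smult_finsum_delta:
  assumes "finite B" "B \<subseteq> carrier M" "c \<in> B"
  shows "(\<Oplus>\<^bsub>M\<^esub>b\<in>B. (if b = c then \<one> else \<zero>) \<odot>\<^bsub>M\<^esub> b) = c"
proof -
  have "(\<Oplus>\<^bsub>M\<^esub>b\<in>B. (if b = c then \<one> else \<zero>) \<odot>\<^bsub>M\<^esub> b) = (\<Oplus>\<^bsub>M\<^esub>b\<in>B. if b = c then b else \<zero>\<^bsub>M\<^esub>)"
    using assms by (intro M.finsum_cong') (auto simp: Pi_iff subset_iff)
  also have "\<dots> = c"
    using assms by (intro M.add.finprod_singleton_swap) auto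
  finally show ?thesis .
qed

definition spans :: "'v set \<Rightarrow> bool" where
  "spans B \<longleftrightarrow> finite B \<and> B \<subseteq> carrier M \<and>
     (\<forall>v\<in>carrier M. \<exists>a\<in>B \<rightarrow> carrier K. v = (\<Oplus>\<^bsub>M\<^esub>b\<in>B. a b \<odot>\<^bsub>M\<^esub> b))"

text \<open>Two expansions that differ at \<open>b0\<close> would give a linear relation with an
  invertible coefficient there. It could be used to remove \<open>b0\<close> from the spanning set,
  against minimality. So a spanning set of least size behaves like a basis.\<close>

lemma minimal_spans_unique:
  assumes B: "spans B" and min: "\<And>B'. spans B' \<Longrightarrow> card B \<le> card B'"
    and a: "a \<in> B \<rightarrow> carrier K" "a' \<in> B \<rightarrow> carrier K"
    and eq: "(\<Oplus>\<^bsub>M\<^esub>b\<in>B. a b \<odot>\<^bsub>M\<^esub> b) = (\<Oplus>\<^bsub>M\<^esub>b\<in>B. a' b \<odot>\<^bsub>M\<^esub> b)" and b0: "b0 \<in> B"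
  shows "a b0 = a' b0"
proof (rule ccontr)
  assume ne: "a b0 \<noteq> a' b0"
  have fin: "finite B" and BM: "B \<subseteq> carrier M" using B by (auto simp: spans_def)
  define d where "d b = a b \<ominus> a' b" for b
  have d: "d \<in> B \<rightarrow> carrier K" using a by (auto simp: d_def Pi_iff)
  have d0: "d b0 \<in> Units K"
    using ne a b0 field_Units by (auto simp: d_def Pi_iff)
  have "(\<Oplus>\<^bsub>M\<^esub>b\<in>B. d b \<odot>\<^bsub>M\<^esub> b) = (\<Oplus>\<^bsub>M\<^esub>b\<in>B. (a b \<oplus> (\<ominus> \<one>) \<otimes> a' b) \<odot>\<^bsub>M\<^esub> b)"
    using a BM by (intro M.finsum_cong') (auto simp: d_def Pi_iff subset_iff R.minus_eq R.l_minus)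
  also have "\<dots> = (\<Oplus>\<^bsub>M\<^esub>b\<in>B. a b \<odot>\<^bsub>M\<^esub> b) \<oplus>\<^bsub>M\<^esub> (\<ominus> \<one>) \<odot>\<^bsub>M\<^esub> (\<Oplus>\<^bsub>M\<^esub>b\<in>B. a' b \<odot>\<^bsub>M\<^esub> b)"
    using a BM fin by (subst finsum_coeffs_add) (auto simp: finsum_coeffs_smult)
  also have "\<dots> = \<zero>\<^bsub>M\<^esub>"
    using a BM eq by (auto simp: smult_l_minus M.r_neg Pi_iff subset_iff intro!: M.finsum_closed)
  finally have dsum: "(\<Oplus>\<^bsub>M\<^esub>b\<in>B. d b \<odot>\<^bsub>M\<^esub> b) = \<zero>\<^bsub>M\<^esub>" .
  have "spans (B - {b0})"
    unfolding spans_def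
  proof (intro conjI ballI)
    fix v assume "v \<in> carrier M"
    then obtain e where e: "e \<in> B \<rightarrow> carrier K" "v = (\<Oplus>\<^bsub>M\<^esub>b\<in>B. e b \<odot>\<^bsub>M\<^esub> b)"
      using B by (auto simp: spans_def)
    \<comment> \<open>This multiple of the relation \<open>d\<close> makes the coefficient of
      \<open>b0\<close> vanish.\<close>
    define t where "t = \<ominus> (e b0 \<otimes> inv (d b0))"
    have t: "t \<in> carrier K" using e b0 d0 by (auto simp: t_def)
    define f where "f b = e b \<oplus> t \<otimes> d b" for b
    have f: "f \<in> B \<rightarrow> carrier K" using e(1) d t by (auto simp: f_def Pi_iff)
    have "f b0 = e b0 \<ominus> e b0 \<otimes> (inv (d b0) \<otimes> d b0)"
      using e b0 d0 d by (auto simp: f_def t_def R.l_minus R.minus_eq R.m_assoc Pi_iff)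
    then have f0: "f b0 = \<zero>" using d0 e b0 by (auto simp: Pi_iff)
    have "v = (\<Oplus>\<^bsub>M\<^esub>b\<in>B. f b \<odot>\<^bsub>M\<^esub> b)"
      unfolding f_def using e d t BM fin dsum
      by (subst finsum_coeffs_add)
        (auto simp: finsum_coeffs_smult Pi_iff subset_iff intro!: M.r_zero[symmetric] M.finsum_closed)
    also have "\<dots> = (\<Oplus>\<^bsub>M\<^esub>b\<in>B - {b0}. f b \<odot>\<^bsub>M\<^esub> b)"
    proof -
      have "(\<Oplus>\<^bsub>M\<^esub>b\<in>insert b0 (B - {b0}). f b \<odot>\<^bsub>M\<^esub> b) =
          f b0 \<odot>\<^bsub>M\<^esub> b0 \<oplus>\<^bsub>M\<^esub> (\<Oplus>\<^bsub>M\<^esub>b\<in>B - {b0}. f b \<odot>\<^bsub>M\<^esub> b)"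
        using fin f BM b0 by (intro M.finsum_insert) (auto simp: Pi_iff subset_iff)
      then show ?thesis using f0 f BM b0
        by (auto simp: insert_absorb Pi_iff subset_iff intro!: M.l_zero M.finsum_closed)
    qed
    finally show "\<exists>a\<in>B - {b0} \<rightarrow> carrier K. v = (\<Oplus>\<^bsub>M\<^esub>b\<in>B - {b0}. a b \<odot>\<^bsub>M\<^esub> b)"
      using f by blast
  qed (use fin BM in auto)
  then have "card B \<le> card (B - {b0})" by (rule min)
  then show False using b0 fin by (metis card_Diff1_less not_le)
qed

text \<open>The dual functionals are the coefficients of the expansion in a spanning set of least
  size. They are linear in the vector because the coefficients are unique.\<close>

lemma dual_basis:
  assumes "finite_dim K M"
  obtains B \<beta> where "finite B" "B \<subseteq> carrier M" "\<And>b. b \<in> B \<Longrightarrow> \<beta> b \<in> functionals K M"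
    "\<And>v. v \<in> carrier M \<Longrightarrow> v = (\<Oplus>\<^bsub>M\<^esub>b\<in>B. \<beta> b v \<odot>\<^bsub>M\<^esub> b)"
    "\<And>b c. \<lbrakk>b \<in> B; c \<in> B\<rbrakk> \<Longrightarrow> \<beta> b c = (if b = c then \<one> else \<zero>)"
proof -
  have "\<exists>B. spans B" using assms by (auto simp: finite_dim_def spans_def)
  then obtain B where B: "spans B" and min: "\<And>B'. spans B' \<Longrightarrow> card B \<le> card B'"
    using ex_has_least_nat[of spans _ card] by blast
  have fin: "finite B" and BM: "B \<subseteq> carrier M" using B by (auto simp: spans_def)
  have "\<forall>v. \<exists>a. v \<in> carrier M \<longrightarrow> a \<in> B \<rightarrow> carrier K \<and> v = (\<Oplus>\<^bsub>M\<^esub>b\<in>B. a b \<odot>\<^bsub>M\<^esub> b)"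
    using B unfolding spans_def by blast
  then obtain a where a: "\<And>v. v \<in> carrier M \<Longrightarrow> a v \<in> B \<rightarrow> carrier K"
      "\<And>v. v \<in> carrier M \<Longrightarrow> v = (\<Oplus>\<^bsub>M\<^esub>b\<in>B. a v b \<odot>\<^bsub>M\<^esub> b)"
    by metis
  have uniq: "a v b = f b" if "f \<in> B \<rightarrow> carrier K" "v = (\<Oplus>\<^bsub>M\<^esub>b\<in>B. f b \<odot>\<^bsub>M\<^esub> b)"
    "v \<in> carrier M" "b \<in> B" for v f b
  proof (rule minimal_spans_unique[OF B min])
    show "(\<Oplus>\<^bsub>M\<^esub>b\<in>B. a v b \<odot>\<^bsub>M\<^esub> b) = (\<Oplus>\<^bsub>M\<^esub>b\<in>B. f b \<odot>\<^bsub>M\<^esub> b)"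
      using a(2)[OF that(3)] that(2) by simp
  qed (use that a in auto)
  show thesis
  proof (rule that[of B "\<lambda>b v. a v b"])
    fix b assume b: "b \<in> B"
    show "(\<lambda>v. a v b) \<in> functionals K M"
    proof (rule functionalsI)
      fix v w assume vw: "v \<in> carrier M" "w \<in> carrier M"
      show "a (v \<oplus>\<^bsub>M\<^esub> w) b = a v b \<oplus> a w b"
      proof (rule uniq)
        show "v \<oplus>\<^bsub>M\<^esub> w = (\<Oplus>\<^bsub>M\<^esub>b\<in>B. (a v b \<oplus> a w b) \<odot>\<^bsub>M\<^esub> b)"
          using a vw BM by (subst finsum_coeffs_add) auto
        show "(\<lambda>b. a v b \<oplus> a w b) \<in> B \<rightarrow> carrier K" using a vw by (force simp: Pi_iff)
      qed (use vw b in auto)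
    next
      fix c v assume cv: "c \<in> carrier K" "v \<in> carrier M"
      show "a (c \<odot>\<^bsub>M\<^esub> v) b = c \<otimes> a v b"
      proof (rule uniq)
        show "c \<odot>\<^bsub>M\<^esub> v = (\<Oplus>\<^bsub>M\<^esub>b\<in>B. (c \<otimes> a v b) \<odot>\<^bsub>M\<^esub> b)"
          using a cv BM fin by (subst finsum_coeffs_smult) auto
        show "(\<lambda>b. c \<otimes> a v b) \<in> B \<rightarrow> carrier K" using a cv by (force simp: Pi_iff)
      qed (use cv b in auto)
    qed (use a b in auto)
  next
    fix b c assume "b \<in> B" "c \<in> B"
    then show "a c b = (if b = c then \<one> else \<zero>)"
      using BM fin by (intro uniq[of "\<lambda>b. if b = c then \<one> else \<zero>"])
        (auto simp: smult_finsum_delta)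
  qed (use fin BM a in auto)
qed

section \<open>Subspaces and separating families of functionals\<close>

definition subspace :: "'v set \<Rightarrow> bool" where
  "subspace W \<longleftrightarrow> W \<subseteq> carrier M \<and> \<zero>\<^bsub>M\<^esub> \<in> W \<and> (\<forall>v\<in>W. \<forall>w\<in>W. v \<oplus>\<^bsub>M\<^esub> w \<in> W) \<and>
     (\<forall>c\<in>carrier K. \<forall>v\<in>W. c \<odot>\<^bsub>M\<^esub> v \<in> W)"

lemma subspaceD:
  assumes "subspace W"
  shows "v \<in> W \<Longrightarrow> v \<in> carrier M" "\<zero>\<^bsub>M\<^esub> \<in> W" "\<lbrakk>v \<in> W; w \<in> W\<rbrakk> \<Longrightarrow> v \<oplus>\<^bsub>M\<^esub> w \<in> W"
    "\<lbrakk>c \<in> carrier K; v \<in> W\<rbrakk> \<Longrightarrow> c \<odot>\<^bsub>M\<^esub> v \<in> W"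
  using assms by (auto simp: subspace_def)

lemma subspace_minus:
  assumes "subspace W" "v \<in> W" "w \<in> W"
  shows "v \<ominus>\<^bsub>M\<^esub> w \<in> W"
proof -
  have "v \<ominus>\<^bsub>M\<^esub> w = v \<oplus>\<^bsub>M\<^esub> (\<ominus> \<one>) \<odot>\<^bsub>M\<^esub> w"
    using assms by (simp add: M.minus_eq smult_l_minus subspaceD)
  then show ?thesis using assms by (simp add: subspaceD)
qed

lemma subspace_kernel:
  assumes "subspace W" "f \<in> functionals K M"
  shows "subspace {w \<in> W. f w = \<zero>}"
  using assms functional_zero[OF assms(2)] functionalsD[OF assms(2)]
  by (auto simp: subspace_def subset_iff)

text \<open>Each functional costs at most one vector: either \<open>f\<close> vanishes on
  \<open>W\<close>, or a single vector outside the kernel completes a spanning set of the kernel to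
  one of \<open>W\<close>.\<close>

lemma subspace_spanned:
  assumes "finite \<Phi>" "\<Phi> \<subseteq> functionals K M" "subspace W"
    and "\<And>w. \<lbrakk>w \<in> W; \<forall>f\<in>\<Phi>. f w = \<zero>\<rbrakk> \<Longrightarrow> w = \<zero>\<^bsub>M\<^esub>"
  shows "\<exists>B. finite B \<and> B \<subseteq> W \<and> (\<forall>w\<in>W. \<exists>a\<in>B \<rightarrow> carrier K. w = (\<Oplus>\<^bsub>M\<^esub>b\<in>B. a b \<odot>\<^bsub>M\<^esub> b))"
  using assms
proof (induction \<Phi> arbitrary: W)
  case empty
  then show ?case by (intro exI[of _ "{}"]) auto
next
  case (insert f \<Phi>)
  let ?W = "{w \<in> W. f w = \<zero>}"
  have f: "f \<in> functionals K M" using insert.prems by auto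
  have "\<exists>B. finite B \<and> B \<subseteq> ?W \<and> (\<forall>w\<in>?W. \<exists>a\<in>B \<rightarrow> carrier K. w = (\<Oplus>\<^bsub>M\<^esub>b\<in>B. a b \<odot>\<^bsub>M\<^esub> b))"
    using insert.prems subspace_kernel[OF insert.prems(2) f] by (intro insert.IH) auto
  then obtain B where B: "finite B" "B \<subseteq> ?W"
      "\<And>w. w \<in> ?W \<Longrightarrow> \<exists>a\<in>B \<rightarrow> carrier K. w = (\<Oplus>\<^bsub>M\<^esub>b\<in>B. a b \<odot>\<^bsub>M\<^esub> b)"
    by blast
  show ?case
  proof (cases "?W = W")
    case True
    then show ?thesis using B by auto
  next
    case False
    then obtain w1 where w1: "w1 \<in> W" "f w1 \<noteq> \<zero>" by auto
    have WM: "W \<subseteq> carrier M" using insert.prems by (auto simp: subspace_def)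
    have u: "f w1 \<in> Units K"
      using w1 WM functionalsD(1)[OF f] field_Units by auto
    have nin: "w1 \<notin> B" using B w1 by auto
    show ?thesis
    proof (intro exI[of _ "insert w1 B"] conjI ballI)
      fix w assume w: "w \<in> W"
      \<comment> \<open>With this coefficient the difference of \<open>w\<close> and
        \<open>t\<close> times \<open>w1\<close> lies in the kernel of \<open>f\<close>.\<close>
      define t where "t = f w \<otimes> inv (f w1)"
      have fw: "f w \<in> carrier K" using w WM functionalsD(1)[OF f] by auto
      then have t: "t \<in> carrier K" using u by (auto simp: t_def)
      have "t \<otimes> f w1 = f w" using fw u by (simp add: t_def R.m_assoc R.Units_closed)
      then have "f (w \<ominus>\<^bsub>M\<^esub> t \<odot>\<^bsub>M\<^esub> w1) = \<zero>"
        using w w1 t WM fw by (simp add: functional_minus[OF f] functionalsD[OF f] subset_iff R.minus_eq R.r_neg)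
      then have "w \<ominus>\<^bsub>M\<^esub> t \<odot>\<^bsub>M\<^esub> w1 \<in> ?W"
        using w w1 t subspace_minus[OF insert.prems(2) w] subspaceD(4)[OF insert.prems(2) t w1(1)] by simp
      then obtain a where a: "a \<in> B \<rightarrow> carrier K" "w \<ominus>\<^bsub>M\<^esub> t \<odot>\<^bsub>M\<^esub> w1 = (\<Oplus>\<^bsub>M\<^esub>b\<in>B. a b \<odot>\<^bsub>M\<^esub> b)"
        using B(3) by blast
      have "w = t \<odot>\<^bsub>M\<^esub> w1 \<oplus>\<^bsub>M\<^esub> (w \<ominus>\<^bsub>M\<^esub> t \<odot>\<^bsub>M\<^esub> w1)"
      proof -
        have "w \<in> carrier M" "t \<odot>\<^bsub>M\<^esub> w1 \<in> carrier M" using w w1 t WM by auto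
        then show ?thesis by (simp add: M.minus_eq M.a_lcomm[of "t \<odot>\<^bsub>M\<^esub> w1" w] M.r_neg)
      qed
      also have "\<dots> = (\<Oplus>\<^bsub>M\<^esub>b\<in>insert w1 B. (a(w1 := t)) b \<odot>\<^bsub>M\<^esub> b)"
      proof -
        have "(\<Oplus>\<^bsub>M\<^esub>b\<in>B. (a(w1 := t)) b \<odot>\<^bsub>M\<^esub> b) = (\<Oplus>\<^bsub>M\<^esub>b\<in>B. a b \<odot>\<^bsub>M\<^esub> b)"
          using nin a(1) B(2) WM by (intro M.finsum_cong') (auto simp: Pi_iff subset_iff)
        moreover have "(\<Oplus>\<^bsub>M\<^esub>b\<in>insert w1 B. (a(w1 := t)) b \<odot>\<^bsub>M\<^esub> b) =
            t \<odot>\<^bsub>M\<^esub> w1 \<oplus>\<^bsub>M\<^esub> (\<Oplus>\<^bsub>M\<^esub>b\<in>B. (a(w1 := t)) b \<odot>\<^bsub>M\<^esub> b)"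
          using nin a(1) B(1,2) WM w1 t by (subst M.finsum_insert) (auto simp: Pi_iff subset_iff)
        ultimately show ?thesis using a(2) by simp
      qed
      finally show "\<exists>a\<in>insert w1 B \<rightarrow> carrier K. w = (\<Oplus>\<^bsub>M\<^esub>b\<in>insert w1 B. a b \<odot>\<^bsub>M\<^esub> b)"
        using a(1) t by (intro bexI[of _ "a(w1 := t)"]) auto
    qed (use B w1 in auto)
  qed
qed

lemma subspace_carrier: "subspace (carrier M)"
  by (auto simp: subspace_def)

lemma finite_dim_separating:
  assumes "finite \<Phi>" "\<Phi> \<subseteq> functionals K M"
    and "\<And>w. \<lbrakk>w \<in> carrier M; \<forall>f\<in>\<Phi>. f w = \<zero>\<rbrakk> \<Longrightarrow> w = \<zero>\<^bsub>M\<^esub>"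
  shows "finite_dim K M"
  unfolding finite_dim_def by (rule subspace_spanned[OF assms(1,2) subspace_carrier assms(3)])

text \<open>In this form finite dimension is easy to inherit: functionals restrict to a subspace,
  whereas a spanning set need not lie in it. The way back is
  \<open>finite_dim_separating\<close>.\<close>

lemma separating_functionals:
  assumes "finite_dim K M"
  obtains \<Phi> where "finite \<Phi>" "\<Phi> \<subseteq> functionals K M"
    "\<And>w. \<lbrakk>w \<in> carrier M; \<forall>f\<in>\<Phi>. f w = \<zero>\<rbrakk> \<Longrightarrow> w = \<zero>\<^bsub>M\<^esub>"
proof -
  obtain B \<beta> where B: "finite B" "B \<subseteq> carrier M" "\<And>b. b \<in> B \<Longrightarrow> \<beta> b \<in> functionals K M"
    "\<And>v. v \<in> carrier M \<Longrightarrow> v = (\<Oplus>\<^bsub>M\<^esub>b\<in>B. \<beta> b v \<odot>\<^bsub>M\<^esub> b)"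
    "\<And>b c. \<lbrakk>b \<in> B; c \<in> B\<rbrakk> \<Longrightarrow> \<beta> b c = (if b = c then \<one> else \<zero>)"
    by (rule dual_basis[OF assms], rule that)
  show thesis
  proof (rule that[of "\<beta> ` B"])
    fix w assume w: "w \<in> carrier M" "\<forall>f\<in>\<beta> ` B. f w = \<zero>"
    have "(\<Oplus>\<^bsub>M\<^esub>b\<in>B. \<beta> b w \<odot>\<^bsub>M\<^esub> b) = (\<Oplus>\<^bsub>M\<^esub>b\<in>B. \<zero>\<^bsub>M\<^esub>)"
      using w B by (intro M.finsum_cong') (auto simp: subset_iff)
    then show "w = \<zero>\<^bsub>M\<^esub>" using B(4)[OF w(1)] by simp
  qed (use B in auto)
qed

text \<open>For a set not contained in the carrier there is no subspace to intersect, and everything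
  is in the span; hence the premise of \<open>subspace_lspan\<close>.\<close>

definition lspan :: "'v set \<Rightarrow> 'v set" where
  "lspan S = {v. \<forall>W. subspace W \<and> S \<subseteq> W \<longrightarrow> v \<in> W}"

lemma lspan_subset: "\<lbrakk>subspace W; S \<subseteq> W\<rbrakk> \<Longrightarrow> lspan S \<subseteq> W"
  by (auto simp: lspan_def)

lemma lspan_superset: "S \<subseteq> lspan S"
  by (auto simp: lspan_def)

lemma subspace_lspan: "S \<subseteq> carrier M \<Longrightarrow> subspace (lspan S)"
  using subspace_carrier unfolding lspan_def subspace_def by (auto simp: Ball_def)

text \<open>Gaussian elimination in place of a dimension count. If \<open>f\<close> does not vanish
  on all terms, a term with nonzero value serves as pivot. Subtracting its multiples from the later
  terms gives a sequence in the kernel of \<open>f\<close>, to which the induction hypothesis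
  applies. For a separating family the agreement of values is an equality of vectors.\<close>

lemma dependent_sequence:
  assumes "finite \<Phi>" "\<Phi> \<subseteq> functionals K M" "range v \<subseteq> carrier M"
  shows "\<exists>n. \<exists>s\<in>lspan (v ` {..<n::nat}). \<forall>f\<in>\<Phi>. f (v n) = f s"
  using assms
proof (induction \<Phi> arbitrary: v)
  case empty
  then show ?case by (intro exI[of _ 0] bexI[of _ "\<zero>\<^bsub>M\<^esub>"]) (auto simp: lspan_def subspace_def)
next
  case (insert f \<Phi>)
  have f: "f \<in> functionals K M" and \<Phi>: "\<Phi> \<subseteq> functionals K M" using insert.prems by auto
  have vM: "v i \<in> carrier M" for i using insert.prems by auto
  show ?case
  proof (cases "\<forall>i. f (v i) = \<zero>")
    case True
    obtain n s where s: "s \<in> lspan (v ` {..<n})" "\<forall>g\<in>\<Phi>. g (v n) = g s"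
      using insert.IH[OF \<Phi>, of v] insert.prems by auto
    have "lspan (v ` {..<n}) \<subseteq> {w \<in> carrier M. f w = \<zero>}"
      using vM True by (intro lspan_subset subspace_kernel[OF subspace_carrier f]) auto
    then show ?thesis using s True by (intro exI[of _ n] bexI[of _ s]) auto
  next
    case False
    then obtain m where m: "f (v m) \<noteq> \<zero>" by auto
    then have u: "f (v m) \<in> Units K"
      using vM functionalsD(1)[OF f] field_Units by auto
    \<comment> \<open>The shift by \<open>m + 1\<close> skips the pivot \<open>v m\<close>. Each
      \<open>w i\<close> then involves only the pivot and one later term, and the terms of
      \<open>w\<close> before \<open>n\<close> involve only terms of \<open>v\<close> before
      \<open>?N\<close>.\<close>
    define t where "t i = f (v (m + 1 + i)) \<otimes> inv (f (v m))" for i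
    define w where "w i = v (m + 1 + i) \<ominus>\<^bsub>M\<^esub> t i \<odot>\<^bsub>M\<^esub> v m" for i
    have fv: "f (v i) \<in> carrier K" for i using vM functionalsD(1)[OF f] by auto
    have t: "t i \<in> carrier K" for i using fv u by (auto simp: t_def)
    have tm: "t i \<otimes> f (v m) = f (v (m + 1 + i))" for i
      using fv u by (simp add: t_def R.m_assoc R.Units_closed)
    have w: "w i \<in> carrier M" for i using vM t by (auto simp: w_def)
    have fw: "f (w i) = \<zero>" for i
      using vM t fv tm[of i] by (simp add: w_def functional_minus[OF f] functionalsD[OF f] R.minus_eq R.r_neg)
    have "range w \<subseteq> carrier M" using w by auto
    from insert.IH[OF \<Phi> this] obtain n s
      where s: "s \<in> lspan (w ` {..<n})" "\<forall>g\<in>\<Phi>. g (w n) = g s"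
      by blast
    let ?N = "m + 1 + n"
    let ?S = "lspan (v ` {..<?N})"
    have S: "subspace ?S" using vM by (intro subspace_lspan) auto
    have vS: "v i \<in> ?S" if "i < ?N" for i using that by (intro subsetD[OF lspan_superset]) auto
    have "lspan (w ` {..<n}) \<subseteq> {w \<in> ?S. f w = \<zero>}"
    proof (intro lspan_subset subspace_kernel[OF S f] image_subsetI)
      fix i assume "i \<in> {..<n}"
      then show "w i \<in> {w \<in> ?S. f w = \<zero>}"
        using fw[of i] subspace_minus[OF S vS[of "m + 1 + i"] subspaceD(4)[OF S t[of i] vS[of m]]]
        unfolding w_def by auto
    qed
    then have s': "s \<in> ?S" "f s = \<zero>" using s by auto
    have sM: "s \<in> carrier M" using subspaceD(1)[OF S s'(1)] .
    have vN: "g (v ?N) = g (w n) \<oplus> t n \<otimes> g (v m)" if g: "g \<in> functionals K M" for g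
    proof -
      have "g (v ?N) \<in> carrier K" "g (v m) \<in> carrier K" using vM functionalsD(1)[OF g] by auto
      moreover have "g (w n) = g (v ?N) \<ominus> t n \<otimes> g (v m)"
        using vM t by (simp add: w_def functional_minus[OF g] functionalsD[OF g])
      ultimately show ?thesis using t by (simp add: R.minus_eq R.add.m_assoc R.l_neg)
    qed
    show ?thesis
    proof (intro exI[of _ ?N] bexI[of _ "s \<oplus>\<^bsub>M\<^esub> t n \<odot>\<^bsub>M\<^esub> v m"] ballI)
      fix g assume "g \<in> insert f \<Phi>"
      then have g: "g \<in> functionals K M" and "g (w n) = g s"
        using f \<Phi> s(2) s'(2) fw by auto
      then have "g (v ?N) = g s \<oplus> t n \<otimes> g (v m)" using vN[OF g] by simp
      also have "\<dots> = g (s \<oplus>\<^bsub>M\<^esub> t n \<odot>\<^bsub>M\<^esub> v m)"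
        using sM t vM by (simp add: functionalsD[OF g])
      finally show "g (v ?N) = g (s \<oplus>\<^bsub>M\<^esub> t n \<odot>\<^bsub>M\<^esub> v m)" .
    next
      show "s \<oplus>\<^bsub>M\<^esub> t n \<odot>\<^bsub>M\<^esub> v m \<in> ?S"
        using subspaceD(3)[OF S s'(1) subspaceD(4)[OF S t[of n] vS[of m]]] by simp
    qed
  qed
qed

section \<open>Eigenvectors over an algebraically closed field\<close>

definition endo :: "('v \<Rightarrow> 'v) \<Rightarrow> bool" where
  "endo f \<longleftrightarrow> f \<in> carrier M \<rightarrow> carrier M \<and>
     (\<forall>v\<in>carrier M. \<forall>w\<in>carrier M. f (v \<oplus>\<^bsub>M\<^esub> w) = f v \<oplus>\<^bsub>M\<^esub> f w) \<and>
     (\<forall>c\<in>carrier K. \<forall>v\<in>carrier M. f (c \<odot>\<^bsub>M\<^esub> v) = c \<odot>\<^bsub>M\<^esub> f v)"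

context
  fixes f :: "'v \<Rightarrow> 'v" and v :: 'v
  assumes f: "endo f" and v: "v \<in> carrier M"
begin

lemma endoD:
  shows "w \<in> carrier M \<Longrightarrow> f w \<in> carrier M"
    and "\<lbrakk>u \<in> carrier M; w \<in> carrier M\<rbrakk> \<Longrightarrow> f (u \<oplus>\<^bsub>M\<^esub> w) = f u \<oplus>\<^bsub>M\<^esub> f w"
    and "\<lbrakk>c \<in> carrier K; w \<in> carrier M\<rbrakk> \<Longrightarrow> f (c \<odot>\<^bsub>M\<^esub> w) = c \<odot>\<^bsub>M\<^esub> f w"
  using f by (auto simp: endo_def)

lemma endo_zero: "f \<zero>\<^bsub>M\<^esub> = \<zero>\<^bsub>M\<^esub>"
  using f by (intro additive_zero[OF M.abelian_group_axioms M.abelian_group_axioms]) (auto simp: endo_def)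

text \<open>The values at \<open>v\<close> of the polynomials in \<open>f\<close> of degree less than \<open>n\<close>, and of the monic ones
  of degree \<open>n\<close>, generated by Horner's scheme.\<close>

primrec poly_values :: "nat \<Rightarrow> 'v set" where
  "poly_values 0 = {\<zero>\<^bsub>M\<^esub>}"
| "poly_values (Suc n) = {f u \<oplus>\<^bsub>M\<^esub> a \<odot>\<^bsub>M\<^esub> v |u a. u \<in> poly_values n \<and> a \<in> carrier K}"

primrec monic_values :: "nat \<Rightarrow> 'v set" where
  "monic_values 0 = {v}"
| "monic_values (Suc n) = {f u \<oplus>\<^bsub>M\<^esub> a \<odot>\<^bsub>M\<^esub> v |u a. u \<in> monic_values n \<and> a \<in> carrier K}"

lemma subspace_poly_values: "subspace (poly_values n)"
proof (induction n)
  case 0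
  then show ?case by (auto simp: subspace_def)
next
  case (Suc n)
  note S = subspaceD[OF Suc]
  show ?case
    unfolding subspace_def
  proof (intro conjI ballI)
    show "poly_values (Suc n) \<subseteq> carrier M" using S(1) v endoD by auto
    show "\<zero>\<^bsub>M\<^esub> \<in> poly_values (Suc n)"
      using S(2) v endo_zero by (auto intro!: exI[of _ "\<zero>\<^bsub>M\<^esub>"] exI[of _ "\<zero>"])
  next
    fix x y assume "x \<in> poly_values (Suc n)" "y \<in> poly_values (Suc n)"
    then obtain u a u' a' where *: "x = f u \<oplus>\<^bsub>M\<^esub> a \<odot>\<^bsub>M\<^esub> v" "y = f u' \<oplus>\<^bsub>M\<^esub> a' \<odot>\<^bsub>M\<^esub> v"
      "u \<in> poly_values n" "u' \<in> poly_values n" "a \<in> carrier K" "a' \<in> carrier K" by auto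
    then have "x \<oplus>\<^bsub>M\<^esub> y = f (u \<oplus>\<^bsub>M\<^esub> u') \<oplus>\<^bsub>M\<^esub> (a \<oplus> a') \<odot>\<^bsub>M\<^esub> v"
      using S(1) v endoD by (simp add: smult_l_distr M.a_ac)
    then show "x \<oplus>\<^bsub>M\<^esub> y \<in> poly_values (Suc n)" using * S(3) by auto
  next
    fix c x assume "c \<in> carrier K" "x \<in> poly_values (Suc n)"
    then obtain u a where *: "x = f u \<oplus>\<^bsub>M\<^esub> a \<odot>\<^bsub>M\<^esub> v" "u \<in> poly_values n" "a \<in> carrier K" by auto
    then have "c \<odot>\<^bsub>M\<^esub> x = f (c \<odot>\<^bsub>M\<^esub> u) \<oplus>\<^bsub>M\<^esub> (c \<otimes> a) \<odot>\<^bsub>M\<^esub> v"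
      using S(1) v endoD \<open>c \<in> carrier K\<close> by (simp add: smult_r_distr smult_assoc1)
    then show "c \<odot>\<^bsub>M\<^esub> x \<in> poly_values (Suc n)" using * S(4) \<open>c \<in> carrier K\<close> by auto
  qed
qed

lemma funpow_carrier: "(f ^^ i) v \<in> carrier M"
  by (induction i) (use v endoD in auto)

lemma funpow_poly_values: "i < n \<Longrightarrow> (f ^^ i) v \<in> poly_values n"
proof (induction n arbitrary: i)
  case (Suc n)
  show ?case
  proof (cases i)
    case 0
    then have "(f ^^ i) v = f \<zero>\<^bsub>M\<^esub> \<oplus>\<^bsub>M\<^esub> \<one> \<odot>\<^bsub>M\<^esub> v" using v endo_zero by simp
    then show ?thesis using subspaceD(2)[OF subspace_poly_values] by auto
  next
    case (Suc j)
    then have "(f ^^ i) v = f ((f ^^ j) v) \<oplus>\<^bsub>M\<^esub> \<zero> \<odot>\<^bsub>M\<^esub> v"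
      using v endoD funpow_carrier[of j] by simp
    then show ?thesis using Suc Suc.IH[of j] Suc.prems by auto
  qed
qed auto

lemma monic_values_funpow: "w \<in> poly_values n \<Longrightarrow> (f ^^ n) v \<oplus>\<^bsub>M\<^esub> w \<in> monic_values n"
proof (induction n arbitrary: w)
  case 0
  then show ?case using v by auto
next
  case (Suc n)
  then obtain u a where *: "w = f u \<oplus>\<^bsub>M\<^esub> a \<odot>\<^bsub>M\<^esub> v" "u \<in> poly_values n" "a \<in> carrier K" by auto
  have "u \<in> carrier M" using subspaceD(1)[OF subspace_poly_values *(2)] .
  then have "(f ^^ Suc n) v \<oplus>\<^bsub>M\<^esub> w = f ((f ^^ n) v \<oplus>\<^bsub>M\<^esub> u) \<oplus>\<^bsub>M\<^esub> a \<odot>\<^bsub>M\<^esub> v"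
    using * v endoD funpow_carrier[of n] by (simp add: M.a_assoc)
  then show ?case using * Suc.IH[of u] by auto
qed

lemma monic_values_carrier: "monic_values n \<subseteq> carrier M"
  by (induction n) (use v endoD in auto)

text \<open>\<open>p\<close> lists the lower coefficients in descending degree; the leading
  coefficient one is implicit in the starting value \<open>v\<close>. The matching polynomial in
  list form is \<open>\<one> # p\<close>.\<close>

definition horner :: "'k list \<Rightarrow> 'v" where
  "horner p = foldl (\<lambda>u a. f u \<oplus>\<^bsub>M\<^esub> a \<odot>\<^bsub>M\<^esub> v) v p"

lemma monic_values_horner:
  "u \<in> monic_values n \<Longrightarrow> \<exists>q. length q = n \<and> set q \<subseteq> carrier K \<and> u = horner q"
proof (induction n arbitrary: u)
  case 0
  then show ?case by (auto simp: horner_def)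
next
  case (Suc n)
  then obtain u' a where *: "u = f u' \<oplus>\<^bsub>M\<^esub> a \<odot>\<^bsub>M\<^esub> v" "u' \<in> monic_values n" "a \<in> carrier K" by auto
  then obtain q where "length q = n" "set q \<subseteq> carrier K" "u' = horner q" using Suc.IH by blast
  then show ?case using * by (intro exI[of _ "q @ [a]"]) (auto simp: horner_def)
qed

text \<open>Synthetic division of a monic polynomial by X - c, evaluated at \<open>f\<close> and
  \<open>v\<close>: the remainder is the value of the polynomial at \<open>c\<close>. A Horner step
  appends a coefficient and extends the quotient by one, so the induction runs from the end of the
  list.\<close>

lemma horner_division:
  assumes "q \<noteq> []" "set q \<subseteq> carrier K" and c: "c \<in> carrier K"
  shows "\<exists>w\<in>monic_values (length q - 1).
    horner q = f w \<ominus>\<^bsub>M\<^esub> c \<odot>\<^bsub>M\<^esub> w \<oplus>\<^bsub>M\<^esub> R.eval (\<one> # q) c \<odot>\<^bsub>M\<^esub> v"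
  using assms(1,2)
proof (induction q rule: rev_nonempty_induct)
  case (single a)
  have "R.eval [\<one>, a] c = c \<oplus> a" using single c by simp
  moreover have "f v \<oplus>\<^bsub>M\<^esub> a \<odot>\<^bsub>M\<^esub> v = f v \<ominus>\<^bsub>M\<^esub> c \<odot>\<^bsub>M\<^esub> v \<oplus>\<^bsub>M\<^esub> (c \<oplus> a) \<odot>\<^bsub>M\<^esub> v"
  proof -
    have "f v \<in> carrier M" "c \<odot>\<^bsub>M\<^esub> v \<in> carrier M" "a \<odot>\<^bsub>M\<^esub> v \<in> carrier M"
      using endoD v c single by auto
    then show ?thesis using v c single
      by (simp add: smult_l_distr M.minus_eq M.a_assoc M.r_neg2 M.r_neg1)
  qed
  ultimately show ?case using single v by (simp add: horner_def)
next
  case (snoc a q)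
  then obtain w where w: "w \<in> monic_values (length q - 1)"
    "horner q = f w \<ominus>\<^bsub>M\<^esub> c \<odot>\<^bsub>M\<^esub> w \<oplus>\<^bsub>M\<^esub> R.eval (\<one> # q) c \<odot>\<^bsub>M\<^esub> v" by auto
  define e where "e = R.eval (\<one> # q) c"
  have e: "e \<in> carrier K" unfolding e_def using snoc c by (intro R.eval_in_carrier) auto
  have a: "a \<in> carrier K" using snoc by auto
  have ee: "R.eval (\<one> # q @ [a]) c = e \<otimes> c \<oplus> a"
    using R.eval_append_aux[of "\<one> # q" a c] snoc c by (simp add: e_def)
  have wM: "w \<in> carrier M" using subsetD[OF monic_values_carrier w(1)] .
  \<comment> \<open>The next coefficient of the quotient is the Horner value \<open>e\<close>
    reached so far at \<open>c\<close>.\<close>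
  define w' where "w' = f w \<oplus>\<^bsub>M\<^esub> e \<odot>\<^bsub>M\<^esub> v"
  have "w' \<in> monic_values (Suc (length q - 1))" using w e by (auto simp: w'_def)
  then have "w' \<in> monic_values (length (q @ [a]) - 1)" using snoc by simp
  moreover have "horner (q @ [a]) = f w' \<ominus>\<^bsub>M\<^esub> c \<odot>\<^bsub>M\<^esub> w' \<oplus>\<^bsub>M\<^esub> R.eval (\<one> # q @ [a]) c \<odot>\<^bsub>M\<^esub> v"
  proof -
    define x1 where "x1 = f (f w)"
    define x2 where "x2 = e \<odot>\<^bsub>M\<^esub> f v"
    define x3 where "x3 = c \<odot>\<^bsub>M\<^esub> f w"
    define x4 where "x4 = (e \<otimes> c) \<odot>\<^bsub>M\<^esub> v"
    define x5 where "x5 = a \<odot>\<^bsub>M\<^esub> v"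
    have x: "x1 \<in> carrier M" "x2 \<in> carrier M" "x3 \<in> carrier M" "x4 \<in> carrier M" "x5 \<in> carrier M"
      using wM e c a v endoD by (auto simp: x1_def x2_def x3_def x4_def x5_def)
    have "f (f w \<ominus>\<^bsub>M\<^esub> c \<odot>\<^bsub>M\<^esub> w) = x1 \<ominus>\<^bsub>M\<^esub> x3"
    proof -
      have "f w \<ominus>\<^bsub>M\<^esub> c \<odot>\<^bsub>M\<^esub> w = f w \<oplus>\<^bsub>M\<^esub> (\<ominus> c) \<odot>\<^bsub>M\<^esub> w"
        using wM c endoD by (simp add: M.minus_eq smult_l_minus)
      moreover have "f (f w \<oplus>\<^bsub>M\<^esub> (\<ominus> c) \<odot>\<^bsub>M\<^esub> w) = f (f w) \<oplus>\<^bsub>M\<^esub> (\<ominus> c) \<odot>\<^bsub>M\<^esub> f w"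
        using wM c endoD by simp
      ultimately show ?thesis using wM c endoD(1)
        by (simp add: x1_def x3_def M.minus_eq smult_l_minus)
    qed
    then have "horner (q @ [a]) = x1 \<ominus>\<^bsub>M\<^esub> x3 \<oplus>\<^bsub>M\<^esub> x2 \<oplus>\<^bsub>M\<^esub> x5"
      using w(2) wM e c v endoD unfolding e_def[symmetric] by (simp add: horner_def x2_def x5_def)
    also have "\<dots> = (x1 \<oplus>\<^bsub>M\<^esub> x2) \<oplus>\<^bsub>M\<^esub> (\<ominus>\<^bsub>M\<^esub> x3 \<oplus>\<^bsub>M\<^esub> x5)"
      using x by (simp add: M.minus_eq M.a_ac)
    also have "\<ominus>\<^bsub>M\<^esub> x3 \<oplus>\<^bsub>M\<^esub> x5 = \<ominus>\<^bsub>M\<^esub> x3 \<oplus>\<^bsub>M\<^esub> \<ominus>\<^bsub>M\<^esub> x4 \<oplus>\<^bsub>M\<^esub> (x4 \<oplus>\<^bsub>M\<^esub> x5)"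
      using x by (simp add: M.a_assoc M.r_neg1)
    also have "(x1 \<oplus>\<^bsub>M\<^esub> x2) \<oplus>\<^bsub>M\<^esub> \<dots> = (x1 \<oplus>\<^bsub>M\<^esub> x2) \<ominus>\<^bsub>M\<^esub> (x3 \<oplus>\<^bsub>M\<^esub> x4) \<oplus>\<^bsub>M\<^esub> (x4 \<oplus>\<^bsub>M\<^esub> x5)"
      using x by (simp add: M.minus_eq M.minus_add M.a_assoc)
    also have "\<dots> = f w' \<ominus>\<^bsub>M\<^esub> c \<odot>\<^bsub>M\<^esub> w' \<oplus>\<^bsub>M\<^esub> R.eval (\<one> # q @ [a]) c \<odot>\<^bsub>M\<^esub> v"
      using wM e c a v endoD unfolding ee
      by (simp add: w'_def x1_def x2_def x3_def x4_def x5_def smult_r_distr smult_l_distr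
          smult_assoc1[symmetric] R.m_comm)
    finally show ?thesis .
  qed
  ultimately show ?case by blast
qed

text \<open>Take a monic polynomial of least degree whose value at \<open>f\<close> kills
  \<open>v\<close>, and a root \<open>c\<close> of it. Division by X - c leaves a monic polynomial
  of smaller degree. Its value at \<open>v\<close> is nonzero by minimality and is killed by f -
  c.\<close>

lemma ex_eigenvector:
  assumes "algebraically_closed K" "finite_dim K M" "v \<noteq> \<zero>\<^bsub>M\<^esub>"
  shows "\<exists>c\<in>carrier K. \<exists>w\<in>carrier M. w \<noteq> \<zero>\<^bsub>M\<^esub> \<and> f w = c \<odot>\<^bsub>M\<^esub> w"
proof -
  interpret AC: algebraically_closed K by fact
  obtain \<Phi> where \<Phi>: "finite \<Phi>" "\<Phi> \<subseteq> functionals K M"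
    "\<And>w. \<lbrakk>w \<in> carrier M; \<forall>f\<in>\<Phi>. f w = \<zero>\<rbrakk> \<Longrightarrow> w = \<zero>\<^bsub>M\<^esub>"
    by (rule separating_functionals[OF assms(2)], rule that)
  obtain n s where s: "s \<in> lspan ((\<lambda>i. (f ^^ i) v) ` {..<n})" "\<forall>g\<in>\<Phi>. g ((f ^^ n) v) = g s"
    using dependent_sequence[OF \<Phi>(1,2), of "\<lambda>i. (f ^^ i) v"] funpow_carrier by auto
  have "lspan ((\<lambda>i. (f ^^ i) v) ` {..<n}) \<subseteq> poly_values n"
    using funpow_poly_values by (intro lspan_subset subspace_poly_values) auto
  then have s': "s \<in> poly_values n" using s by auto
  then have sM: "s \<in> carrier M" by (rule subspaceD(1)[OF subspace_poly_values])
  have "(f ^^ n) v \<ominus>\<^bsub>M\<^esub> s = \<zero>\<^bsub>M\<^esub>"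
  proof (rule \<Phi>(3))
    show "\<forall>g\<in>\<Phi>. g ((f ^^ n) v \<ominus>\<^bsub>M\<^esub> s) = \<zero>"
    proof
      fix g assume "g \<in> \<Phi>"
      then have g: "g \<in> functionals K M" and "g ((f ^^ n) v) = g s" using \<Phi> s by auto
      then show "g ((f ^^ n) v \<ominus>\<^bsub>M\<^esub> s) = \<zero>"
        using sM funpow_carrier[of n] functionalsD(1)[OF g sM]
        by (simp add: functional_minus R.minus_eq R.r_neg)
    qed
  qed (use sM funpow_carrier in auto)
  moreover have "\<zero>\<^bsub>M\<^esub> \<ominus>\<^bsub>M\<^esub> s \<in> poly_values n"
    by (rule subspace_minus[OF subspace_poly_values subspaceD(2)[OF subspace_poly_values] s'])
  ultimately have "\<zero>\<^bsub>M\<^esub> \<in> monic_values n"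
    using monic_values_funpow[of "\<zero>\<^bsub>M\<^esub> \<ominus>\<^bsub>M\<^esub> s" n] sM funpow_carrier[of n] by (simp add: M.minus_eq)
  \<comment> \<open>From here \<open>n\<close> is the least degree and no longer the index found by
    linear dependence. It is positive, because the only monic value in degree zero is
    \<open>v\<close>.\<close>
  then obtain n where n: "\<zero>\<^bsub>M\<^esub> \<in> monic_values n" "\<And>m. \<zero>\<^bsub>M\<^esub> \<in> monic_values m \<Longrightarrow> n \<le> m"
    using ex_has_least_nat[of "\<lambda>n. \<zero>\<^bsub>M\<^esub> \<in> monic_values n" n "\<lambda>n. n"] by blast
  have n0: "n \<noteq> 0" using n(1) assms(3) by (cases n) auto
  obtain q where q: "length q = n" "set q \<subseteq> carrier K" "\<zero>\<^bsub>M\<^esub> = horner q"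
    using monic_values_horner[OF n(1)] by blast
  \<comment> \<open>The leading coefficient that \<open>horner\<close> leaves implicit is put
    back.\<close>
  let ?p = "\<one> # q"
  have p: "?p \<in> carrier (poly_ring K)"
    using q by (auto simp: univ_poly_carrier[symmetric] polynomial_def)
  then have "size (R.roots ?p) = n" using AC.roots_over_carrier[of ?p] q by (simp add: R.splitted_def)
  then obtain c where "c \<in># R.roots ?p" using n0 by (metis multiset_nonemptyE size_empty)
  then have c: "c \<in> carrier K" "R.eval ?p c = \<zero>"
    using R.roots_mem_iff_is_root[OF p] by (auto simp: R.is_root_def)
  have "q \<noteq> []" using q n0 by auto
  from horner_division[OF this q(2) c(1)] obtain w where w: "w \<in> monic_values (n - 1)"
    "horner q = f w \<ominus>\<^bsub>M\<^esub> c \<odot>\<^bsub>M\<^esub> w \<oplus>\<^bsub>M\<^esub> R.eval ?p c \<odot>\<^bsub>M\<^esub> v" using q by auto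
  have wM: "w \<in> carrier M" using subsetD[OF monic_values_carrier w(1)] .
  have "f w \<ominus>\<^bsub>M\<^esub> c \<odot>\<^bsub>M\<^esub> w = \<zero>\<^bsub>M\<^esub>"
    using w(2) c q(3) wM v endoD by simp
  then have "f w = c \<odot>\<^bsub>M\<^esub> w" using wM c endoD by (simp add: M.minus_eq_zero_iff)
  moreover have "w \<noteq> \<zero>\<^bsub>M\<^esub>" using w(1) n(2)[of "n - 1"] n0 by auto
  ultimately show ?thesis using c wM by blast
qed

end

end

section \<open>Finite abelian categories as concrete categories\<close>

text \<open>Without the extensionality of \<open>module_homs\<close>, homomorphisms can be given by
  plain formulas. The assumption \<open>full\<close> returns an arrow that agrees with such a map on
  the carrier.\<close>

definition module_hom ::
    "('a, 'y) ring_scheme \<Rightarrow> ('a, 'v, 'p) module_scheme \<Rightarrow> ('a, 'w, 'q) module_scheme \<Rightarrow> ('v \<Rightarrow> 'w) \<Rightarrow> bool" where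
  "module_hom A M N h \<longleftrightarrow> h \<in> carrier M \<rightarrow> carrier N \<and>
     (\<forall>v\<in>carrier M. \<forall>w\<in>carrier M. h (v \<oplus>\<^bsub>M\<^esub> w) = h v \<oplus>\<^bsub>N\<^esub> h w) \<and>
     (\<forall>a\<in>carrier A. \<forall>v\<in>carrier M. h (a \<odot>\<^bsub>M\<^esub> v) = a \<odot>\<^bsub>N\<^esub> h v)"

lemma module_homD:
  assumes "module_hom A M N h"
  shows "v \<in> carrier M \<Longrightarrow> h v \<in> carrier N"
    and "\<lbrakk>v \<in> carrier M; w \<in> carrier M\<rbrakk> \<Longrightarrow> h (v \<oplus>\<^bsub>M\<^esub> w) = h v \<oplus>\<^bsub>N\<^esub> h w"
    and "\<lbrakk>a \<in> carrier A; v \<in> carrier M\<rbrakk> \<Longrightarrow> h (a \<odot>\<^bsub>M\<^esub> v) = a \<odot>\<^bsub>N\<^esub> h v"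
  using assms by (auto simp: module_hom_def)

lemma module_homI:
  assumes "\<And>v. v \<in> carrier M \<Longrightarrow> h v \<in> carrier N"
    and "\<And>v w. \<lbrakk>v \<in> carrier M; w \<in> carrier M\<rbrakk> \<Longrightarrow> h (v \<oplus>\<^bsub>M\<^esub> w) = h v \<oplus>\<^bsub>N\<^esub> h w"
    and "\<And>a v. \<lbrakk>a \<in> carrier A; v \<in> carrier M\<rbrakk> \<Longrightarrow> h (a \<odot>\<^bsub>M\<^esub> v) = a \<odot>\<^bsub>N\<^esub> h v"
  shows "module_hom A M N h"
  using assms by (auto simp: module_hom_def)

lemma (in category) HomD:
  assumes "f \<in> Hom C X Y"
  shows "f \<in> Arr C" "Dom C f = X" "Cod C f = Y" "X \<in> Obj C" "Y \<in> Obj C"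
  using assms Dom_Obj Cod_Obj by (auto simp: Hom_def)

text \<open>An equivalence with the finite-dimensional modules in the form in which it is used.
  Fullness and essential surjectivity replace the inverse functor and its isomorphisms: objects and
  arrows are constructed from modules and compared on elements.\<close>

locale concrete_linear_category = linear_category K C
  for K :: "('k, 'x) ring_scheme" and C :: "('k, 'o, 'm, 'z) lcat_scheme" (structure) +
  fixes A :: "('k, nat \<Rightarrow> 'k) module" and V :: "'o \<Rightarrow> (nat \<Rightarrow> 'k, nat \<Rightarrow> 'k) module"
    and ap :: "'m \<Rightarrow> (nat \<Rightarrow> 'k) \<Rightarrow> nat \<Rightarrow> 'k"
  assumes fd_algebra: "fd_algebra K A"
    and V_module: "X \<in> Obj C \<Longrightarrow> V X \<in> fd_left_modules K A"
    and ap_hom: "f \<in> Hom C X Y \<Longrightarrow> module_hom A (V X) (V Y) (ap f)"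
    and ap_ident: "\<lbrakk>X \<in> Obj C; v \<in> carrier (V X)\<rbrakk> \<Longrightarrow> ap (ident X) v = v"
    and ap_Comp: "\<lbrakk>f \<in> Hom C X Y; g \<in> Hom C Y W; v \<in> carrier (V X)\<rbrakk> \<Longrightarrow> ap (g \<cdot> f) v = ap g (ap f v)"
    and ap_Add: "\<lbrakk>f \<in> Hom C X Y; g \<in> Hom C X Y; v \<in> carrier (V X)\<rbrakk>
      \<Longrightarrow> ap (Add C f g) v = ap f v \<oplus>\<^bsub>V Y\<^esub> ap g v"
    and ap_Scal: "\<lbrakk>c \<in> carrier K; f \<in> Hom C X Y; v \<in> carrier (V X)\<rbrakk>
      \<Longrightarrow> ap (Scal C c f) v = (c \<odot>\<^bsub>A\<^esub> \<one>\<^bsub>A\<^esub>) \<odot>\<^bsub>V Y\<^esub> ap f v"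
    and faithful: "\<lbrakk>f \<in> Hom C X Y; g \<in> Hom C X Y; \<And>v. v \<in> carrier (V X) \<Longrightarrow> ap f v = ap g v\<rbrakk> \<Longrightarrow> f = g"
    and full: "\<lbrakk>X \<in> Obj C; Y \<in> Obj C; module_hom A (V X) (V Y) h\<rbrakk>
      \<Longrightarrow> \<exists>f\<in>Hom C X Y. \<forall>v\<in>carrier (V X). ap f v = h v"
    and ess_surj: "(M :: (nat \<Rightarrow> 'k, nat \<Rightarrow> 'k) module) \<in> fd_left_modules K A
      \<Longrightarrow> \<exists>X\<in>Obj C. \<exists>h. module_hom A (V X) M h \<and> bij_betw h (carrier (V X)) (carrier M)"

lemma Hom_module_category:
  "u \<in> Hom (module_category K A) M N \<longleftrightarrow> (\<exists>f. u = (M, f, N) \<and> M \<in> fd_left_modules K A \<and>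
     N \<in> fd_left_modules K A \<and> f \<in> module_homs A M N)"
  by (auto simp: Hom_def module_category_def)

lemma module_homs_module_hom: "f \<in> module_homs A M N \<Longrightarrow> module_hom A M N f"
  by (auto simp: module_homs_def module_hom_def PiE_def)

text \<open>The unit of the equivalence makes \<open>F\<close> faithful and the counit makes
  \<open>G\<close> faithful. Fullness of \<open>F\<close> takes both: the preimage of an arrow is
  found by conjugation with the unit, and it is recognized after applying \<open>G\<close>.\<close>

lemma finite_abelian_category_concrete:
  fixes K :: "('k, 'x) ring_scheme" and C :: "('k, 'o, 'm, 'z) lcat_scheme"
  assumes "finite_abelian_category K C"
  shows "\<exists>(A :: ('k, nat \<Rightarrow> 'k) module) (V :: 'o \<Rightarrow> (nat \<Rightarrow> 'k, nat \<Rightarrow> 'k) module) ap.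
    concrete_linear_category K C A V ap"
proof -
  from assms obtain A :: "('k, nat \<Rightarrow> 'k) module" where lin: "linear_category K C" and A: "fd_algebra K A"
    and "linearly_equivalent K C (module_category K A :: ('k, (nat \<Rightarrow> 'k, nat \<Rightarrow> 'k) module,
             (nat \<Rightarrow> 'k, nat \<Rightarrow> 'k) module \<times> ((nat \<Rightarrow> 'k) \<Rightarrow> (nat \<Rightarrow> 'k))
               \<times> (nat \<Rightarrow> 'k, nat \<Rightarrow> 'k) module) lcat)"
    unfolding finite_abelian_category_def by blast
  define D where "D = (module_category K A :: ('k, (nat \<Rightarrow> 'k, nat \<Rightarrow> 'k) module,
             (nat \<Rightarrow> 'k, nat \<Rightarrow> 'k) module \<times> ((nat \<Rightarrow> 'k) \<Rightarrow> (nat \<Rightarrow> 'k))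
               \<times> (nat \<Rightarrow> 'k, nat \<Rightarrow> 'k) module) lcat)"
  have "linearly_equivalent K C D" unfolding D_def by fact
  then obtain F G where F: "linear_functor K C D F" and G: "linear_functor K D C G"
    and "naturally_isomorphic C C id_functor (comp_functor G F)"
    and "naturally_isomorphic D D (comp_functor F G) id_functor"
    unfolding linearly_equivalent_def by blast
  then obtain \<eta> \<epsilon> where
    \<eta>: "nat_transformation C C id_functor (comp_functor G F) \<eta>"
       "\<And>X. X \<in> Obj C \<Longrightarrow> iso_arrow C X (OMap G (OMap F X)) (\<eta> X)" and
    \<epsilon>: "nat_transformation D D (comp_functor F G) id_functor \<epsilon>"
       "\<And>M. M \<in> Obj D \<Longrightarrow> iso_arrow D (OMap F (OMap G M)) M (\<epsilon> M)"
    unfolding naturally_isomorphic_def by (auto simp: id_functor_def comp_functor_def)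
  interpret C: linear_category K C by (fact lin)
  have FF: "is_functor C D F" and GG: "is_functor D C G"
    using F G by (auto simp: linear_functor_def)
  interpret D: category D using FF by (auto simp: is_functor_def)
  have F_Obj: "OMap F X \<in> Obj D" if "X \<in> Obj C" for X
    using FF that unfolding is_functor_def by blast
  have G_Obj: "OMap G M \<in> Obj C" if "M \<in> Obj D" for M
    using GG that unfolding is_functor_def by blast
  have F_Hom: "AMap F f \<in> Hom D (OMap F X) (OMap F Y)" if "f \<in> Hom C X Y" for f X Y
    using FF that C.HomD[OF that] unfolding is_functor_def by blast
  have G_Hom: "AMap G u \<in> Hom C (OMap G M) (OMap G N)" if "u \<in> Hom D M N" for u M N
    using GG that D.HomD[OF that] unfolding is_functor_def by blast
  have F_Comp: "AMap F (g \<cdot>\<^bsub>C\<^esub> f) = AMap F g \<cdot>\<^bsub>D\<^esub> AMap F f" if "f \<in> Hom C X Y" "g \<in> Hom C Y W" for f g X Y W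
    using FF that C.HomD[OF that(1)] C.HomD[OF that(2)] unfolding is_functor_def by blast
  have \<eta>_Hom: "\<eta> X \<in> Hom C X (OMap G (OMap F X))" if "X \<in> Obj C" for X
    using \<eta>(1) that by (simp add: nat_transformation_def id_functor_def comp_functor_def)
  have \<eta>_nat: "AMap G (AMap F f) \<cdot>\<^bsub>C\<^esub> \<eta> X = \<eta> Y \<cdot>\<^bsub>C\<^esub> f" if "f \<in> Hom C X Y" for f X Y
    using \<eta>(1) that C.HomD[OF that] by (simp add: nat_transformation_def id_functor_def comp_functor_def)
  have \<epsilon>_Hom: "\<epsilon> M \<in> Hom D (OMap F (OMap G M)) M" if "M \<in> Obj D" for M
    using \<epsilon>(1) that by (simp add: nat_transformation_def id_functor_def comp_functor_def)
  have \<epsilon>_nat: "u \<cdot>\<^bsub>D\<^esub> \<epsilon> M = \<epsilon> N \<cdot>\<^bsub>D\<^esub> AMap F (AMap G u)" if "u \<in> Hom D M N" for u M N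
    using \<epsilon>(1) that D.HomD[OF that] by (simp add: nat_transformation_def id_functor_def comp_functor_def)
  have F_faithful: "f = g" if f: "f \<in> Hom C X Y" "g \<in> Hom C X Y" "AMap F f = AMap F g" for f g X Y
  proof -
    have XY: "X \<in> Obj C" "Y \<in> Obj C" using C.HomD[OF f(1)] by auto
    obtain k where k: "k \<in> Hom C (OMap G (OMap F Y)) Y" "k \<cdot>\<^bsub>C\<^esub> \<eta> Y = ident\<^bsub>C\<^esub> Y"
      using \<eta>(2)[OF XY(2)] by (auto simp: iso_arrow_def inverse_arrows_def)
    have "\<eta> Y \<cdot>\<^bsub>C\<^esub> f = \<eta> Y \<cdot>\<^bsub>C\<^esub> g"
      using \<eta>_nat[OF f(1)] \<eta>_nat[OF f(2)] f(3) by simp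
    then have "(k \<cdot>\<^bsub>C\<^esub> \<eta> Y) \<cdot>\<^bsub>C\<^esub> f = (k \<cdot>\<^bsub>C\<^esub> \<eta> Y) \<cdot>\<^bsub>C\<^esub> g"
      using C.Comp_assoc[OF f(1) \<eta>_Hom[OF XY(2)] k(1)] C.Comp_assoc[OF f(2) \<eta>_Hom[OF XY(2)] k(1)] by simp
    then show ?thesis using k(2) C.ident_left[OF f(1)] C.ident_left[OF f(2)] by simp
  qed
  have G_faithful: "u = u'" if u: "u \<in> Hom D M N" "u' \<in> Hom D M N" "AMap G u = AMap G u'" for u u' M N
  proof -
    have MN: "M \<in> Obj D" "N \<in> Obj D" using D.HomD[OF u(1)] by auto
    obtain k where k: "k \<in> Hom D M (OMap F (OMap G M))" "\<epsilon> M \<cdot>\<^bsub>D\<^esub> k = ident\<^bsub>D\<^esub> M"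
      using \<epsilon>(2)[OF MN(1)] by (auto simp: iso_arrow_def inverse_arrows_def)
    have "u \<cdot>\<^bsub>D\<^esub> \<epsilon> M = u' \<cdot>\<^bsub>D\<^esub> \<epsilon> M"
      using \<epsilon>_nat[OF u(1)] \<epsilon>_nat[OF u(2)] u(3) by simp
    then have "u \<cdot>\<^bsub>D\<^esub> (\<epsilon> M \<cdot>\<^bsub>D\<^esub> k) = u' \<cdot>\<^bsub>D\<^esub> (\<epsilon> M \<cdot>\<^bsub>D\<^esub> k)"
      using D.Comp_assoc[OF k(1) \<epsilon>_Hom[OF MN(1)] u(1)] D.Comp_assoc[OF k(1) \<epsilon>_Hom[OF MN(1)] u(2)] by simp
    then show ?thesis using k(2) D.ident_right[OF u(1)] D.ident_right[OF u(2)] by simp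
  qed
  have F_full: "\<exists>f\<in>Hom C X Y. AMap F f = u" if XY: "X \<in> Obj C" "Y \<in> Obj C" "u \<in> Hom D (OMap F X) (OMap F Y)" for u X Y
  proof -
    obtain k where k: "k \<in> Hom C (OMap G (OMap F Y)) Y" "\<eta> Y \<cdot>\<^bsub>C\<^esub> k = ident\<^bsub>C\<^esub> (OMap G (OMap F Y))"
      using \<eta>(2)[OF XY(2)] by (auto simp: iso_arrow_def inverse_arrows_def)
    obtain l where l: "l \<in> Hom C (OMap G (OMap F X)) X" "\<eta> X \<cdot>\<^bsub>C\<^esub> l = ident\<^bsub>C\<^esub> (OMap G (OMap F X))"
      using \<eta>(2)[OF XY(1)] by (auto simp: iso_arrow_def inverse_arrows_def)
    note Gu = G_Hom[OF XY(3)]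
    have Gu\<eta>: "AMap G u \<cdot>\<^bsub>C\<^esub> \<eta> X \<in> Hom C X (OMap G (OMap F Y))"
      by (rule C.Comp_Hom[OF \<eta>_Hom[OF XY(1)] Gu])
    \<comment> \<open>By naturality of the unit this is the only candidate for a preimage of
      \<open>u\<close>.\<close>
    define f where "f = k \<cdot>\<^bsub>C\<^esub> (AMap G u \<cdot>\<^bsub>C\<^esub> \<eta> X)"
    have f: "f \<in> Hom C X Y" unfolding f_def by (rule C.Comp_Hom[OF Gu\<eta> k(1)])
    have "\<eta> Y \<cdot>\<^bsub>C\<^esub> f = AMap G u \<cdot>\<^bsub>C\<^esub> \<eta> X"
      unfolding f_def using C.Comp_assoc[OF Gu\<eta> k(1) \<eta>_Hom[OF XY(2)]] k(2) C.ident_left[OF Gu\<eta>] by simp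
    then have "AMap G (AMap F f) \<cdot>\<^bsub>C\<^esub> \<eta> X = AMap G u \<cdot>\<^bsub>C\<^esub> \<eta> X" using \<eta>_nat[OF f] by simp
    moreover note Gf = G_Hom[OF F_Hom[OF f]]
    ultimately have "AMap G (AMap F f) \<cdot>\<^bsub>C\<^esub> (\<eta> X \<cdot>\<^bsub>C\<^esub> l) = AMap G u \<cdot>\<^bsub>C\<^esub> (\<eta> X \<cdot>\<^bsub>C\<^esub> l)"
      using C.Comp_assoc[OF l(1) \<eta>_Hom[OF XY(1)] Gf] C.Comp_assoc[OF l(1) \<eta>_Hom[OF XY(1)] Gu] by simp
    then have "AMap G (AMap F f) = AMap G u" using l(2) C.ident_right[OF Gf] C.ident_right[OF Gu] by simp
    then show ?thesis using G_faithful[OF F_Hom[OF f] XY(3)] f by blast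
  qed
  define ap where "ap f = fst (snd (AMap F f))" for f
  have Fap: "AMap F f = (OMap F X, ap f, OMap F Y) \<and> ap f \<in> module_homs A (OMap F X) (OMap F Y)"
    if "f \<in> Hom C X Y" for f X Y
    using F_Hom[OF that] unfolding D_def Hom_module_category by (auto simp: ap_def D_def[symmetric])
  have ObjD: "Obj D = fd_left_modules K A" by (simp add: D_def module_category_def)
  have "concrete_linear_category K C A (OMap F) ap"
  proof (intro concrete_linear_category.intro lin concrete_linear_category_axioms.intro)
    show "fd_algebra K A" by fact
    show "OMap F X \<in> fd_left_modules K A" if "X \<in> Obj C" for X
      using F_Obj[OF that] ObjD by simp
    show "module_hom A (OMap F X) (OMap F Y) (ap f)" if "f \<in> Hom C X Y" for f X Y
      using Fap[OF that] module_homs_module_hom by blast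
    show "ap (ident\<^bsub>C\<^esub> X) v = v" if "X \<in> Obj C" "v \<in> carrier (OMap F X)" for X v
    proof -
      have "AMap F (ident\<^bsub>C\<^esub> X) = ident\<^bsub>D\<^esub> (OMap F X)" using FF that unfolding is_functor_def by blast
      then show ?thesis using that by (simp add: ap_def D_def module_category_def)
    qed
    show "ap (g \<cdot>\<^bsub>C\<^esub> f) v = ap g (ap f v)"
      if "f \<in> Hom C X Y" "g \<in> Hom C Y W" "v \<in> carrier (OMap F X)" for f g X Y W v
    proof -
      have "AMap F (g \<cdot>\<^bsub>C\<^esub> f) = (OMap F Y, ap g, OMap F W) \<cdot>\<^bsub>D\<^esub> (OMap F X, ap f, OMap F Y)"
        using F_Comp[OF that(1,2)] Fap[OF that(1)] Fap[OF that(2)] by simp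
      then show ?thesis using that(3)
        by (simp add: ap_def[of "g \<cdot>\<^bsub>C\<^esub> f"] D_def module_category_def compose_def)
    qed
    show "ap (Add C f g) v = ap f v \<oplus>\<^bsub>OMap F Y\<^esub> ap g v"
      if "f \<in> Hom C X Y" "g \<in> Hom C X Y" "v \<in> carrier (OMap F X)" for f g X Y v
    proof -
      have "AMap F (Add C f g) = Add D (AMap F f) (AMap F g)"
        using F that C.HomD[OF that(1)] unfolding linear_functor_def by blast
      also have "\<dots> = Add D (OMap F X, ap f, OMap F Y) (OMap F X, ap g, OMap F Y)"
        using Fap[OF that(1)] Fap[OF that(2)] by simp
      finally show ?thesis using that(3)
        by (simp add: ap_def[of "Add C f g"] D_def module_category_def)
    qed
    show "ap (Scal C c f) v = (c \<odot>\<^bsub>A\<^esub> \<one>\<^bsub>A\<^esub>) \<odot>\<^bsub>OMap F Y\<^esub> ap f v"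
      if "c \<in> carrier K" "f \<in> Hom C X Y" "v \<in> carrier (OMap F X)" for c f X Y v
    proof -
      have "AMap F (Scal C c f) = Scal D c (AMap F f)"
        using F that C.HomD[OF that(2)] unfolding linear_functor_def by blast
      also have "\<dots> = Scal D c (OMap F X, ap f, OMap F Y)"
        using Fap[OF that(2)] by simp
      finally show ?thesis using that(3)
        by (simp add: ap_def[of "Scal C c f"] D_def module_category_def)
    qed
    show "f = g" if "f \<in> Hom C X Y" "g \<in> Hom C X Y"
      "\<And>v. v \<in> carrier (OMap F X) \<Longrightarrow> ap f v = ap g v" for f g X Y
    proof (rule F_faithful[OF that(1,2)])
      have "ap f = ap g"
      proof (rule extensionalityI)
        show "ap f \<in> extensional (carrier (OMap F X))" "ap g \<in> extensional (carrier (OMap F X))"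
          using Fap[OF that(1)] Fap[OF that(2)] by (auto simp: module_homs_def PiE_def)
      qed (use that in auto)
      then show "AMap F f = AMap F g" using Fap[OF that(1)] Fap[OF that(2)] by simp
    qed
    show "\<exists>f\<in>Hom C X Y. \<forall>v\<in>carrier (OMap F X). ap f v = h v"
      if "X \<in> Obj C" "Y \<in> Obj C" "module_hom A (OMap F X) (OMap F Y) h" for X Y h
    proof -
      have XY: "left_module A (OMap F X)" using F_Obj[OF that(1)] ObjD by (simp add: fd_left_modules_def)
      then interpret X: abelian_group "OMap F X" by (simp add: left_module_def)
      have sm: "a \<odot>\<^bsub>OMap F X\<^esub> v \<in> carrier (OMap F X)"
        if "a \<in> carrier A" "v \<in> carrier (OMap F X)" for a v
        using XY that by (simp add: left_module_def)
      have "restrict h (carrier (OMap F X)) \<in> module_homs A (OMap F X) (OMap F Y)"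
        unfolding module_homs_def
        using module_homD[OF that(3)] sm by simp
      then have "(OMap F X, restrict h (carrier (OMap F X)), OMap F Y) \<in> Hom D (OMap F X) (OMap F Y)"
        unfolding D_def Hom_module_category using F_Obj[OF that(1)] F_Obj[OF that(2)] ObjD by blast
      from F_full[OF that(1,2) this] obtain f where f: "f \<in> Hom C X Y"
        "AMap F f = (OMap F X, restrict h (carrier (OMap F X)), OMap F Y)" by blast
      then show ?thesis by (intro bexI[of _ f]) (auto simp: ap_def)
    qed
    show "\<exists>X\<in>Obj C. \<exists>h. module_hom A (OMap F X) M h \<and> bij_betw h (carrier (OMap F X)) (carrier M)"
      if "M \<in> fd_left_modules K A" for M :: "(nat \<Rightarrow> 'k, nat \<Rightarrow> 'k) module"
    proof -
      have M: "M \<in> Obj D" using that ObjD by simp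
      let ?X = "OMap G M"
      obtain k where k: "inverse_arrows D (OMap F ?X) M (\<epsilon> M) k"
        using \<epsilon>(2)[OF M] by (auto simp: iso_arrow_def)
      obtain h where h: "\<epsilon> M = (OMap F ?X, h, M)" "h \<in> module_homs A (OMap F ?X) M"
        using \<epsilon>_Hom[OF M] unfolding D_def Hom_module_category by auto
      obtain l where l: "k = (M, l, OMap F ?X)" "l \<in> module_homs A M (OMap F ?X)"
        using k unfolding inverse_arrows_def D_def Hom_module_category by auto
      have hh: "module_hom A (OMap F ?X) M h" and ll: "module_hom A M (OMap F ?X) l"
        using h l module_homs_module_hom by auto
      have lh: "compose (carrier (OMap F ?X)) l h = restrict (\<lambda>v. v) (carrier (OMap F ?X))"
        and hl: "compose (carrier M) h l = restrict (\<lambda>v. v) (carrier M)"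
        using k h(1) l(1) unfolding inverse_arrows_def D_def by (auto simp: module_category_def)
      have "l (h v) = v" if "v \<in> carrier (OMap F ?X)" for v
        using that fun_cong[OF lh, of v] by (simp add: compose_def)
      moreover have "h (l v) = v" if "v \<in> carrier M" for v
        using that fun_cong[OF hl, of v] by (simp add: compose_def)
      ultimately have "bij_betw h (carrier (OMap F ?X)) (carrier M)"
        using module_homD(1)[OF hh] module_homD(1)[OF ll]
        by (intro bij_betw_byWitness[of _ l]) auto
      then show ?thesis using hh G_Obj[OF M] by blast
    qed
  qed
  then show ?thesis by blast
qed

section \<open>Finite-dimensional modules\<close>

lemma restrict_scalars_simps [simp]:
  "carrier (restrict_scalars A M) = carrier M" "zero (restrict_scalars A M) = zero M"
  "add (restrict_scalars A M) = add M"
  "c \<odot>\<^bsub>restrict_scalars A M\<^esub> v = (c \<odot>\<^bsub>A\<^esub> \<one>\<^bsub>A\<^esub>) \<odot>\<^bsub>M\<^esub> v"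
  "finsum (restrict_scalars A M) f B = finsum M f B"
  by (simp_all add: restrict_scalars_def finsum_def finprod_def)

lemma (in lin_space) subspace_lin_space:
  assumes "subspace W"
  shows "lin_space K (M\<lparr>carrier := W\<rparr>)"
proof -
  note W = subspaceD[OF assms]
  have "abelian_group (M\<lparr>carrier := W\<rparr>)"
  proof (rule abelian_groupI)
    fix x assume x: "x \<in> carrier (M\<lparr>carrier := W\<rparr>)"
    show "\<exists>y\<in>carrier (M\<lparr>carrier := W\<rparr>). y \<oplus>\<^bsub>M\<lparr>carrier := W\<rparr>\<^esub> x = \<zero>\<^bsub>M\<lparr>carrier := W\<rparr>\<^esub>"
      using x W(1)[of x] W(4)[of "\<ominus> \<one>" x]
      by (intro bexI[of _ "(\<ominus> \<one>) \<odot>\<^bsub>M\<^esub> x"]) (auto simp: smult_l_minus M.l_neg)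
  qed (use W in \<open>auto simp: M.a_ac\<close>)
  then have "module K (M\<lparr>carrier := W\<rparr>)"
    using W by (intro moduleI R.is_cring) (auto simp: smult_l_distr smult_r_distr smult_assoc1)
  then show ?thesis
    by (simp add: lin_space_def R.field_axioms)
qed

text \<open>Functionals that separate the points of the whole space still do so on a
  subspace.\<close>

lemma (in lin_space) finite_dim_subspace:
  assumes "subspace W" "finite_dim K M"
  shows "finite_dim K (M\<lparr>carrier := W\<rparr>)"
proof -
  interpret W: lin_space K "M\<lparr>carrier := W\<rparr>" by (rule subspace_lin_space) fact
  obtain \<Phi> where \<Phi>: "finite \<Phi>" "\<Phi> \<subseteq> functionals K M"
    "\<And>w. \<lbrakk>w \<in> carrier M; \<forall>f\<in>\<Phi>. f w = \<zero>\<rbrakk> \<Longrightarrow> w = \<zero>\<^bsub>M\<^esub>"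
    by (rule separating_functionals[OF assms(2)], rule that)
  show ?thesis
  proof (rule W.finite_dim_separating[OF \<Phi>(1)])
    show "\<Phi> \<subseteq> functionals K (M\<lparr>carrier := W\<rparr>)"
    proof
      fix f assume "f \<in> \<Phi>"
      then have f: "f \<in> functionals K M" using \<Phi>(2) by auto
      show "f \<in> functionals K (M\<lparr>carrier := W\<rparr>)"
        by (rule functionalsI) (use functionalsD[OF f] subspaceD(1)[OF assms(1)] in auto)
    qed
  qed (use \<Phi>(3) subspaceD(1)[OF assms(1)] in auto)
qed

text \<open>A sum in the record with the smaller carrier is formally a different sum; the inclusion
  is additive and identifies the two.\<close>

lemma (in lin_space) finsum_subspace:
  assumes "subspace W" "f \<in> B \<rightarrow> W"
  shows "finsum (M\<lparr>carrier := W\<rparr>) f B = finsum M f B"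
proof -
  interpret W: lin_space K "M\<lparr>carrier := W\<rparr>" by (rule subspace_lin_space) fact
  show ?thesis
    using finsum_additive[OF W.M.abelian_monoid_axioms M.abelian_monoid_axioms, of f B "\<lambda>v. v"]
      assms subspaceD(1)[OF assms(1)] by auto
qed

locale alg_module = R?: field K
  for K :: "('k, 'x) ring_scheme" (structure) +
  fixes A :: "('k, 'a) module" and M :: "('a, 'v) module"
  assumes fd_alg: "fd_algebra K A" and left_mod: "left_module A M"
begin

sublocale A: ring A using fd_alg by (simp add: fd_algebra_def)
sublocale KA: lin_space K A
  using fd_alg R.field_axioms by (simp add: fd_algebra_def lin_space_def)
sublocale M: abelian_group M using left_mod by (simp add: left_module_def)

lemma act_closed [simp, intro]: "\<lbrakk>a \<in> carrier A; v \<in> carrier M\<rbrakk> \<Longrightarrow> a \<odot>\<^bsub>M\<^esub> v \<in> carrier M"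
  and act_add_left: "\<lbrakk>a \<in> carrier A; b \<in> carrier A; v \<in> carrier M\<rbrakk>
    \<Longrightarrow> (a \<oplus>\<^bsub>A\<^esub> b) \<odot>\<^bsub>M\<^esub> v = a \<odot>\<^bsub>M\<^esub> v \<oplus>\<^bsub>M\<^esub> b \<odot>\<^bsub>M\<^esub> v"
  and act_mult: "\<lbrakk>a \<in> carrier A; b \<in> carrier A; v \<in> carrier M\<rbrakk>
    \<Longrightarrow> (a \<otimes>\<^bsub>A\<^esub> b) \<odot>\<^bsub>M\<^esub> v = a \<odot>\<^bsub>M\<^esub> (b \<odot>\<^bsub>M\<^esub> v)"
  and act_add: "\<lbrakk>a \<in> carrier A; v \<in> carrier M; w \<in> carrier M\<rbrakk>
    \<Longrightarrow> a \<odot>\<^bsub>M\<^esub> (v \<oplus>\<^bsub>M\<^esub> w) = a \<odot>\<^bsub>M\<^esub> v \<oplus>\<^bsub>M\<^esub> a \<odot>\<^bsub>M\<^esub> w"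
  and act_one [simp]: "v \<in> carrier M \<Longrightarrow> \<one>\<^bsub>A\<^esub> \<odot>\<^bsub>M\<^esub> v = v"
  using left_mod by (auto simp: left_module_def)

lemma act_zero [simp]: "a \<in> carrier A \<Longrightarrow> a \<odot>\<^bsub>M\<^esub> \<zero>\<^bsub>M\<^esub> = \<zero>\<^bsub>M\<^esub>"
  by (rule additive_zero[OF M.abelian_group_axioms M.abelian_group_axioms]) (auto simp: act_add)

lemma zero_act [simp]: "v \<in> carrier M \<Longrightarrow> \<zero>\<^bsub>A\<^esub> \<odot>\<^bsub>M\<^esub> v = \<zero>\<^bsub>M\<^esub>"
  by (rule additive_zero[OF A.abelian_group_axioms M.abelian_group_axioms, of "\<lambda>a. a \<odot>\<^bsub>M\<^esub> v"])
    (auto simp: act_add_left)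

lemma act_minus_left:
  assumes "a \<in> carrier A" "b \<in> carrier A" "v \<in> carrier M"
  shows "(a \<ominus>\<^bsub>A\<^esub> b) \<odot>\<^bsub>M\<^esub> v = a \<odot>\<^bsub>M\<^esub> v \<ominus>\<^bsub>M\<^esub> b \<odot>\<^bsub>M\<^esub> v"
proof -
  have "a \<odot>\<^bsub>M\<^esub> v = (a \<ominus>\<^bsub>A\<^esub> b \<oplus>\<^bsub>A\<^esub> b) \<odot>\<^bsub>M\<^esub> v"
    using assms by (simp add: A.minus_eq A.a_assoc A.l_neg)
  also have "\<dots> = (a \<ominus>\<^bsub>A\<^esub> b) \<odot>\<^bsub>M\<^esub> v \<oplus>\<^bsub>M\<^esub> b \<odot>\<^bsub>M\<^esub> v"
    using assms by (simp add: act_add_left)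
  finally show ?thesis using assms by (simp add: M.minus_eq M.a_assoc M.r_neg)
qed

lemma act_finsum:
  "\<lbrakk>f \<in> B \<rightarrow> carrier A; v \<in> carrier M\<rbrakk> \<Longrightarrow> finsum A f B \<odot>\<^bsub>M\<^esub> v = finsum M (\<lambda>b. f b \<odot>\<^bsub>M\<^esub> v) B"
  by (rule finsum_additive[OF A.abelian_monoid_axioms M.abelian_monoid_axioms, where h = "\<lambda>a. a \<odot>\<^bsub>M\<^esub> v"])
    (auto simp: act_add_left)

lemma finsum_act:
  "\<lbrakk>a \<in> carrier A; f \<in> B \<rightarrow> carrier M\<rbrakk> \<Longrightarrow> a \<odot>\<^bsub>M\<^esub> finsum M f B = finsum M (\<lambda>b. a \<odot>\<^bsub>M\<^esub> f b) B"
  by (rule finsum_additive[OF M.abelian_monoid_axioms M.abelian_monoid_axioms, where h = "\<lambda>v. a \<odot>\<^bsub>M\<^esub> v"])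
    (auto simp: act_add)

lemma scalar_mult:
  assumes "c \<in> carrier K" "a \<in> carrier A"
  shows "(c \<odot>\<^bsub>A\<^esub> \<one>\<^bsub>A\<^esub>) \<otimes>\<^bsub>A\<^esub> a = c \<odot>\<^bsub>A\<^esub> a" "a \<otimes>\<^bsub>A\<^esub> (c \<odot>\<^bsub>A\<^esub> \<one>\<^bsub>A\<^esub>) = c \<odot>\<^bsub>A\<^esub> a"
  using fd_alg assms by (auto simp: fd_algebra_def)

lemma scalar_closed [simp, intro]: "c \<in> carrier K \<Longrightarrow> c \<odot>\<^bsub>A\<^esub> \<one>\<^bsub>A\<^esub> \<in> carrier A"
  by simp

lemma scalar_act:
  "\<lbrakk>c \<in> carrier K; a \<in> carrier A; v \<in> carrier M\<rbrakk>
    \<Longrightarrow> a \<odot>\<^bsub>M\<^esub> ((c \<odot>\<^bsub>A\<^esub> \<one>\<^bsub>A\<^esub>) \<odot>\<^bsub>M\<^esub> v) = (c \<odot>\<^bsub>A\<^esub> \<one>\<^bsub>A\<^esub>) \<odot>\<^bsub>M\<^esub> (a \<odot>\<^bsub>M\<^esub> v)"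
  by (simp add: act_mult[symmetric] scalar_mult)

sublocale KM: lin_space K "restrict_scalars A M"
proof -
  have "abelian_group (restrict_scalars A M)"
    by (rule abelian_groupI) (auto simp: M.a_ac intro: M.l_neg bexI[of _ "\<ominus>\<^bsub>M\<^esub> _"])
  then have "module K (restrict_scalars A M)"
    by (intro moduleI R.is_cring)
      (auto simp: KA.smult_l_distr act_add_left act_add act_mult[symmetric] scalar_mult(1) KA.smult_assoc1)
  then show "lin_space K (restrict_scalars A M)"
    by (simp add: lin_space_def R.field_axioms)
qed

definition submod :: "'v set \<Rightarrow> bool" where
  "submod L \<longleftrightarrow> L \<subseteq> carrier M \<and> \<zero>\<^bsub>M\<^esub> \<in> L \<and> (\<forall>v\<in>L. \<forall>w\<in>L. v \<oplus>\<^bsub>M\<^esub> w \<in> L) \<and>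
     (\<forall>a\<in>carrier A. \<forall>v\<in>L. a \<odot>\<^bsub>M\<^esub> v \<in> L)"

lemma submod_fd_left_modules:
  assumes "submod L" "finite_dim K (restrict_scalars A M)"
  shows "M\<lparr>carrier := L\<rparr> \<in> fd_left_modules K A"
proof -
  have sub: "KM.subspace L"
    using assms(1) by (auto simp: KM.subspace_def submod_def)
  have eq: "restrict_scalars A (M\<lparr>carrier := L\<rparr>) = (restrict_scalars A M)\<lparr>carrier := L\<rparr>"
    by (simp add: restrict_scalars_def)
  interpret L: lin_space K "restrict_scalars A (M\<lparr>carrier := L\<rparr>)"
    unfolding eq by (rule KM.subspace_lin_space) fact
  have "abelian_group (M\<lparr>carrier := L\<rparr>)"
  proof (rule abelian_groupI)
    fix x assume "x \<in> carrier (M\<lparr>carrier := L\<rparr>)"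
    then show "\<exists>y\<in>carrier (M\<lparr>carrier := L\<rparr>). y \<oplus>\<^bsub>M\<lparr>carrier := L\<rparr>\<^esub> x = \<zero>\<^bsub>M\<lparr>carrier := L\<rparr>\<^esub>"
      using L.M.l_neg[of x] L.M.a_inv_closed[of x] by auto
  qed (use assms(1) in \<open>auto simp: submod_def subset_iff M.a_ac\<close>)
  then have "left_module A (M\<lparr>carrier := L\<rparr>)"
    using assms(1) A.ring_axioms unfolding left_module_def submod_def
    by (auto simp: subset_iff act_add_left act_add act_mult)
  moreover have "finite_dim K (restrict_scalars A (M\<lparr>carrier := L\<rparr>))"
    unfolding eq by (rule KM.finite_dim_subspace) fact+
  ultimately show ?thesis by (simp add: fd_left_modules_def)
qed

end

subsection \<open>The regular module and its dual\<close>

definition regular_module :: "('k, 'a) module \<Rightarrow> ('a, 'a) module" where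
  "regular_module A = \<lparr>carrier = carrier A, monoid.mult = undefined, one = undefined,
     zero = zero A, add = add A, smult = monoid.mult A\<rparr>"

lemma regular_module_simps [simp]:
  "carrier (regular_module A) = carrier A" "zero (regular_module A) = zero A"
  "add (regular_module A) = add A" "smult (regular_module A) = monoid.mult A"
  "finsum (regular_module A) f B = finsum A f B"
  by (simp_all add: regular_module_def finsum_def finprod_def)

lemma regular_module_fd:
  assumes "field K" "fd_algebra K A"
  shows "regular_module A \<in> fd_left_modules K A"
proof -
  interpret K: field K by fact
  interpret A: ring A using assms by (simp add: fd_algebra_def)
  interpret KA: module K A using assms by (simp add: fd_algebra_def)
  have "abelian_group (regular_module A)"
    by (rule abelian_groupI) (auto simp: A.a_ac intro: A.l_neg bexI[of _ "\<ominus>\<^bsub>A\<^esub> _"])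
  then have left: "left_module A (regular_module A)"
    using A.ring_axioms by (simp add: left_module_def A.l_distr A.r_distr A.m_assoc)
  interpret R: alg_module K A "regular_module A"
    by (intro alg_module.intro alg_module_axioms.intro left assms)
  obtain B where B: "finite B" "B \<subseteq> carrier A"
    "\<forall>v\<in>carrier A. \<exists>a\<in>B \<rightarrow> carrier K. v = (\<Oplus>\<^bsub>A\<^esub>b\<in>B. a b \<odot>\<^bsub>A\<^esub> b)"
    using assms(2) unfolding fd_algebra_def finite_dim_def by blast
  have "(\<Oplus>\<^bsub>A\<^esub>b\<in>B. a b \<odot>\<^bsub>A\<^esub> b) = (\<Oplus>\<^bsub>A\<^esub>b\<in>B. (a b \<odot>\<^bsub>A\<^esub> \<one>\<^bsub>A\<^esub>) \<otimes>\<^bsub>A\<^esub> b)" if "a \<in> B \<rightarrow> carrier K" for a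
    using that B by (intro A.finsum_cong') (auto simp: R.scalar_mult Pi_iff subset_iff)
  then have "finite_dim K (restrict_scalars A (regular_module A))"
    unfolding finite_dim_def using B by (intro exI[of _ B]) fastforce
  with left show ?thesis by (simp add: fd_left_modules_def)
qed

text \<open>The dual of the regular module, transported to the type of sequences along the evaluation at
  a sequence \<open>e\<close> of elements that spans \<open>A\<close>.\<close>

definition dual_set :: "('k, 'x) ring_scheme \<Rightarrow> ('k, 'a) module \<Rightarrow> ('a \<Rightarrow> 'k) set" where
  "dual_set K A = functionals K A \<inter> extensional (carrier A)"

locale dual_regular = R?: field K
  for K :: "('k, 'x) ring_scheme" (structure) +
  fixes A :: "('k, 'a) module" and e :: "nat \<Rightarrow> 'a" and B :: "'a set"
  assumes fd_alg: "fd_algebra K A"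
    and B: "finite B" "B \<subseteq> carrier A" "B \<subseteq> range e"
      "\<And>v. v \<in> carrier A \<Longrightarrow> \<exists>a\<in>B \<rightarrow> carrier K. v = (\<Oplus>\<^bsub>A\<^esub>b\<in>B. a b \<odot>\<^bsub>A\<^esub> b)"
begin

sublocale A: ring A using fd_alg by (simp add: fd_algebra_def)
sublocale KA: lin_space K A
  using fd_alg R.field_axioms by (simp add: fd_algebra_def lin_space_def)

lemma smult_mult:
  assumes "c \<in> carrier K" "a \<in> carrier A" "b \<in> carrier A"
  shows "(c \<odot>\<^bsub>A\<^esub> a) \<otimes>\<^bsub>A\<^esub> b = c \<odot>\<^bsub>A\<^esub> (a \<otimes>\<^bsub>A\<^esub> b)" "a \<otimes>\<^bsub>A\<^esub> (c \<odot>\<^bsub>A\<^esub> b) = c \<odot>\<^bsub>A\<^esub> (a \<otimes>\<^bsub>A\<^esub> b)"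
  using fd_alg assms by (auto simp: fd_algebra_def)

definition enc :: "('a \<Rightarrow> 'k) \<Rightarrow> nat \<Rightarrow> 'k" where "enc \<phi> = (\<lambda>i. \<phi> (e i))"
definition dec :: "(nat \<Rightarrow> 'k) \<Rightarrow> 'a \<Rightarrow> 'k" where "dec = inv_into (dual_set K A) enc"

lemma functionals_eqI:
  assumes "\<phi> \<in> functionals K A" "\<psi> \<in> functionals K A" "\<And>b. b \<in> B \<Longrightarrow> \<phi> b = \<psi> b" "v \<in> carrier A"
  shows "\<phi> v = \<psi> v"
proof -
  obtain a where a: "a \<in> B \<rightarrow> carrier K" "v = (\<Oplus>\<^bsub>A\<^esub>b\<in>B. a b \<odot>\<^bsub>A\<^esub> b)" using B(4)[OF assms(4)] by blast
  have *: "\<phi> v = (\<Oplus>b\<in>B. a b \<otimes> \<phi> b)" if "\<phi> \<in> functionals K A" for \<phi>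
  proof -
    have "\<phi> v = (\<Oplus>b\<in>B. \<phi> (a b \<odot>\<^bsub>A\<^esub> b))"
      unfolding a(2) using a(1) B(2) that by (intro KA.functional_finsum) (auto simp: Pi_iff subset_iff)
    also have "\<dots> = (\<Oplus>b\<in>B. a b \<otimes> \<phi> b)"
      using a(1) B(2) functionalsD[OF that] by (intro R.finsum_cong') (auto simp: Pi_iff subset_iff)
    finally show ?thesis .
  qed
  have "(\<Oplus>b\<in>B. a b \<otimes> \<phi> b) = (\<Oplus>b\<in>B. a b \<otimes> \<psi> b)"
    using a(1) B(2) assms(3) functionalsD(1)[OF assms(2)]
    by (intro R.finsum_cong') (auto simp: Pi_iff subset_iff)
  then show ?thesis using *[OF assms(1)] *[OF assms(2)] by simp
qed

lemma inj_enc: "inj_on enc (dual_set K A)"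
proof (rule inj_onI)
  fix \<phi> \<psi> assume *: "\<phi> \<in> dual_set K A" "\<psi> \<in> dual_set K A" "enc \<phi> = enc \<psi>"
  have "\<phi> b = \<psi> b" if "b \<in> B" for b
    using that B(3) fun_cong[OF *(3)] by (auto simp: enc_def)
  then show "\<phi> = \<psi>"
    using * functionals_eqI[of \<phi> \<psi>]
    by (intro extensionalityI[of _ "carrier A"]) (auto simp: dual_set_def)
qed

lemma dec_enc [simp]: "\<phi> \<in> dual_set K A \<Longrightarrow> dec (enc \<phi>) = \<phi>"
  unfolding dec_def using inj_enc by (rule inv_into_f_f)

text \<open>Right multiplication of the algebra on itself becomes a left action on functionals:
  \<open>a\<close> sends \<phi> to v |-> \<phi>(v a). The maps \<open>enc\<close> and
  \<open>dec\<close> only rename the elements.\<close>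

definition dual_module :: "('a, nat \<Rightarrow> 'k) module" where
  "dual_module = \<lparr>carrier = enc ` dual_set K A, monoid.mult = undefined, one = undefined,
     zero = enc (\<lambda>v\<in>carrier A. \<zero>), add = (\<lambda>x y. enc (\<lambda>v\<in>carrier A. dec x v \<oplus> dec y v)),
     smult = (\<lambda>a x. enc (\<lambda>v\<in>carrier A. dec x (v \<otimes>\<^bsub>A\<^esub> a)))\<rparr>"

lemma dual_setD:
  assumes "\<phi> \<in> dual_set K A"
  shows "v \<in> carrier A \<Longrightarrow> \<phi> v \<in> carrier K"
    and "\<lbrakk>v \<in> carrier A; w \<in> carrier A\<rbrakk> \<Longrightarrow> \<phi> (v \<oplus>\<^bsub>A\<^esub> w) = \<phi> v \<oplus> \<phi> w"
    and "\<lbrakk>c \<in> carrier K; v \<in> carrier A\<rbrakk> \<Longrightarrow> \<phi> (c \<odot>\<^bsub>A\<^esub> v) = c \<otimes> \<phi> v"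
  using assms functionalsD[of \<phi> K A] by (auto simp: dual_set_def)

lemma dual_setI:
  assumes "\<And>v. v \<in> carrier A \<Longrightarrow> \<phi> v \<in> carrier K"
    and "\<And>v w. \<lbrakk>v \<in> carrier A; w \<in> carrier A\<rbrakk> \<Longrightarrow> \<phi> (v \<oplus>\<^bsub>A\<^esub> w) = \<phi> v \<oplus> \<phi> w"
    and "\<And>c v. \<lbrakk>c \<in> carrier K; v \<in> carrier A\<rbrakk> \<Longrightarrow> \<phi> (c \<odot>\<^bsub>A\<^esub> v) = c \<otimes> \<phi> v"
  shows "restrict \<phi> (carrier A) \<in> dual_set K A"
  using assms by (auto simp: dual_set_def intro!: functionalsI)

lemma dual_add:
  assumes "\<phi> \<in> dual_set K A" "\<psi> \<in> dual_set K A"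
  shows "(\<lambda>v\<in>carrier A. \<phi> v \<oplus> \<psi> v) \<in> dual_set K A"
  using dual_setD[OF assms(1)] dual_setD[OF assms(2)]
  by (intro dual_setI) (auto simp: R.a_ac R.r_distr)

lemma dual_act:
  assumes "\<phi> \<in> dual_set K A" "a \<in> carrier A"
  shows "(\<lambda>v\<in>carrier A. \<phi> (v \<otimes>\<^bsub>A\<^esub> a)) \<in> dual_set K A"
  using dual_setD[OF assms(1)] assms(2)
  by (intro dual_setI) (auto simp: A.l_distr smult_mult)

lemma dual_zero: "(\<lambda>v\<in>carrier A. \<zero>) \<in> dual_set K A"
  by (intro dual_setI) auto

lemma dual_module_simps:
  "carrier dual_module = enc ` dual_set K A" "zero dual_module = enc (\<lambda>v\<in>carrier A. \<zero>)"
  "\<lbrakk>\<phi> \<in> dual_set K A; \<psi> \<in> dual_set K A\<rbrakk>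
    \<Longrightarrow> enc \<phi> \<oplus>\<^bsub>dual_module\<^esub> enc \<psi> = enc (\<lambda>v\<in>carrier A. \<phi> v \<oplus> \<psi> v)"
  "\<phi> \<in> dual_set K A \<Longrightarrow> a \<odot>\<^bsub>dual_module\<^esub> enc \<phi> = enc (\<lambda>v\<in>carrier A. \<phi> (v \<otimes>\<^bsub>A\<^esub> a))"
  by (simp_all add: dual_module_def)

lemma left_module_dual: "left_module A dual_module"
  unfolding left_module_def
proof (intro conjI ballI)
  show "abelian_group dual_module"
  proof (rule abelian_groupI)
    fix x assume "x \<in> carrier dual_module"
    then obtain \<phi> where \<phi>: "\<phi> \<in> dual_set K A" "x = enc \<phi>" by (auto simp: dual_module_simps)
    then have m: "(\<lambda>v\<in>carrier A. \<ominus> \<phi> v) \<in> dual_set K A"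
      using dual_setD[OF \<phi>(1)] by (intro dual_setI) (auto simp: R.minus_add R.r_minus)
    show "\<exists>y\<in>carrier dual_module. y \<oplus>\<^bsub>dual_module\<^esub> x = \<zero>\<^bsub>dual_module\<^esub>"
    proof (rule bexI[of _ "enc (\<lambda>v\<in>carrier A. \<ominus> \<phi> v)"])
      show "enc (\<lambda>v\<in>carrier A. \<ominus> \<phi> v) \<oplus>\<^bsub>dual_module\<^esub> x = \<zero>\<^bsub>dual_module\<^esub>"
        using \<phi> m dual_setD(1)[OF \<phi>(1)]
        by (simp add: dual_module_simps R.l_neg cong: restrict_cong)
    qed (use m in \<open>simp add: dual_module_simps\<close>)
    show "\<zero>\<^bsub>dual_module\<^esub> \<oplus>\<^bsub>dual_module\<^esub> x = x"
    proof -
      have "(\<lambda>v\<in>carrier A. \<phi> v) = \<phi>"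
        using \<phi>(1) by (intro extensional_restrict) (auto simp: dual_set_def)
      then show ?thesis using \<phi> dual_setD(1)[OF \<phi>(1)] dual_zero
        by (simp add: dual_module_simps cong: restrict_cong)
    qed
  next
    fix x y assume "x \<in> carrier dual_module" "y \<in> carrier dual_module"
    then obtain \<phi> \<psi> where \<phi>: "\<phi> \<in> dual_set K A" "x = enc \<phi>" "\<psi> \<in> dual_set K A" "y = enc \<psi>"
      by (auto simp: dual_module_simps)
    show "x \<oplus>\<^bsub>dual_module\<^esub> y \<in> carrier dual_module"
      using \<phi> dual_add by (auto simp: dual_module_simps)
    show "x \<oplus>\<^bsub>dual_module\<^esub> y = y \<oplus>\<^bsub>dual_module\<^esub> x"
      using \<phi> dual_setD(1)[OF \<phi>(1)] dual_setD(1)[OF \<phi>(3)]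
      by (simp add: dual_module_simps R.a_comm cong: restrict_cong)
    fix z assume "z \<in> carrier dual_module"
    then obtain \<chi> where \<chi>: "\<chi> \<in> dual_set K A" "z = enc \<chi>" by (auto simp: dual_module_simps)
    show "x \<oplus>\<^bsub>dual_module\<^esub> y \<oplus>\<^bsub>dual_module\<^esub> z = x \<oplus>\<^bsub>dual_module\<^esub> (y \<oplus>\<^bsub>dual_module\<^esub> z)"
      using \<phi> \<chi> dual_setD(1)[OF \<phi>(1)] dual_setD(1)[OF \<phi>(3)] dual_setD(1)[OF \<chi>(1)]
        dual_add[OF \<phi>(1,3)] dual_add[OF \<phi>(3) \<chi>(1)]
      by (simp add: dual_module_simps R.a_assoc cong: restrict_cong)
  qed (use dual_zero in \<open>auto simp: dual_module_simps\<close>)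
next
  fix a v assume a: "a \<in> carrier A" "v \<in> carrier dual_module"
  then obtain \<phi> where \<phi>: "\<phi> \<in> dual_set K A" "v = enc \<phi>" by (auto simp: dual_module_simps)
  show "a \<odot>\<^bsub>dual_module\<^esub> v \<in> carrier dual_module"
    using \<phi> dual_act a by (auto simp: dual_module_simps)
  fix b assume b: "b \<in> carrier A"
  show "(a \<oplus>\<^bsub>A\<^esub> b) \<odot>\<^bsub>dual_module\<^esub> v = a \<odot>\<^bsub>dual_module\<^esub> v \<oplus>\<^bsub>dual_module\<^esub> b \<odot>\<^bsub>dual_module\<^esub> v"
    using \<phi> a b dual_act[OF \<phi>(1) a(1)] dual_act[OF \<phi>(1) b] dual_setD[OF \<phi>(1)]
    by (simp add: dual_module_simps A.r_distr cong: restrict_cong)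
  show "(a \<otimes>\<^bsub>A\<^esub> b) \<odot>\<^bsub>dual_module\<^esub> v = a \<odot>\<^bsub>dual_module\<^esub> (b \<odot>\<^bsub>dual_module\<^esub> v)"
    using \<phi> a b dual_act[OF \<phi>(1) b]
    by (simp add: dual_module_simps A.m_assoc cong: restrict_cong)
next
  fix a v w assume a: "a \<in> carrier A" "v \<in> carrier dual_module" "w \<in> carrier dual_module"
  then obtain \<phi> \<psi> where \<phi>: "\<phi> \<in> dual_set K A" "v = enc \<phi>" "\<psi> \<in> dual_set K A" "w = enc \<psi>"
    by (auto simp: dual_module_simps)
  show "a \<odot>\<^bsub>dual_module\<^esub> (v \<oplus>\<^bsub>dual_module\<^esub> w) = a \<odot>\<^bsub>dual_module\<^esub> v \<oplus>\<^bsub>dual_module\<^esub> a \<odot>\<^bsub>dual_module\<^esub> w"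
    using \<phi> a dual_act[OF \<phi>(1) a(1)] dual_act[OF \<phi>(3) a(1)] dual_add[OF \<phi>(1,3)]
    by (simp add: dual_module_simps cong: restrict_cong)
next
  fix v assume "v \<in> carrier dual_module"
  then obtain \<phi> where \<phi>: "\<phi> \<in> dual_set K A" "v = enc \<phi>" by (auto simp: dual_module_simps)
  have "(\<lambda>v\<in>carrier A. \<phi> v) = \<phi>"
    using \<phi>(1) by (intro extensional_restrict) (auto simp: dual_set_def)
  then show "\<one>\<^bsub>A\<^esub> \<odot>\<^bsub>dual_module\<^esub> v = v"
    using \<phi> by (simp add: dual_module_simps cong: restrict_cong)
qed (use A.ring_axioms in auto)

sublocale dual: alg_module K A dual_module
  by (intro alg_module.intro alg_module_axioms.intro left_module_dual fd_alg R.field_axioms)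

text \<open>The evaluations at the elements of the spanning set \<open>B\<close> separate
  functionals, which is enough for finite dimension.\<close>

lemma dual_module_fd: "dual_module \<in> fd_left_modules K A"
proof -
  have "finite_dim K (restrict_scalars A dual_module)"
  proof (rule dual.KM.finite_dim_separating[of "(\<lambda>b x. dec x b) ` B"])
    show "(\<lambda>b x. dec x b) ` B \<subseteq> functionals K (restrict_scalars A dual_module)"
    proof (intro image_subsetI functionalsI)
      fix b x assume b: "b \<in> B" and "x \<in> carrier (restrict_scalars A dual_module)"
      then obtain \<phi> where \<phi>: "\<phi> \<in> dual_set K A" "x = enc \<phi>" by (auto simp: dual_module_simps)
      show "dec x b \<in> carrier K" using \<phi> b B(2) dual_setD(1)[OF \<phi>(1)] by auto
      fix c assume c: "c \<in> carrier K"
      show "dec (c \<odot>\<^bsub>restrict_scalars A dual_module\<^esub> x) b = c \<otimes> dec x b"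
        using \<phi> b c B(2) dual_setD[OF \<phi>(1)] dual_act[OF \<phi>(1), of "c \<odot>\<^bsub>A\<^esub> \<one>\<^bsub>A\<^esub>"]
        by (simp add: dual_module_simps subset_iff dual.scalar_mult)
    next
      fix b x y assume b: "b \<in> B" and "x \<in> carrier (restrict_scalars A dual_module)"
        "y \<in> carrier (restrict_scalars A dual_module)"
      then obtain \<phi> \<psi> where \<phi>: "\<phi> \<in> dual_set K A" "x = enc \<phi>" "\<psi> \<in> dual_set K A" "y = enc \<psi>"
        by (auto simp: dual_module_simps)
      show "dec (x \<oplus>\<^bsub>restrict_scalars A dual_module\<^esub> y) b = dec x b \<oplus> dec y b"
        using \<phi> b B(2) dual_add[OF \<phi>(1,3)] by (simp add: dual_module_simps subset_iff)
    qed
    fix w assume w: "w \<in> carrier (restrict_scalars A dual_module)" "\<forall>f\<in>(\<lambda>b x. dec x b) ` B. f w = \<zero>"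
    from w(1) obtain \<phi> where \<phi>: "\<phi> \<in> dual_set K A" "w = enc \<phi>" by (auto simp: dual_module_simps)
    have 0: "(\<lambda>v\<in>carrier A. \<zero>) \<in> functionals K A" "\<phi> \<in> functionals K A"
      using IntD1[OF dual_zero[unfolded dual_set_def]] IntD1[OF \<phi>(1)[unfolded dual_set_def]] .
    have "\<phi> b = (\<lambda>v\<in>carrier A. \<zero>) b" if b: "b \<in> B" for b
    proof -
      have "dec w b = \<zero>" using w(2) b by simp
      then show ?thesis using \<phi> b B(2) by (simp add: subset_iff)
    qed
    then have "\<phi> v = (\<lambda>v\<in>carrier A. \<zero>) v" if "v \<in> carrier A" for v
      using that by (rule functionals_eqI[OF 0(2,1)])
    moreover have "\<phi> \<in> extensional (carrier A)" using IntD2[OF \<phi>(1)[unfolded dual_set_def]] .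
    ultimately have "\<phi> = (\<lambda>v\<in>carrier A. \<zero>)"
      by (intro extensionalityI[of \<phi> "carrier A"]) simp_all
    then show "w = \<zero>\<^bsub>restrict_scalars A dual_module\<^esub>" using \<phi> by (simp add: dual_module_simps)
  qed (use B in auto)
  then show ?thesis using left_module_dual by (simp add: fd_left_modules_def)
qed

end

section \<open>Objects representing the fibre functor and its dual\<close>

context concrete_linear_category
begin

lemma V_alg_module: "X \<in> Obj C \<Longrightarrow> alg_module K A (V X)"
  using V_module[of X] fd_algebra K.field_axioms
  by (simp add: alg_module_def alg_module_axioms_def fd_left_modules_def)

lemma V_finite_dim: "X \<in> Obj C \<Longrightarrow> finite_dim K (restrict_scalars A (V X))"
  using V_module[of X] by (simp add: fd_left_modules_def)

lemma ring_A: "ring A"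
  using fd_algebra by (simp add: fd_algebra_def)

lemma Scal_Hom: "\<lbrakk>c \<in> carrier K; f \<in> Hom C X Y\<rbrakk> \<Longrightarrow> Scal C c f \<in> Hom C X Y"
proof -
  assume *: "c \<in> carrier K" "f \<in> Hom C X Y"
  interpret H: module K "hom_space C X Y" using hom_space HomD[OF *(2)] by auto
  show ?thesis using H.smult_closed[of c f] * by (simp add: hom_space_def)
qed

lemma Zer_Hom: "\<lbrakk>X \<in> Obj C; Y \<in> Obj C\<rbrakk> \<Longrightarrow> Zer C X Y \<in> Hom C X Y"
proof -
  assume *: "X \<in> Obj C" "Y \<in> Obj C"
  interpret H: module K "hom_space C X Y" using hom_space * by auto
  show ?thesis using H.M.zero_closed by (simp add: hom_space_def)
qed

lemma ap_zero: "f \<in> Hom C X Y \<Longrightarrow> ap f \<zero>\<^bsub>V X\<^esub> = \<zero>\<^bsub>V Y\<^esub>"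
proof -
  assume f: "f \<in> Hom C X Y"
  interpret X: alg_module K A "V X" using V_alg_module HomD[OF f] by auto
  interpret Y: alg_module K A "V Y" using V_alg_module HomD[OF f] by auto
  show ?thesis
    using module_homD[OF ap_hom[OF f]]
    by (intro additive_zero[OF X.M.abelian_group_axioms Y.M.abelian_group_axioms]) auto
qed

lemma ap_Zer: "\<lbrakk>X \<in> Obj C; Y \<in> Obj C; v \<in> carrier (V X)\<rbrakk> \<Longrightarrow> ap (Zer C X Y) v = \<zero>\<^bsub>V Y\<^esub>"
proof -
  assume *: "X \<in> Obj C" "Y \<in> Obj C" "v \<in> carrier (V X)"
  interpret H: module K "hom_space C X Y" using hom_space * by auto
  interpret Y: alg_module K A "V Y" using V_alg_module * by auto
  have h: "abelian_group (hom_space C X Y)" by (rule H.M.abelian_group_axioms)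
  have "(\<lambda>f. ap f v) \<zero>\<^bsub>hom_space C X Y\<^esub> = \<zero>\<^bsub>V Y\<^esub>"
    using * ap_Add module_homD(1)[OF ap_hom]
    by (intro additive_zero[OF h Y.M.abelian_group_axioms, of "\<lambda>f. ap f v"]) (auto simp: hom_space_def)
  then show ?thesis by (simp add: hom_space_def)
qed

lemma ap_closed: "\<lbrakk>f \<in> Hom C X Y; v \<in> carrier (V X)\<rbrakk> \<Longrightarrow> ap f v \<in> carrier (V Y)"
  by (rule module_homD(1)[OF ap_hom])

lemma ap_finsum:
  assumes "X \<in> Obj C" "Y \<in> Obj C" "f \<in> B \<rightarrow> Hom C X Y" "v \<in> carrier (V X)"
  shows "ap (finsum (hom_space C X Y) f B) v = finsum (V Y) (\<lambda>b. ap (f b) v) B"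
proof -
  interpret H: module K "hom_space C X Y" using hom_space assms by auto
  interpret Y: alg_module K A "V Y" using V_alg_module assms by auto
  have h: "abelian_monoid (hom_space C X Y)" by (rule H.M.abelian_monoid_axioms)
  have 0: "ap \<zero>\<^bsub>hom_space C X Y\<^esub> v = \<zero>\<^bsub>V Y\<^esub>"
    using ap_Zer assms by (simp add: hom_space_def)
  show ?thesis
    using assms ap_Add ap_closed 0
    by (intro finsum_additive[OF h Y.M.abelian_monoid_axioms, where h = "\<lambda>f. ap f v"])
      (auto simp: hom_space_def)
qed

text \<open>Yoneda for the regular module: a homomorphism out of it is determined by the image of
  one, and this image is arbitrary. Here \<open>g\<close> corresponds to one.\<close>

lemma ex_free_object:
  "\<exists>P\<in>Obj C. \<exists>g\<in>carrier (V P). \<forall>X\<in>Obj C. \<forall>m\<in>carrier (V X). \<exists>!p. p \<in> Hom C P X \<and> ap p g = m"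
proof -
  interpret A: ring A by (rule ring_A)
  from ess_surj[OF regular_module_fd[OF K.field_axioms fd_algebra]] obtain P h
    where P: "P \<in> Obj C" and h: "module_hom A (V P) (regular_module A) h"
      and bij: "bij_betw h (carrier (V P)) (carrier A)" by auto
  interpret P: alg_module K A "V P" using V_alg_module P by auto
  obtain g where g: "g \<in> carrier (V P)" "h g = \<one>\<^bsub>A\<^esub>"
    using bij A.one_closed unfolding bij_betw_def by (metis image_iff)
  \<comment> \<open>Every element of \<open>V P\<close> is a multiple of \<open>g\<close>, with its
    image under \<open>h\<close> as coefficient.\<close>
  have gen: "v = h v \<odot>\<^bsub>V P\<^esub> g" "h v \<in> carrier A" if "v \<in> carrier (V P)" for v
  proof -
    show hv: "h v \<in> carrier A" using module_homD(1)[OF h that] by simp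
    have "h (h v \<odot>\<^bsub>V P\<^esub> g) = h v" using module_homD(3)[OF h hv g(1)] g(2) hv by simp
    then show "v = h v \<odot>\<^bsub>V P\<^esub> g"
      using bij that hv g(1) by (metis P.act_closed bij_betw_imp_inj_on inj_on_def)
  qed
  have "\<exists>!p. p \<in> Hom C P X \<and> ap p g = m" if X: "X \<in> Obj C" and m: "m \<in> carrier (V X)" for X m
  proof -
    interpret X: alg_module K A "V X" using V_alg_module X by auto
    have "module_hom A (V P) (V X) (\<lambda>v. h v \<odot>\<^bsub>V X\<^esub> m)"
      using m gen(2) module_homD[OF h] by (intro module_homI) (auto simp: X.act_add_left X.act_mult)
    from full[OF P X this] obtain p where p: "p \<in> Hom C P X"
      "\<And>v. v \<in> carrier (V P) \<Longrightarrow> ap p v = h v \<odot>\<^bsub>V X\<^esub> m" by auto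
    show ?thesis
    proof (rule ex1I[of _ p])
      show "p \<in> Hom C P X \<and> ap p g = m" using p g m by simp
    next
      fix q assume q: "q \<in> Hom C P X \<and> ap q g = m"
      show "q = p"
      proof (rule faithful[of q P X p])
        fix v assume v: "v \<in> carrier (V P)"
        have "ap q v = ap q (h v \<odot>\<^bsub>V P\<^esub> g)" using gen(1)[OF v] by simp
        also have "\<dots> = h v \<odot>\<^bsub>V X\<^esub> m"
          using module_homD(3)[OF ap_hom gen(2)[OF v] g(1)] q by auto
        finally show "ap q v = ap p v" using p(2)[OF v] by simp
      qed (use q p in auto)
    qed
  qed
  then show ?thesis using P g by blast
qed

text \<open>Coinduction: a functional \<phi> on a module lifts to the homomorphism that sends v to
  the functional a |-> \<phi>(a v) on the algebra. Evaluation at one, here \<open>t\<close>,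
  recovers \<phi>. So \<open>E\<close> carries the dual of the regular module.\<close>

lemma ex_cofree_object:
  "\<exists>E\<in>Obj C. \<exists>t\<in>functionals K (restrict_scalars A (V E)). \<forall>X\<in>Obj C.
     \<forall>\<phi>\<in>functionals K (restrict_scalars A (V X)).
     \<exists>!f. f \<in> Hom C X E \<and> (\<forall>v\<in>carrier (V X). t (ap f v) = \<phi> v)"
proof -
  interpret A: ring A by (rule ring_A)
  from fd_algebra obtain B where B: "finite B" "B \<subseteq> carrier A"
    "\<forall>v\<in>carrier A. \<exists>a\<in>B \<rightarrow> carrier K. v = (\<Oplus>\<^bsub>A\<^esub>b\<in>B. a b \<odot>\<^bsub>A\<^esub> b)"
    unfolding fd_algebra_def finite_dim_def by blast
  obtain xs where xs: "set xs = B" using finite_list[OF B(1)] by blast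
  \<comment> \<open>Indices past the end of \<open>xs\<close> give arbitrary values. Injectivity of
    the encoding rests only on \<open>B\<close> lying in the range.\<close>
  define e where "e i = xs ! i" for i
  have "B \<subseteq> range e" unfolding e_def xs[symmetric] by (auto simp: in_set_conv_nth)
  then interpret D: dual_regular K A e B
    using B fd_algebra K.field_axioms
    by (intro dual_regular.intro dual_regular_axioms.intro) blast+
  from ess_surj[OF D.dual_module_fd] obtain E h
    where E: "E \<in> Obj C" and h: "module_hom A (V E) D.dual_module h"
      and bij: "bij_betw h (carrier (V E)) (carrier D.dual_module)" by auto
  interpret E: alg_module K A "V E" using V_alg_module E by auto
  have img: "h ` carrier (V E) = D.enc ` dual_set K A"
    using bij by (simp add: bij_betw_def D.dual_module_simps)
  \<comment> \<open>\<open>L v\<close> is the functional on the algebra for which the element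
    \<open>v\<close> of \<open>V E\<close> stands; it hides the isomorphism \<open>h\<close> and the
    encoding.\<close>
  define L where "L v = D.dec (h v)" for v
  have L: "L v \<in> dual_set K A" "h v = D.enc (L v)" if "v \<in> carrier (V E)" for v
  proof -
    have "h v \<in> D.enc ` dual_set K A" using imageI[OF that, of h] unfolding img .
    then obtain \<phi> where "h v = D.enc \<phi>" "\<phi> \<in> dual_set K A" by (rule imageE)
    then show "L v \<in> dual_set K A" "h v = D.enc (L v)" by (auto simp: L_def)
  qed
  have L_add: "L (v \<oplus>\<^bsub>V E\<^esub> w) a = L v a \<oplus>\<^bsub>K\<^esub> L w a"
    if "v \<in> carrier (V E)" "w \<in> carrier (V E)" "a \<in> carrier A" for v w a
    using module_homD(2)[OF h that(1,2)] L[OF that(1)] L[OF that(2)] that(3) D.dual_add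
    by (simp add: L_def[of "v \<oplus>\<^bsub>V E\<^esub> w"] D.dual_module_simps)
  have L_act: "L (a \<odot>\<^bsub>V E\<^esub> v) b = L v (b \<otimes>\<^bsub>A\<^esub> a)"
    if "a \<in> carrier A" "v \<in> carrier (V E)" "b \<in> carrier A" for v a b
    using module_homD(3)[OF h that(1,2)] L[OF that(2)] that(1,3) D.dual_act
    by (simp add: L_def[of "a \<odot>\<^bsub>V E\<^esub> v"] D.dual_module_simps)
  have L_inj: "v = w" if "v \<in> carrier (V E)" "w \<in> carrier (V E)" "\<And>a. a \<in> carrier A \<Longrightarrow> L v a = L w a" for v w
  proof -
    have "L v = L w"
      using L(1)[OF that(1)] L(1)[OF that(2)] that(3)
      by (intro extensionalityI[of _ "carrier A"]) (simp_all add: dual_set_def)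
    then show ?thesis using L(2)[OF that(1)] L(2)[OF that(2)] bij that(1,2)
      by (simp add: bij_betw_def inj_on_def)
  qed
  have L_surj: "\<exists>v\<in>carrier (V E). L v = \<phi>" if "\<phi> \<in> dual_set K A" for \<phi>
  proof -
    have "D.enc \<phi> \<in> h ` carrier (V E)" unfolding img using that by (rule imageI)
    then obtain v where "D.enc \<phi> = h v" "v \<in> carrier (V E)" by (rule imageE)
    then show ?thesis using that by (intro bexI[of _ v]) (simp_all add: L_def flip: \<open>D.enc \<phi> = h v\<close>)
  qed
  define t where "t v = L v \<one>\<^bsub>A\<^esub>" for v
  have t: "t \<in> functionals K (restrict_scalars A (V E))"
  proof (rule functionalsI)
    fix c v assume cv: "c \<in> carrier K" "v \<in> carrier (restrict_scalars A (V E))"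
    then show "t (c \<odot>\<^bsub>restrict_scalars A (V E)\<^esub> v) = c \<otimes>\<^bsub>K\<^esub> t v"
      using L_act[of "c \<odot>\<^bsub>A\<^esub> \<one>\<^bsub>A\<^esub>" v "\<one>\<^bsub>A\<^esub>"] D.dual_setD(3)[OF L(1)[of v]]
      by (simp add: t_def)
  qed (use L D.dual_setD(1) L_add in \<open>auto simp: t_def\<close>)
  have "\<exists>!f. f \<in> Hom C X E \<and> (\<forall>v\<in>carrier (V X). t (ap f v) = \<phi> v)"
    if X: "X \<in> Obj C" and \<phi>: "\<phi> \<in> functionals K (restrict_scalars A (V X))" for X \<phi>
  proof -
    interpret X: alg_module K A "V X" using V_alg_module X by auto
    note \<phi>D = functionalsD[OF \<phi>, simplified]
    have q: "(\<lambda>a\<in>carrier A. \<phi> (a \<odot>\<^bsub>V X\<^esub> v)) \<in> dual_set K A" if "v \<in> carrier (V X)" for v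
    proof (rule D.dual_setI)
      fix c a assume ca: "c \<in> carrier K" "a \<in> carrier A"
      have "(c \<odot>\<^bsub>A\<^esub> a) \<odot>\<^bsub>V X\<^esub> v = (c \<odot>\<^bsub>A\<^esub> \<one>\<^bsub>A\<^esub>) \<odot>\<^bsub>V X\<^esub> (a \<odot>\<^bsub>V X\<^esub> v)"
        using ca that X.act_mult[of "c \<odot>\<^bsub>A\<^esub> \<one>\<^bsub>A\<^esub>" a v] by (simp add: X.scalar_mult(1))
      then show "\<phi> ((c \<odot>\<^bsub>A\<^esub> a) \<odot>\<^bsub>V X\<^esub> v) = c \<otimes>\<^bsub>K\<^esub> \<phi> (a \<odot>\<^bsub>V X\<^esub> v)"
        using \<phi>D(3)[OF ca(1), of "a \<odot>\<^bsub>V X\<^esub> v"] ca that by simp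
    qed (use that \<phi>D in \<open>simp_all add: X.act_add_left\<close>)
    define k where "k v = (SOME w. w \<in> carrier (V E) \<and> L w = (\<lambda>a\<in>carrier A. \<phi> (a \<odot>\<^bsub>V X\<^esub> v)))" for v
    have k: "k v \<in> carrier (V E)" "L (k v) = (\<lambda>a\<in>carrier A. \<phi> (a \<odot>\<^bsub>V X\<^esub> v))"
      if "v \<in> carrier (V X)" for v
    proof -
      have "\<exists>w. w \<in> carrier (V E) \<and> L w = (\<lambda>a\<in>carrier A. \<phi> (a \<odot>\<^bsub>V X\<^esub> v))"
        using L_surj[OF q[OF that]] by blast
      from someI_ex[OF this] show "k v \<in> carrier (V E)" "L (k v) = (\<lambda>a\<in>carrier A. \<phi> (a \<odot>\<^bsub>V X\<^esub> v))"
        unfolding k_def by auto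
    qed
    have "module_hom A (V X) (V E) k"
    proof (rule module_homI)
      fix v w assume vw: "v \<in> carrier (V X)" "w \<in> carrier (V X)"
      show "k (v \<oplus>\<^bsub>V X\<^esub> w) = k v \<oplus>\<^bsub>V E\<^esub> k w"
        using vw k \<phi>D by (intro L_inj) (auto simp: L_add X.act_add)
    next
      fix a v assume av: "a \<in> carrier A" "v \<in> carrier (V X)"
      show "k (a \<odot>\<^bsub>V X\<^esub> v) = a \<odot>\<^bsub>V E\<^esub> k v"
        using av k by (intro L_inj) (auto simp: L_act X.act_mult)
    qed (use k in auto)
    from full[OF X E this] obtain f where f: "f \<in> Hom C X E" "\<And>v. v \<in> carrier (V X) \<Longrightarrow> ap f v = k v"
      by auto
    show ?thesis
    proof (rule ex1I[of _ f])
      show "f \<in> Hom C X E \<and> (\<forall>v\<in>carrier (V X). t (ap f v) = \<phi> v)"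
        using f k by (simp add: t_def)
    next
      fix f' assume f': "f' \<in> Hom C X E \<and> (\<forall>v\<in>carrier (V X). t (ap f' v) = \<phi> v)"
      show "f' = f"
      proof (rule faithful[of f' X E f])
        fix v assume v: "v \<in> carrier (V X)"
        have f'_hom: "f' \<in> Hom C X E" using f' by blast
        note cl = ap_closed[OF f'_hom v]
        show "ap f' v = ap f v"
        proof (rule L_inj)
          fix a assume a: "a \<in> carrier A"
          \<comment> \<open>The value of a functional at \<open>a\<close> is its value at one after
            acting by \<open>a\<close>. So \<open>t\<close>, together with linearity over the
            algebra, determines the whole functional.\<close>
          have "L (ap f' v) a = L (a \<odot>\<^bsub>V E\<^esub> ap f' v) \<one>\<^bsub>A\<^esub>"
            using a cl by (simp add: L_act)
          also have "a \<odot>\<^bsub>V E\<^esub> ap f' v = ap f' (a \<odot>\<^bsub>V X\<^esub> v)"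
            using module_homD(3)[OF ap_hom[OF f'_hom] a v] by simp
          also have "L (ap f' (a \<odot>\<^bsub>V X\<^esub> v)) \<one>\<^bsub>A\<^esub> = \<phi> (a \<odot>\<^bsub>V X\<^esub> v)"
            using f' a v by (simp add: t_def)
          also have "\<dots> = L (ap f v) a" using f(2)[OF v] k[OF v] a by simp
          finally show "L (ap f' v) a = L (ap f v) a" .
        qed (use cl f k v in auto)
      qed (use f f' in auto)
    qed
  qed
  then show ?thesis using E t by blast
qed

section \<open>Kernels and simple objects\<close>

text \<open>Essential surjectivity turns a submodule into an object, and fullness turns its
  inclusion into an arrow.\<close>

lemma ex_subobject:
  assumes X: "X \<in> Obj C" and L: "alg_module.submod A (V X) L"
  obtains U k where "U \<in> Obj C" "k \<in> Hom C U X" "inj_on (ap k) (carrier (V U))"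
    "ap k ` carrier (V U) = L"
proof -
  interpret X: alg_module K A "V X" using V_alg_module X by auto
  from ess_surj[OF X.submod_fd_left_modules[OF L V_finite_dim[OF X]]] obtain U h
    where U: "U \<in> Obj C" and h: "module_hom A (V U) ((V X)\<lparr>carrier := L\<rparr>) h"
      and bij: "bij_betw h (carrier (V U)) L" by auto
  have "L \<subseteq> carrier (V X)" using L by (simp add: X.submod_def)
  then have "module_hom A (V U) (V X) h"
    using module_homD[OF h] by (intro module_homI) auto
  from full[OF U X this] obtain k where k: "k \<in> Hom C U X" "\<And>v. v \<in> carrier (V U) \<Longrightarrow> ap k v = h v"
    by auto
  show thesis
  proof (rule that[OF U k(1)])
    show "inj_on (ap k) (carrier (V U))" using bij k(2) by (simp add: bij_betw_def inj_on_def)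
    show "ap k ` carrier (V U) = L" using bij k(2) by (simp add: bij_betw_def)
  qed
qed

lemma mono_if_inj:
  assumes "k \<in> Hom C U X" "inj_on (ap k) (carrier (V U))"
  shows "mono_arrow C U X k"
  unfolding mono_arrow_def
proof (intro conjI ballI impI assms(1))
  fix W g h assume gh: "g \<in> Hom C W U" "h \<in> Hom C W U" and eq: "k \<cdot> g = k \<cdot> h"
  show "g = h"
  proof (rule faithful[OF gh])
    fix v assume v: "v \<in> carrier (V W)"
    have "ap k (ap g v) = ap k (ap h v)"
      using ap_Comp[OF gh(1) assms(1) v] ap_Comp[OF gh(2) assms(1) v] eq by simp
    then show "ap g v = ap h v"
      using inj_onD[OF assms(2)] ap_closed[OF gh(1) v] ap_closed[OF gh(2) v] by blast
  qed
qed

lemma zero_object_if_trivial: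
  assumes X: "X \<in> Obj C" and V0: "carrier (V X) = {\<zero>\<^bsub>V X\<^esub>}"
  shows "zero_object C X"
  unfolding zero_object_def
proof (intro conjI ballI X)
  fix Y assume Y: "Y \<in> Obj C"
  show "\<exists>!f. f \<in> Hom C X Y"
  proof (rule ex1I)
    show "Zer C X Y \<in> Hom C X Y" by (rule Zer_Hom[OF X Y])
  next
    fix f assume f: "f \<in> Hom C X Y"
    show "f = Zer C X Y"
      using V0 ap_zero[OF f] ap_zero[OF Zer_Hom[OF X Y]]
      by (intro faithful[OF f Zer_Hom[OF X Y]]) auto
  qed
  show "\<exists>!f. f \<in> Hom C Y X"
  proof (rule ex1I)
    show "Zer C Y X \<in> Hom C Y X" by (rule Zer_Hom[OF Y X])
  next
    fix f assume f: "f \<in> Hom C Y X"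
    show "f = Zer C Y X"
      using V0 ap_closed[OF f] ap_closed[OF Zer_Hom[OF Y X]]
      by (intro faithful[OF f Zer_Hom[OF Y X]]) simp
  qed
qed

lemma zero_object_trivial:
  assumes "zero_object C X" "v \<in> carrier (V X)"
  shows "v = \<zero>\<^bsub>V X\<^esub>"
proof -
  have X: "X \<in> Obj C" using assms by (simp add: zero_object_def)
  have "\<exists>!f. f \<in> Hom C X X" using assms X by (simp add: zero_object_def)
  then have "ident X = Zer C X X" using ident_Hom[OF X] Zer_Hom[OF X X] by blast
  then show ?thesis using ap_ident[OF X assms(2)] ap_Zer[OF X X assms(2)] by simp
qed

text \<open>The elements on which the two maps agree form a submodule. An arrow that lands in it is
  lifted by inverting the injective map \<open>ap k\<close>.\<close>

lemma equalizer_exists: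
  assumes f: "f \<in> Hom C X Y" and g: "g \<in> Hom C X Y"
  obtains U k where "U \<in> Obj C" "mono_arrow C U X k" "f \<cdot> k = g \<cdot> k"
    "\<And>W h. h \<in> Hom C W X \<Longrightarrow> f \<cdot> h = g \<cdot> h \<Longrightarrow> \<exists>u\<in>Hom C W U. h = k \<cdot> u"
proof -
  have X: "X \<in> Obj C" and Y: "Y \<in> Obj C" using HomD[OF f] by auto
  interpret X: alg_module K A "V X" using V_alg_module X by auto
  let ?L = "{v \<in> carrier (V X). ap f v = ap g v}"
  have L: "X.submod ?L"
    using module_homD[OF ap_hom[OF f]] module_homD[OF ap_hom[OF g]] ap_zero[OF f] ap_zero[OF g]
    by (auto simp: X.submod_def)
  obtain U k where U: "U \<in> Obj C" "k \<in> Hom C U X" "inj_on (ap k) (carrier (V U))"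
    "ap k ` carrier (V U) = ?L" by (rule ex_subobject[OF X L], rule that)
  interpret U: alg_module K A "V U" using V_alg_module U by auto
  note kD = module_homD[OF ap_hom[OF U(2)]]
  show thesis
  proof (rule that[OF U(1) mono_if_inj[OF U(2,3)]])
    show "f \<cdot> k = g \<cdot> k"
    proof (rule faithful[OF Comp_Hom[OF U(2) f] Comp_Hom[OF U(2) g]])
      fix v assume v: "v \<in> carrier (V U)"
      then have "ap k v \<in> ?L" using U(4) by blast
      then show "ap (f \<cdot> k) v = ap (g \<cdot> k) v"
        using ap_Comp[OF U(2) f v] ap_Comp[OF U(2) g v] by simp
    qed
  next
    fix W h assume h: "h \<in> Hom C W X" and eq: "f \<cdot> h = g \<cdot> h"
    have W: "W \<in> Obj C" using HomD[OF h] by auto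
    interpret W: alg_module K A "V W" using V_alg_module W by auto
    note hD = module_homD[OF ap_hom[OF h]]
    have in_L: "ap h v \<in> ap k ` carrier (V U)" if v: "v \<in> carrier (V W)" for v
      unfolding U(4) using ap_Comp[OF h f v] ap_Comp[OF h g v] eq ap_closed[OF h v] by simp
    define u where "u v = inv_into (carrier (V U)) (ap k) (ap h v)" for v
    have u: "u v \<in> carrier (V U)" "ap k (u v) = ap h v" if v: "v \<in> carrier (V W)" for v
      unfolding u_def using inv_into_into[OF in_L[OF v]] f_inv_into_f[OF in_L[OF v]] .
    have "module_hom A (V W) (V U) u"
    proof (rule module_homI)
      fix v w assume vw: "v \<in> carrier (V W)" "w \<in> carrier (V W)"
      have "v \<oplus>\<^bsub>V W\<^esub> w \<in> carrier (V W)" "u v \<oplus>\<^bsub>V U\<^esub> u w \<in> carrier (V U)"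
        using vw u(1) by simp_all
      with vw show "u (v \<oplus>\<^bsub>V W\<^esub> w) = u v \<oplus>\<^bsub>V U\<^esub> u w"
        by - (rule inj_onD[OF U(3)], simp_all add: u kD(2) hD(2))
    next
      fix a v assume av: "a \<in> carrier A" "v \<in> carrier (V W)"
      then have "a \<odot>\<^bsub>V W\<^esub> v \<in> carrier (V W)" "a \<odot>\<^bsub>V U\<^esub> u v \<in> carrier (V U)"
        using u(1) by simp_all
      with av show "u (a \<odot>\<^bsub>V W\<^esub> v) = a \<odot>\<^bsub>V U\<^esub> u v"
        by - (rule inj_onD[OF U(3)], simp_all add: u kD(3) hD(3))
    qed (rule u(1))
    from full[OF W U(1) this] obtain u' where u': "u' \<in> Hom C W U" "\<And>v. v \<in> carrier (V W) \<Longrightarrow> ap u' v = u v"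
      by auto
    have "h = k \<cdot> u'"
    proof (rule faithful[OF h Comp_Hom[OF u'(1) U(2)]])
      fix v assume v: "v \<in> carrier (V W)"
      show "ap h v = ap (k \<cdot> u') v" using ap_Comp[OF u'(1) U(2) v] u'(2)[OF v] u[OF v] by simp
    qed
    then show "\<exists>u\<in>Hom C W U. h = k \<cdot> u" using u' by blast
  qed
qed

end

section \<open>Simple objects: Schur's lemma and the density theorem\<close>

locale simple_in_concrete = concrete_linear_category K C A V ap
  for K :: "('k, 'x) ring_scheme" and C :: "('k, 'o, 'm, 'z) lcat_scheme" (structure)
    and A :: "('k, nat \<Rightarrow> 'k) module" and V :: "'o \<Rightarrow> (nat \<Rightarrow> 'k, nat \<Rightarrow> 'k) module"
    and ap :: "'m \<Rightarrow> (nat \<Rightarrow> 'k) \<Rightarrow> nat \<Rightarrow> 'k" +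
  fixes S :: 'o
  assumes alg_closed: "algebraically_closed K" and simple: "simple_object C S"
begin

lemma S_Obj: "S \<in> Obj C"
  using simple by (simp add: simple_object_def)

sublocale S: alg_module K A "V S"
  by (rule V_alg_module[OF S_Obj])

lemma S_nontrivial: "\<exists>v\<in>carrier (V S). v \<noteq> \<zero>\<^bsub>V S\<^esub>"
proof (rule ccontr)
  assume "\<not> ?thesis"
  then have "carrier (V S) = {\<zero>\<^bsub>V S\<^esub>}" using S.M.zero_closed by auto
  then have "zero_object C S" by (rule zero_object_if_trivial[OF S_Obj])
  then show False using simple by (simp add: simple_object_def)
qed

text \<open>The subobject with underlying module \<open>L\<close> is nonzero, so by simplicity its
  inclusion is an isomorphism and reaches every element.\<close>

lemma S_submod:
  assumes "S.submod L" "v \<in> L" "v \<noteq> \<zero>\<^bsub>V S\<^esub>"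
  shows "L = carrier (V S)"
proof -
  obtain U k where U: "U \<in> Obj C" "k \<in> Hom C U S" "inj_on (ap k) (carrier (V U))"
    "ap k ` carrier (V U) = L" by (rule ex_subobject[OF S_Obj assms(1)], rule that)
  have "v \<in> ap k ` carrier (V U)" using U(4) assms(2) by simp
  then obtain w where w: "v = ap k w" "w \<in> carrier (V U)" by (rule imageE)
  have "\<not> zero_object C U"
  proof
    assume "zero_object C U"
    then have "w = \<zero>\<^bsub>V U\<^esub>" using w(2) by (rule zero_object_trivial)
    then show False using w(1) ap_zero[OF U(2)] assms(3) by simp
  qed
  then have "iso_arrow C U S k"
    using simple U(1) mono_if_inj[OF U(2,3)] unfolding simple_object_def by blast
  then obtain l where l: "l \<in> Hom C S U" "k \<cdot> l = ident S"
    by (auto simp: iso_arrow_def inverse_arrows_def)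
  have "carrier (V S) \<subseteq> L"
  proof
    fix n assume n: "n \<in> carrier (V S)"
    have "n = ap k (ap l n)" using ap_Comp[OF l(1) U(2) n] l(2) ap_ident[OF S_Obj n] by simp
    moreover have "ap k (ap l n) \<in> ap k ` carrier (V U)" using ap_closed[OF l(1) n] by (rule imageI)
    ultimately show "n \<in> L" using U(4) by simp
  qed
  then show ?thesis using assms(1) by (auto simp: S.submod_def)
qed

text \<open>Scalars commute with the action, so an eigenspace of a module endomorphism is a
  submodule. For an eigenvalue it is nonzero, hence everything.\<close>

lemma schur:
  assumes h: "module_hom A (V S) (V S) h"
  shows "\<exists>c\<in>carrier K. \<forall>v\<in>carrier (V S). h v = (c \<odot>\<^bsub>A\<^esub> \<one>\<^bsub>A\<^esub>) \<odot>\<^bsub>V S\<^esub> v"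
proof -
  obtain v0 where v0: "v0 \<in> carrier (V S)" "v0 \<noteq> \<zero>\<^bsub>V S\<^esub>" using S_nontrivial by blast
  have "S.KM.endo h"
    unfolding S.KM.endo_def using module_homD[OF h] by simp
  from S.KM.ex_eigenvector[OF this _ alg_closed V_finite_dim[OF S_Obj], of v0] v0
  obtain c w where c: "c \<in> carrier K" "w \<in> carrier (V S)" "w \<noteq> \<zero>\<^bsub>V S\<^esub>"
    "h w = (c \<odot>\<^bsub>A\<^esub> \<one>\<^bsub>A\<^esub>) \<odot>\<^bsub>V S\<^esub> w" by auto
  let ?L = "{v \<in> carrier (V S). h v = (c \<odot>\<^bsub>A\<^esub> \<one>\<^bsub>A\<^esub>) \<odot>\<^bsub>V S\<^esub> v}"
  have h0: "h \<zero>\<^bsub>V S\<^esub> = \<zero>\<^bsub>V S\<^esub>"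
    using module_homD[OF h]
    by (intro additive_zero[OF S.M.abelian_group_axioms S.M.abelian_group_axioms, of h]) auto
  have "S.submod ?L"
    unfolding S.submod_def using module_homD[OF h] c(1) h0
    by (auto simp: S.act_add S.scalar_act)
  from S_submod[OF this, of w] c have "?L = carrier (V S)" by simp
  then show ?thesis using c(1) by blast
qed

definition left_ideal :: "(nat \<Rightarrow> 'k) set \<Rightarrow> bool" where
  "left_ideal L \<longleftrightarrow> L \<subseteq> carrier A \<and> \<zero>\<^bsub>A\<^esub> \<in> L \<and> (\<forall>a\<in>L. \<forall>b\<in>L. a \<oplus>\<^bsub>A\<^esub> b \<in> L) \<and>
     (\<forall>a\<in>carrier A. \<forall>b\<in>L. a \<otimes>\<^bsub>A\<^esub> b \<in> L)"

lemma left_idealD: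
  assumes "left_ideal L"
  shows "a \<in> L \<Longrightarrow> a \<in> carrier A" "\<zero>\<^bsub>A\<^esub> \<in> L" "\<lbrakk>a \<in> L; b \<in> L\<rbrakk> \<Longrightarrow> a \<oplus>\<^bsub>A\<^esub> b \<in> L"
    "\<lbrakk>a \<in> carrier A; b \<in> L\<rbrakk> \<Longrightarrow> a \<otimes>\<^bsub>A\<^esub> b \<in> L"
  using assms by (auto simp: left_ideal_def)

lemma left_ideal_minus:
  assumes "left_ideal L" "a \<in> L" "b \<in> L"
  shows "a \<ominus>\<^bsub>A\<^esub> b \<in> L"
proof -
  have "a \<in> carrier A" "b \<in> carrier A" using left_idealD(1)[OF assms(1)] assms by auto
  then have "a \<ominus>\<^bsub>A\<^esub> b = a \<oplus>\<^bsub>A\<^esub> (\<ominus>\<^bsub>A\<^esub> \<one>\<^bsub>A\<^esub>) \<otimes>\<^bsub>A\<^esub> b"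
    by (simp add: S.A.minus_eq S.A.l_minus)
  moreover have "(\<ominus>\<^bsub>A\<^esub> \<one>\<^bsub>A\<^esub>) \<otimes>\<^bsub>A\<^esub> b \<in> L"
    by (rule left_idealD(4)[OF assms(1) _ assms(3)]) simp
  ultimately show ?thesis using left_idealD(3)[OF assms(1,2)] by simp
qed

text \<open>Stated for a left ideal, because the induction passes to the annihilator of an element.\<close>

lemma density_left_ideal:
  assumes "finite T" "T \<subseteq> carrier (V S)" "left_ideal L"
    and "\<And>c. c \<in> T \<rightarrow> carrier K \<Longrightarrow>
      (\<And>a. a \<in> L \<Longrightarrow> a \<odot>\<^bsub>V S\<^esub> (\<Oplus>\<^bsub>V S\<^esub>n\<in>T. (c n \<odot>\<^bsub>A\<^esub> \<one>\<^bsub>A\<^esub>) \<odot>\<^bsub>V S\<^esub> n) = \<zero>\<^bsub>V S\<^esub>) \<Longrightarrow>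
      \<forall>n\<in>T. c n = \<zero>\<^bsub>K\<^esub>"
    and "t \<in> T \<rightarrow> carrier (V S)"
  shows "\<exists>a\<in>L. \<forall>n\<in>T. a \<odot>\<^bsub>V S\<^esub> n = t n"
  using assms
proof (induction T arbitrary: L t)
  case empty
  then show ?case using left_idealD(2) by auto
next
  case (insert x T)
  note L = left_idealD[OF insert.prems(2)]
  have x: "x \<in> carrier (V S)" and T: "T \<subseteq> carrier (V S)" using insert.prems by auto
  \<comment> \<open>Elements that annihilate \<open>x\<close> can correct the values on
    \<open>T\<close> without disturbing the one at \<open>x\<close>.\<close>
  let ?L = "{a \<in> L. a \<odot>\<^bsub>V S\<^esub> x = \<zero>\<^bsub>V S\<^esub>}"
  have L': "left_ideal ?L"
    unfolding left_ideal_def using L x by (auto simp: S.act_add_left S.act_mult)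
  have "S.submod ((\<lambda>a. a \<odot>\<^bsub>V S\<^esub> x) ` L)"
    unfolding S.submod_def
  proof (intro conjI ballI)
    show "(\<lambda>a. a \<odot>\<^bsub>V S\<^esub> x) ` L \<subseteq> carrier (V S)" using L x by auto
    show "\<zero>\<^bsub>V S\<^esub> \<in> (\<lambda>a. a \<odot>\<^bsub>V S\<^esub> x) ` L"
      using L x by (intro image_eqI[of _ _ "\<zero>\<^bsub>A\<^esub>"]) auto
  next
    fix v w assume "v \<in> (\<lambda>a. a \<odot>\<^bsub>V S\<^esub> x) ` L" "w \<in> (\<lambda>a. a \<odot>\<^bsub>V S\<^esub> x) ` L"
    then obtain a b where "a \<in> L" "b \<in> L" "v = a \<odot>\<^bsub>V S\<^esub> x" "w = b \<odot>\<^bsub>V S\<^esub> x" by auto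
    then show "v \<oplus>\<^bsub>V S\<^esub> w \<in> (\<lambda>a. a \<odot>\<^bsub>V S\<^esub> x) ` L"
      using L x by (intro image_eqI[of _ _ "a \<oplus>\<^bsub>A\<^esub> b"]) (simp_all add: S.act_add_left)
  next
    fix a v assume "a \<in> carrier A" "v \<in> (\<lambda>a. a \<odot>\<^bsub>V S\<^esub> x) ` L"
    then obtain b where "a \<in> carrier A" "b \<in> L" "v = b \<odot>\<^bsub>V S\<^esub> x" by auto
    then show "a \<odot>\<^bsub>V S\<^esub> v \<in> (\<lambda>a. a \<odot>\<^bsub>V S\<^esub> x) ` L"
      using L x by (intro image_eqI[of _ _ "a \<otimes>\<^bsub>A\<^esub> b"]) (simp_all add: S.act_mult)
  qed
  moreover have "\<exists>a\<in>L. a \<odot>\<^bsub>V S\<^esub> x \<noteq> \<zero>\<^bsub>V S\<^esub>"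
  proof (rule ccontr)
    assume "\<not> ?thesis"
    then have 0: "\<And>a. a \<in> L \<Longrightarrow> a \<odot>\<^bsub>V S\<^esub> x = \<zero>\<^bsub>V S\<^esub>" by blast
    \<comment> \<open>If \<open>L\<close> annihilated \<open>x\<close>, then \<open>x\<close> alone
      would be a killed combination, with coefficient one.\<close>
    define c where "c n = (if n = x then \<one>\<^bsub>K\<^esub> else \<zero>\<^bsub>K\<^esub>)" for n
    have "(\<Oplus>\<^bsub>V S\<^esub>n\<in>insert x T. (c n \<odot>\<^bsub>A\<^esub> \<one>\<^bsub>A\<^esub>) \<odot>\<^bsub>V S\<^esub> n) = x"
      using S.KM.smult_finsum_delta[of "insert x T" x] insert.hyps(1) insert.prems(1) by (simp add: c_def)
    then have "\<forall>n\<in>insert x T. c n = \<zero>\<^bsub>K\<^esub>"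
      using 0 by (intro insert.prems(3)) (auto simp: c_def)
    then show False by (simp add: c_def)
  qed
  then obtain a1 where "a1 \<in> L" "a1 \<odot>\<^bsub>V S\<^esub> x \<noteq> \<zero>\<^bsub>V S\<^esub>" by blast
  ultimately have Lx: "(\<lambda>a. a \<odot>\<^bsub>V S\<^esub> x) ` L = carrier (V S)" by (intro S_submod[of _ "a1 \<odot>\<^bsub>V S\<^esub> x"]) auto
  have Lx': "\<exists>a\<in>L. a \<odot>\<^bsub>V S\<^esub> x = w" if "w \<in> carrier (V S)" for w
  proof -
    have "w \<in> (\<lambda>a. a \<odot>\<^bsub>V S\<^esub> x) ` L" using that Lx by simp
    then show ?thesis by auto
  qed
  \<comment> \<open>Suppose a combination \<open>y\<close> is killed by all elements of
    \<open>L\<close> that kill \<open>x\<close>. Then a x |-> a y is a well-defined endomorphism of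
    the simple module. By Schur's lemma it is a scalar \<tau>, and \<open>L\<close> kills y - \<tau>
    x. The premise for \<open>insert x T\<close> makes all coefficients of this combination vanish,
    those of \<open>y\<close> among them.\<close>
  have indep: "\<forall>n\<in>T. c n = \<zero>\<^bsub>K\<^esub>" if c: "c \<in> T \<rightarrow> carrier K"
    and kill: "\<And>a. a \<in> ?L \<Longrightarrow> a \<odot>\<^bsub>V S\<^esub> (\<Oplus>\<^bsub>V S\<^esub>n\<in>T. (c n \<odot>\<^bsub>A\<^esub> \<one>\<^bsub>A\<^esub>) \<odot>\<^bsub>V S\<^esub> n) = \<zero>\<^bsub>V S\<^esub>" for c
  proof -
    define y where "y = (\<Oplus>\<^bsub>V S\<^esub>n\<in>T. (c n \<odot>\<^bsub>A\<^esub> \<one>\<^bsub>A\<^esub>) \<odot>\<^bsub>V S\<^esub> n)"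
    have cT: "(\<lambda>n. (c n \<odot>\<^bsub>A\<^esub> \<one>\<^bsub>A\<^esub>) \<odot>\<^bsub>V S\<^esub> n) \<in> T \<rightarrow> carrier (V S)" using c T by auto
    then have y: "y \<in> carrier (V S)" unfolding y_def by (rule S.M.finsum_closed)
    have wd: "a \<odot>\<^bsub>V S\<^esub> y = b \<odot>\<^bsub>V S\<^esub> y" if ab: "a \<in> L" "b \<in> L" "a \<odot>\<^bsub>V S\<^esub> x = b \<odot>\<^bsub>V S\<^esub> x" for a b
    proof -
      have cl: "a \<in> carrier A" "b \<in> carrier A" using L(1) ab by auto
      have "(a \<ominus>\<^bsub>A\<^esub> b) \<odot>\<^bsub>V S\<^esub> x = \<zero>\<^bsub>V S\<^esub>"
        using cl ab(3) x by (simp add: S.act_minus_left S.M.minus_eq S.M.r_neg)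
      then have "(a \<ominus>\<^bsub>A\<^esub> b) \<odot>\<^bsub>V S\<^esub> y = \<zero>\<^bsub>V S\<^esub>"
        unfolding y_def using left_ideal_minus[OF insert.prems(2) ab(1,2)] by (intro kill) simp
      then show ?thesis using cl y by (simp add: S.act_minus_left S.M.minus_eq_zero_iff)
    qed
    \<comment> \<open>A preimage of \<open>w\<close> under a |-> a x is chosen; by \<open>wd\<close>
      the result does not depend on the choice.\<close>
    define h where "h w = (SOME a. a \<in> L \<and> a \<odot>\<^bsub>V S\<^esub> x = w) \<odot>\<^bsub>V S\<^esub> y" for w
    have h: "h (a \<odot>\<^bsub>V S\<^esub> x) = a \<odot>\<^bsub>V S\<^esub> y" if a: "a \<in> L" for a
    proof -
      have "\<exists>b. b \<in> L \<and> b \<odot>\<^bsub>V S\<^esub> x = a \<odot>\<^bsub>V S\<^esub> x" using a by blast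
      from someI_ex[OF this] show ?thesis unfolding h_def using a by (intro wd) auto
    qed
    have "module_hom A (V S) (V S) h"
    proof (rule module_homI)
      fix v w assume "v \<in> carrier (V S)" "w \<in> carrier (V S)"
      then obtain a b where ab: "a \<in> L" "a \<odot>\<^bsub>V S\<^esub> x = v" "b \<in> L" "b \<odot>\<^bsub>V S\<^esub> x = w"
        using Lx'[of v] Lx'[of w] by blast
      then have "h (v \<oplus>\<^bsub>V S\<^esub> w) = h ((a \<oplus>\<^bsub>A\<^esub> b) \<odot>\<^bsub>V S\<^esub> x)" using L x by (simp add: S.act_add_left)
      also have "\<dots> = a \<odot>\<^bsub>V S\<^esub> y \<oplus>\<^bsub>V S\<^esub> b \<odot>\<^bsub>V S\<^esub> y" using ab L y by (simp add: h S.act_add_left)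
      also have "\<dots> = h v \<oplus>\<^bsub>V S\<^esub> h w" using ab h by metis
      finally show "h (v \<oplus>\<^bsub>V S\<^esub> w) = h v \<oplus>\<^bsub>V S\<^esub> h w" .
    next
      fix a v assume a: "a \<in> carrier A" and "v \<in> carrier (V S)"
      then obtain b where b: "b \<in> L" "b \<odot>\<^bsub>V S\<^esub> x = v" using Lx'[of v] by blast
      then have "h (a \<odot>\<^bsub>V S\<^esub> v) = h ((a \<otimes>\<^bsub>A\<^esub> b) \<odot>\<^bsub>V S\<^esub> x)" using L x a by (simp add: S.act_mult)
      also have "\<dots> = a \<odot>\<^bsub>V S\<^esub> (b \<odot>\<^bsub>V S\<^esub> y)" using a b L y by (simp add: h S.act_mult)
      also have "\<dots> = a \<odot>\<^bsub>V S\<^esub> h v" using b h by metis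
      finally show "h (a \<odot>\<^bsub>V S\<^esub> v) = a \<odot>\<^bsub>V S\<^esub> h v" .
    next
      fix v assume "v \<in> carrier (V S)"
      then obtain b where b: "b \<in> L" "b \<odot>\<^bsub>V S\<^esub> x = v" using Lx'[of v] by blast
      have "h v = b \<odot>\<^bsub>V S\<^esub> y" using h[OF b(1)] b(2) by simp
      then show "h v \<in> carrier (V S)" using b(1) L(1) y by simp
    qed
    from schur[OF this] obtain \<tau> where \<tau>: "\<tau> \<in> carrier K"
      "\<And>v. v \<in> carrier (V S) \<Longrightarrow> h v = (\<tau> \<odot>\<^bsub>A\<^esub> \<one>\<^bsub>A\<^esub>) \<odot>\<^bsub>V S\<^esub> v" by blast
    define d where "d = c(x := \<ominus>\<^bsub>K\<^esub> \<tau>)"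
    have d: "d \<in> insert x T \<rightarrow> carrier K" using c \<tau>(1) by (auto simp: d_def)
    have "(\<Oplus>\<^bsub>V S\<^esub>n\<in>T. (d n \<odot>\<^bsub>A\<^esub> \<one>\<^bsub>A\<^esub>) \<odot>\<^bsub>V S\<^esub> n) = y"
      unfolding y_def using insert.hyps(2) cT by (intro S.M.finsum_cong') (auto simp: d_def)
    moreover have "(\<Oplus>\<^bsub>V S\<^esub>n\<in>insert x T. (d n \<odot>\<^bsub>A\<^esub> \<one>\<^bsub>A\<^esub>) \<odot>\<^bsub>V S\<^esub> n) =
        ((\<ominus>\<^bsub>K\<^esub> \<tau>) \<odot>\<^bsub>A\<^esub> \<one>\<^bsub>A\<^esub>) \<odot>\<^bsub>V S\<^esub> x \<oplus>\<^bsub>V S\<^esub> (\<Oplus>\<^bsub>V S\<^esub>n\<in>T. (d n \<odot>\<^bsub>A\<^esub> \<one>\<^bsub>A\<^esub>) \<odot>\<^bsub>V S\<^esub> n)"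
    proof -
      have "(\<lambda>n. (d n \<odot>\<^bsub>A\<^esub> \<one>\<^bsub>A\<^esub>) \<odot>\<^bsub>V S\<^esub> n) \<in> T \<rightarrow> carrier (V S)" using d T by auto
      moreover have "d x = \<ominus>\<^bsub>K\<^esub> \<tau>" by (simp add: d_def)
      ultimately show ?thesis using insert.hyps x \<tau>(1) by simp
    qed
    ultimately have dsum: "(\<Oplus>\<^bsub>V S\<^esub>n\<in>insert x T. (d n \<odot>\<^bsub>A\<^esub> \<one>\<^bsub>A\<^esub>) \<odot>\<^bsub>V S\<^esub> n) =
        ((\<ominus>\<^bsub>K\<^esub> \<tau>) \<odot>\<^bsub>A\<^esub> \<one>\<^bsub>A\<^esub>) \<odot>\<^bsub>V S\<^esub> x \<oplus>\<^bsub>V S\<^esub> y" by simp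
    have "\<forall>n\<in>insert x T. d n = \<zero>\<^bsub>K\<^esub>"
    proof (rule insert.prems(3)[OF d])
      fix a assume a: "a \<in> L"
      then have aA: "a \<in> carrier A" by (rule L(1))
      have ay: "a \<odot>\<^bsub>V S\<^esub> y = (\<tau> \<odot>\<^bsub>A\<^esub> \<one>\<^bsub>A\<^esub>) \<odot>\<^bsub>V S\<^esub> (a \<odot>\<^bsub>V S\<^esub> x)"
        using h[OF a] \<tau>(2)[of "a \<odot>\<^bsub>V S\<^esub> x"] aA x by simp
      have mc: "\<ominus>\<^bsub>K\<^esub> \<tau> \<in> carrier K" using \<tau>(1) by simp
      have m: "(\<ominus>\<^bsub>K\<^esub> \<tau>) \<odot>\<^bsub>A\<^esub> \<one>\<^bsub>A\<^esub> \<oplus>\<^bsub>A\<^esub> \<tau> \<odot>\<^bsub>A\<^esub> \<one>\<^bsub>A\<^esub> = \<zero>\<^bsub>A\<^esub>"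
        using \<tau>(1) by (simp add: S.KA.smult_l_minus S.A.l_neg)
      have "a \<odot>\<^bsub>V S\<^esub> (((\<ominus>\<^bsub>K\<^esub> \<tau>) \<odot>\<^bsub>A\<^esub> \<one>\<^bsub>A\<^esub>) \<odot>\<^bsub>V S\<^esub> x \<oplus>\<^bsub>V S\<^esub> y) =
          ((\<ominus>\<^bsub>K\<^esub> \<tau>) \<odot>\<^bsub>A\<^esub> \<one>\<^bsub>A\<^esub>) \<odot>\<^bsub>V S\<^esub> (a \<odot>\<^bsub>V S\<^esub> x) \<oplus>\<^bsub>V S\<^esub> (\<tau> \<odot>\<^bsub>A\<^esub> \<one>\<^bsub>A\<^esub>) \<odot>\<^bsub>V S\<^esub> (a \<odot>\<^bsub>V S\<^esub> x)"
        using S.act_add[OF aA S.act_closed[OF S.scalar_closed[OF mc] x] y] S.scalar_act[OF mc aA x] ay by simp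
      also have "\<dots> = \<zero>\<^bsub>V S\<^esub>"
        using aA x \<tau>(1) m by (simp flip: S.act_add_left)
      finally show "a \<odot>\<^bsub>V S\<^esub> (\<Oplus>\<^bsub>V S\<^esub>n\<in>insert x T. (d n \<odot>\<^bsub>A\<^esub> \<one>\<^bsub>A\<^esub>) \<odot>\<^bsub>V S\<^esub> n) = \<zero>\<^bsub>V S\<^esub>"
        unfolding dsum .
    qed
    then show ?thesis using insert.hyps(2) by (auto simp: d_def split: if_splits)
  qed
  have tx: "t x \<in> carrier (V S)" and tT: "t \<in> T \<rightarrow> carrier (V S)" using insert.prems(4) by auto
  \<comment> \<open>\<open>a0\<close> settles the value at \<open>x\<close>. The induction
    hypothesis supplies an element that kills \<open>x\<close> and makes up the difference on
    \<open>T\<close>.\<close>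
  obtain a0 where a0: "a0 \<in> L" "a0 \<odot>\<^bsub>V S\<^esub> x = t x" using Lx'[OF tx] by blast
  have a0A: "a0 \<in> carrier A" using a0(1) by (rule L(1))
  have "(\<lambda>n. t n \<ominus>\<^bsub>V S\<^esub> a0 \<odot>\<^bsub>V S\<^esub> n) \<in> T \<rightarrow> carrier (V S)"
    using tT T a0A by (auto simp: Pi_iff subset_iff)
  from insert.IH[OF T L' indep this] obtain a2 where a2: "a2 \<in> ?L"
    "\<And>n. n \<in> T \<Longrightarrow> a2 \<odot>\<^bsub>V S\<^esub> n = t n \<ominus>\<^bsub>V S\<^esub> a0 \<odot>\<^bsub>V S\<^esub> n" by blast
  have a2A: "a2 \<in> carrier A" using a2(1) L(1) by blast
  show ?case
  proof (intro bexI[of _ "a0 \<oplus>\<^bsub>A\<^esub> a2"] ballI)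
    show "a0 \<oplus>\<^bsub>A\<^esub> a2 \<in> L" using L(3) a0 a2 by blast
    fix n assume n: "n \<in> insert x T"
    show "(a0 \<oplus>\<^bsub>A\<^esub> a2) \<odot>\<^bsub>V S\<^esub> n = t n"
    proof (cases "n = x")
      case True
      then show ?thesis using a0 a2(1) a0A a2A x tx by (simp add: S.act_add_left)
    next
      case False
      then have nT: "n \<in> T" using n by simp
      then have "n \<in> carrier (V S)" "t n \<in> carrier (V S)" using T tT by auto
      then show ?thesis using a2(2)[OF nT] a0A a2A
        by (simp add: S.act_add_left S.M.minus_eq S.M.a_lcomm[of "a0 \<odot>\<^bsub>V S\<^esub> n" "t n"] S.M.r_neg)
    qed
  qed
qed

text \<open>The image of \<open>x\<close> is a nonzero submodule of a simple module.\<close>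

lemma nonzero_surj:
  assumes x: "x \<in> Hom C D S" "x \<noteq> Zer C D S"
  shows "ap x ` carrier (V D) = carrier (V S)"
proof -
  have D: "D \<in> Obj C" using HomD[OF x(1)] by auto
  interpret D: alg_module K A "V D" by (rule V_alg_module[OF D])
  note xD = module_homD[OF ap_hom[OF x(1)]]
  have "S.submod (ap x ` carrier (V D))"
    unfolding S.submod_def
  proof (intro conjI ballI)
    show "ap x ` carrier (V D) \<subseteq> carrier (V S)" using xD(1) by blast
    show "\<zero>\<^bsub>V S\<^esub> \<in> ap x ` carrier (V D)"
      using ap_zero[OF x(1)] by (intro image_eqI[of _ _ "\<zero>\<^bsub>V D\<^esub>"]) simp_all
  next
    fix v w assume "v \<in> ap x ` carrier (V D)" "w \<in> ap x ` carrier (V D)"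
    then obtain a b where "a \<in> carrier (V D)" "b \<in> carrier (V D)" "v = ap x a" "w = ap x b" by auto
    then show "v \<oplus>\<^bsub>V S\<^esub> w \<in> ap x ` carrier (V D)"
      by (intro image_eqI[of _ _ "a \<oplus>\<^bsub>V D\<^esub> b"]) (simp_all add: xD(2))
  next
    fix a v assume "a \<in> carrier A" "v \<in> ap x ` carrier (V D)"
    then obtain b where "a \<in> carrier A" "b \<in> carrier (V D)" "v = ap x b" by auto
    then show "a \<odot>\<^bsub>V S\<^esub> v \<in> ap x ` carrier (V D)"
      by (intro image_eqI[of _ _ "a \<odot>\<^bsub>V D\<^esub> b"]) (simp_all add: xD(3))
  qed
  moreover have "\<exists>v\<in>carrier (V D). ap x v \<noteq> \<zero>\<^bsub>V S\<^esub>"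
  proof (rule ccontr)
    assume "\<not> ?thesis"
    then have "x = Zer C D S"
      using ap_Zer[OF D S_Obj] by (intro faithful[OF x(1) Zer_Hom[OF D S_Obj]]) auto
    then show False using x(2) by simp
  qed
  then obtain v where "v \<in> carrier (V D)" "ap x v \<noteq> \<zero>\<^bsub>V S\<^esub>" by blast
  ultimately show ?thesis by (intro S_submod[of _ "ap x v"]) auto
qed

lemma nonzero_epi:
  assumes x: "x \<in> Hom C D S" "x \<noteq> Zer C D S"
    and g: "g \<in> Hom C S W" "g' \<in> Hom C S W" "g \<cdot> x = g' \<cdot> x"
  shows "g = g'"
proof (rule faithful[OF g(1,2)])
  fix v assume "v \<in> carrier (V S)"
  then have "v \<in> ap x ` carrier (V D)" using nonzero_surj[OF x] by simp
  then obtain w where w: "v = ap x w" "w \<in> carrier (V D)" by (rule imageE)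
  show "ap g v = ap g' v"
    using ap_Comp[OF x(1) g(1) w(2)] ap_Comp[OF x(1) g(2) w(2)] g(3) w(1) by simp
qed

text \<open>An arrow that vanishes on the kernel of \<open>x\<close> factors through the surjective
  \<open>x\<close> by an endomorphism of \<open>S\<close>, which is a scalar by Schur's lemma. The
  kernel therefore detects proportionality to \<open>x\<close>.\<close>

lemma ex_kernel_scalar:
  assumes x: "x \<in> Hom C D S" "x \<noteq> Zer C D S"
  obtains U k where "k \<in> Hom C U D" "x \<cdot> k = Zer C U S"
    "\<And>x'. \<lbrakk>x' \<in> Hom C D S; x' \<cdot> k = Zer C U S\<rbrakk> \<Longrightarrow> \<exists>c\<in>carrier K. x' = Scal C c x"
proof -
  have D: "D \<in> Obj C" using HomD[OF x(1)] by auto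
  interpret D: alg_module K A "V D" by (rule V_alg_module[OF D])
  note xD = module_homD[OF ap_hom[OF x(1)]]
  let ?L = "{v \<in> carrier (V D). ap x v = \<zero>\<^bsub>V S\<^esub>}"
  have L: "D.submod ?L"
    using xD ap_zero[OF x(1)] by (auto simp: D.submod_def)
  obtain U k where U: "U \<in> Obj C" "k \<in> Hom C U D" "inj_on (ap k) (carrier (V U))"
    "ap k ` carrier (V U) = ?L" by (rule ex_subobject[OF D L], rule that)
  show thesis
  proof (rule that[OF U(2)])
    show "x \<cdot> k = Zer C U S"
    proof (rule faithful[OF Comp_Hom[OF U(2) x(1)] Zer_Hom[OF U(1) S_Obj]])
      fix v assume v: "v \<in> carrier (V U)"
      then have "ap k v \<in> ?L" using U(4) by blast
      then show "ap (x \<cdot> k) v = ap (Zer C U S) v"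
        using ap_Comp[OF U(2) x(1) v] ap_Zer[OF U(1) S_Obj v] by simp
    qed
  next
    fix x' assume x': "x' \<in> Hom C D S" "x' \<cdot> k = Zer C U S"
    note x'D = module_homD[OF ap_hom[OF x'(1)]]
    have ker: "ap x' v = \<zero>\<^bsub>V S\<^esub>" if v: "v \<in> carrier (V D)" "ap x v = \<zero>\<^bsub>V S\<^esub>" for v
    proof -
      have "v \<in> ap k ` carrier (V U)" using v U(4) by simp
      then obtain w where w: "v = ap k w" "w \<in> carrier (V U)" by (rule imageE)
      then show ?thesis using ap_Comp[OF U(2) x'(1) w(2)] x'(2) ap_Zer[OF U(1) S_Obj w(2)] by simp
    qed
    have wd: "ap x' v = ap x' w" if vw: "v \<in> carrier (V D)" "w \<in> carrier (V D)" "ap x v = ap x w" for v w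
    proof -
      \<comment> \<open>The negative of \<open>w\<close>, written as the action of minus one so that
        homomorphisms commute with it.\<close>
      define w' where "w' = (\<ominus>\<^bsub>A\<^esub> \<one>\<^bsub>A\<^esub>) \<odot>\<^bsub>V D\<^esub> w"
      have w': "w' \<in> carrier (V D)" using vw by (simp add: w'_def)
      have neg: "(\<ominus>\<^bsub>A\<^esub> \<one>\<^bsub>A\<^esub>) \<odot>\<^bsub>V S\<^esub> u = \<ominus>\<^bsub>V S\<^esub> u" if "u \<in> carrier (V S)" for u
        using S.act_minus_left[of "\<zero>\<^bsub>A\<^esub>" "\<one>\<^bsub>A\<^esub>" u] that by (simp add: S.A.minus_eq S.M.minus_eq)
      have e: "ap y w' = \<ominus>\<^bsub>V S\<^esub> ap y w" if "y \<in> Hom C D S" for y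
        using module_homD(1,3)[OF ap_hom[OF that]] vw(2) neg by (simp add: w'_def)
      have "ap x (v \<oplus>\<^bsub>V D\<^esub> w') = \<zero>\<^bsub>V S\<^esub>"
        using xD(2)[OF vw(1) w'] e[OF x(1)] vw xD(1)[of w] by (simp add: S.M.r_neg)
      then have "ap x' (v \<oplus>\<^bsub>V D\<^esub> w') = \<zero>\<^bsub>V S\<^esub>" using vw w' by (intro ker) simp_all
      then have "ap x' v \<ominus>\<^bsub>V S\<^esub> ap x' w = \<zero>\<^bsub>V S\<^esub>"
        using x'D(2)[OF vw(1) w'] e[OF x'(1)] by (simp add: S.M.minus_eq)
      then show ?thesis using x'D(1) vw by (simp add: S.M.minus_eq_zero_iff)
    qed
    define h where "h n = ap x' (inv_into (carrier (V D)) (ap x) n)" for n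
    have h: "h (ap x v) = ap x' v" if v: "v \<in> carrier (V D)" for v
    proof -
      have "ap x v \<in> ap x ` carrier (V D)" using v by (rule imageI)
      then show ?thesis unfolding h_def using v
        by (intro wd) (simp_all add: inv_into_into f_inv_into_f)
    qed
    have lift: "\<exists>v\<in>carrier (V D). ap x v = n" if "n \<in> carrier (V S)" for n
    proof -
      have "n \<in> ap x ` carrier (V D)" using that nonzero_surj[OF x] by simp
      then show ?thesis by auto
    qed
    have "module_hom A (V S) (V S) h"
    proof (rule module_homI)
      fix n assume "n \<in> carrier (V S)"
      then obtain v where v: "v \<in> carrier (V D)" "n = ap x v" using lift by metis
      then show "h n \<in> carrier (V S)" using h[OF v(1)] x'D(1)[OF v(1)] by simp
    next
      fix n m assume "n \<in> carrier (V S)" "m \<in> carrier (V S)"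
      then obtain v w where v: "v \<in> carrier (V D)" "n = ap x v" "w \<in> carrier (V D)" "m = ap x w"
        using lift by metis
      then show "h (n \<oplus>\<^bsub>V S\<^esub> m) = h n \<oplus>\<^bsub>V S\<^esub> h m"
        using h[of "v \<oplus>\<^bsub>V D\<^esub> w"] h[OF v(1)] h[OF v(3)] xD(2)[OF v(1,3)] x'D(2)[OF v(1,3)] by simp
    next
      fix a n assume a: "a \<in> carrier A" and "n \<in> carrier (V S)"
      then obtain v where v: "v \<in> carrier (V D)" "n = ap x v" using lift by metis
      then show "h (a \<odot>\<^bsub>V S\<^esub> n) = a \<odot>\<^bsub>V S\<^esub> h n"
        using a h[of "a \<odot>\<^bsub>V D\<^esub> v"] h[OF v(1)] xD(3)[OF a v(1)] x'D(3)[OF a v(1)] by simp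
    qed
    from schur[OF this] obtain c where c: "c \<in> carrier K"
      "\<And>v. v \<in> carrier (V S) \<Longrightarrow> h v = (c \<odot>\<^bsub>A\<^esub> \<one>\<^bsub>A\<^esub>) \<odot>\<^bsub>V S\<^esub> v" by blast
    have "x' = Scal C c x"
    proof (rule faithful[OF x'(1) Scal_Hom[OF c(1) x(1)]])
      fix v assume v: "v \<in> carrier (V D)"
      show "ap x' v = ap (Scal C c x) v"
        using h[OF v] c(2)[OF xD(1)[OF v]] ap_Scal[OF c(1) x(1) v] by simp
    qed
    then show "\<exists>c\<in>carrier K. x' = Scal C c x" using c(1) by blast
  qed
qed

end

section \<open>Decomposition of an object into copies of a simple object\<close>

context simple_in_concrete
begin

abbreviation sc :: "'o \<Rightarrow> 'k \<Rightarrow> (nat \<Rightarrow> 'k) \<Rightarrow> (nat \<Rightarrow> 'k)" where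
  "sc X c v \<equiv> (c \<odot>\<^bsub>A\<^esub> \<one>\<^bsub>A\<^esub>) \<odot>\<^bsub>V X\<^esub> v"

text \<open>Density with the whole algebra as left ideal realizes any prescribed values on a basis.
  Linearity over \<open>K\<close> extends the formula from the basis to all vectors.\<close>

lemma ex_rank_one:
  assumes f: "f \<in> functionals K (restrict_scalars A (V S))" and n: "n \<in> carrier (V S)"
  shows "\<exists>a\<in>carrier A. \<forall>x\<in>carrier (V S). a \<odot>\<^bsub>V S\<^esub> x = sc S (f x) n"
proof -
  obtain B \<nu> where B: "finite B" "B \<subseteq> carrier (restrict_scalars A (V S))"
    "\<And>b. b \<in> B \<Longrightarrow> \<nu> b \<in> functionals K (restrict_scalars A (V S))"
    "\<And>v. v \<in> carrier (restrict_scalars A (V S)) \<Longrightarrow>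
      v = (\<Oplus>\<^bsub>restrict_scalars A (V S)\<^esub>b\<in>B. \<nu> b v \<odot>\<^bsub>restrict_scalars A (V S)\<^esub> b)"
    "\<And>b c. \<lbrakk>b \<in> B; c \<in> B\<rbrakk> \<Longrightarrow> \<nu> b c = (if b = c then \<one>\<^bsub>K\<^esub> else \<zero>\<^bsub>K\<^esub>)"
    by (rule S.KM.dual_basis[OF V_finite_dim[OF S_Obj]], rule that)
  have BS: "B \<subseteq> carrier (V S)" using B(2) by simp
  have fK: "f x \<in> carrier K" if "x \<in> carrier (V S)" for x using functionalsD(1)[OF f] that by simp
  have "\<exists>a\<in>carrier A. \<forall>b\<in>B. a \<odot>\<^bsub>V S\<^esub> b = sc S (f b) n"
  proof (rule density_left_ideal[OF B(1) BS])
    show "left_ideal (carrier A)" by (simp add: left_ideal_def)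
    show "(\<lambda>b. sc S (f b) n) \<in> B \<rightarrow> carrier (V S)" using fK BS n by auto
    fix c assume c: "c \<in> B \<rightarrow> carrier K"
      and "\<And>a. a \<in> carrier A \<Longrightarrow> a \<odot>\<^bsub>V S\<^esub> (\<Oplus>\<^bsub>V S\<^esub>n\<in>B. sc S (c n) n) = \<zero>\<^bsub>V S\<^esub>"
    \<comment> \<open>For the whole algebra the premise of the density lemma reduces to linear
      independence, because one is among the annihilating elements.\<close>
    then have "\<one>\<^bsub>A\<^esub> \<odot>\<^bsub>V S\<^esub> (\<Oplus>\<^bsub>V S\<^esub>n\<in>B. sc S (c n) n) = \<zero>\<^bsub>V S\<^esub>" by simp
    moreover have "(\<Oplus>\<^bsub>V S\<^esub>n\<in>B. sc S (c n) n) \<in> carrier (V S)"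
      using c BS by (intro S.M.finsum_closed) auto
    ultimately have 0: "(\<Oplus>\<^bsub>V S\<^esub>n\<in>B. sc S (c n) n) = \<zero>\<^bsub>V S\<^esub>" by simp
    show "\<forall>b\<in>B. c b = \<zero>\<^bsub>K\<^esub>"
    proof
      fix b assume b: "b \<in> B"
      have "\<nu> b (\<Oplus>\<^bsub>V S\<^esub>n\<in>B. sc S (c n) n) = (\<Oplus>\<^bsub>K\<^esub>n\<in>B. c n \<otimes>\<^bsub>K\<^esub> \<nu> b n)"
        using S.KM.functional_coeffs[OF B(3)[OF b] c B(2)] by simp
      also have "\<dots> = (\<Oplus>\<^bsub>K\<^esub>n\<in>B. c n \<otimes>\<^bsub>K\<^esub> (if b = n then \<one>\<^bsub>K\<^esub> else \<zero>\<^bsub>K\<^esub>))"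
        using c b B(5) by (intro K.finsum_cong') (auto simp: Pi_iff)
      also have "\<dots> = c b" using B(1) b c by (rule S.KM.finsum_delta)
      finally show "c b = \<zero>\<^bsub>K\<^esub>" using 0 S.KM.functional_zero[OF B(3)[OF b]] by simp
    qed
  qed
  then obtain a where a: "a \<in> carrier A" "\<And>b. b \<in> B \<Longrightarrow> a \<odot>\<^bsub>V S\<^esub> b = sc S (f b) n" by blast
  have "a \<odot>\<^bsub>V S\<^esub> x = sc S (f x) n" if x: "x \<in> carrier (V S)" for x
  proof -
    have \<nu>K: "\<nu> b x \<in> carrier K" if "b \<in> B" for b using functionalsD(1)[OF B(3)[OF that]] x by simp
    have x_eq: "x = (\<Oplus>\<^bsub>V S\<^esub>b\<in>B. sc S (\<nu> b x) b)" using B(4)[of x] x by simp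
    have fx: "f x = (\<Oplus>\<^bsub>K\<^esub>b\<in>B. \<nu> b x \<otimes>\<^bsub>K\<^esub> f b)"
      using S.KM.functional_coeffs[OF f _ B(2), of "\<lambda>b. \<nu> b x"] \<nu>K x_eq by simp
    have "a \<odot>\<^bsub>V S\<^esub> (\<Oplus>\<^bsub>V S\<^esub>b\<in>B. sc S (\<nu> b x) b) = (\<Oplus>\<^bsub>V S\<^esub>b\<in>B. a \<odot>\<^bsub>V S\<^esub> sc S (\<nu> b x) b)"
      using a(1) \<nu>K BS by (intro S.finsum_act) auto
    also have "\<dots> = (\<Oplus>\<^bsub>V S\<^esub>b\<in>B. sc S (\<nu> b x \<otimes>\<^bsub>K\<^esub> f b) n)"
    proof (rule S.M.finsum_cong')
      fix b assume b: "b \<in> B"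
      then have bS: "b \<in> carrier (V S)" using BS by auto
      then show "a \<odot>\<^bsub>V S\<^esub> sc S (\<nu> b x) b = sc S (\<nu> b x \<otimes>\<^bsub>K\<^esub> f b) n"
        using a(2)[OF b] \<nu>K[OF b] n fK[OF bS] S.KM.smult_assoc1[of "\<nu> b x" "f b" n]
          S.scalar_act[OF \<nu>K[OF b] a(1) bS] by simp
    qed (use \<nu>K fK BS n in auto)
    also have "\<dots> = sc S (\<Oplus>\<^bsub>K\<^esub>b\<in>B. \<nu> b x \<otimes>\<^bsub>K\<^esub> f b) n"
      using \<nu>K fK BS n
      by (intro finsum_additive[OF K.abelian_monoid_axioms S.M.abelian_monoid_axioms,
            of "\<lambda>b. \<nu> b x \<otimes>\<^bsub>K\<^esub> f b" B "\<lambda>c. sc S c n", symmetric])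
        (auto simp: S.KA.smult_l_distr S.act_add_left)
    finally show ?thesis using x_eq fx by simp
  qed
  then show ?thesis using a(1) by blast
qed

text \<open>By \<open>kill\<close> the action of an algebra element on \<open>V Y\<close> depends
  only on its action on \<open>V S\<close>. There every rank-one operator comes from the algebra, so
  these operators act on \<open>V Y\<close> too and obey the rules of matrix units. The image
  \<open>W\<close> of one idempotent of rank one is the multiplicity space: \<open>V Y\<close> is
  the tensor product of \<open>V S\<close> and \<open>W\<close> over \<open>K\<close>, and a basis
  \<open>D\<close> of \<open>W\<close> lists the copies of \<open>S\<close>.\<close>

lemma isotypic_direct_sum:
  assumes Y: "Y \<in> Obj C"
    and kill: "\<And>a m. \<lbrakk>a \<in> carrier A; \<forall>n\<in>carrier (V S). a \<odot>\<^bsub>V S\<^esub> n = \<zero>\<^bsub>V S\<^esub>; m \<in> carrier (V Y)\<rbrakk>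
      \<Longrightarrow> a \<odot>\<^bsub>V Y\<^esub> m = \<zero>\<^bsub>V Y\<^esub>"
  shows "\<exists>r. is_direct_sum C r (\<lambda>_. S) Y"
proof -
  interpret Y: alg_module K A "V Y" by (rule V_alg_module[OF Y])
  let ?F = "functionals K (restrict_scalars A (V S))"
  obtain B \<nu> where B: "finite B" "B \<subseteq> carrier (restrict_scalars A (V S))"
    "\<And>b. b \<in> B \<Longrightarrow> \<nu> b \<in> ?F"
    "\<And>v. v \<in> carrier (restrict_scalars A (V S)) \<Longrightarrow>
      v = (\<Oplus>\<^bsub>restrict_scalars A (V S)\<^esub>b\<in>B. \<nu> b v \<odot>\<^bsub>restrict_scalars A (V S)\<^esub> b)"
    "\<And>b c. \<lbrakk>b \<in> B; c \<in> B\<rbrakk> \<Longrightarrow> \<nu> b c = (if b = c then \<one>\<^bsub>K\<^esub> else \<zero>\<^bsub>K\<^esub>)"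
    by (rule S.KM.dual_basis[OF V_finite_dim[OF S_Obj]], rule that)
  have BS: "b \<in> carrier (V S)" if "b \<in> B" for b using B(2) that by auto
  have expand: "x = (\<Oplus>\<^bsub>V S\<^esub>b\<in>B. sc S (\<nu> b x) b)" if "x \<in> carrier (V S)" for x
    using B(4)[of x] that by simp
  have FK: "f x \<in> carrier K" if "f \<in> ?F" "x \<in> carrier (V S)" for f x
    using functionalsD(1)[OF that(1)] that(2) by simp
  have sep: "x = y" if "x \<in> carrier (V S)" "y \<in> carrier (V S)" "\<And>b. b \<in> B \<Longrightarrow> \<nu> b x = \<nu> b y" for x y
  proof -
    have "x = (\<Oplus>\<^bsub>V S\<^esub>b\<in>B. sc S (\<nu> b x) b)" by (rule expand[OF that(1)])
    also have "\<dots> = (\<Oplus>\<^bsub>V S\<^esub>b\<in>B. sc S (\<nu> b y) b)"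
      using that BS FK B(3) by (intro S.M.finsum_cong') auto
    also have "\<dots> = y" by (rule expand[OF that(2), symmetric])
    finally show ?thesis .
  qed
  have "B \<noteq> {}"
  proof
    assume "B = {}"
    then have "x = \<zero>\<^bsub>V S\<^esub>" if "x \<in> carrier (V S)" for x using expand[OF that] by simp
    then show False using S_nontrivial by blast
  qed
  \<comment> \<open>A basis vector kept fixed; its diagonal matrix unit cuts out the multiplicity
    space.\<close>
  then obtain n1 where n1: "n1 \<in> B" by blast
  have n1S: "n1 \<in> carrier (V S)" and \<nu>1: "\<nu> n1 \<in> ?F" and \<nu>11: "\<nu> n1 n1 = \<one>\<^bsub>K\<^esub>"
    using BS B(3,5) n1 by auto
  \<comment> \<open>Several algebra elements may act on \<open>V S\<close> as the same rank-one
    operator. By \<open>tr\<close> below they act alike on \<open>V Y\<close>, so any choice will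
    do.\<close>
  define r where "r f n = (SOME a. a \<in> carrier A \<and> (\<forall>x\<in>carrier (V S). a \<odot>\<^bsub>V S\<^esub> x = sc S (f x) n))" for f n
  have r: "r f n \<in> carrier A \<and> (\<forall>x\<in>carrier (V S). r f n \<odot>\<^bsub>V S\<^esub> x = sc S (f x) n)"
    if "f \<in> ?F" "n \<in> carrier (V S)" for f n
    unfolding r_def by (rule someI_ex[OF ex_rank_one[OF that, unfolded Bex_def]])
  have rA: "r f n \<in> carrier A" if "f \<in> ?F" "n \<in> carrier (V S)" for f n using r[OF that] by blast
  have rS: "r f n \<odot>\<^bsub>V S\<^esub> x = sc S (f x) n" if "f \<in> ?F" "n \<in> carrier (V S)" "x \<in> carrier (V S)" for f n x
    using r[OF that(1,2)] that(3) by blast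
  have tr: "a \<odot>\<^bsub>V Y\<^esub> m = a' \<odot>\<^bsub>V Y\<^esub> m"
    if a: "a \<in> carrier A" "a' \<in> carrier A" "m \<in> carrier (V Y)"
      and eq: "\<And>x. x \<in> carrier (V S) \<Longrightarrow> a \<odot>\<^bsub>V S\<^esub> x = a' \<odot>\<^bsub>V S\<^esub> x" for a a' m
  proof -
    have "(a \<ominus>\<^bsub>A\<^esub> a') \<odot>\<^bsub>V Y\<^esub> m = \<zero>\<^bsub>V Y\<^esub>"
      using a eq by (intro kill) (simp_all add: S.act_minus_left S.M.minus_eq S.M.r_neg)
    then show ?thesis using a by (simp add: Y.act_minus_left Y.M.minus_eq_zero_iff)
  qed
  \<comment> \<open>The multiplication rule of matrix units: composing two rank-one operators
    contracts the inner pair to the scalar \<open>f n'\<close>.\<close>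
  have R1: "r f n \<odot>\<^bsub>V Y\<^esub> (r g n' \<odot>\<^bsub>V Y\<^esub> m) = sc Y (f n') (r g n \<odot>\<^bsub>V Y\<^esub> m)"
    if fg: "f \<in> ?F" "g \<in> ?F" and nn: "n \<in> carrier (V S)" "n' \<in> carrier (V S)" and m: "m \<in> carrier (V Y)"
    for f g n n' m
  proof -
    have "(r f n \<otimes>\<^bsub>A\<^esub> r g n') \<odot>\<^bsub>V Y\<^esub> m = ((f n' \<odot>\<^bsub>A\<^esub> \<one>\<^bsub>A\<^esub>) \<otimes>\<^bsub>A\<^esub> r g n) \<odot>\<^bsub>V Y\<^esub> m"
    proof (rule tr)
      fix x assume x: "x \<in> carrier (V S)"
      have gx: "g x \<in> carrier K" and fn: "f n' \<in> carrier K" using FK fg x nn by auto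
      have "(r f n \<otimes>\<^bsub>A\<^esub> r g n') \<odot>\<^bsub>V S\<^esub> x = sc S (g x) (sc S (f n') n)"
        using S.act_mult[OF rA[OF fg(1) nn(1)] rA[OF fg(2) nn(2)] x] rS[OF fg(2) nn(2) x]
          rS[OF fg(1) nn(1) nn(2)] S.scalar_act[OF gx rA[OF fg(1) nn(1)] nn(2)] by simp
      also have "\<dots> = sc S (f n') (sc S (g x) n)"
        using gx fn nn S.scalar_act[OF gx S.scalar_closed[OF fn] nn(1)] by simp
      also have "\<dots> = ((f n' \<odot>\<^bsub>A\<^esub> \<one>\<^bsub>A\<^esub>) \<otimes>\<^bsub>A\<^esub> r g n) \<odot>\<^bsub>V S\<^esub> x"
        using rA[OF fg(2) nn(1)] x fn rS[OF fg(2) nn(1) x] by (simp add: S.act_mult)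
      finally show "(r f n \<otimes>\<^bsub>A\<^esub> r g n') \<odot>\<^bsub>V S\<^esub> x = ((f n' \<odot>\<^bsub>A\<^esub> \<one>\<^bsub>A\<^esub>) \<otimes>\<^bsub>A\<^esub> r g n) \<odot>\<^bsub>V S\<^esub> x" .
    qed (use rA fg nn FK m in auto)
    then show ?thesis
      using rA[OF fg(1) nn(1)] rA[OF fg(2) nn(2)] rA[OF fg(2) nn(1)] m FK[OF fg(1) nn(2)]
      by (simp add: Y.act_mult)
  qed
  have R2: "r f (n \<oplus>\<^bsub>V S\<^esub> n') \<odot>\<^bsub>V Y\<^esub> m = r f n \<odot>\<^bsub>V Y\<^esub> m \<oplus>\<^bsub>V Y\<^esub> r f n' \<odot>\<^bsub>V Y\<^esub> m"
    if "f \<in> ?F" "n \<in> carrier (V S)" "n' \<in> carrier (V S)" "m \<in> carrier (V Y)" for f n n' m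
  proof -
    have "r f (n \<oplus>\<^bsub>V S\<^esub> n') \<odot>\<^bsub>V Y\<^esub> m = (r f n \<oplus>\<^bsub>A\<^esub> r f n') \<odot>\<^bsub>V Y\<^esub> m"
      using that rA FK by (intro tr) (simp_all add: S.act_add_left rS S.act_add)
    then show ?thesis using that rA by (simp add: Y.act_add_left)
  qed
  have R3: "r f (a \<odot>\<^bsub>V S\<^esub> n) \<odot>\<^bsub>V Y\<^esub> m = a \<odot>\<^bsub>V Y\<^esub> (r f n \<odot>\<^bsub>V Y\<^esub> m)"
    if "f \<in> ?F" "n \<in> carrier (V S)" "a \<in> carrier A" "m \<in> carrier (V Y)" for f n a m
  proof -
    have "r f (a \<odot>\<^bsub>V S\<^esub> n) \<odot>\<^bsub>V Y\<^esub> m = (a \<otimes>\<^bsub>A\<^esub> r f n) \<odot>\<^bsub>V Y\<^esub> m"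
      using that rA FK by (intro tr) (simp_all add: S.act_mult rS S.scalar_act)
    then show ?thesis using that rA by (simp add: Y.act_mult)
  qed
  have Fa: "(\<lambda>x. f (a \<odot>\<^bsub>V S\<^esub> x)) \<in> ?F" if "f \<in> ?F" "a \<in> carrier A" for f a
    using functionalsD[OF that(1)] that(2) by (intro functionalsI) (auto simp: S.act_add S.scalar_act)
  have R4: "r f n \<odot>\<^bsub>V Y\<^esub> (a \<odot>\<^bsub>V Y\<^esub> m) = r (\<lambda>x. f (a \<odot>\<^bsub>V S\<^esub> x)) n \<odot>\<^bsub>V Y\<^esub> m"
    if "f \<in> ?F" "n \<in> carrier (V S)" "a \<in> carrier A" "m \<in> carrier (V Y)" for f n a m
  proof -
    have "(r f n \<otimes>\<^bsub>A\<^esub> a) \<odot>\<^bsub>V Y\<^esub> m = r (\<lambda>x. f (a \<odot>\<^bsub>V S\<^esub> x)) n \<odot>\<^bsub>V Y\<^esub> m"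
      using that rA Fa FK by (intro tr) (simp_all add: S.act_mult rS)
    then show ?thesis using that rA by (simp add: Y.act_mult)
  qed
  \<comment> \<open>The dual basis resolves the identity of \<open>V S\<close> into rank-one
    operators, and \<open>tr\<close> carries this over to \<open>V Y\<close>.\<close>
  have R5: "m = (\<Oplus>\<^bsub>V Y\<^esub>b\<in>B. r (\<nu> b) b \<odot>\<^bsub>V Y\<^esub> m)" if m: "m \<in> carrier (V Y)" for m
  proof -
    have rb: "(\<lambda>b. r (\<nu> b) b) \<in> B \<rightarrow> carrier A" using rA B(3) BS by auto
    have "\<one>\<^bsub>A\<^esub> \<odot>\<^bsub>V Y\<^esub> m = (\<Oplus>\<^bsub>A\<^esub>b\<in>B. r (\<nu> b) b) \<odot>\<^bsub>V Y\<^esub> m"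
    proof (rule tr)
      fix x assume x: "x \<in> carrier (V S)"
      have "(\<Oplus>\<^bsub>A\<^esub>b\<in>B. r (\<nu> b) b) \<odot>\<^bsub>V S\<^esub> x = (\<Oplus>\<^bsub>V S\<^esub>b\<in>B. r (\<nu> b) b \<odot>\<^bsub>V S\<^esub> x)"
        by (rule S.act_finsum[OF rb x])
      also have "\<dots> = (\<Oplus>\<^bsub>V S\<^esub>b\<in>B. sc S (\<nu> b x) b)"
        using x BS B(3) FK rS by (intro S.M.finsum_cong') auto
      finally show "\<one>\<^bsub>A\<^esub> \<odot>\<^bsub>V S\<^esub> x = (\<Oplus>\<^bsub>A\<^esub>b\<in>B. r (\<nu> b) b) \<odot>\<^bsub>V S\<^esub> x"
        using expand[OF x] x by simp
    qed (use m rb in \<open>auto intro!: S.A.finsum_closed\<close>)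
    then show ?thesis using Y.act_finsum[OF rb m] m by simp
  qed
  define W where "W = {m \<in> carrier (V Y). r (\<nu> n1) n1 \<odot>\<^bsub>V Y\<^esub> m = m}"
  have e1: "r (\<nu> n1) n1 \<in> carrier A" by (rule rA[OF \<nu>1 n1S])
  have WY: "w \<in> carrier (V Y)" "r (\<nu> n1) n1 \<odot>\<^bsub>V Y\<^esub> w = w" if "w \<in> W" for w
    using that by (auto simp: W_def)
  have W: "Y.KM.subspace W"
    unfolding Y.KM.subspace_def W_def using e1 by (auto simp: Y.act_add Y.scalar_act)
  let ?W = "(restrict_scalars A (V Y))\<lparr>carrier := W\<rparr>"
  interpret W: lin_space K ?W by (rule Y.KM.subspace_lin_space[OF W])
  have sc1: "sc Y \<one>\<^bsub>K\<^esub> m = m" if "m \<in> carrier (V Y)" for m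
    using Y.KM.smult_one[of m] that by simp
  \<comment> \<open>The idempotent does not change such an element, since \<open>\<nu> n1\<close>
    takes the value one at \<open>n1\<close>.\<close>
  have inW: "r f n1 \<odot>\<^bsub>V Y\<^esub> m \<in> W" if "f \<in> ?F" "m \<in> carrier (V Y)" for f m
    using R1[OF \<nu>1 that(1) n1S n1S that(2)] \<nu>11 rA[OF that(1) n1S] that sc1 by (simp add: W_def)
  obtain D \<mu> where D: "finite D" "D \<subseteq> carrier ?W"
    "\<And>s. s \<in> D \<Longrightarrow> \<mu> s \<in> functionals K ?W"
    "\<And>v. v \<in> carrier ?W \<Longrightarrow> v = (\<Oplus>\<^bsub>?W\<^esub>s\<in>D. \<mu> s v \<odot>\<^bsub>?W\<^esub> s)"
    "\<And>s t. \<lbrakk>s \<in> D; t \<in> D\<rbrakk> \<Longrightarrow> \<mu> s t = (if s = t then \<one>\<^bsub>K\<^esub> else \<zero>\<^bsub>K\<^esub>)"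
    by (rule W.dual_basis[OF Y.KM.finite_dim_subspace[OF W V_finite_dim[OF Y]]], rule that)
  have DW: "s \<in> W" "s \<in> carrier (V Y)" if "s \<in> D" for s using D(2) that WY(1) by auto
  have \<mu>K: "\<mu> s w \<in> carrier K" if "s \<in> D" "w \<in> W" for s w
    using functionalsD(1)[OF D(3)[OF that(1)], of w] that(2) by simp
  have \<mu>_add: "\<mu> s (w \<oplus>\<^bsub>V Y\<^esub> w') = \<mu> s w \<oplus>\<^bsub>K\<^esub> \<mu> s w'" if "s \<in> D" "w \<in> W" "w' \<in> W" for s w w'
    using functionalsD(2)[OF D(3)[OF that(1)], of w w'] that by simp
  have \<mu>_sc: "\<mu> s (sc Y c w) = c \<otimes>\<^bsub>K\<^esub> \<mu> s w" if "s \<in> D" "w \<in> W" "c \<in> carrier K" for s w c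
    using functionalsD(3)[OF D(3)[OF that(1)], of c w] that by simp
  have expandW: "w = (\<Oplus>\<^bsub>V Y\<^esub>s\<in>D. sc Y (\<mu> s w) s)" if w: "w \<in> W" for w
  proof -
    have "w = (\<Oplus>\<^bsub>?W\<^esub>s\<in>D. sc Y (\<mu> s w) s)" using D(4)[of w] w by simp
    also have "\<dots> = (\<Oplus>\<^bsub>restrict_scalars A (V Y)\<^esub>s\<in>D. sc Y (\<mu> s w) s)"
      using \<mu>K w DW Y.KM.subspaceD(4)[OF W] by (intro Y.KM.finsum_subspace[OF W]) simp
    finally show ?thesis by simp
  qed
  \<comment> \<open>The component of \<open>m\<close> in the copy of \<open>S\<close> that belongs
    to \<open>s\<close>. The fact \<open>F\<close> below describes it without the basis
    \<open>B\<close>: a functional \<open>f\<close> takes on it the value that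
    \<open>\<mu> s\<close> takes on \<open>r f n1\<close> applied to \<open>m\<close>. Linearity
    over the algebra is then checked one functional at a time.\<close>
  define k where "k s m = (\<Oplus>\<^bsub>V S\<^esub>b\<in>B. sc S (\<mu> s (r (\<nu> b) n1 \<odot>\<^bsub>V Y\<^esub> m)) b)" for s m
  have \<mu>r: "\<mu> s (r (\<nu> b) n1 \<odot>\<^bsub>V Y\<^esub> m) \<in> carrier K" if "s \<in> D" "b \<in> B" "m \<in> carrier (V Y)" for s b m
    using \<mu>K inW B(3) that by blast
  have kS: "k s m \<in> carrier (V S)" if "s \<in> D" "m \<in> carrier (V Y)" for s m
    unfolding k_def using \<mu>r that BS by (intro S.M.finsum_closed) auto
  have F: "f (k s m) = \<mu> s (r f n1 \<odot>\<^bsub>V Y\<^esub> m)" if f: "f \<in> ?F" and s: "s \<in> D" and m: "m \<in> carrier (V Y)" for f s m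
  proof -
    have cl: "r (\<nu> b) n1 \<odot>\<^bsub>V Y\<^esub> m \<in> W" "f b \<in> carrier K" if "b \<in> B" for b
      using inW[OF B(3)[OF that] m] FK[OF f BS[OF that]] by auto
    have "f (k s m) = (\<Oplus>\<^bsub>K\<^esub>b\<in>B. \<mu> s (r (\<nu> b) n1 \<odot>\<^bsub>V Y\<^esub> m) \<otimes>\<^bsub>K\<^esub> f b)"
      using S.KM.functional_coeffs[OF f _ B(2), of "\<lambda>b. \<mu> s (r (\<nu> b) n1 \<odot>\<^bsub>V Y\<^esub> m)"] \<mu>r[OF s _ m]
      by (simp add: k_def)
    also have "\<dots> = (\<Oplus>\<^bsub>K\<^esub>b\<in>B. \<mu> s (sc Y (f b) (r (\<nu> b) n1 \<odot>\<^bsub>V Y\<^esub> m)))"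
      using cl \<mu>K s by (intro K.finsum_cong') (auto simp: \<mu>_sc K.m_comm)
    also have "\<dots> = \<mu> s (\<Oplus>\<^bsub>?W\<^esub>b\<in>B. sc Y (f b) (r (\<nu> b) n1 \<odot>\<^bsub>V Y\<^esub> m))"
      using cl Y.KM.subspaceD(4)[OF W] by (intro W.functional_finsum[OF D(3)[OF s], symmetric]) simp
    also have "(\<Oplus>\<^bsub>?W\<^esub>b\<in>B. sc Y (f b) (r (\<nu> b) n1 \<odot>\<^bsub>V Y\<^esub> m)) =
        (\<Oplus>\<^bsub>restrict_scalars A (V Y)\<^esub>b\<in>B. sc Y (f b) (r (\<nu> b) n1 \<odot>\<^bsub>V Y\<^esub> m))"
      using cl Y.KM.subspaceD(4)[OF W] by (intro Y.KM.finsum_subspace[OF W]) simp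
    also have "\<dots> = (\<Oplus>\<^bsub>V Y\<^esub>b\<in>B. r f n1 \<odot>\<^bsub>V Y\<^esub> (r (\<nu> b) b \<odot>\<^bsub>V Y\<^esub> m))"
      unfolding restrict_scalars_simps
      using R1[OF f B(3) n1S BS m] rA[OF f n1S] rA[OF B(3) BS] m by (intro Y.M.finsum_cong') auto
    also have "\<dots> = r f n1 \<odot>\<^bsub>V Y\<^esub> (\<Oplus>\<^bsub>V Y\<^esub>b\<in>B. r (\<nu> b) b \<odot>\<^bsub>V Y\<^esub> m)"
      using rA[OF f n1S] rA[OF B(3) BS] m by (intro Y.finsum_act[symmetric]) auto
    also have "\<dots> = r f n1 \<odot>\<^bsub>V Y\<^esub> m" using R5[OF m] by simp
    finally show ?thesis .
  qed
  have k_hom: "module_hom A (V Y) (V S) (k s)" if s: "s \<in> D" for s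
  proof (rule module_homI)
    fix m m' assume m: "m \<in> carrier (V Y)" "m' \<in> carrier (V Y)"
    show "k s (m \<oplus>\<^bsub>V Y\<^esub> m') = k s m \<oplus>\<^bsub>V S\<^esub> k s m'"
    proof (rule sep)
      fix b assume b: "b \<in> B"
      have "\<nu> b (k s (m \<oplus>\<^bsub>V Y\<^esub> m')) = \<nu> b (k s m) \<oplus>\<^bsub>K\<^esub> \<nu> b (k s m')"
        using F[OF B(3)[OF b] s] m rA[OF B(3)[OF b] n1S] inW[OF B(3)[OF b]]
        by (simp add: Y.act_add \<mu>_add[OF s])
      also have "\<dots> = \<nu> b (k s m \<oplus>\<^bsub>V S\<^esub> k s m')"
        using functionalsD(2)[OF B(3)[OF b], of "k s m" "k s m'"] kS[OF s] m by simp
      finally show "\<nu> b (k s (m \<oplus>\<^bsub>V Y\<^esub> m')) = \<nu> b (k s m \<oplus>\<^bsub>V S\<^esub> k s m')" .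
    qed (use kS[OF s] m in auto)
  next
    fix a m assume a: "a \<in> carrier A" and m: "m \<in> carrier (V Y)"
    show "k s (a \<odot>\<^bsub>V Y\<^esub> m) = a \<odot>\<^bsub>V S\<^esub> k s m"
    proof (rule sep)
      fix b assume b: "b \<in> B"
      show "\<nu> b (k s (a \<odot>\<^bsub>V Y\<^esub> m)) = \<nu> b (a \<odot>\<^bsub>V S\<^esub> k s m)"
        using F[OF B(3)[OF b] s, of "a \<odot>\<^bsub>V Y\<^esub> m"] F[OF Fa[OF B(3)[OF b] a] s m]
          R4[OF B(3)[OF b] n1S a m] a m by simp
    qed (use kS[OF s] a m in auto)
  qed (rule kS[OF s])
  \<comment> \<open>The copy of \<open>S\<close> generated by \<open>s\<close>: as the idempotent
    fixes \<open>s\<close>, the vector \<open>n1\<close> goes to \<open>s\<close>.\<close>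
  define h where "h s n = r (\<nu> n1) n \<odot>\<^bsub>V Y\<^esub> s" for s n
  have h_hom: "module_hom A (V S) (V Y) (h s)" if s: "s \<in> D" for s
    unfolding h_def using R2[OF \<nu>1] R3[OF \<nu>1] rA[OF \<nu>1] DW[OF s] by (intro module_homI) simp_all
  have kh: "k s (h t n) = (if s = t then n else \<zero>\<^bsub>V S\<^esub>)"
    if s: "s \<in> D" and t: "t \<in> D" and n: "n \<in> carrier (V S)" for s t n
  proof (rule sep)
    have ht: "h t n \<in> carrier (V Y)" using module_homD(1)[OF h_hom[OF t] n] .
    then show "k s (h t n) \<in> carrier (V S)" by (rule kS[OF s])
    fix b assume b: "b \<in> B"
    have nb: "\<nu> b n \<in> carrier K" by (rule FK[OF B(3)[OF b] n])
    have "\<nu> b (k s (h t n)) = \<mu> s (r (\<nu> b) n1 \<odot>\<^bsub>V Y\<^esub> (r (\<nu> n1) n \<odot>\<^bsub>V Y\<^esub> t))"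
      using F[OF B(3)[OF b] s ht] by (simp add: h_def)
    also have "\<dots> = \<mu> s (sc Y (\<nu> b n) t)"
      using R1[OF B(3)[OF b] \<nu>1 n1S n DW(2)[OF t]] WY(2)[OF DW(1)[OF t]] by simp
    also have "\<dots> = \<nu> b n \<otimes>\<^bsub>K\<^esub> (if s = t then \<one>\<^bsub>K\<^esub> else \<zero>\<^bsub>K\<^esub>)"
      using \<mu>_sc[OF s DW(1)[OF t] nb] D(5)[OF s t] by simp
    also have "\<dots> = \<nu> b (if s = t then n else \<zero>\<^bsub>V S\<^esub>)"
      using nb S.KM.functional_zero[OF B(3)[OF b]] by simp
    finally show "\<nu> b (k s (h t n)) = \<nu> b (if s = t then n else \<zero>\<^bsub>V S\<^esub>)" .
  qed (use n in auto)
  have hk: "(\<Oplus>\<^bsub>V Y\<^esub>s\<in>D. h s (k s m)) = m" if m: "m \<in> carrier (V Y)" for m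
  proof -
    define m' where "m' = (\<Oplus>\<^bsub>V Y\<^esub>s\<in>D. h s (k s m))"
    have hkY: "(\<lambda>s. h s (k s m)) \<in> D \<rightarrow> carrier (V Y)"
      using module_homD(1)[OF h_hom] kS[OF _ m] by auto
    then have m': "m' \<in> carrier (V Y)" unfolding m'_def by (rule Y.M.finsum_closed)
    have "r (\<nu> b) n1 \<odot>\<^bsub>V Y\<^esub> m' = r (\<nu> b) n1 \<odot>\<^bsub>V Y\<^esub> m" if b: "b \<in> B" for b
    proof -
      note rb = rA[OF B(3)[OF b] n1S]
      have "r (\<nu> b) n1 \<odot>\<^bsub>V Y\<^esub> m' = (\<Oplus>\<^bsub>V Y\<^esub>s\<in>D. r (\<nu> b) n1 \<odot>\<^bsub>V Y\<^esub> h s (k s m))"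
        unfolding m'_def by (rule Y.finsum_act[OF rb hkY])
      also have "\<dots> = (\<Oplus>\<^bsub>V Y\<^esub>s\<in>D. sc Y (\<mu> s (r (\<nu> b) n1 \<odot>\<^bsub>V Y\<^esub> m)) s)"
      proof (rule Y.M.finsum_cong')
        fix s assume s: "s \<in> D"
        have "r (\<nu> b) n1 \<odot>\<^bsub>V Y\<^esub> h s (k s m) = sc Y (\<nu> b (k s m)) s"
          using R1[OF B(3)[OF b] \<nu>1 n1S kS[OF s m] DW(2)[OF s]] WY(2)[OF DW(1)[OF s]] by (simp add: h_def)
        then show "r (\<nu> b) n1 \<odot>\<^bsub>V Y\<^esub> h s (k s m) = sc Y (\<mu> s (r (\<nu> b) n1 \<odot>\<^bsub>V Y\<^esub> m)) s"
          using F[OF B(3)[OF b] s m] by simp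
      qed (use \<mu>r b m DW in auto)
      also have "\<dots> = r (\<nu> b) n1 \<odot>\<^bsub>V Y\<^esub> m" by (rule expandW[OF inW[OF B(3)[OF b] m], symmetric])
      finally show ?thesis .
    qed
    \<comment> \<open>A diagonal matrix unit factors through \<open>n1\<close>, so an element of
      \<open>V Y\<close> is determined by its images in \<open>W\<close>.\<close>
    moreover have "r (\<nu> b) b \<odot>\<^bsub>V Y\<^esub> x = r (\<nu> n1) b \<odot>\<^bsub>V Y\<^esub> (r (\<nu> b) n1 \<odot>\<^bsub>V Y\<^esub> x)"
      if "b \<in> B" "x \<in> carrier (V Y)" for b x
      using R1[OF \<nu>1 B(3)[OF that(1)] BS[OF that(1)] n1S that(2)] \<nu>11
        sc1[of "r (\<nu> b) b \<odot>\<^bsub>V Y\<^esub> x"] rA[OF B(3)[OF that(1)] BS[OF that(1)]] that(2) by simp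
    ultimately have "(\<Oplus>\<^bsub>V Y\<^esub>b\<in>B. r (\<nu> b) b \<odot>\<^bsub>V Y\<^esub> m') = (\<Oplus>\<^bsub>V Y\<^esub>b\<in>B. r (\<nu> b) b \<odot>\<^bsub>V Y\<^esub> m)"
      using m m' rA[OF B(3) BS] by (intro Y.M.finsum_cong') auto
    then show ?thesis using R5[OF m] R5[OF m'] by (simp add: m'_def)
  qed
  have "\<exists>i. i \<in> Hom C S Y \<and> (\<forall>v\<in>carrier (V S). ap i v = h s v)" if "s \<in> D" for s
    using full[OF S_Obj Y h_hom[OF that]] by blast
  then obtain i where i: "\<And>s. s \<in> D \<Longrightarrow> i s \<in> Hom C S Y"
    "\<And>s v. s \<in> D \<Longrightarrow> v \<in> carrier (V S) \<Longrightarrow> ap (i s) v = h s v" by metis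
  have "\<exists>p. p \<in> Hom C Y S \<and> (\<forall>v\<in>carrier (V Y). ap p v = k s v)" if "s \<in> D" for s
    using full[OF Y S_Obj k_hom[OF that]] by blast
  then obtain p where p: "\<And>s. s \<in> D \<Longrightarrow> p s \<in> Hom C Y S"
    "\<And>s v. s \<in> D \<Longrightarrow> v \<in> carrier (V Y) \<Longrightarrow> ap (p s) v = k s v" by metis
  \<comment> \<open>\<open>is_direct_sum\<close> numbers its summands, so the basis \<open>D\<close>
    is enumerated.\<close>
  obtain g where g: "bij_betw g {0..<card D} D" using ex_bij_betw_nat_finite[OF D(1)] by blast
  then have g': "bij_betw g {..<card D} D" by (simp add: atLeast0LessThan)
  have gD: "g j \<in> D" if "j < card D" for j using g' that by (auto simp: bij_betw_def)
  have "is_direct_sum C (card D) (\<lambda>_. S) Y"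
    unfolding is_direct_sum_def
  proof (rule conjI[OF Y], rule exI[of _ "\<lambda>j. i (g j)"], rule exI[of _ "\<lambda>j. p (g j)"],
      intro conjI allI impI)
    fix j l assume jl: "j < card D" "l < card D"
    note J = gD[OF jl(1)] and L = gD[OF jl(2)]
    have "p (g j) \<cdot> i (g l) = (if g j = g l then ident S else Zer C S S)"
    proof (rule faithful[OF Comp_Hom[OF i(1)[OF L] p(1)[OF J]]])
      show "(if g j = g l then ident S else Zer C S S) \<in> Hom C S S"
        using ident_Hom[OF S_Obj] Zer_Hom[OF S_Obj S_Obj] by simp
      fix v assume v: "v \<in> carrier (V S)"
      have "ap (p (g j) \<cdot> i (g l)) v = k (g j) (h (g l) v)"
        using ap_Comp[OF i(1)[OF L] p(1)[OF J] v] i(2)[OF L v] p(2)[OF J] module_homD(1)[OF h_hom[OF L] v]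
        by simp
      then show "ap (p (g j) \<cdot> i (g l)) v = ap (if g j = g l then ident S else Zer C S S) v"
        using kh[OF J L v] ap_ident[OF S_Obj v] ap_Zer[OF S_Obj S_Obj v] by simp
    qed
    moreover have "g j = g l \<longleftrightarrow> j = l"
      using g' jl by (auto simp: bij_betw_def inj_on_def)
    ultimately show "p (g j) \<cdot> i (g l) = (if j = l then ident S else Zer C S S)" by simp
  next
    have ip: "(\<lambda>j. i (g j) \<cdot> p (g j)) \<in> {..<card D} \<rightarrow> Hom C Y Y"
      using i(1) p(1) gD Comp_Hom by blast
    interpret H: module K "hom_space C Y Y" by (rule hom_space[OF Y Y])
    have "(\<Oplus>\<^bsub>hom_space C Y Y\<^esub>j\<in>{..<card D}. i (g j) \<cdot> p (g j)) \<in> carrier (hom_space C Y Y)"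
      using ip by (intro H.M.finsum_closed) (simp add: hom_space_def)
    then have HomYY: "(\<Oplus>\<^bsub>hom_space C Y Y\<^esub>j\<in>{..<card D}. i (g j) \<cdot> p (g j)) \<in> Hom C Y Y"
      by (simp add: hom_space_def)
    show "(\<Oplus>\<^bsub>hom_space C Y Y\<^esub>j\<in>{..<card D}. i (g j) \<cdot> p (g j)) = ident Y"
    proof (rule faithful[OF HomYY ident_Hom[OF Y]])
      fix v assume v: "v \<in> carrier (V Y)"
      have "ap (\<Oplus>\<^bsub>hom_space C Y Y\<^esub>j\<in>{..<card D}. i (g j) \<cdot> p (g j)) v =
          (\<Oplus>\<^bsub>V Y\<^esub>j\<in>{..<card D}. ap (i (g j) \<cdot> p (g j)) v)"
        by (rule ap_finsum[OF Y Y ip v])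
      also have "\<dots> = (\<Oplus>\<^bsub>V Y\<^esub>j\<in>{..<card D}. h (g j) (k (g j) v))"
      proof (rule Y.M.finsum_cong')
        fix j assume "j \<in> {..<card D}"
        then have J: "g j \<in> D" by (simp add: gD)
        show "ap (i (g j) \<cdot> p (g j)) v = h (g j) (k (g j) v)"
          using ap_Comp[OF p(1)[OF J] i(1)[OF J] v] p(2)[OF J v] i(2)[OF J kS[OF J v]] by simp
      next
        show "(\<lambda>j. h (g j) (k (g j) v)) \<in> {..<card D} \<rightarrow> carrier (V Y)"
          using module_homD(1)[OF h_hom[OF gD] kS[OF gD v]] by simp
      qed simp
      also have "\<dots> = (\<Oplus>\<^bsub>V Y\<^esub>s\<in>g ` {..<card D}. h s (k s v))"
      proof (rule Y.M.finsum_reindex[symmetric])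
        show "inj_on g {..<card D}" using g' by (rule bij_betw_imp_inj_on)
        show "(\<lambda>s. h s (k s v)) \<in> g ` {..<card D} \<rightarrow> carrier (V Y)"
          using module_homD(1)[OF h_hom[OF gD] kS[OF gD v]] by auto
      qed
      also have "\<dots> = v" using hk[OF v] bij_betw_imp_surj_on[OF g'] by simp
      finally show "ap (\<Oplus>\<^bsub>hom_space C Y Y\<^esub>j\<in>{..<card D}. i (g j) \<cdot> p (g j)) v = ap (ident Y) v"
        using ap_ident[OF Y v] by simp
    qed
  qed (use i p gD in auto)
  then show ?thesis by blast
qed

end

section \<open>Calculus in strict monoidal categories\<close>

context strict_monoidal_category
begin

lemma HomI: "\<lbrakk>f \<in> Arr C; Dom C f = X; Cod C f = Y\<rbrakk> \<Longrightarrow> f \<in> Hom C X Y"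
  by (simp add: Hom_def)

lemma Arr_Hom: "f \<in> Arr C \<Longrightarrow> f \<in> Hom C (Dom C f) (Cod C f)"
  by (simp add: Hom_def)

lemma Comp_typing:
  assumes "f \<in> Arr C" "g \<in> Arr C" "Cod C f = Dom C g"
  shows "g \<cdot> f \<in> Arr C" "Dom C (g \<cdot> f) = Dom C f" "Cod C (g \<cdot> f) = Cod C g"
  using Comp_Hom[of f "Dom C f" "Cod C f" g "Cod C g"] assms by (auto simp: Hom_def)

lemma TArr_typing:
  assumes "f \<in> Arr C" "g \<in> Arr C"
  shows "f \<otimes>\<^sub>a g \<in> Arr C" "Dom C (f \<otimes>\<^sub>a g) = Dom C f \<otimes>\<^sub>o Dom C g" "Cod C (f \<otimes>\<^sub>a g) = Cod C f \<otimes>\<^sub>o Cod C g"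
  using TArr_Hom[OF Arr_Hom[OF assms(1)] Arr_Hom[OF assms(2)]] by (auto simp: Hom_def)

lemma ident_typing:
  assumes "X \<in> Obj C"
  shows "ident X \<in> Arr C" "Dom C (ident X) = X" "Cod C (ident X) = X"
  using ident_Hom[OF assms] by (auto simp: Hom_def)

lemma comp_ident: "\<lbrakk>f \<in> Arr C; Dom C f = X\<rbrakk> \<Longrightarrow> f \<cdot> ident X = f"
  "\<lbrakk>f \<in> Arr C; Cod C f = X\<rbrakk> \<Longrightarrow> ident X \<cdot> f = f"
  using ident_left[OF Arr_Hom[of f]] ident_right[OF Arr_Hom[of f]] by auto

lemma comp_assoc:
  "\<lbrakk>f \<in> Arr C; g \<in> Arr C; h \<in> Arr C; Cod C f = Dom C g; Cod C g = Dom C h\<rbrakk>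
    \<Longrightarrow> (h \<cdot> g) \<cdot> f = h \<cdot> (g \<cdot> f)"
  using Comp_assoc[of f "Dom C f" "Cod C f" g "Cod C g" h "Cod C h"] by (auto simp: Hom_def)

lemma interchange:
  "\<lbrakk>f \<in> Arr C; g \<in> Arr C; f' \<in> Arr C; g' \<in> Arr C; Cod C f = Dom C g; Cod C f' = Dom C g'\<rbrakk>
    \<Longrightarrow> (g \<otimes>\<^sub>a g') \<cdot> (f \<otimes>\<^sub>a f') = (g \<cdot> f) \<otimes>\<^sub>a (g' \<cdot> f')"
  using TArr_Comp[of f "Dom C f" "Cod C f" g "Cod C g" f' "Dom C f'" "Cod C f'" g' "Cod C g'"]
  by (auto simp: Hom_def)

lemmas typing = Comp_typing TArr_typing ident_typing Dom_Obj Cod_Obj Unit_Obj TObj_Obj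
lemma ident_merge:
  "\<lbrakk>X \<in> Obj C; Y \<in> Obj C; f \<in> Arr C\<rbrakk> \<Longrightarrow> ident X \<otimes>\<^sub>a (ident Y \<otimes>\<^sub>a f) = ident (X \<otimes>\<^sub>o Y) \<otimes>\<^sub>a f"
  by (simp add: TArr_ident[symmetric] TArr_assoc typing)

lemmas strict = ident_merge TObj_assoc TObj_Unit TArr_assoc TArr_Unit TArr_ident

lemma interchange_assoc:
  "\<lbrakk>f \<in> Arr C; g \<in> Arr C; f' \<in> Arr C; g' \<in> Arr C; Cod C f = Dom C g; Cod C f' = Dom C g';
    h \<in> Arr C; Cod C h = Dom C f \<otimes>\<^sub>o Dom C f'\<rbrakk>
    \<Longrightarrow> (g \<otimes>\<^sub>a g') \<cdot> ((f \<otimes>\<^sub>a f') \<cdot> h) = ((g \<cdot> f) \<otimes>\<^sub>a (g' \<cdot> f')) \<cdot> h"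
  by (subst interchange[symmetric]) (simp_all add: comp_assoc typing)

text \<open>An arrow into the unit object leaves no tensor factor behind, so composing with it
  amounts to tensoring with it.\<close>

lemma absorb_right:
  "\<lbrakk>f \<in> Arr C; u \<in> Arr C; Dom C f = X; Cod C u = \<I>\<rbrakk> \<Longrightarrow> f \<cdot> (ident X \<otimes>\<^sub>a u) = f \<otimes>\<^sub>a u"
  using interchange[of "ident X" f u "ident \<I>"] by (simp add: typing strict comp_ident) (metis Dom_Obj comp_ident typing strict)

lemma absorb_left:
  "\<lbrakk>f \<in> Arr C; u \<in> Arr C; Dom C f = X; Cod C u = \<I>\<rbrakk> \<Longrightarrow> f \<cdot> (u \<otimes>\<^sub>a ident X) = u \<otimes>\<^sub>a f"
  using interchange[of u "ident \<I>" "ident X" f] by (simp add: typing strict comp_ident) (metis Dom_Obj comp_ident typing strict)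

lemma whisker_right:
  "\<lbrakk>f \<in> Arr C; g \<in> Arr C; Cod C f = Dom C g; X \<in> Obj C\<rbrakk>
    \<Longrightarrow> (g \<cdot> f) \<otimes>\<^sub>a ident X = (g \<otimes>\<^sub>a ident X) \<cdot> (f \<otimes>\<^sub>a ident X)"
  by (subst interchange) (simp_all add: typing comp_ident)

lemma whisker_left:
  "\<lbrakk>f \<in> Arr C; g \<in> Arr C; Cod C f = Dom C g; X \<in> Obj C\<rbrakk>
    \<Longrightarrow> ident X \<otimes>\<^sub>a (g \<cdot> f) = (ident X \<otimes>\<^sub>a g) \<cdot> (ident X \<otimes>\<^sub>a f)"
  by (subst interchange) (simp_all add: typing comp_ident)

text \<open>Rewriting with these rules merges composites of tensor products as far as the boundaries allow.\<close>

lemmas merge = comp_assoc comp_ident interchange interchange_assoc typing strict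

lemma left_dualD:
  assumes "is_left_dual C X X' e c"
  shows "X \<in> Obj C" "X' \<in> Obj C" "e \<in> Arr C" "Dom C e = X' \<otimes>\<^sub>o X" "Cod C e = \<I>"
    "c \<in> Arr C" "Dom C c = \<I>" "Cod C c = X \<otimes>\<^sub>o X'"
    "(ident X \<otimes>\<^sub>a e) \<cdot> (c \<otimes>\<^sub>a ident X) = ident X"
    "(e \<otimes>\<^sub>a ident X') \<cdot> (ident X' \<otimes>\<^sub>a c) = ident X'"
  using assms by (auto simp: is_left_dual_def Hom_def)

text \<open>Duality makes tensoring with \<open>X'\<close> left adjoint to tensoring with
  \<open>X\<close>; this half of the bijection yields injectivity of transposition. The arrow
  \<open>f\<close> slides past \<open>e\<close>, and the zigzag identity of \<open>X'\<close>
  straightens what remains.\<close>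

lemma untranspose:
  assumes d: "is_left_dual C X X' e c" and Y: "Y \<in> Obj C" and W: "W \<in> Obj C"
    and f: "f \<in> Hom C (X' \<otimes>\<^sub>o Y) W"
  shows "(e \<otimes>\<^sub>a ident W) \<cdot> (ident X' \<otimes>\<^sub>a ((ident X \<otimes>\<^sub>a f) \<cdot> (c \<otimes>\<^sub>a ident Y))) = f"
proof -
  note D [simp] = left_dualD(1-8)[OF d] Y W
  have [simp]: "f \<in> Arr C" "Dom C f = X' \<otimes>\<^sub>o Y" "Cod C f = W" using f by (auto simp: Hom_def)
  have "ident X' \<otimes>\<^sub>a ((ident X \<otimes>\<^sub>a f) \<cdot> (c \<otimes>\<^sub>a ident Y)) =
      (ident X' \<otimes>\<^sub>a ident X \<otimes>\<^sub>a f) \<cdot> (ident X' \<otimes>\<^sub>a c \<otimes>\<^sub>a ident Y)"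
    by (subst whisker_left) (simp_all add: typing strict)
  then have "(e \<otimes>\<^sub>a ident W) \<cdot> (ident X' \<otimes>\<^sub>a ((ident X \<otimes>\<^sub>a f) \<cdot> (c \<otimes>\<^sub>a ident Y))) =
      ((e \<otimes>\<^sub>a ident W) \<cdot> (ident (X' \<otimes>\<^sub>o X) \<otimes>\<^sub>a f)) \<cdot> (ident X' \<otimes>\<^sub>a c \<otimes>\<^sub>a ident Y)"
    by (simp add: comp_assoc typing strict)
  also have "(e \<otimes>\<^sub>a ident W) \<cdot> (ident (X' \<otimes>\<^sub>o X) \<otimes>\<^sub>a f) = e \<otimes>\<^sub>a f"
    by (simp add: merge)
  also have "e \<otimes>\<^sub>a f = f \<cdot> (e \<otimes>\<^sub>a ident (X' \<otimes>\<^sub>o Y))"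
    by (simp add: absorb_left typing)
  also have "\<dots> \<cdot> (ident X' \<otimes>\<^sub>a c \<otimes>\<^sub>a ident Y) = f \<cdot> (((e \<otimes>\<^sub>a ident X') \<cdot> (ident X' \<otimes>\<^sub>a c)) \<otimes>\<^sub>a ident Y)"
    by (subst whisker_right) (simp_all add: typing strict comp_assoc)
  also have "\<dots> = f" using left_dualD(10)[OF d] by (simp add: merge)
  finally show ?thesis .
qed

lemma transpose_inj:
  assumes "is_left_dual C X X' e c" "Y \<in> Obj C" "W \<in> Obj C"
    and "f \<in> Hom C (X' \<otimes>\<^sub>o Y) W" "f' \<in> Hom C (X' \<otimes>\<^sub>o Y) W"
    and "(ident X \<otimes>\<^sub>a f) \<cdot> (c \<otimes>\<^sub>a ident Y) = (ident X \<otimes>\<^sub>a f') \<cdot> (c \<otimes>\<^sub>a ident Y)"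
  shows "f = f'"
  using untranspose[OF assms(1-3)] assms(4-6) by metis

end

context finite_tensor_category
begin

lemma Dual_typing:
  assumes "X \<in> Obj C"
  shows "Dual C X \<in> Obj C" "Ev C X \<in> Arr C" "Dom C (Ev C X) = Dual C X \<otimes>\<^sub>o X" "Cod C (Ev C X) = \<I>"
    "Coev C X \<in> Arr C" "Dom C (Coev C X) = \<I>" "Cod C (Coev C X) = X \<otimes>\<^sub>o Dual C X"
  using left_dualD[OF left_dual[OF assms]] by simp_all

lemma zigzag:
  assumes "X \<in> Obj C"
  shows "(ident X \<otimes>\<^sub>a Ev C X) \<cdot> (Coev C X \<otimes>\<^sub>a ident X) = ident X"
    "(Ev C X \<otimes>\<^sub>a ident (Dual C X)) \<cdot> (ident (Dual C X) \<otimes>\<^sub>a Coev C X) = ident (Dual C X)"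
  using left_dualD[OF left_dual[OF assms]] by simp_all

lemma dual_arrow_typing:
  assumes "f \<in> Hom C X Y"
  shows "dual_arrow C X Y f \<in> Arr C" "Dom C (dual_arrow C X Y f) = Dual C Y"
    "Cod C (dual_arrow C X Y f) = Dual C X"
proof -
  note [simp] = HomD[OF assms] Dual_typing
  show "dual_arrow C X Y f \<in> Arr C" "Dom C (dual_arrow C X Y f) = Dual C Y"
    "Cod C (dual_arrow C X Y f) = Dual C X"
    by (simp_all add: dual_arrow_def typing strict)
qed

text \<open>\<open>dual_arrow\<close> contains the coevaluation of \<open>X\<close>, which the
  zigzag identity of \<open>X\<close> straightens against the evaluation. So an arrow can be moved
  round an evaluation as its dual.\<close>

lemma Ev_dual_arrow:
  assumes "f \<in> Hom C X Y"
  shows "Ev C X \<cdot> (dual_arrow C X Y f \<otimes>\<^sub>a ident X) = Ev C Y \<cdot> (ident (Dual C Y) \<otimes>\<^sub>a f)"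
proof -
  note [simp] = HomD[OF assms] Dual_typing
  let ?X = "Dual C X" and ?Y = "Dual C Y"
  have "dual_arrow C X Y f \<otimes>\<^sub>a ident X =
     (Ev C Y \<otimes>\<^sub>a ident (?X \<otimes>\<^sub>o X)) \<cdot> ((ident ?Y \<otimes>\<^sub>a f \<otimes>\<^sub>a ident (?X \<otimes>\<^sub>o X)) \<cdot> (ident ?Y \<otimes>\<^sub>a Coev C X \<otimes>\<^sub>a ident X))"
    unfolding dual_arrow_def
    by (subst whisker_right, simp_all add: typing strict)+
  then have "Ev C X \<cdot> (dual_arrow C X Y f \<otimes>\<^sub>a ident X) =
     (Ev C X \<cdot> (Ev C Y \<otimes>\<^sub>a ident (?X \<otimes>\<^sub>o X)) \<cdot> (ident ?Y \<otimes>\<^sub>a f \<otimes>\<^sub>a ident (?X \<otimes>\<^sub>o X))) \<cdot> (ident ?Y \<otimes>\<^sub>a Coev C X \<otimes>\<^sub>a ident X)"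
    by (simp add: comp_assoc typing strict)
  also have "Ev C X \<cdot> (Ev C Y \<otimes>\<^sub>a ident (?X \<otimes>\<^sub>o X)) \<cdot> (ident ?Y \<otimes>\<^sub>a f \<otimes>\<^sub>a ident (?X \<otimes>\<^sub>o X)) =
      (Ev C Y \<cdot> (ident ?Y \<otimes>\<^sub>a f)) \<cdot> (ident ?Y \<otimes>\<^sub>a ident X \<otimes>\<^sub>a Ev C X)"
  proof -
    have "(Ev C Y \<otimes>\<^sub>a ident (?X \<otimes>\<^sub>o X)) \<cdot> ((ident ?Y \<otimes>\<^sub>a f) \<otimes>\<^sub>a ident (?X \<otimes>\<^sub>o X)) =
        (Ev C Y \<cdot> (ident ?Y \<otimes>\<^sub>a f)) \<otimes>\<^sub>a ident (?X \<otimes>\<^sub>o X)"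
      by (subst whisker_right) (simp_all add: typing)
    moreover have "Ev C X \<cdot> ((Ev C Y \<cdot> (ident ?Y \<otimes>\<^sub>a f)) \<otimes>\<^sub>a ident (?X \<otimes>\<^sub>o X)) =
        (Ev C Y \<cdot> (ident ?Y \<otimes>\<^sub>a f)) \<otimes>\<^sub>a Ev C X"
      by (rule absorb_left) (simp_all add: typing strict)
    moreover have "(Ev C Y \<cdot> (ident ?Y \<otimes>\<^sub>a f)) \<cdot> (ident (?Y \<otimes>\<^sub>o X) \<otimes>\<^sub>a Ev C X) =
        (Ev C Y \<cdot> (ident ?Y \<otimes>\<^sub>a f)) \<otimes>\<^sub>a Ev C X"
      by (rule absorb_right) (simp_all add: typing strict)
    ultimately show ?thesis by (simp add: typing strict)
  qed
  also have "\<dots> \<cdot> (ident ?Y \<otimes>\<^sub>a Coev C X \<otimes>\<^sub>a ident X) =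
      (Ev C Y \<cdot> (ident ?Y \<otimes>\<^sub>a f)) \<cdot> (ident ?Y \<otimes>\<^sub>a ((ident X \<otimes>\<^sub>a Ev C X) \<cdot> (Coev C X \<otimes>\<^sub>a ident X)))"
    by (subst whisker_left) (simp_all add: typing strict comp_assoc)
  also have "\<dots> = Ev C Y \<cdot> (ident ?Y \<otimes>\<^sub>a f)"
    by (simp add: zigzag typing strict comp_ident)
  finally show ?thesis .
qed

text \<open>The counterpart for coevaluations; here the evaluation of \<open>Y\<close> inside
  \<open>dual_arrow\<close> is straightened by the zigzag identity of \<open>Y\<close>.\<close>

lemma dual_arrow_Coev:
  assumes "f \<in> Hom C X Y"
  shows "(f \<otimes>\<^sub>a ident (Dual C X)) \<cdot> Coev C X = (ident Y \<otimes>\<^sub>a dual_arrow C X Y f) \<cdot> Coev C Y"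
proof -
  note [simp] = HomD[OF assms] Dual_typing
  let ?X = "Dual C X" and ?Y = "Dual C Y"
  let ?u = "(f \<otimes>\<^sub>a ident ?X) \<cdot> Coev C X"
  have u [simp]: "?u \<in> Arr C" "Dom C ?u = \<I>" "Cod C ?u = Y \<otimes>\<^sub>o ?X" by (simp_all add: typing strict)
  have "dual_arrow C X Y f = (Ev C Y \<otimes>\<^sub>a ident ?X) \<cdot> (ident ?Y \<otimes>\<^sub>a ?u)"
    unfolding dual_arrow_def by (subst whisker_left) (simp_all add: typing strict comp_assoc)
  then have "ident Y \<otimes>\<^sub>a dual_arrow C X Y f =
      (ident Y \<otimes>\<^sub>a Ev C Y \<otimes>\<^sub>a ident ?X) \<cdot> (ident Y \<otimes>\<^sub>a ident ?Y \<otimes>\<^sub>a ?u)"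
    using whisker_left[of "ident ?Y \<otimes>\<^sub>a ?u" "Ev C Y \<otimes>\<^sub>a ident ?X" Y] u by (simp add: typing strict del: u)
  then have "(ident Y \<otimes>\<^sub>a dual_arrow C X Y f) \<cdot> Coev C Y =
      (ident Y \<otimes>\<^sub>a Ev C Y \<otimes>\<^sub>a ident ?X) \<cdot> ((ident (Y \<otimes>\<^sub>o ?Y) \<otimes>\<^sub>a ?u) \<cdot> Coev C Y)"
    using u by (simp add: typing strict comp_assoc)
  also have "(ident (Y \<otimes>\<^sub>o ?Y) \<otimes>\<^sub>a ?u) \<cdot> Coev C Y = Coev C Y \<otimes>\<^sub>a ?u"
    using interchange[of "Coev C Y" "ident (Y \<otimes>\<^sub>o ?Y)" "ident \<I>" ?u] u by (simp add: typing strict comp_ident)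
  also have "\<dots> = (Coev C Y \<otimes>\<^sub>a ident (Y \<otimes>\<^sub>o ?X)) \<cdot> ?u"
    using interchange[of "ident \<I>" "Coev C Y" ?u "ident (Y \<otimes>\<^sub>o ?X)"] u by (simp add: typing strict comp_ident)
  also have "(ident Y \<otimes>\<^sub>a Ev C Y \<otimes>\<^sub>a ident ?X) \<cdot> \<dots> =
      (((ident Y \<otimes>\<^sub>a Ev C Y) \<cdot> (Coev C Y \<otimes>\<^sub>a ident Y)) \<otimes>\<^sub>a ident ?X) \<cdot> ?u"
    using whisker_right[of "Coev C Y \<otimes>\<^sub>a ident Y" "ident Y \<otimes>\<^sub>a Ev C Y" ?X] by (simp add: typing strict comp_assoc)
  also have "\<dots> = ?u" by (simp add: zigzag typing strict comp_ident)
  finally show ?thesis ..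
qed

end

section \<open>The action of the end on objects\<close>

context finite_tensor_category
begin

text \<open>The transpose of \<open>\<rho> X\<close> along the duality of \<open>X\<close>. For the
  universal family \<open>\<pi> \<I>\<close> it is the canonical action of Z(1) on
  \<open>X\<close>.\<close>

definition coaction_action :: "('o \<Rightarrow> 'm) \<Rightarrow> 'o \<Rightarrow> 'm" where
  "coaction_action \<rho> X = (ident X \<otimes>\<^sub>a Ev C X) \<cdot> (\<rho> X \<otimes>\<^sub>a ident X)"

lemma dinatural_unitD:
  assumes "dinatural_from C \<I> W \<rho>" "X \<in> Obj C"
  shows "W \<in> Obj C" "\<rho> X \<in> Arr C" "Dom C (\<rho> X) = W" "Cod C (\<rho> X) = X \<otimes>\<^sub>o Dual C X"
  using assms by (auto simp: dinatural_from_def Hom_def strict Dual_typing)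

lemma dinatural_unit_natural:
  assumes "dinatural_from C \<I> W \<rho>" "f \<in> Hom C X Y"
  shows "(f \<otimes>\<^sub>a ident (Dual C X)) \<cdot> \<rho> X = (ident Y \<otimes>\<^sub>a dual_arrow C X Y f) \<cdot> \<rho> Y"
proof -
  note [simp] = HomD[OF assms(2)] Dual_typing dual_arrow_typing[OF assms(2)]
  have "(f \<otimes>\<^sub>a ident \<I> \<otimes>\<^sub>a ident (Dual C X)) \<cdot> \<rho> X = (ident Y \<otimes>\<^sub>a ident \<I> \<otimes>\<^sub>a dual_arrow C X Y f) \<cdot> \<rho> Y"
    using assms HomD[OF assms(2)] by (simp add: dinatural_from_def del: TArr_ident)
  then show ?thesis by (simp add: typing strict)
qed

lemma coaction_action_typing:
  assumes "dinatural_from C \<I> W \<rho>" "X \<in> Obj C"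
  shows "coaction_action \<rho> X \<in> Arr C" "Dom C (coaction_action \<rho> X) = W \<otimes>\<^sub>o X"
    "Cod C (coaction_action \<rho> X) = X"
  using assms(2) dinatural_unitD[OF assms] Dual_typing[OF assms(2)]
  by (simp_all add: coaction_action_def typing strict)

text \<open>Dinaturality moves \<open>f\<close> to the dual factor, and the evaluation returns it to
  the argument. Transposition thus turns dinatural families into natural transformations.\<close>

lemma coaction_action_natural:
  assumes \<rho>: "dinatural_from C \<I> W \<rho>" and f: "f \<in> Hom C X Y"
  shows "f \<cdot> coaction_action \<rho> X = coaction_action \<rho> Y \<cdot> (ident W \<otimes>\<^sub>a f)"
proof -
  note F [simp] = HomD[OF f]
  note [simp] = Dual_typing dual_arrow_typing[OF f] dinatural_unitD[OF \<rho> F(4)] dinatural_unitD[OF \<rho> F(5)]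
  let ?g = "dual_arrow C X Y f"
  have "f \<cdot> coaction_action \<rho> X = (f \<cdot> (ident X \<otimes>\<^sub>a Ev C X)) \<cdot> (\<rho> X \<otimes>\<^sub>a ident X)"
    by (simp add: coaction_action_def comp_assoc typing strict)
  also have "f \<cdot> (ident X \<otimes>\<^sub>a Ev C X) = (ident Y \<otimes>\<^sub>a Ev C X) \<cdot> (f \<otimes>\<^sub>a ident (Dual C X \<otimes>\<^sub>o X))"
    by (simp add: absorb_right interchange comp_ident typing strict)
  also have "\<dots> \<cdot> (\<rho> X \<otimes>\<^sub>a ident X) = (ident Y \<otimes>\<^sub>a Ev C X) \<cdot> (((f \<otimes>\<^sub>a ident (Dual C X)) \<cdot> \<rho> X) \<otimes>\<^sub>a ident X)"
    by (subst whisker_right) (simp_all add: comp_assoc typing strict)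
  also have "\<dots> = (ident Y \<otimes>\<^sub>a Ev C X) \<cdot> (((ident Y \<otimes>\<^sub>a ?g) \<cdot> \<rho> Y) \<otimes>\<^sub>a ident X)"
    using dinatural_unit_natural[OF \<rho> f] by simp
  also have "\<dots> = ((ident Y \<otimes>\<^sub>a Ev C X) \<cdot> (ident Y \<otimes>\<^sub>a (?g \<otimes>\<^sub>a ident X))) \<cdot> (\<rho> Y \<otimes>\<^sub>a ident X)"
    by (subst whisker_right) (simp_all add: comp_assoc typing strict)
  also have "(ident Y \<otimes>\<^sub>a Ev C X) \<cdot> (ident Y \<otimes>\<^sub>a (?g \<otimes>\<^sub>a ident X)) = ident Y \<otimes>\<^sub>a (Ev C Y \<cdot> (ident (Dual C Y) \<otimes>\<^sub>a f))"
    using Ev_dual_arrow[OF f] by (simp add: interchange comp_ident typing strict)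
  also have "\<dots> = (ident Y \<otimes>\<^sub>a Ev C Y) \<cdot> (ident (Y \<otimes>\<^sub>o Dual C Y) \<otimes>\<^sub>a f)"
    by (subst whisker_left) (simp_all add: typing strict)
  also have "\<dots> \<cdot> (\<rho> Y \<otimes>\<^sub>a ident X) = coaction_action \<rho> Y \<cdot> (ident W \<otimes>\<^sub>a f)"
    by (simp add: coaction_action_def comp_assoc interchange comp_ident typing strict)
  finally show ?thesis .
qed

text \<open>Transposing back with the coevaluation inverts the passage to actions. It makes the
  universal property of the end applicable to natural transformations from W (x) X to X.\<close>

lemma natural_dinatural:
  assumes W: "W \<in> Obj C" and \<theta>: "\<And>X. X \<in> Obj C \<Longrightarrow> \<theta> X \<in> Hom C (W \<otimes>\<^sub>o X) X"
    and nat: "\<And>X Y f. f \<in> Hom C X Y \<Longrightarrow> f \<cdot> \<theta> X = \<theta> Y \<cdot> (ident W \<otimes>\<^sub>a f)"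
  defines "\<rho> X \<equiv> (\<theta> X \<otimes>\<^sub>a ident (Dual C X)) \<cdot> (ident W \<otimes>\<^sub>a Coev C X)"
  shows "dinatural_from C \<I> W \<rho>" "X \<in> Obj C \<Longrightarrow> coaction_action \<rho> X = \<theta> X"
proof -
  have \<theta>t [simp]: "\<theta> X \<in> Arr C" "Dom C (\<theta> X) = W \<otimes>\<^sub>o X" "Cod C (\<theta> X) = X" if "X \<in> Obj C" for X
    using \<theta>[OF that] by (auto simp: Hom_def)
  note [simp] = Dual_typing W
  have \<rho>t [simp]: "\<rho> X \<in> Arr C" "Dom C (\<rho> X) = W" "Cod C (\<rho> X) = X \<otimes>\<^sub>o Dual C X" if "X \<in> Obj C" for X
    using that by (simp_all add: \<rho>_def typing strict)
  have natural: "(f \<otimes>\<^sub>a ident (Dual C X)) \<cdot> \<rho> X = (ident Y \<otimes>\<^sub>a dual_arrow C X Y f) \<cdot> \<rho> Y"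
    if f: "f \<in> Hom C X Y" for f X Y
  proof -
    note [simp] = HomD[OF f] dual_arrow_typing[OF f]
    let ?g = "dual_arrow C X Y f"
    have "(f \<otimes>\<^sub>a ident (Dual C X)) \<cdot> \<rho> X = ((f \<cdot> \<theta> X) \<otimes>\<^sub>a ident (Dual C X)) \<cdot> (ident W \<otimes>\<^sub>a Coev C X)"
      by (subst whisker_right) (simp_all add: \<rho>_def comp_assoc typing strict)
    also have "\<dots> = ((\<theta> Y \<cdot> (ident W \<otimes>\<^sub>a f)) \<otimes>\<^sub>a ident (Dual C X)) \<cdot> (ident W \<otimes>\<^sub>a Coev C X)"
      using nat[OF f] by simp
    also have "\<dots> = (\<theta> Y \<otimes>\<^sub>a ident (Dual C X)) \<cdot> ((ident W \<otimes>\<^sub>a (f \<otimes>\<^sub>a ident (Dual C X))) \<cdot> (ident W \<otimes>\<^sub>a Coev C X))"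
      by (subst whisker_right) (simp_all add: comp_assoc typing strict)
    also have "(ident W \<otimes>\<^sub>a (f \<otimes>\<^sub>a ident (Dual C X))) \<cdot> (ident W \<otimes>\<^sub>a Coev C X) =
        ident W \<otimes>\<^sub>a ((ident Y \<otimes>\<^sub>a ?g) \<cdot> Coev C Y)"
      using dual_arrow_Coev[OF f] by (simp add: interchange comp_ident typing strict)
    also have "\<dots> = (ident (W \<otimes>\<^sub>o Y) \<otimes>\<^sub>a ?g) \<cdot> (ident W \<otimes>\<^sub>a Coev C Y)"
      by (subst whisker_left) (simp_all add: typing strict)
    also have "(\<theta> Y \<otimes>\<^sub>a ident (Dual C X)) \<cdot> \<dots> =
        ((\<theta> Y \<otimes>\<^sub>a ident (Dual C X)) \<cdot> (ident (W \<otimes>\<^sub>o Y) \<otimes>\<^sub>a ?g)) \<cdot> (ident W \<otimes>\<^sub>a Coev C Y)"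
      by (simp add: comp_assoc typing strict)
    also have "(\<theta> Y \<otimes>\<^sub>a ident (Dual C X)) \<cdot> (ident (W \<otimes>\<^sub>o Y) \<otimes>\<^sub>a ?g) =
        (ident Y \<otimes>\<^sub>a ?g) \<cdot> (\<theta> Y \<otimes>\<^sub>a ident (Dual C Y))"
      by (simp add: interchange comp_ident typing strict)
    also have "\<dots> \<cdot> (ident W \<otimes>\<^sub>a Coev C Y) = (ident Y \<otimes>\<^sub>a ?g) \<cdot> \<rho> Y"
      by (simp add: \<rho>_def comp_assoc typing strict)
    finally show ?thesis .
  qed
  show "dinatural_from C \<I> W \<rho>"
    unfolding dinatural_from_def
  proof (intro conjI ballI)
    fix X assume "X \<in> Obj C"
    then show "\<rho> X \<in> Hom C W (X \<otimes>\<^sub>o \<I> \<otimes>\<^sub>o Dual C X)" by (intro HomI) (simp_all add: typing strict)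
  next
    fix X Y f assume f: "f \<in> Hom C X Y"
    note [simp] = HomD[OF f] dual_arrow_typing[OF f]
    show "(f \<otimes>\<^sub>a ident \<I> \<otimes>\<^sub>a ident (Dual C X)) \<cdot> \<rho> X =
        (ident Y \<otimes>\<^sub>a ident \<I> \<otimes>\<^sub>a dual_arrow C X Y f) \<cdot> \<rho> Y"
      using natural[OF f] by (simp add: typing strict)
  qed (rule W)
  assume X [simp]: "X \<in> Obj C"
  have "\<rho> X \<otimes>\<^sub>a ident X = (\<theta> X \<otimes>\<^sub>a ident (Dual C X \<otimes>\<^sub>o X)) \<cdot> (ident W \<otimes>\<^sub>a (Coev C X \<otimes>\<^sub>a ident X))"
    unfolding \<rho>_def by (subst whisker_right) (simp_all add: typing strict)
  then have "coaction_action \<rho> X =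
      ((ident X \<otimes>\<^sub>a Ev C X) \<cdot> (\<theta> X \<otimes>\<^sub>a ident (Dual C X \<otimes>\<^sub>o X))) \<cdot> (ident W \<otimes>\<^sub>a (Coev C X \<otimes>\<^sub>a ident X))"
    by (simp add: coaction_action_def comp_assoc typing strict)
  also have "(ident X \<otimes>\<^sub>a Ev C X) \<cdot> (\<theta> X \<otimes>\<^sub>a ident (Dual C X \<otimes>\<^sub>o X)) = \<theta> X \<otimes>\<^sub>a Ev C X"
    by (simp add: interchange comp_ident typing strict)
  also have "\<dots> = \<theta> X \<cdot> (ident W \<otimes>\<^sub>a (ident X \<otimes>\<^sub>a Ev C X))"
    by (simp add: absorb_right typing strict)
  also have "\<dots> \<cdot> (ident W \<otimes>\<^sub>a (Coev C X \<otimes>\<^sub>a ident X)) =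
      \<theta> X \<cdot> (ident W \<otimes>\<^sub>a ((ident X \<otimes>\<^sub>a Ev C X) \<cdot> (Coev C X \<otimes>\<^sub>a ident X)))"
    by (subst whisker_left) (simp_all add: comp_assoc typing strict)
  also have "\<dots> = \<theta> X" by (simp add: zigzag comp_ident typing strict)
  finally show "coaction_action \<rho> X = \<theta> X" .
qed

lemma coaction_action_precomp:
  assumes \<rho>: "dinatural_from C \<I> W \<rho>" and h: "h \<in> Hom C W' W" and X: "X \<in> Obj C"
    and eq: "\<rho> X \<cdot> h = \<rho>' X"
  shows "coaction_action \<rho> X \<cdot> (h \<otimes>\<^sub>a ident X) = coaction_action \<rho>' X"
proof -
  note [simp] = X HomD[OF h] dinatural_unitD[OF \<rho> X] Dual_typing
  have "\<rho>' X \<otimes>\<^sub>a ident X = (\<rho> X \<otimes>\<^sub>a ident X) \<cdot> (h \<otimes>\<^sub>a ident X)"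
    unfolding eq[symmetric] by (rule whisker_right) simp_all
  then show ?thesis by (simp add: coaction_action_def comp_assoc typing strict)
qed

text \<open>The evaluation in the action on the unit object is the one by which
  \<open>comonad_counit\<close> identifies the dual of the unit object.\<close>

lemma coaction_action_unit:
  assumes "dinatural_from C \<I> W (\<pi> \<I>)"
  shows "coaction_action (\<pi> \<I>) \<I> = comonad_counit C \<pi> \<I>"
  using dinatural_unitD[OF assms Unit_Obj]
  by (simp add: coaction_action_def comonad_counit_def strict)

lemma comonad_counit_typing:
  assumes "dinatural_from C \<I> W (\<pi> \<I>)"
  shows "comonad_counit C \<pi> \<I> \<in> Arr C" "Dom C (comonad_counit C \<pi> \<I>) = W"
    "Cod C (comonad_counit C \<pi> \<I>) = \<I>"
  using coaction_action_typing[OF assms Unit_Obj] dinatural_unitD[OF assms Unit_Obj]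
  by (simp_all add: coaction_action_unit[where \<pi> = \<pi>, OF assms] strict)

text \<open>The universal property writes \<theta> as the canonical action precomposed with one
  arrow \<open>h\<close> into Z(1). At the unit object the action is the counit, so \<theta> is
  there the counit after \<open>h\<close>. By \<open>good\<close> the action on \<open>Y\<close> is
  the same counit tensored with \<open>Y\<close>.\<close>

lemma natural_at_counit_object:
  assumes Z: "central_comonad C Z \<pi>" and Y: "Y \<in> Obj C"
    and good: "coaction_action (\<pi> \<I>) Y = comonad_counit C \<pi> \<I> \<otimes>\<^sub>a ident Y"
    and W: "W \<in> Obj C" and \<theta>: "\<And>X. X \<in> Obj C \<Longrightarrow> \<theta> X \<in> Hom C (W \<otimes>\<^sub>o X) X"
    and nat: "\<And>X Y f. f \<in> Hom C X Y \<Longrightarrow> f \<cdot> \<theta> X = \<theta> Y \<cdot> (ident W \<otimes>\<^sub>a f)"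
  shows "\<theta> Y = \<theta> \<I> \<otimes>\<^sub>a ident Y"
proof -
  define \<rho> where "\<rho> X = (\<theta> X \<otimes>\<^sub>a ident (Dual C X)) \<cdot> (ident W \<otimes>\<^sub>a Coev C X)" for X
  have \<rho>: "dinatural_from C \<I> W \<rho>" "\<And>X. X \<in> Obj C \<Longrightarrow> coaction_action \<rho> X = \<theta> X"
    using natural_dinatural[OF W \<theta> nat] unfolding \<rho>_def by auto
  have \<pi>: "dinatural_from C \<I> (OMap Z \<I>) (\<pi> \<I>)"
    using Z Unit_Obj unfolding central_comonad_def by blast
  have "\<exists>!h. h \<in> Hom C W (OMap Z \<I>) \<and> (\<forall>X\<in>Obj C. \<pi> \<I> X \<cdot> h = \<rho> X)"
    using Z Unit_Obj \<rho>(1) unfolding central_comonad_def by blast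
  then obtain h where h: "h \<in> Hom C W (OMap Z \<I>)" "\<And>X. X \<in> Obj C \<Longrightarrow> \<pi> \<I> X \<cdot> h = \<rho> X"
    by blast
  note [simp] = Y HomD[OF h(1)] comonad_counit_typing[where \<pi> = \<pi>, OF \<pi>]
  have act: "\<theta> X = coaction_action (\<pi> \<I>) X \<cdot> (h \<otimes>\<^sub>a ident X)" if "X \<in> Obj C" for X
    using coaction_action_precomp[OF \<pi> h(1) that, of \<rho>] h(2)[OF that] \<rho>(2)[OF that] by simp
  have "\<theta> \<I> = comonad_counit C \<pi> \<I> \<cdot> h"
    using act[OF Unit_Obj] coaction_action_unit[where \<pi> = \<pi>, OF \<pi>] by (simp add: strict)
  moreover have "\<theta> Y = (comonad_counit C \<pi> \<I> \<cdot> h) \<otimes>\<^sub>a ident Y"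
    using act[OF Y] good by (simp add: whisker_right)
  ultimately show ?thesis by simp
qed

section \<open>The image of an integral\<close>

lemma dinaturalD:
  assumes "dinatural_from C V W \<rho>" "V \<in> Obj C" "X \<in> Obj C"
  shows "W \<in> Obj C" "\<rho> X \<in> Arr C" "Dom C (\<rho> X) = W" "Cod C (\<rho> X) = X \<otimes>\<^sub>o (V \<otimes>\<^sub>o Dual C X)"
  using assms by (auto simp: dinatural_from_def Hom_def strict Dual_typing)

text \<open>The multiplication of the comonad is the arrow that the universal property assigns to
  this family, once it is known to be dinatural. The arrow \<open>f\<close> enters at the left,
  crosses to the dual factor by dinaturality of \<rho>, goes round the evaluation, and leaves at the
  right by dinaturality of \<sigma>.\<close>

lemma dinatural_mult:
  assumes \<rho>: "dinatural_from C \<I> W \<rho>" and \<sigma>: "dinatural_from C V W' \<sigma>" and V [simp]: "V \<in> Obj C"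
  defines "\<tau> X \<equiv> (ident X \<otimes>\<^sub>a Ev C X \<otimes>\<^sub>a ident (V \<otimes>\<^sub>o Dual C X)) \<cdot> (\<rho> X \<otimes>\<^sub>a \<sigma> X)"
  shows "dinatural_from C V (W \<otimes>\<^sub>o W') \<tau>"
proof -
  note [simp] = Dual_typing
  have W [simp]: "W \<in> Obj C" "W' \<in> Obj C"
    using \<rho> \<sigma> by (auto simp: dinatural_from_def)
  have \<tau>t: "\<tau> X \<in> Arr C" "Dom C (\<tau> X) = W \<otimes>\<^sub>o W'" "Cod C (\<tau> X) = X \<otimes>\<^sub>o (V \<otimes>\<^sub>o Dual C X)" if X: "X \<in> Obj C" for X
    using X dinatural_unitD[OF \<rho> X] dinaturalD[OF \<sigma> V X] by (simp_all add: \<tau>_def typing strict)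
  have nat: "(f \<otimes>\<^sub>a ident (V \<otimes>\<^sub>o Dual C X)) \<cdot> \<tau> X = (ident (Y \<otimes>\<^sub>o V) \<otimes>\<^sub>a dual_arrow C X Y f) \<cdot> \<tau> Y"
    if f: "f \<in> Hom C X Y" for f X Y
  proof -
    note F [simp] = HomD[OF f]
    note [simp] = dual_arrow_typing[OF f] dinatural_unitD[OF \<rho> F(4)] dinatural_unitD[OF \<rho> F(5)]
      dinaturalD[OF \<sigma> V F(4)] dinaturalD[OF \<sigma> V F(5)]
    let ?g = "dual_arrow C X Y f" and ?X = "Dual C X" and ?Y = "Dual C Y"
    have \<sigma>n: "(f \<otimes>\<^sub>a ident (V \<otimes>\<^sub>o ?X)) \<cdot> \<sigma> X = (ident (Y \<otimes>\<^sub>o V) \<otimes>\<^sub>a ?g) \<cdot> \<sigma> Y"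
    proof -
      have "(f \<otimes>\<^sub>a ident V \<otimes>\<^sub>a ident ?X) \<cdot> \<sigma> X = (ident Y \<otimes>\<^sub>a ident V \<otimes>\<^sub>a ?g) \<cdot> \<sigma> Y"
        using \<sigma> f F by (simp add: dinatural_from_def del: TArr_ident)
      then show ?thesis by (simp add: typing strict)
    qed
    have "(f \<otimes>\<^sub>a ident (V \<otimes>\<^sub>o ?X)) \<cdot> \<tau> X =
        ((f \<otimes>\<^sub>a ident (V \<otimes>\<^sub>o ?X)) \<cdot> ((ident X \<otimes>\<^sub>a Ev C X) \<otimes>\<^sub>a ident (V \<otimes>\<^sub>o ?X))) \<cdot> (\<rho> X \<otimes>\<^sub>a \<sigma> X)"
      by (simp add: \<tau>_def comp_assoc typing strict)
    also have "(f \<otimes>\<^sub>a ident (V \<otimes>\<^sub>o ?X)) \<cdot> ((ident X \<otimes>\<^sub>a Ev C X) \<otimes>\<^sub>a ident (V \<otimes>\<^sub>o ?X)) =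
        (f \<otimes>\<^sub>a Ev C X) \<otimes>\<^sub>a ident (V \<otimes>\<^sub>o ?X)"
      using interchange[of "ident X \<otimes>\<^sub>a Ev C X" f "ident (V \<otimes>\<^sub>o ?X)" "ident (V \<otimes>\<^sub>o ?X)"]
      by (simp add: absorb_right comp_ident typing strict)
    also have "\<dots> = (ident Y \<otimes>\<^sub>a (Ev C X \<otimes>\<^sub>a ident (V \<otimes>\<^sub>o ?X))) \<cdot> ((f \<otimes>\<^sub>a ident ?X) \<otimes>\<^sub>a ident (X \<otimes>\<^sub>o (V \<otimes>\<^sub>o ?X)))"
      by (simp add: interchange comp_ident typing strict)
    also have "\<dots> \<cdot> (\<rho> X \<otimes>\<^sub>a \<sigma> X) =
        (ident Y \<otimes>\<^sub>a (Ev C X \<otimes>\<^sub>a ident (V \<otimes>\<^sub>o ?X))) \<cdot> (((f \<otimes>\<^sub>a ident ?X) \<cdot> \<rho> X) \<otimes>\<^sub>a \<sigma> X)"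
      using interchange[of "\<rho> X" "f \<otimes>\<^sub>a ident ?X" "\<sigma> X" "ident (X \<otimes>\<^sub>o (V \<otimes>\<^sub>o ?X))"]
      by (simp add: comp_ident comp_assoc typing strict)
    also have "\<dots> = (ident Y \<otimes>\<^sub>a (Ev C X \<otimes>\<^sub>a ident (V \<otimes>\<^sub>o ?X))) \<cdot> (((ident Y \<otimes>\<^sub>a ?g) \<cdot> \<rho> Y) \<otimes>\<^sub>a \<sigma> X)"
      using dinatural_unit_natural[OF \<rho> f] by simp
    also have "\<dots> = ((ident Y \<otimes>\<^sub>a (Ev C X \<otimes>\<^sub>a ident (V \<otimes>\<^sub>o ?X))) \<cdot> (ident Y \<otimes>\<^sub>a (?g \<otimes>\<^sub>a ident X) \<otimes>\<^sub>a ident (V \<otimes>\<^sub>o ?X)))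
        \<cdot> (\<rho> Y \<otimes>\<^sub>a \<sigma> X)"
      using interchange[of "\<rho> Y" "ident Y \<otimes>\<^sub>a ?g" "\<sigma> X" "ident (X \<otimes>\<^sub>o (V \<otimes>\<^sub>o ?X))"]
      by (simp add: comp_ident comp_assoc typing strict)
    also have "(ident Y \<otimes>\<^sub>a (Ev C X \<otimes>\<^sub>a ident (V \<otimes>\<^sub>o ?X))) \<cdot> (ident Y \<otimes>\<^sub>a (?g \<otimes>\<^sub>a ident X) \<otimes>\<^sub>a ident (V \<otimes>\<^sub>o ?X)) =
        ident Y \<otimes>\<^sub>a ((Ev C X \<cdot> (?g \<otimes>\<^sub>a ident X)) \<otimes>\<^sub>a ident (V \<otimes>\<^sub>o ?X))"
      using whisker_left[of "(?g \<otimes>\<^sub>a ident X) \<otimes>\<^sub>a ident (V \<otimes>\<^sub>o ?X)" "Ev C X \<otimes>\<^sub>a ident (V \<otimes>\<^sub>o ?X)" Y]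
        whisker_right[of "?g \<otimes>\<^sub>a ident X" "Ev C X" "V \<otimes>\<^sub>o ?X"]
      by (simp add: typing strict)
    also have "\<dots> = ident Y \<otimes>\<^sub>a ((Ev C Y \<cdot> (ident ?Y \<otimes>\<^sub>a f)) \<otimes>\<^sub>a ident (V \<otimes>\<^sub>o ?X))"
      using Ev_dual_arrow[OF f] by simp
    also have "\<dots> = (ident Y \<otimes>\<^sub>a (Ev C Y \<otimes>\<^sub>a ident (V \<otimes>\<^sub>o ?X))) \<cdot> (ident (Y \<otimes>\<^sub>o ?Y) \<otimes>\<^sub>a (f \<otimes>\<^sub>a ident (V \<otimes>\<^sub>o ?X)))"
      using whisker_left[of "(ident ?Y \<otimes>\<^sub>a f) \<otimes>\<^sub>a ident (V \<otimes>\<^sub>o ?X)" "Ev C Y \<otimes>\<^sub>a ident (V \<otimes>\<^sub>o ?X)" Y]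
        whisker_right[of "ident ?Y \<otimes>\<^sub>a f" "Ev C Y" "V \<otimes>\<^sub>o ?X"]
      by (simp add: typing strict)
    also have "\<dots> \<cdot> (\<rho> Y \<otimes>\<^sub>a \<sigma> X) =
        (ident Y \<otimes>\<^sub>a (Ev C Y \<otimes>\<^sub>a ident (V \<otimes>\<^sub>o ?X))) \<cdot> (\<rho> Y \<otimes>\<^sub>a ((f \<otimes>\<^sub>a ident (V \<otimes>\<^sub>o ?X)) \<cdot> \<sigma> X))"
      using interchange[of "\<rho> Y" "ident (Y \<otimes>\<^sub>o ?Y)" "\<sigma> X" "f \<otimes>\<^sub>a ident (V \<otimes>\<^sub>o ?X)"]
      by (simp add: comp_ident comp_assoc typing strict)
    also have "\<dots> = (ident Y \<otimes>\<^sub>a (Ev C Y \<otimes>\<^sub>a ident (V \<otimes>\<^sub>o ?X))) \<cdot> (\<rho> Y \<otimes>\<^sub>a ((ident (Y \<otimes>\<^sub>o V) \<otimes>\<^sub>a ?g) \<cdot> \<sigma> Y))"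
      using \<sigma>n by simp
    also have "\<dots> = ((ident Y \<otimes>\<^sub>a (Ev C Y \<otimes>\<^sub>a ident (V \<otimes>\<^sub>o ?X))) \<cdot> (ident (Y \<otimes>\<^sub>o ?Y \<otimes>\<^sub>o Y \<otimes>\<^sub>o V) \<otimes>\<^sub>a ?g)) \<cdot> (\<rho> Y \<otimes>\<^sub>a \<sigma> Y)"
      using interchange[of "\<rho> Y" "ident (Y \<otimes>\<^sub>o ?Y)" "\<sigma> Y" "ident (Y \<otimes>\<^sub>o V) \<otimes>\<^sub>a ?g"]
      by (simp add: comp_ident comp_assoc typing strict)
    also have "(ident Y \<otimes>\<^sub>a (Ev C Y \<otimes>\<^sub>a ident (V \<otimes>\<^sub>o ?X))) \<cdot> (ident (Y \<otimes>\<^sub>o ?Y \<otimes>\<^sub>o Y \<otimes>\<^sub>o V) \<otimes>\<^sub>a ?g) =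
        (ident (Y \<otimes>\<^sub>o V) \<otimes>\<^sub>a ?g) \<cdot> (ident Y \<otimes>\<^sub>a (Ev C Y \<otimes>\<^sub>a ident (V \<otimes>\<^sub>o ?Y)))"
    proof -
      let ?e = "ident Y \<otimes>\<^sub>a (Ev C Y \<otimes>\<^sub>a ident V)"
      have "(?e \<otimes>\<^sub>a ident ?X) \<cdot> (ident (Y \<otimes>\<^sub>o ?Y \<otimes>\<^sub>o Y \<otimes>\<^sub>o V) \<otimes>\<^sub>a ?g) = ?e \<otimes>\<^sub>a ?g"
        "(ident (Y \<otimes>\<^sub>o V) \<otimes>\<^sub>a ?g) \<cdot> (?e \<otimes>\<^sub>a ident ?Y) = ?e \<otimes>\<^sub>a ?g"
        by (subst interchange; simp add: comp_ident typing strict)+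
      then show ?thesis by (simp add: typing strict)
    qed
    also have "\<dots> \<cdot> (\<rho> Y \<otimes>\<^sub>a \<sigma> Y) = (ident (Y \<otimes>\<^sub>o V) \<otimes>\<^sub>a ?g) \<cdot> \<tau> Y"
      by (simp add: \<tau>_def comp_assoc typing strict)
    finally show ?thesis .
  qed
  show ?thesis
    unfolding dinatural_from_def
  proof (intro conjI ballI)
    fix X assume X: "X \<in> Obj C"
    then show "\<tau> X \<in> Hom C (W \<otimes>\<^sub>o W') (X \<otimes>\<^sub>o V \<otimes>\<^sub>o Dual C X)"
      using \<tau>t[OF X] by (intro HomI) (simp_all add: typing strict)
  next
    fix X Y f assume f: "f \<in> Hom C X Y"
    note [simp] = HomD[OF f] dual_arrow_typing[OF f]
    show "(f \<otimes>\<^sub>a ident V \<otimes>\<^sub>a ident (Dual C X)) \<cdot> \<tau> X =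
        (ident Y \<otimes>\<^sub>a ident V \<otimes>\<^sub>a dual_arrow C X Y f) \<cdot> \<tau> Y"
      using nat[OF f] by (simp add: typing strict)
  qed (simp add: typing)
qed

end

section \<open>The integral condition as a relation for the action of Z(1)\<close>

context finite_tensor_category
begin

lemma central_comonad_dinatural:
  assumes "central_comonad C Z \<pi>" "V \<in> Obj C"
  shows "dinatural_from C V (OMap Z V) (\<pi> V)"
  using assms unfolding central_comonad_def by blast

text \<open>Dinaturality gives a unique mediating arrow, so the definite description in
  \<open>comonad_mult\<close> has its defining property; strictness absorbs the identity of the unit
  object.\<close>

lemma comonad_mult_unit:
  assumes Z: "central_comonad C Z \<pi>" and V [simp]: "V \<in> Obj C"
  shows "comonad_mult C Z \<pi> \<I> V \<in> Hom C (OMap Z \<I> \<otimes>\<^sub>o OMap Z V) (OMap Z V) \<and>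
    (\<forall>X\<in>Obj C. \<pi> V X \<cdot> comonad_mult C Z \<pi> \<I> V =
       (ident X \<otimes>\<^sub>a Ev C X \<otimes>\<^sub>a ident (V \<otimes>\<^sub>o Dual C X)) \<cdot> (\<pi> \<I> X \<otimes>\<^sub>a \<pi> V X))"
proof -
  define \<tau> where "\<tau> X = (ident X \<otimes>\<^sub>a Ev C X \<otimes>\<^sub>a ident (V \<otimes>\<^sub>o Dual C X)) \<cdot> (\<pi> \<I> X \<otimes>\<^sub>a \<pi> V X)" for X
  have "dinatural_from C V (OMap Z \<I> \<otimes>\<^sub>o OMap Z V) \<tau>"
    unfolding \<tau>_def
    by (rule dinatural_mult[OF central_comonad_dinatural[OF Z Unit_Obj] central_comonad_dinatural[OF Z V] V])
  then have ex: "\<exists>!m. m \<in> Hom C (OMap Z \<I> \<otimes>\<^sub>o OMap Z V) (OMap Z V) \<and> (\<forall>X\<in>Obj C. \<pi> V X \<cdot> m = \<tau> X)"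
    using Z V unfolding central_comonad_def by blast
  have \<tau>: "(ident X \<otimes>\<^sub>a ident \<I> \<otimes>\<^sub>a Ev C X \<otimes>\<^sub>a ident V \<otimes>\<^sub>a ident (Dual C X)) \<cdot> (\<pi> \<I> X \<otimes>\<^sub>a \<pi> V X) = \<tau> X"
    if "X \<in> Obj C" for X
    using that by (simp add: \<tau>_def Dual_typing typing strict)
  have "comonad_mult C Z \<pi> \<I> V =
      (THE m. m \<in> Hom C (OMap Z \<I> \<otimes>\<^sub>o OMap Z V) (OMap Z V) \<and> (\<forall>X\<in>Obj C. \<pi> V X \<cdot> m = \<tau> X))"
    unfolding comonad_mult_def using \<tau> by (simp add: TObj_Unit cong: conj_cong)
  with theI'[OF ex] show ?thesis by (simp add: \<tau>_def)
qed

text \<open>Compose the integral condition with the universal arrow at \<open>X\<close> and bend the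
  last dual factor back by an evaluation. The multiplication then becomes the action of Z(1) on the
  left factor of X (x) \<alpha>, and the condition says that it acts on the output of the integral
  by the counit.\<close>

lemma integral_relation:
  assumes Z: "central_comonad C Z \<pi>" and \<alpha> [simp]: "\<alpha> \<in> Obj C"
    and \<Lambda>: "left_integral C Z \<pi> \<alpha> \<Lambda>" and X [simp]: "X \<in> Obj C"
  shows "(coaction_action (\<pi> \<I>) X \<otimes>\<^sub>a ident \<alpha>) \<cdot> (ident (OMap Z \<I>) \<otimes>\<^sub>a integral_action C \<pi> \<alpha> \<Lambda> X) =
    comonad_counit C \<pi> \<I> \<otimes>\<^sub>a integral_action C \<pi> \<alpha> \<Lambda> X"
    and "integral_action C \<pi> \<alpha> \<Lambda> X \<in> Hom C X (X \<otimes>\<^sub>o \<alpha>)"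
proof -
  note d1 = central_comonad_dinatural[OF Z Unit_Obj] and d\<alpha> = central_comonad_dinatural[OF Z \<alpha>]
  note [simp] = Dual_typing dinatural_unitD[OF d1 X] dinaturalD[OF d\<alpha> \<alpha> X]
    comonad_counit_typing[where \<pi> = \<pi>, OF d1]
  let ?Z = "OMap Z \<I>" and ?X = "Dual C X" and ?\<epsilon> = "comonad_counit C \<pi> \<I>"
  have \<Lambda>H: "\<Lambda> \<in> Hom C \<I> (OMap Z \<alpha>)"
    and \<Lambda>int: "comonad_mult C Z \<pi> \<I> \<alpha> \<cdot> (ident ?Z \<otimes>\<^sub>a \<Lambda>) = ?\<epsilon> \<otimes>\<^sub>a \<Lambda>"
    using \<Lambda> by (auto simp: left_integral_def)
  note [simp] = HomD(1-3)[OF \<Lambda>H]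
  let ?m = "comonad_mult C Z \<pi> \<I> \<alpha>"
  have m: "?m \<in> Hom C (?Z \<otimes>\<^sub>o OMap Z \<alpha>) (OMap Z \<alpha>)"
    "\<pi> \<alpha> X \<cdot> ?m = (ident X \<otimes>\<^sub>a Ev C X \<otimes>\<^sub>a ident (\<alpha> \<otimes>\<^sub>o ?X)) \<cdot> (\<pi> \<I> X \<otimes>\<^sub>a \<pi> \<alpha> X)"
    using comonad_mult_unit[OF Z \<alpha>] X by blast+
  note [simp] = HomD(1-3)[OF m(1)]
  \<comment> \<open>The integral as seen at \<open>X\<close>; \<open>rel\<close> below is the
    integral condition in this component.\<close>
  define l where "l = \<pi> \<alpha> X \<cdot> \<Lambda>"
  have l [simp]: "l \<in> Arr C" "Dom C l = \<I>" "Cod C l = X \<otimes>\<^sub>o (\<alpha> \<otimes>\<^sub>o ?X)"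
    by (simp_all add: l_def typing)
  have "(ident X \<otimes>\<^sub>a Ev C X \<otimes>\<^sub>a ident (\<alpha> \<otimes>\<^sub>o ?X)) \<cdot> (\<pi> \<I> X \<otimes>\<^sub>a l) =
      ((ident X \<otimes>\<^sub>a Ev C X \<otimes>\<^sub>a ident (\<alpha> \<otimes>\<^sub>o ?X)) \<cdot> (\<pi> \<I> X \<otimes>\<^sub>a \<pi> \<alpha> X)) \<cdot> (ident ?Z \<otimes>\<^sub>a \<Lambda>)"
    using interchange[of "ident ?Z" "\<pi> \<I> X" \<Lambda> "\<pi> \<alpha> X"]
    by (simp add: l_def comp_assoc comp_ident typing strict)
  also have "\<dots> = \<pi> \<alpha> X \<cdot> (?\<epsilon> \<otimes>\<^sub>a \<Lambda>)"
    unfolding m(2)[symmetric] \<Lambda>int[symmetric] by (rule comp_assoc) (simp_all add: typing strict)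
  also have "\<dots> = ?\<epsilon> \<otimes>\<^sub>a l"
    using interchange[of ?\<epsilon> "ident \<I>" \<Lambda> "\<pi> \<alpha> X"] by (simp add: l_def comp_ident typing strict)
  finally have rel: "(ident X \<otimes>\<^sub>a Ev C X \<otimes>\<^sub>a ident (\<alpha> \<otimes>\<^sub>o ?X)) \<cdot> (\<pi> \<I> X \<otimes>\<^sub>a l) = ?\<epsilon> \<otimes>\<^sub>a l" .
  let ?L = "integral_action C \<pi> \<alpha> \<Lambda> X"
  have L_eq: "?L = (ident (X \<otimes>\<^sub>o \<alpha>) \<otimes>\<^sub>a Ev C X) \<cdot> (l \<otimes>\<^sub>a ident X)"
    using whisker_right[of \<Lambda> "\<pi> \<alpha> X" X]
    by (simp add: integral_action_def l_def comp_assoc typing strict)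
  then have L [simp]: "?L \<in> Arr C" "Dom C ?L = X" "Cod C ?L = X \<otimes>\<^sub>o \<alpha>"
    by (simp_all add: typing strict)
  then show "?L \<in> Hom C X (X \<otimes>\<^sub>o \<alpha>)" by (rule HomI)
  let ?e = "ident X \<otimes>\<^sub>a (Ev C X \<otimes>\<^sub>a ident \<alpha>)"
  have "coaction_action (\<pi> \<I>) X \<otimes>\<^sub>a ident \<alpha> = ?e \<cdot> (\<pi> \<I> X \<otimes>\<^sub>a ident (X \<otimes>\<^sub>o \<alpha>))"
    unfolding coaction_action_def by (subst whisker_right) (simp_all add: typing strict)
  then have "(coaction_action (\<pi> \<I>) X \<otimes>\<^sub>a ident \<alpha>) \<cdot> (ident ?Z \<otimes>\<^sub>a ?L) = ?e \<cdot> (\<pi> \<I> X \<otimes>\<^sub>a ?L)"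
    using interchange[of "ident ?Z" "\<pi> \<I> X" ?L "ident (X \<otimes>\<^sub>o \<alpha>)"]
    by (simp add: comp_assoc comp_ident typing strict)
  also have "\<pi> \<I> X \<otimes>\<^sub>a ?L = (ident (X \<otimes>\<^sub>o ?X \<otimes>\<^sub>o X \<otimes>\<^sub>o \<alpha>) \<otimes>\<^sub>a Ev C X) \<cdot> (\<pi> \<I> X \<otimes>\<^sub>a (l \<otimes>\<^sub>a ident X))"
    using interchange[of "\<pi> \<I> X" "ident (X \<otimes>\<^sub>o ?X)" "l \<otimes>\<^sub>a ident X" "ident (X \<otimes>\<^sub>o \<alpha>) \<otimes>\<^sub>a Ev C X"]
    by (simp add: L_eq comp_ident typing strict)
  also have "?e \<cdot> \<dots> = (?e \<cdot> (ident (X \<otimes>\<^sub>o ?X \<otimes>\<^sub>o X \<otimes>\<^sub>o \<alpha>) \<otimes>\<^sub>a Ev C X)) \<cdot> (\<pi> \<I> X \<otimes>\<^sub>a (l \<otimes>\<^sub>a ident X))"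
    by (simp add: comp_assoc typing strict)
  also have "?e \<cdot> (ident (X \<otimes>\<^sub>o ?X \<otimes>\<^sub>o X \<otimes>\<^sub>o \<alpha>) \<otimes>\<^sub>a Ev C X) = ?e \<otimes>\<^sub>a Ev C X"
    by (rule absorb_right) (simp_all add: typing strict)
  also have "\<dots> = (ident (X \<otimes>\<^sub>o \<alpha>) \<otimes>\<^sub>a Ev C X) \<cdot> (?e \<otimes>\<^sub>a ident (?X \<otimes>\<^sub>o X))"
    using interchange[of ?e "ident (X \<otimes>\<^sub>o \<alpha>)" "ident (?X \<otimes>\<^sub>o X)" "Ev C X"]
    by (simp add: comp_ident typing strict)
  also have "\<dots> \<cdot> (\<pi> \<I> X \<otimes>\<^sub>a (l \<otimes>\<^sub>a ident X)) =
      (ident (X \<otimes>\<^sub>o \<alpha>) \<otimes>\<^sub>a Ev C X) \<cdot> (((ident X \<otimes>\<^sub>a Ev C X \<otimes>\<^sub>a ident (\<alpha> \<otimes>\<^sub>o ?X)) \<cdot> (\<pi> \<I> X \<otimes>\<^sub>a l)) \<otimes>\<^sub>a ident X)"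
    by (subst whisker_right) (simp_all add: comp_assoc typing strict)
  also have "\<dots> = (ident (X \<otimes>\<^sub>o \<alpha>) \<otimes>\<^sub>a Ev C X) \<cdot> (?\<epsilon> \<otimes>\<^sub>a (l \<otimes>\<^sub>a ident X))"
    unfolding rel by (simp add: typing strict)
  also have "\<dots> = ?\<epsilon> \<otimes>\<^sub>a ?L"
    using interchange[of ?\<epsilon> "ident \<I>" "l \<otimes>\<^sub>a ident X" "ident (X \<otimes>\<^sub>o \<alpha>) \<otimes>\<^sub>a Ev C X"]
    by (simp add: L_eq comp_ident typing strict)
  finally show "(coaction_action (\<pi> \<I>) X \<otimes>\<^sub>a ident \<alpha>) \<cdot> (ident ?Z \<otimes>\<^sub>a ?L) = ?\<epsilon> \<otimes>\<^sub>a ?L" .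
qed

text \<open>The action touches only the factor \<open>X\<close>, so the arrow \<open>c\<close> that
  cancels \<alpha> against its dual passes through it, and the relation for the integral
  survives.\<close>

lemma integral_projection_relation:
  assumes Z: "central_comonad C Z \<pi>" and \<alpha> [simp]: "\<alpha> \<in> Obj C"
    and \<Lambda>: "left_integral C Z \<pi> \<alpha> \<Lambda>" and X [simp]: "X \<in> Obj C"
    and c: "c \<in> Hom C (\<alpha> \<otimes>\<^sub>o Dual C \<alpha>) \<I>"
  defines "f \<equiv> (ident X \<otimes>\<^sub>a c) \<cdot> (integral_action C \<pi> \<alpha> \<Lambda> X \<otimes>\<^sub>a ident (Dual C \<alpha>))"
  shows "f \<in> Hom C (X \<otimes>\<^sub>o Dual C \<alpha>) X"
    and "coaction_action (\<pi> \<I>) X \<cdot> (ident (OMap Z \<I>) \<otimes>\<^sub>a f) = comonad_counit C \<pi> \<I> \<otimes>\<^sub>a f"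
proof -
  note d1 = central_comonad_dinatural[OF Z Unit_Obj]
  note L = integral_relation[OF Z \<alpha> \<Lambda> X]
  note [simp] = Dual_typing dinatural_unitD[OF d1 X] HomD(1-3)[OF L(2)] HomD(1-3)[OF c]
    comonad_counit_typing[where \<pi> = \<pi>, OF d1] coaction_action_typing[OF d1 X]
  let ?Z = "OMap Z \<I>" and ?\<epsilon> = "comonad_counit C \<pi> \<I>" and ?L = "integral_action C \<pi> \<alpha> \<Lambda> X"
    and ?T = "coaction_action (\<pi> \<I>) X" and ?a = "Dual C \<alpha>"
  show "f \<in> Hom C (X \<otimes>\<^sub>o ?a) X"
    unfolding f_def by (rule HomI) (simp_all add: typing strict)
  have "ident ?Z \<otimes>\<^sub>a f = (ident (?Z \<otimes>\<^sub>o X) \<otimes>\<^sub>a c) \<cdot> (ident ?Z \<otimes>\<^sub>a (?L \<otimes>\<^sub>a ident ?a))"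
    unfolding f_def by (subst whisker_left) (simp_all add: typing strict)
  then have "?T \<cdot> (ident ?Z \<otimes>\<^sub>a f) = (?T \<cdot> (ident (?Z \<otimes>\<^sub>o X) \<otimes>\<^sub>a c)) \<cdot> (ident ?Z \<otimes>\<^sub>a (?L \<otimes>\<^sub>a ident ?a))"
    by (simp add: comp_assoc typing strict)
  also have "?T \<cdot> (ident (?Z \<otimes>\<^sub>o X) \<otimes>\<^sub>a c) = (ident X \<otimes>\<^sub>a c) \<cdot> (?T \<otimes>\<^sub>a ident (\<alpha> \<otimes>\<^sub>o ?a))"
    by (simp add: absorb_right interchange comp_ident typing strict)
  also have "\<dots> \<cdot> (ident ?Z \<otimes>\<^sub>a (?L \<otimes>\<^sub>a ident ?a)) =
      (ident X \<otimes>\<^sub>a c) \<cdot> (((?T \<otimes>\<^sub>a ident \<alpha>) \<cdot> (ident ?Z \<otimes>\<^sub>a ?L)) \<otimes>\<^sub>a ident ?a)"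
    by (subst whisker_right) (simp_all add: comp_assoc typing strict)
  also have "\<dots> = (ident X \<otimes>\<^sub>a c) \<cdot> (?\<epsilon> \<otimes>\<^sub>a (?L \<otimes>\<^sub>a ident ?a))"
    unfolding L(1) by (simp add: typing strict)
  also have "\<dots> = ?\<epsilon> \<otimes>\<^sub>a f"
    using interchange[of ?\<epsilon> "ident \<I>" "?L \<otimes>\<^sub>a ident ?a" "ident X \<otimes>\<^sub>a c"]
    by (simp add: f_def comp_ident typing strict)
  finally show "?T \<cdot> (ident ?Z \<otimes>\<^sub>a f) = ?\<epsilon> \<otimes>\<^sub>a f" .
qed

end

section \<open>From an arrow to its image\<close>

context strict_monoidal_category
begin

lemma transpose_natural:
  assumes d: "is_left_dual C Y W e c" and h: "h \<in> Hom C U X" and f: "f \<in> Hom C (W \<otimes>\<^sub>o X) X'"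
  shows "((ident Y \<otimes>\<^sub>a f) \<cdot> (c \<otimes>\<^sub>a ident X)) \<cdot> h = (ident Y \<otimes>\<^sub>a (f \<cdot> (ident W \<otimes>\<^sub>a h))) \<cdot> (c \<otimes>\<^sub>a ident U)"
proof -
  note [simp] = left_dualD(1-8)[OF d] HomD[OF h] HomD(1-3)[OF f]
  have "((ident Y \<otimes>\<^sub>a f) \<cdot> (c \<otimes>\<^sub>a ident X)) \<cdot> h = (ident Y \<otimes>\<^sub>a f) \<cdot> (c \<otimes>\<^sub>a h)"
    using interchange[of "ident \<I>" c h "ident X"] by (simp add: comp_assoc comp_ident typing strict)
  also have "c \<otimes>\<^sub>a h = (ident (Y \<otimes>\<^sub>o W) \<otimes>\<^sub>a h) \<cdot> (c \<otimes>\<^sub>a ident U)"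
    by (simp add: interchange comp_ident typing strict)
  also have "(ident Y \<otimes>\<^sub>a f) \<cdot> \<dots> = (ident Y \<otimes>\<^sub>a (f \<cdot> (ident W \<otimes>\<^sub>a h))) \<cdot> (c \<otimes>\<^sub>a ident U)"
    by (subst whisker_left) (simp_all add: comp_assoc typing strict)
  finally show ?thesis .
qed

end

locale concrete_tensor_category = finite_tensor_category K C + simple_in_concrete K C A V ap "\<I>\<^bsub>C\<^esub>"
  for K :: "('k, 'x) ring_scheme" and C :: "('k, 'o, 'm, 'z) tcat_scheme" (structure)
    and A :: "('k, nat \<Rightarrow> 'k) module" and V :: "'o \<Rightarrow> (nat \<Rightarrow> 'k, nat \<Rightarrow> 'k) module"
    and ap :: "'m \<Rightarrow> (nat \<Rightarrow> 'k) \<Rightarrow> nat \<Rightarrow> 'k"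
begin

text \<open>Action and counit agree after \<open>f\<close>, but as arrows on Z(1) (x) X they have an
  equalizer that is not a subobject of \<open>X\<close>. Transposition along an object
  \<open>Y\<close> with left dual Z(1) moves Z(1) to the target. The equalizer of the transposes is
  a subobject of \<open>X\<close> through which \<open>f\<close> factors, so the image, the least
  such subobject, lies in it.\<close>

lemma counit_on_image:
  assumes Z: "central_comonad C Z \<pi>" and X [simp]: "X \<in> Obj C"
    and img: "is_image C D X f J i"
    and rel: "coaction_action (\<pi> \<I>) X \<cdot> (ident (OMap Z \<I>) \<otimes>\<^sub>a f) = comonad_counit C \<pi> \<I> \<otimes>\<^sub>a f"
  shows "coaction_action (\<pi> \<I>) J = comonad_counit C \<pi> \<I> \<otimes>\<^sub>a ident J"
proof -
  note d1 = central_comonad_dinatural[OF Z Unit_Obj]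
  note [simp] = dinatural_unitD[OF d1 X] comonad_counit_typing[where \<pi> = \<pi>, OF d1]
  let ?Z = "OMap Z \<I>" and ?\<epsilon> = "comonad_counit C \<pi> \<I>"
  let ?T = "coaction_action (\<pi> \<I>) X" and ?S = "?\<epsilon> \<otimes>\<^sub>a ident X"
  have f: "f \<in> Hom C D X" and J [simp]: "J \<in> Obj C" and i: "mono_arrow C J X i"
    and ex: "\<exists>e\<in>Hom C D J. f = i \<cdot> e"
    and least: "\<And>J' i'. \<lbrakk>J' \<in> Obj C; mono_arrow C J' X i'; \<exists>e\<in>Hom C D J'. f = i' \<cdot> e\<rbrakk>
      \<Longrightarrow> \<exists>u\<in>Hom C J J'. i = i' \<cdot> u"
    using img unfolding is_image_def by blast+
  have iH: "i \<in> Hom C J X" using i by (simp add: mono_arrow_def)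
  note [simp] = HomD[OF f] HomD(1-3)[OF iH]
  obtain Y e c where d: "is_left_dual C Y ?Z e c"
    using right_dual[OF dinatural_unitD(1)[OF d1 X]] by blast
  note [simp] = left_dualD(1-8)[OF d] coaction_action_typing[OF d1 X] coaction_action_typing[OF d1 J]
  have T: "?T \<in> Hom C (?Z \<otimes>\<^sub>o X) X" and S: "?S \<in> Hom C (?Z \<otimes>\<^sub>o X) X"
    by (rule HomI; simp add: typing strict)+
  let ?t = "\<lambda>h. (ident Y \<otimes>\<^sub>a h) \<cdot> (c \<otimes>\<^sub>a ident X)"
  have tH: "?t h \<in> Hom C X (Y \<otimes>\<^sub>o X)" if "h \<in> Hom C (?Z \<otimes>\<^sub>o X) X" for h
    using HomD[OF that] by (intro HomI) (simp_all add: typing strict)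
  have S_comp: "?S \<cdot> (ident ?Z \<otimes>\<^sub>a h) = ?\<epsilon> \<otimes>\<^sub>a h" if "h \<in> Hom C U X" for h U
    using HomD[OF that] by (simp add: interchange comp_ident typing strict)
  obtain U k where U: "U \<in> Obj C" "mono_arrow C U X k" "?t ?T \<cdot> k = ?t ?S \<cdot> k"
    "\<And>W h. h \<in> Hom C W X \<Longrightarrow> ?t ?T \<cdot> h = ?t ?S \<cdot> h \<Longrightarrow> \<exists>u\<in>Hom C W U. h = k \<cdot> u"
    by (rule equalizer_exists[OF tH[OF T] tH[OF S]], rule that)
  have "?t ?T \<cdot> f = ?t ?S \<cdot> f"
    using transpose_natural[OF d f T] transpose_natural[OF d f S] rel S_comp[OF f] by simp
  from least[OF U(1,2) U(4)[OF f this]] obtain u where u: "u \<in> Hom C J U" "i = k \<cdot> u" by blast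
  have kH: "k \<in> Hom C U X" using U(2) by (simp add: mono_arrow_def)
  have "?t ?T \<cdot> i = ?t ?S \<cdot> i"
    unfolding u(2) using U(3) Comp_assoc[OF u(1) kH tH[OF T]] Comp_assoc[OF u(1) kH tH[OF S]] by simp
  then have "(ident Y \<otimes>\<^sub>a (?T \<cdot> (ident ?Z \<otimes>\<^sub>a i))) \<cdot> (c \<otimes>\<^sub>a ident J) =
      (ident Y \<otimes>\<^sub>a (?S \<cdot> (ident ?Z \<otimes>\<^sub>a i))) \<cdot> (c \<otimes>\<^sub>a ident J)"
    using transpose_natural[OF d iH T] transpose_natural[OF d iH S] by simp
  then have "?T \<cdot> (ident ?Z \<otimes>\<^sub>a i) = ?S \<cdot> (ident ?Z \<otimes>\<^sub>a i)"
    by (rule transpose_inj[OF d J X, rotated 2]; intro HomI; simp add: typing strict)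
  also have "\<dots> = ?\<epsilon> \<otimes>\<^sub>a i" by (rule S_comp[OF iH])
  also have "\<dots> = i \<cdot> (?\<epsilon> \<otimes>\<^sub>a ident J)" by (simp add: absorb_left)
  \<comment> \<open>Naturality carries the action from \<open>X\<close> to \<open>J\<close>, where
    the monomorphism \<open>i\<close> can be cancelled.\<close>
  finally have "i \<cdot> coaction_action (\<pi> \<I>) J = i \<cdot> (?\<epsilon> \<otimes>\<^sub>a ident J)"
    using coaction_action_natural[OF d1 iH] by simp
  moreover have "coaction_action (\<pi> \<I>) J \<in> Hom C (?Z \<otimes>\<^sub>o J) J" "?\<epsilon> \<otimes>\<^sub>a ident J \<in> Hom C (?Z \<otimes>\<^sub>o J) J"
    by (rule HomI; simp add: typing strict)+
  moreover have "?Z \<otimes>\<^sub>o J \<in> Obj C" by (simp add: typing)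
  ultimately show ?thesis using i unfolding mono_arrow_def by blast
qed

end

section \<open>Sums of arrows\<close>

context linear_category
begin

lemma hom_space_simps [simp]:
  "carrier (hom_space C X Y) = Hom C X Y" "zero (hom_space C X Y) = Zer C X Y"
  "add (hom_space C X Y) = Add C" "smult (hom_space C X Y) = Scal C"
  by (simp_all add: hom_space_def)

lemma hom_space_abelian_group: "\<lbrakk>X \<in> Obj C; Y \<in> Obj C\<rbrakk> \<Longrightarrow> abelian_group (hom_space C X Y)"
  using hom_space by (rule module.axioms(2))

lemma hom_space_lin_space: "\<lbrakk>X \<in> Obj C; Y \<in> Obj C\<rbrakk> \<Longrightarrow> lin_space K (hom_space C X Y)"
  using hom_space K.field_axioms by (simp add: lin_space_def)

lemma finsum_Hom:
  "\<lbrakk>X \<in> Obj C; Y \<in> Obj C; f \<in> B \<rightarrow> Hom C X Y\<rbrakk> \<Longrightarrow> finsum (hom_space C X Y) f B \<in> Hom C X Y"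
  using abelian_monoid.finsum_closed[OF abelian_group.axioms(1)[OF hom_space_abelian_group], of X Y f B]
  by simp

lemma additive_arrows:
  assumes "X \<in> Obj C" "Y \<in> Obj C" "X' \<in> Obj C" "Y' \<in> Obj C"
    and "\<And>f. f \<in> Hom C X Y \<Longrightarrow> h f \<in> Hom C X' Y'"
    and "\<And>f g. \<lbrakk>f \<in> Hom C X Y; g \<in> Hom C X Y\<rbrakk> \<Longrightarrow> h (Add C f g) = Add C (h f) (h g)"
  shows "h (Zer C X Y) = Zer C X' Y'"
    and "f \<in> B \<rightarrow> Hom C X Y \<Longrightarrow> h (finsum (hom_space C X Y) f B) = finsum (hom_space C X' Y') (\<lambda>b. h (f b)) B"
proof -
  note g = hom_space_abelian_group[OF assms(1,2)] hom_space_abelian_group[OF assms(3,4)]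
  show 0: "h (Zer C X Y) = Zer C X' Y'"
    using additive_zero[OF g, of h] assms(5,6) by simp
  assume "f \<in> B \<rightarrow> Hom C X Y"
  then show "h (finsum (hom_space C X Y) f B) = finsum (hom_space C X' Y') (\<lambda>b. h (f b)) B"
    using finsum_additive[OF abelian_group.axioms(1)[OF g(1)] abelian_group.axioms(1)[OF g(2)], of f B h]
      assms(5,6) 0 by simp
qed

lemma Comp_finsum_right:
  assumes "g \<in> Hom C Y W" "X \<in> Obj C"
  shows "g \<cdot> Zer C X Y = Zer C X W"
    and "f \<in> B \<rightarrow> Hom C X Y \<Longrightarrow> g \<cdot> finsum (hom_space C X Y) f B = finsum (hom_space C X W) (\<lambda>b. g \<cdot> f b) B"
  using additive_arrows(1)[of X Y X W "\<lambda>f. g \<cdot> f"] additive_arrows(2)[of X Y X W "\<lambda>f. g \<cdot> f" f B] HomD[OF assms(1)] assms Comp_Hom Comp_Add_right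
  by auto

lemma Comp_finsum_left:
  assumes "g \<in> Hom C W X" "Y \<in> Obj C"
  shows "Zer C X Y \<cdot> g = Zer C W Y"
    and "f \<in> B \<rightarrow> Hom C X Y \<Longrightarrow> finsum (hom_space C X Y) f B \<cdot> g = finsum (hom_space C W Y) (\<lambda>b. f b \<cdot> g) B"
  using additive_arrows(1)[of X Y W Y "\<lambda>f. f \<cdot> g"] additive_arrows(2)[of X Y W Y "\<lambda>f. f \<cdot> g" f B] HomD[OF assms(1)] assms Comp_Hom Comp_Add_left
  by auto

end

section \<open>Linear independence of tensor products with arrows to the unit object\<close>

context concrete_tensor_category
begin

lemma TArr_finsum_left:
  assumes "g \<in> Hom C X' Y'" "X \<in> Obj C" "Y \<in> Obj C"
  shows "Zer C X Y \<otimes>\<^sub>a g = Zer C (X \<otimes>\<^sub>o X') (Y \<otimes>\<^sub>o Y')"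
    and "f \<in> B \<rightarrow> Hom C X Y \<Longrightarrow> finsum (hom_space C X Y) f B \<otimes>\<^sub>a g =
      finsum (hom_space C (X \<otimes>\<^sub>o X') (Y \<otimes>\<^sub>o Y')) (\<lambda>b. f b \<otimes>\<^sub>a g) B"
  using additive_arrows(1)[of X Y "X \<otimes>\<^sub>o X'" "Y \<otimes>\<^sub>o Y'" "\<lambda>f. f \<otimes>\<^sub>a g"] additive_arrows(2)[of X Y "X \<otimes>\<^sub>o X'" "Y \<otimes>\<^sub>o Y'" "\<lambda>f. f \<otimes>\<^sub>a g" f B] HomD[OF assms(1)] assms
    TArr_Hom TArr_Add_left TObj_Obj
  by auto

lemma TArr_finsum_right:
  assumes "g \<in> Hom C X' Y'" "X \<in> Obj C" "Y \<in> Obj C"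
  shows "g \<otimes>\<^sub>a Zer C X Y = Zer C (X' \<otimes>\<^sub>o X) (Y' \<otimes>\<^sub>o Y)"
    and "f \<in> B \<rightarrow> Hom C X Y \<Longrightarrow> g \<otimes>\<^sub>a finsum (hom_space C X Y) f B =
      finsum (hom_space C (X' \<otimes>\<^sub>o X) (Y' \<otimes>\<^sub>o Y)) (\<lambda>b. g \<otimes>\<^sub>a f b) B"
  using additive_arrows(1)[of X Y "X' \<otimes>\<^sub>o X" "Y' \<otimes>\<^sub>o Y" "\<lambda>f. g \<otimes>\<^sub>a f"] additive_arrows(2)[of X Y "X' \<otimes>\<^sub>o X" "Y' \<otimes>\<^sub>o Y" "\<lambda>f. g \<otimes>\<^sub>a f" f B] HomD[OF assms(1)] assms
    TArr_Hom TArr_Add_right TObj_Obj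
  by auto

text \<open>Transposing \<open>P\<close> turns \<open>p \<otimes>\<^sub>a x\<close> into a composite
  that begins with \<open>x\<close>. A nonzero arrow to the simple unit object is an epimorphism and
  can be cancelled.\<close>

lemma tensor_to_unit_cancel:
  assumes p: "p \<in> Hom C P Y" "p' \<in> Hom C P Y" and x: "x \<in> Hom C D \<I>" "x \<noteq> Zer C D \<I>"
    and eq: "p \<otimes>\<^sub>a x = p' \<otimes>\<^sub>a x"
  shows "p = p'"
proof -
  note [simp] = HomD[OF p(1)] HomD(1-3)[OF p(2)] HomD[OF x(1)]
  obtain Q e c where d: "is_left_dual C Q P e c" using right_dual[of P] by auto
  note [simp] = left_dualD(1-8)[OF d]
  have key: "((ident Q \<otimes>\<^sub>a q) \<cdot> c) \<cdot> x = (ident Q \<otimes>\<^sub>a (q \<otimes>\<^sub>a x)) \<cdot> (c \<otimes>\<^sub>a ident D)"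
    "(ident Q \<otimes>\<^sub>a q) \<cdot> c \<in> Hom C \<I> (Q \<otimes>\<^sub>o Y)" if q: "q \<in> Hom C P Y" for q
  proof -
    note [simp] = HomD(1-3)[OF q]
    have "((ident Q \<otimes>\<^sub>a q) \<cdot> (c \<otimes>\<^sub>a ident \<I>)) \<cdot> x = (ident Q \<otimes>\<^sub>a (q \<cdot> (ident P \<otimes>\<^sub>a x))) \<cdot> (c \<otimes>\<^sub>a ident D)"
      by (rule transpose_natural[OF d x(1)]) (rule HomI; simp add: strict)
    then show "((ident Q \<otimes>\<^sub>a q) \<cdot> c) \<cdot> x = (ident Q \<otimes>\<^sub>a (q \<otimes>\<^sub>a x)) \<cdot> (c \<otimes>\<^sub>a ident D)"
      by (simp add: absorb_right strict)
    show "(ident Q \<otimes>\<^sub>a q) \<cdot> c \<in> Hom C \<I> (Q \<otimes>\<^sub>o Y)"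
      by (rule HomI) (simp_all add: typing)
  qed
  have "(ident Q \<otimes>\<^sub>a p) \<cdot> c = (ident Q \<otimes>\<^sub>a p') \<cdot> c"
    by (rule nonzero_epi[OF x key(2)[OF p(1)] key(2)[OF p(2)]]) (simp add: key(1)[OF p(1)] key(1)[OF p(2)] eq)
  then have "(ident Q \<otimes>\<^sub>a p) \<cdot> (c \<otimes>\<^sub>a ident \<I>) = (ident Q \<otimes>\<^sub>a p') \<cdot> (c \<otimes>\<^sub>a ident \<I>)"
    by (simp add: strict)
  then show ?thesis
    by (rule transpose_inj[OF d Unit_Obj, rotated 3]) (use p in \<open>simp_all add: strict\<close>)
qed

text \<open>The tensor product is injective on \<open>Hom(P, Y) \<otimes> Hom(D, \<I>)\<close>.\<close>

lemma tensor_independent: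
  assumes "finite B" "P \<in> Obj C" "Y \<in> Obj C" "D \<in> Obj C"
    and "q \<in> B \<rightarrow> Hom C P Y" "x \<in> B \<rightarrow> Hom C D \<I>"
    and "\<And>c. \<lbrakk>c \<in> B \<rightarrow> carrier K; finsum (hom_space C D \<I>) (\<lambda>b. Scal C (c b) (x b)) B = Zer C D \<I>\<rbrakk>
      \<Longrightarrow> \<forall>b\<in>B. c b = \<zero>\<^bsub>K\<^esub>"
    and "finsum (hom_space C (P \<otimes>\<^sub>o D) Y) (\<lambda>b. q b \<otimes>\<^sub>a x b) B = Zer C (P \<otimes>\<^sub>o D) Y"
  shows "\<forall>b\<in>B. q b = Zer C P Y"
  using assms(1,4-)
proof (induction B arbitrary: D x)
  case empty
  then show ?case by simp
next
  case (insert b0 B)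
  note PY [simp] = assms(2,3) and D [simp] = insert.prems(1)
  have q: "q b0 \<in> Hom C P Y" "q \<in> B \<rightarrow> Hom C P Y" using insert.prems(2) by auto
  have x: "x b0 \<in> Hom C D \<I>" "x \<in> B \<rightarrow> Hom C D \<I>" using insert.prems(3) by auto
  have PD: "P \<otimes>\<^sub>o D \<in> Obj C" by (simp add: typing)
  interpret HD: lin_space K "hom_space C D \<I>" by (rule hom_space_lin_space[OF D Unit_Obj])
  interpret HP: lin_space K "hom_space C (P \<otimes>\<^sub>o D) Y" by (rule hom_space_lin_space[OF PD PY(2)])
  have tens: "p \<otimes>\<^sub>a y \<in> Hom C (P \<otimes>\<^sub>o U) Y" if "p \<in> Hom C P Y" "y \<in> Hom C U \<I>" for p y U
    using TArr_Hom[OF that] by (simp add: strict)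
  have x0: "x b0 \<noteq> Zer C D \<I>"
  proof
    assume 0: "x b0 = Zer C D \<I>"
    define c where "c b = (if b = b0 then \<one>\<^bsub>K\<^esub> else \<zero>\<^bsub>K\<^esub>)" for b
    have "Scal C (c b) (x b) = Zer C D \<I>" if "b \<in> insert b0 B" for b
      using that 0 HD.smult_l_null[of "x b"] HD.smult_r_null[of "\<one>\<^bsub>K\<^esub>"] x by (auto simp: c_def)
    then have "finsum (hom_space C D \<I>) (\<lambda>b. Scal C (c b) (x b)) (insert b0 B) =
        finsum (hom_space C D \<I>) (\<lambda>b. \<zero>\<^bsub>hom_space C D \<I>\<^esub>) (insert b0 B)"
      using HD.M.zero_closed by (intro HD.M.finsum_cong') auto
    also have "\<dots> = Zer C D \<I>" using HD.M.finsum_zero by simp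
    finally have "\<forall>b\<in>insert b0 B. c b = \<zero>\<^bsub>K\<^esub>"
      by (intro insert.prems(4)) (auto simp: c_def)
    then show False by (simp add: c_def)
  qed
  \<comment> \<open>Restriction to the kernel of \<open>x b0\<close> removes the summand of
    \<open>b0\<close>. The other arrows stay independent after restriction, because a combination of
    them that vanishes on the kernel is a scalar multiple of \<open>x b0\<close>.\<close>
  obtain U k where k: "k \<in> Hom C U D" "x b0 \<cdot> k = Zer C U \<I>"
    "\<And>x'. \<lbrakk>x' \<in> Hom C D \<I>; x' \<cdot> k = Zer C U \<I>\<rbrakk> \<Longrightarrow> \<exists>c\<in>carrier K. x' = Scal C c (x b0)"
    by (rule ex_kernel_scalar[OF x(1) x0], rule that)
  have U [simp]: "U \<in> Obj C" using HomD[OF k(1)] by auto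
  have PU: "P \<otimes>\<^sub>o U \<in> Obj C" by (simp add: typing)
  interpret HU: lin_space K "hom_space C (P \<otimes>\<^sub>o U) Y" by (rule hom_space_lin_space[OF PU PY(2)])
  have xk: "(\<lambda>b. x b \<cdot> k) \<in> B \<rightarrow> Hom C U \<I>" using x(2) Comp_Hom[OF k(1)] by auto
  have "\<forall>b\<in>B. q b = Zer C P Y"
  proof (rule insert.IH[OF U q(2) xk])
    fix c assume c: "c \<in> B \<rightarrow> carrier K"
      and 0: "finsum (hom_space C U \<I>) (\<lambda>b. Scal C (c b) (x b \<cdot> k)) B = Zer C U \<I>"
    let ?s = "finsum (hom_space C D \<I>) (\<lambda>b. Scal C (c b) (x b)) B"
    have cx: "(\<lambda>b. Scal C (c b) (x b)) \<in> B \<rightarrow> Hom C D \<I>" using c x by (auto intro!: Scal_Hom)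
    have sH: "?s \<in> Hom C D \<I>" by (rule finsum_Hom[OF D Unit_Obj cx])
    have "?s \<cdot> k = finsum (hom_space C U \<I>) (\<lambda>b. Scal C (c b) (x b) \<cdot> k) B"
      by (rule Comp_finsum_left(2)[OF k(1) Unit_Obj cx])
    also have "\<dots> = finsum (hom_space C U \<I>) (\<lambda>b. Scal C (c b) (x b \<cdot> k)) B"
    proof (rule abelian_monoid.finsum_cong'[OF abelian_group.axioms(1)[OF hom_space_abelian_group[OF U Unit_Obj]]])
      show "(\<lambda>b. Scal C (c b) (x b \<cdot> k)) \<in> B \<rightarrow> carrier (hom_space C U \<I>)"
        using c xk by (auto intro!: Scal_Hom)
      fix b assume "b \<in> B"
      then have "c b \<in> carrier K" "x b \<in> Hom C D \<I>" using c x(2) by auto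
      then show "Scal C (c b) (x b) \<cdot> k = Scal C (c b) (x b \<cdot> k)" by (rule Comp_Scal_left[OF _ k(1)])
    qed simp
    finally have "?s \<cdot> k = Zer C U \<I>" using 0 by simp
    from k(3)[OF sH this] obtain a where a: "a \<in> carrier K" "?s = Scal C a (x b0)" by blast
    \<comment> \<open>A relation on the kernel becomes a relation among all the arrows once
      \<open>x b0\<close> receives the coefficient minus \<open>a\<close>.\<close>
    define d where "d = c(b0 := \<ominus>\<^bsub>K\<^esub> a)"
    have d: "d \<in> insert b0 B \<rightarrow> carrier K" using c a by (auto simp: d_def)
    have "finsum (hom_space C D \<I>) (\<lambda>b. Scal C (d b) (x b)) B = ?s"
      using insert.hyps(2) cx by (intro HD.M.finsum_cong') (auto simp: d_def)
    moreover have "finsum (hom_space C D \<I>) (\<lambda>b. Scal C (d b) (x b)) (insert b0 B) =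
        Add C (Scal C (\<ominus>\<^bsub>K\<^esub> a) (x b0)) (finsum (hom_space C D \<I>) (\<lambda>b. Scal C (d b) (x b)) B)"
    proof -
      have "(\<lambda>b. Scal C (d b) (x b)) \<in> B \<rightarrow> carrier (hom_space C D \<I>)"
        "Scal C (d b0) (x b0) \<in> carrier (hom_space C D \<I>)"
        using d x by (auto intro!: Scal_Hom)
      from HD.M.finsum_insert[OF insert.hyps this] show ?thesis by (simp add: d_def)
    qed
    moreover have "Add C (Scal C (\<ominus>\<^bsub>K\<^esub> a) (x b0)) (Scal C a (x b0)) = Zer C D \<I>"
      using HD.smult_l_distr[of "\<ominus>\<^bsub>K\<^esub> a" a "x b0"] HD.smult_l_null[of "x b0"] a(1) x(1) K.l_neg[of a] by simp
    ultimately have "finsum (hom_space C D \<I>) (\<lambda>b. Scal C (d b) (x b)) (insert b0 B) = Zer C D \<I>"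
      using a(2) by simp
    from insert.prems(4)[OF d this] show "\<forall>b\<in>B. c b = \<zero>\<^bsub>K\<^esub>"
      using insert.hyps(2) by (auto simp: d_def split: if_splits)
  next
    have Pk: "ident P \<otimes>\<^sub>a k \<in> Hom C (P \<otimes>\<^sub>o U) (P \<otimes>\<^sub>o D)"
      using TArr_Hom[OF ident_Hom[OF PY(1)] k(1)] .
    have comp: "(p \<otimes>\<^sub>a y) \<cdot> (ident P \<otimes>\<^sub>a k) = p \<otimes>\<^sub>a (y \<cdot> k)" if "p \<in> Hom C P Y" "y \<in> Hom C D \<I>" for p y
      using HomD[OF that(1)] HomD[OF that(2)] HomD[OF k(1)] by (simp add: interchange comp_ident typing)
    have qx: "(\<lambda>b. q b \<otimes>\<^sub>a x b) \<in> insert b0 B \<rightarrow> Hom C (P \<otimes>\<^sub>o D) Y"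
      using q x by (auto intro!: tens)
    have qxk: "q b \<otimes>\<^sub>a (x b \<cdot> k) \<in> Hom C (P \<otimes>\<^sub>o U) Y" if "b \<in> insert b0 B" for b
      using that q x by (intro tens Comp_Hom[OF k(1)]) auto
    have "Zer C (P \<otimes>\<^sub>o U) Y = finsum (hom_space C (P \<otimes>\<^sub>o D) Y) (\<lambda>b. q b \<otimes>\<^sub>a x b) (insert b0 B) \<cdot> (ident P \<otimes>\<^sub>a k)"
      unfolding insert.prems(5) by (rule Comp_finsum_left(1)[OF Pk PY(2), symmetric])
    also have "\<dots> = finsum (hom_space C (P \<otimes>\<^sub>o U) Y) (\<lambda>b. (q b \<otimes>\<^sub>a x b) \<cdot> (ident P \<otimes>\<^sub>a k)) (insert b0 B)"
      by (rule Comp_finsum_left(2)[OF Pk PY(2) qx])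
    also have "\<dots> = finsum (hom_space C (P \<otimes>\<^sub>o U) Y) (\<lambda>b. q b \<otimes>\<^sub>a (x b \<cdot> k)) (insert b0 B)"
      using q x comp qxk by (intro HU.M.finsum_cong') auto
    also have "\<dots> = Add C (q b0 \<otimes>\<^sub>a (x b0 \<cdot> k)) (finsum (hom_space C (P \<otimes>\<^sub>o U) Y) (\<lambda>b. q b \<otimes>\<^sub>a (x b \<cdot> k)) B)"
      using HU.M.finsum_insert[OF insert.hyps, of "\<lambda>b. q b \<otimes>\<^sub>a (x b \<cdot> k)"] qxk by simp
    also have "q b0 \<otimes>\<^sub>a (x b0 \<cdot> k) = Zer C (P \<otimes>\<^sub>o U) Y"
      using TArr_finsum_right(1)[OF q(1) U Unit_Obj] k(2) by (simp add: strict)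
    also have "Add C \<dots> (finsum (hom_space C (P \<otimes>\<^sub>o U) Y) (\<lambda>b. q b \<otimes>\<^sub>a (x b \<cdot> k)) B) =
        finsum (hom_space C (P \<otimes>\<^sub>o U) Y) (\<lambda>b. q b \<otimes>\<^sub>a (x b \<cdot> k)) B"
      using HU.M.l_zero[of "finsum (hom_space C (P \<otimes>\<^sub>o U) Y) (\<lambda>b. q b \<otimes>\<^sub>a (x b \<cdot> k)) B"]
        finsum_Hom[OF PU PY(2), of "\<lambda>b. q b \<otimes>\<^sub>a (x b \<cdot> k)" B] qxk by simp
    finally show "finsum (hom_space C (P \<otimes>\<^sub>o U) Y) (\<lambda>b. q b \<otimes>\<^sub>a (x b \<cdot> k)) B = Zer C (P \<otimes>\<^sub>o U) Y" ..
  qed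
  note qB = this
  have ZH: "Zer C P Y \<in> Hom C P Y" by (rule Zer_Hom[OF PY])
  have Z0: "Zer C P Y \<otimes>\<^sub>a y = Zer C (P \<otimes>\<^sub>o D) Y" if "y \<in> Hom C D \<I>" for y
    using TArr_finsum_left(1)[OF that PY] by (simp add: strict)
  have "finsum (hom_space C (P \<otimes>\<^sub>o D) Y) (\<lambda>b. q b \<otimes>\<^sub>a x b) B = Zer C (P \<otimes>\<^sub>o D) Y"
  proof -
    have "finsum (hom_space C (P \<otimes>\<^sub>o D) Y) (\<lambda>b. q b \<otimes>\<^sub>a x b) B =
        finsum (hom_space C (P \<otimes>\<^sub>o D) Y) (\<lambda>b. \<zero>\<^bsub>hom_space C (P \<otimes>\<^sub>o D) Y\<^esub>) B"
      using qB Z0 x(2) HP.M.zero_closed by (intro HP.M.finsum_cong') (auto simp: Pi_iff)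
    then show ?thesis using HP.M.finsum_zero by simp
  qed
  moreover have "finsum (hom_space C (P \<otimes>\<^sub>o D) Y) (\<lambda>b. q b \<otimes>\<^sub>a x b) (insert b0 B) =
      Add C (q b0 \<otimes>\<^sub>a x b0) (finsum (hom_space C (P \<otimes>\<^sub>o D) Y) (\<lambda>b. q b \<otimes>\<^sub>a x b) B)"
  proof -
    have "(\<lambda>b. q b \<otimes>\<^sub>a x b) \<in> B \<rightarrow> carrier (hom_space C (P \<otimes>\<^sub>o D) Y)"
      "q b0 \<otimes>\<^sub>a x b0 \<in> carrier (hom_space C (P \<otimes>\<^sub>o D) Y)"
      using q x by (auto intro!: tens)
    from HP.M.finsum_insert[OF insert.hyps this] show ?thesis by simp
  qed
  ultimately have "q b0 \<otimes>\<^sub>a x b0 = Zer C (P \<otimes>\<^sub>o D) Y"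
    using insert.prems(5) HP.M.r_zero[of "q b0 \<otimes>\<^sub>a x b0"] tens[OF q(1) x(1)] by simp
  \<comment> \<open>With the other summands gone, the last one is compared with the zero arrow
    tensored with the same \<open>x b0\<close>, which can be cancelled.\<close>
  then have "q b0 \<otimes>\<^sub>a x b0 = Zer C P Y \<otimes>\<^sub>a x b0" using Z0[OF x(1)] by simp
  from tensor_to_unit_cancel[OF q(1) ZH x(1) x0 this] qB show ?case by simp
qed

end

section \<open>Objects on which the end acts through the counit\<close>

context concrete_tensor_category
begin

definition vspace :: "'o \<Rightarrow> ('k, nat \<Rightarrow> 'k) module" where
  "vspace X = restrict_scalars A (V X)"

text \<open>As a predicate on an object it allows dual bases to be chosen for all objects at once;
  the choices need not be compatible with each other.\<close>

definition is_dual_basis :: "'o \<Rightarrow> (nat \<Rightarrow> 'k) set \<Rightarrow> ((nat \<Rightarrow> 'k) \<Rightarrow> (nat \<Rightarrow> 'k) \<Rightarrow> 'k) \<Rightarrow> bool" where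
  "is_dual_basis X B \<beta> \<longleftrightarrow> finite B \<and> B \<subseteq> carrier (V X) \<and> (\<forall>b\<in>B. \<beta> b \<in> functionals K (vspace X)) \<and>
     (\<forall>v\<in>carrier (V X). v = (\<Oplus>\<^bsub>V X\<^esub>b\<in>B. sc X (\<beta> b v) b)) \<and>
     (\<forall>b\<in>B. \<forall>c\<in>B. \<beta> b c = (if b = c then \<one>\<^bsub>K\<^esub> else \<zero>\<^bsub>K\<^esub>))"

lemma ex_dual_basis: "X \<in> Obj C \<Longrightarrow> \<exists>B \<beta>. is_dual_basis X B \<beta>"
proof -
  assume X: "X \<in> Obj C"
  interpret X: alg_module K A "V X" by (rule V_alg_module[OF X])
  obtain B \<beta> where "finite B" "B \<subseteq> carrier (restrict_scalars A (V X))"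
    "\<And>b. b \<in> B \<Longrightarrow> \<beta> b \<in> functionals K (restrict_scalars A (V X))"
    "\<And>v. v \<in> carrier (restrict_scalars A (V X)) \<Longrightarrow>
      v = (\<Oplus>\<^bsub>restrict_scalars A (V X)\<^esub>b\<in>B. \<beta> b v \<odot>\<^bsub>restrict_scalars A (V X)\<^esub> b)"
    "\<And>b c. \<lbrakk>b \<in> B; c \<in> B\<rbrakk> \<Longrightarrow> \<beta> b c = (if b = c then \<one>\<^bsub>K\<^esub> else \<zero>\<^bsub>K\<^esub>)"
    by (rule X.KM.dual_basis[OF V_finite_dim[OF X]], rule that)
  then have "is_dual_basis X B \<beta>"
    unfolding is_dual_basis_def vspace_def by simp
  then show ?thesis by blast
qed

text \<open>Under Hom(P, X) = V X the action of \<open>a\<close> is precomposition with the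
  endomorphism \<open>r\<close> of \<open>P\<close>, which is right multiplication by
  \<open>a\<close>. Precomposing the canonical transformation with \<open>r\<close> replaces every
  basis vector \<open>b\<close> by \<open>a b\<close> at all objects at once, so vanishing at the
  unit object forces vanishing at \<open>Y\<close>.\<close>

lemma counit_object_annihilator:
  assumes Z: "central_comonad C Z \<pi>" and Y: "Y \<in> Obj C"
    and good: "coaction_action (\<pi> \<I>) Y = comonad_counit C \<pi> \<I> \<otimes>\<^sub>a ident Y"
    and a: "a \<in> carrier A" "\<forall>n\<in>carrier (V \<I>). a \<odot>\<^bsub>V \<I>\<^esub> n = \<zero>\<^bsub>V \<I>\<^esub>" and m: "m \<in> carrier (V Y)"
  shows "a \<odot>\<^bsub>V Y\<^esub> m = \<zero>\<^bsub>V Y\<^esub>"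
proof -
  from ex_free_object obtain P where P [simp]: "P \<in> Obj C"
    and "\<exists>g\<in>carrier (V P). \<forall>X\<in>Obj C. \<forall>m\<in>carrier (V X). \<exists>!p. p \<in> Hom C P X \<and> ap p g = m"
    by (rule bexE)
  then obtain g where g: "g \<in> carrier (V P)"
    and "\<forall>X\<in>Obj C. \<forall>m\<in>carrier (V X). \<exists>!p. p \<in> Hom C P X \<and> ap p g = m"
    by - (erule bexE)
  then have P_univ: "\<exists>!p. p \<in> Hom C P X \<and> ap p g = m" if "X \<in> Obj C" "m \<in> carrier (V X)" for X m
    using that by simp
  from ex_cofree_object[folded vspace_def] obtain E where E [simp]: "E \<in> Obj C"
    and "\<exists>t\<in>functionals K (vspace E). \<forall>X\<in>Obj C. \<forall>\<phi>\<in>functionals K (vspace X).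
      \<exists>!f. f \<in> Hom C X E \<and> (\<forall>v\<in>carrier (V X). t (ap f v) = \<phi> v)"
    by (rule bexE)
  then obtain t where t: "t \<in> functionals K (vspace E)"
    and "\<forall>X\<in>Obj C. \<forall>\<phi>\<in>functionals K (vspace X).
      \<exists>!f. f \<in> Hom C X E \<and> (\<forall>v\<in>carrier (V X). t (ap f v) = \<phi> v)"
    by - (erule bexE)
  then have E_univ: "\<exists>!f. f \<in> Hom C X E \<and> (\<forall>v\<in>carrier (V X). t (ap f v) = \<phi> v)"
    if "X \<in> Obj C" "\<phi> \<in> functionals K (vspace X)" for X \<phi>
    using that by simp
  interpret E: alg_module K A "V E" by (rule V_alg_module[OF E])
  interpret P: alg_module K A "V P" by (rule V_alg_module[OF P])
  have tD: "t v \<in> carrier K" "t (sc E c v) = c \<otimes>\<^bsub>K\<^esub> t v"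
    if "v \<in> carrier (V E)" "c \<in> carrier K" for v c
    using functionalsD(1,3)[OF t] that by (simp_all add: vspace_def)
  \<comment> \<open>The arrow from \<open>P\<close> that stands for the vector \<open>m\<close>;
    \<open>em\<close> below is the arrow to \<open>E\<close> that stands for a functional.\<close>
  define pm where "pm X m = (THE p. p \<in> Hom C P X \<and> ap p g = m)" for X m
  have pm: "pm X m \<in> Hom C P X" "ap (pm X m) g = m" if "X \<in> Obj C" "m \<in> carrier (V X)" for X m
    using theI'[OF P_univ[OF that]] by (auto simp: pm_def)
  have pm_eqI: "p = pm X m" if "p \<in> Hom C P X" "ap p g = m" for p X m
  proof -
    have "X \<in> Obj C" "m \<in> carrier (V X)" using HomD[OF that(1)] ap_closed[OF that(1) g] that(2) by auto
    then show ?thesis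
      unfolding pm_def using P_univ that by (intro the1_equality[symmetric]) simp_all
  qed
  define em where "em X \<phi> = (THE f. f \<in> Hom C X E \<and> (\<forall>v\<in>carrier (V X). t (ap f v) = \<phi> v))" for X \<phi>
  have em': "em X \<phi> \<in> Hom C X E \<and> (\<forall>v\<in>carrier (V X). t (ap (em X \<phi>) v) = \<phi> v)"
    if "X \<in> Obj C" "\<phi> \<in> functionals K (vspace X)" for X \<phi>
    unfolding em_def by (rule theI'[OF E_univ[OF that]])
  have em: "em X \<phi> \<in> Hom C X E" "\<And>v. v \<in> carrier (V X) \<Longrightarrow> t (ap (em X \<phi>) v) = \<phi> v"
    if "X \<in> Obj C" "\<phi> \<in> functionals K (vspace X)" for X \<phi>
    using em'[OF that] by auto
  have em_eqI: "f = em X \<phi>"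
    if "f \<in> Hom C X E" "\<And>v. v \<in> carrier (V X) \<Longrightarrow> t (ap f v) = \<phi> v" "\<phi> \<in> functionals K (vspace X)" for f X \<phi>
  proof -
    have X: "X \<in> Obj C" using HomD[OF that(1)] by auto
    show ?thesis
      unfolding em_def by (rule the1_equality[OF E_univ[OF X that(3)], symmetric]) (use that(1,2) in simp)
  qed
  obtain B \<beta> where db: "\<And>X. X \<in> Obj C \<Longrightarrow> is_dual_basis X (B X) (\<beta> X)"
    using ex_dual_basis by metis
  have Bf: "finite (B X)" and BV: "b \<in> B X \<Longrightarrow> b \<in> carrier (V X)"
    and \<beta>: "b \<in> B X \<Longrightarrow> \<beta> X b \<in> functionals K (vspace X)"
    and delta: "\<lbrakk>b \<in> B X; c \<in> B X\<rbrakk> \<Longrightarrow> \<beta> X b c = (if b = c then \<one>\<^bsub>K\<^esub> else \<zero>\<^bsub>K\<^esub>)"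
    if "X \<in> Obj C" for X b c
    using db[OF that] unfolding is_dual_basis_def by auto
  have expand: "v = (\<Oplus>\<^bsub>V X\<^esub>b\<in>B X. sc X (\<beta> X b v) b)" if "X \<in> Obj C" "v \<in> carrier (V X)" for X v
    using db[OF that(1)] that(2) unfolding is_dual_basis_def by blast
  have \<beta>K: "\<beta> X b v \<in> carrier K" if "X \<in> Obj C" "b \<in> B X" "v \<in> carrier (V X)" for X b v
    using functionalsD(1)[OF \<beta>[OF that(1,2)], of v] that(3) by (simp add: vspace_def)
  have fK: "\<phi> v \<in> carrier K" if "\<phi> \<in> functionals K (vspace X)" "v \<in> carrier (V X)" for \<phi> X v
    using functionalsD(1)[OF that(1), of v] that(2) by (simp add: vspace_def)
  have Ef: "(\<lambda>v. \<phi> (ap f v)) \<in> functionals K (vspace X)"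
    if "\<phi> \<in> functionals K (vspace X')" "f \<in> Hom C X X'" for \<phi> f X X'
    using functionalsD[OF that(1)] module_homD[OF ap_hom[OF that(2)]]
    by (intro functionalsI) (simp_all add: vspace_def)
  have functional_expand: "\<phi> v = (\<Oplus>\<^bsub>K\<^esub>b\<in>B X. \<beta> X b v \<otimes>\<^bsub>K\<^esub> \<phi> b)"
    if X: "X \<in> Obj C" and \<phi>: "\<phi> \<in> functionals K (vspace X)" and v: "v \<in> carrier (V X)" for X \<phi> v
  proof -
    interpret X: alg_module K A "V X" by (rule V_alg_module[OF X])
    have "\<phi> v = \<phi> (\<Oplus>\<^bsub>V X\<^esub>b\<in>B X. sc X (\<beta> X b v) b)" by (rule arg_cong[OF expand[OF X v]])
    also have "\<dots> = (\<Oplus>\<^bsub>K\<^esub>b\<in>B X. \<beta> X b v \<otimes>\<^bsub>K\<^esub> \<phi> b)"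
      using X.KM.functional_coeffs[of \<phi> "\<lambda>b. \<beta> X b v" "B X"] \<phi> \<beta>K[OF X _ v] BV[OF X] by (auto simp: vspace_def)
    finally show ?thesis .
  qed
  \<comment> \<open>Since the representing arrow is unique, the expansion of a vector in the basis
    becomes an expansion of arrows.\<close>
  have pm_expand: "pm X m = finsum (hom_space C P X) (\<lambda>b. Scal C (\<beta> X b m) (pm X b)) (B X)"
    if X: "X \<in> Obj C" and m: "m \<in> carrier (V X)" for X m
  proof -
    interpret X: alg_module K A "V X" by (rule V_alg_module[OF X])
    have H: "(\<lambda>b. Scal C (\<beta> X b m) (pm X b)) \<in> B X \<rightarrow> Hom C P X"
      using \<beta>K[OF X _ m] pm(1)[OF X] BV[OF X] by (auto intro!: Scal_Hom)
    have "ap (finsum (hom_space C P X) (\<lambda>b. Scal C (\<beta> X b m) (pm X b)) (B X)) g =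
        (\<Oplus>\<^bsub>V X\<^esub>b\<in>B X. ap (Scal C (\<beta> X b m) (pm X b)) g)"
      by (rule ap_finsum[OF P X H g])
    also have "\<dots> = (\<Oplus>\<^bsub>V X\<^esub>b\<in>B X. sc X (\<beta> X b m) b)"
    proof (rule X.M.finsum_cong')
      fix b assume b: "b \<in> B X"
      show "ap (Scal C (\<beta> X b m) (pm X b)) g = sc X (\<beta> X b m) b"
        using ap_Scal[OF \<beta>K[OF X b m] pm(1)[OF X BV[OF X b]] g] pm(2)[OF X BV[OF X b]] by simp
    qed (use \<beta>K[OF X _ m] BV[OF X] in auto)
    also have "\<dots> = m" by (rule expand[OF X m, symmetric])
    finally show ?thesis by (rule pm_eqI[OF finsum_Hom[OF P X H], symmetric])
  qed
  have em_expand: "em X \<phi> = finsum (hom_space C X E) (\<lambda>b. Scal C (\<phi> b) (em X (\<beta> X b))) (B X)"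
    if X: "X \<in> Obj C" and \<phi>: "\<phi> \<in> functionals K (vspace X)" for X \<phi>
  proof -
    have H: "(\<lambda>b. Scal C (\<phi> b) (em X (\<beta> X b))) \<in> B X \<rightarrow> Hom C X E"
      using fK[OF \<phi>] em(1)[OF X \<beta>[OF X]] BV[OF X] by (auto intro!: Scal_Hom)
    have "t (ap (finsum (hom_space C X E) (\<lambda>b. Scal C (\<phi> b) (em X (\<beta> X b))) (B X)) v) = \<phi> v"
      if v: "v \<in> carrier (V X)" for v
    proof -
      have cl: "ap (Scal C (\<phi> b) (em X (\<beta> X b))) v \<in> carrier (V E)" if "b \<in> B X" for b
        using H that ap_closed[OF _ v] by blast
      have "t (ap (finsum (hom_space C X E) (\<lambda>b. Scal C (\<phi> b) (em X (\<beta> X b))) (B X)) v) =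
          t (\<Oplus>\<^bsub>restrict_scalars A (V E)\<^esub>b\<in>B X. ap (Scal C (\<phi> b) (em X (\<beta> X b))) v)"
        using ap_finsum[OF X E H v] by simp
      also have "\<dots> = (\<Oplus>\<^bsub>K\<^esub>b\<in>B X. t (ap (Scal C (\<phi> b) (em X (\<beta> X b))) v))"
        using t cl by (intro E.KM.functional_finsum) (auto simp: vspace_def)
      also have "\<dots> = (\<Oplus>\<^bsub>K\<^esub>b\<in>B X. \<beta> X b v \<otimes>\<^bsub>K\<^esub> \<phi> b)"
      proof (rule K.finsum_cong')
        fix b assume b: "b \<in> B X"
        note eb = em(1)[OF X \<beta>[OF X b]]
        have "t (ap (Scal C (\<phi> b) (em X (\<beta> X b))) v) = \<phi> b \<otimes>\<^bsub>K\<^esub> t (ap (em X (\<beta> X b)) v)"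
          using ap_Scal[OF fK[OF \<phi> BV[OF X b]] eb v] tD(2)[OF ap_closed[OF eb v] fK[OF \<phi> BV[OF X b]]] by simp
        also have "\<dots> = \<beta> X b v \<otimes>\<^bsub>K\<^esub> \<phi> b"
          using em(2)[OF X \<beta>[OF X b] v] \<beta>K[OF X b v] fK[OF \<phi> BV[OF X b]] by (simp add: K.m_comm)
        finally show "t (ap (Scal C (\<phi> b) (em X (\<beta> X b))) v) = \<beta> X b v \<otimes>\<^bsub>K\<^esub> \<phi> b" .
      qed (use \<beta>K[OF X _ v] fK[OF \<phi>] BV[OF X] in auto)
      also have "\<dots> = \<phi> v" by (rule functional_expand[OF X \<phi> v, symmetric])
      finally show ?thesis .
    qed
    then show ?thesis by (rule em_eqI[OF finsum_Hom[OF X E H] _ \<phi>, symmetric])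
  qed
  let ?E = "Dual C E"
  have E' [simp]: "?E \<in> Obj C" "Ev C E \<in> Hom C (?E \<otimes>\<^sub>o E) \<I>"
    using Dual_typing[OF E] by (auto simp: Hom_def)
  \<comment> \<open>The transpose of \<open>em X \<phi>\<close> along the duality of
    \<open>E\<close>. It ends in the unit object, so tensoring it with an arrow from
    \<open>P\<close> does not enlarge the target.\<close>
  define xm where "xm X \<phi> = Ev C E \<cdot> (ident ?E \<otimes>\<^sub>a em X \<phi>)" for X \<phi>
  have EX: "?E \<otimes>\<^sub>o X \<in> Obj C" if "X \<in> Obj C" for X using that by (simp add: typing)
  have idem: "ident ?E \<otimes>\<^sub>a h \<in> Hom C (?E \<otimes>\<^sub>o X) (?E \<otimes>\<^sub>o X')" if "h \<in> Hom C X X'" for h X X'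
    by (rule TArr_Hom[OF ident_Hom[OF E'(1)] that])
  have xm: "xm X \<phi> \<in> Hom C (?E \<otimes>\<^sub>o X) \<I>" if "X \<in> Obj C" "\<phi> \<in> functionals K (vspace X)" for X \<phi>
    unfolding xm_def using Comp_Hom[OF idem[OF em(1)[OF that]] E'(2)] .
  have xm_Scal: "Ev C E \<cdot> (ident ?E \<otimes>\<^sub>a Scal C c h) = Scal C c (Ev C E \<cdot> (ident ?E \<otimes>\<^sub>a h))"
    if "c \<in> carrier K" "h \<in> Hom C X E" for c h X
    using TArr_Scal_right[OF that(1) ident_Hom[OF E'(1)] that(2)]
      Comp_Scal_right[OF that(1) idem[OF that(2)] E'(2)] by simp
  have xm_finsum: "Ev C E \<cdot> (ident ?E \<otimes>\<^sub>a finsum (hom_space C X E) h S) =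
      finsum (hom_space C (?E \<otimes>\<^sub>o X) \<I>) (\<lambda>b. Ev C E \<cdot> (ident ?E \<otimes>\<^sub>a h b)) S"
    if X: "X \<in> Obj C" and h: "h \<in> S \<rightarrow> Hom C X E" for X h S
  proof -
    have "(\<lambda>b. ident ?E \<otimes>\<^sub>a h b) \<in> S \<rightarrow> Hom C (?E \<otimes>\<^sub>o X) (?E \<otimes>\<^sub>o E)" using h idem by auto
    then show ?thesis
      using TArr_finsum_right(2)[OF ident_Hom[OF E'(1)] X E h] Comp_finsum_right(2)[OF E'(2) EX[OF X]] by simp
  qed
  have xm_expand: "xm X \<phi> = finsum (hom_space C (?E \<otimes>\<^sub>o X) \<I>) (\<lambda>b. Scal C (\<phi> b) (xm X (\<beta> X b))) (B X)"
    if X: "X \<in> Obj C" and \<phi>: "\<phi> \<in> functionals K (vspace X)" for X \<phi>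
  proof -
    have H: "(\<lambda>b. Scal C (\<phi> b) (em X (\<beta> X b))) \<in> B X \<rightarrow> Hom C X E"
      using fK[OF \<phi>] em(1)[OF X \<beta>[OF X]] BV[OF X] by (auto intro!: Scal_Hom)
    have "xm X \<phi> = finsum (hom_space C (?E \<otimes>\<^sub>o X) \<I>) (\<lambda>b. Ev C E \<cdot> (ident ?E \<otimes>\<^sub>a Scal C (\<phi> b) (em X (\<beta> X b)))) (B X)"
      unfolding xm_def by (subst em_expand[OF X \<phi>]) (rule xm_finsum[OF X H])
    also have "\<dots> = finsum (hom_space C (?E \<otimes>\<^sub>o X) \<I>) (\<lambda>b. Scal C (\<phi> b) (xm X (\<beta> X b))) (B X)"
    proof (rule abelian_monoid.finsum_cong'[OF abelian_group.axioms(1)[OF hom_space_abelian_group[OF EX[OF X] Unit_Obj]]])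
      fix b assume b: "b \<in> B X"
      show "Ev C E \<cdot> (ident ?E \<otimes>\<^sub>a Scal C (\<phi> b) (em X (\<beta> X b))) = Scal C (\<phi> b) (xm X (\<beta> X b))"
        unfolding xm_def by (rule xm_Scal[OF fK[OF \<phi> BV[OF X b]] em(1)[OF X \<beta>[OF X b]]])
    next
      show "(\<lambda>b. Scal C (\<phi> b) (xm X (\<beta> X b))) \<in> B X \<rightarrow> carrier (hom_space C (?E \<otimes>\<^sub>o X) \<I>)"
        using fK[OF \<phi>] BV[OF X] xm[OF X \<beta>[OF X]] by (auto intro!: Scal_Hom)
    qed simp
    finally show ?thesis .
  qed
  define W where "W = P \<otimes>\<^sub>o ?E"
  have W [simp]: "W \<in> Obj C" by (simp add: W_def typing)
  have WX: "W \<otimes>\<^sub>o X \<in> Obj C" "W \<otimes>\<^sub>o X = P \<otimes>\<^sub>o (?E \<otimes>\<^sub>o X)" if "X \<in> Obj C" for X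
    using that by (simp_all add: W_def typing strict)
  have px: "p \<otimes>\<^sub>a x \<in> Hom C (W \<otimes>\<^sub>o X') X" if "p \<in> Hom C P X" "x \<in> Hom C (?E \<otimes>\<^sub>o X') \<I>" "X' \<in> Obj C" for p x X X'
    using TArr_Hom[OF that(1,2)] HomD[OF that(1)] WX(2)[OF that(3)] by (simp add: strict)
  define \<theta> where "\<theta> X = finsum (hom_space C (W \<otimes>\<^sub>o X) X) (\<lambda>b. pm X b \<otimes>\<^sub>a xm X (\<beta> X b)) (B X)" for X
  have summand: "(\<lambda>b. pm X b \<otimes>\<^sub>a xm X (\<beta> X b)) \<in> B X \<rightarrow> Hom C (W \<otimes>\<^sub>o X) X" if X: "X \<in> Obj C" for X
    using px[OF pm(1)[OF X BV[OF X]] xm[OF X \<beta>[OF X]] X] by auto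
  have \<theta>: "\<theta> X \<in> Hom C (W \<otimes>\<^sub>o X) X" if X: "X \<in> Obj C" for X
    unfolding \<theta>_def by (rule finsum_Hom[OF WX(1)[OF X] X summand[OF X]])
  \<comment> \<open>Both sides equal the double sum of \<open>u\<close>, whose coefficients are the
    matrix entries of \<open>f\<close>. One arises from expanding \<open>ap f b\<close> in the basis
    of \<open>V Y\<close>, the other from expanding a functional pulled back along \<open>f\<close>
    in the dual basis of \<open>V X\<close>.\<close>
  have natural: "f \<cdot> \<theta> X = \<theta> Y \<cdot> (ident W \<otimes>\<^sub>a f)" if f: "f \<in> Hom C X Y" for f X Y
  proof -
    have X [simp]: "X \<in> Obj C" and Y [simp]: "Y \<in> Obj C" using HomD[OF f] by auto
    interpret H: lin_space K "hom_space C (W \<otimes>\<^sub>o X) Y" by (rule hom_space_lin_space[OF WX(1)[OF X] Y])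
    have Wf: "ident W \<otimes>\<^sub>a f \<in> Hom C (W \<otimes>\<^sub>o X) (W \<otimes>\<^sub>o Y)" by (rule TArr_Hom[OF ident_Hom[OF W] f])
    define u where "u b c = Scal C (\<beta> Y c (ap f b)) (pm Y c \<otimes>\<^sub>a xm X (\<beta> X b))" for b c
    have pxH: "pm Y c \<otimes>\<^sub>a xm X (\<beta> X b) \<in> Hom C (W \<otimes>\<^sub>o X) Y" if "b \<in> B X" "c \<in> B Y" for b c
      by (rule px[OF pm(1)[OF Y BV[OF Y that(2)]] xm[OF X \<beta>[OF X that(1)]] X])
    have \<beta>f: "\<beta> Y c (ap f b) \<in> carrier K" if "b \<in> B X" "c \<in> B Y" for b c
      by (rule \<beta>K[OF Y that(2) ap_closed[OF f BV[OF X that(1)]]])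
    have u: "u b c \<in> Hom C (W \<otimes>\<^sub>o X) Y" if "b \<in> B X" "c \<in> B Y" for b c
      unfolding u_def by (rule Scal_Hom[OF \<beta>f[OF that] pxH[OF that]])
    have uc: "(\<lambda>c. u b c) \<in> B Y \<rightarrow> carrier (hom_space C (W \<otimes>\<^sub>o X) Y)" if "b \<in> B X" for b
      using u[OF that] by auto
    have ub: "(\<lambda>b. u b c) \<in> B X \<rightarrow> carrier (hom_space C (W \<otimes>\<^sub>o X) Y)" if "c \<in> B Y" for c
      using u that by auto
    have "f \<cdot> \<theta> X = finsum (hom_space C (W \<otimes>\<^sub>o X) Y) (\<lambda>b. f \<cdot> (pm X b \<otimes>\<^sub>a xm X (\<beta> X b))) (B X)"
      unfolding \<theta>_def by (rule Comp_finsum_right(2)[OF f WX(1)[OF X] summand[OF X]])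
    also have "\<dots> = finsum (hom_space C (W \<otimes>\<^sub>o X) Y) (\<lambda>b. finsum (hom_space C (W \<otimes>\<^sub>o X) Y) (u b) (B Y)) (B X)"
    proof (rule H.M.finsum_cong')
      fix b assume b: "b \<in> B X"
      note p = pm[OF X BV[OF X b]] and x = xm[OF X \<beta>[OF X b]]
      have fb: "ap f b \<in> carrier (V Y)" by (rule ap_closed[OF f BV[OF X b]])
      have "f \<cdot> (pm X b \<otimes>\<^sub>a xm X (\<beta> X b)) = (f \<cdot> pm X b) \<otimes>\<^sub>a xm X (\<beta> X b)"
        using interchange[of "pm X b" f "xm X (\<beta> X b)" "ident \<I>"] HomD[OF f] HomD[OF p(1)] HomD[OF x]
        by (simp add: comp_ident typing strict)
      also have "f \<cdot> pm X b = pm Y (ap f b)"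
        by (rule pm_eqI[OF Comp_Hom[OF p(1) f]]) (simp add: ap_Comp[OF p(1) f g] p(2))
      also have "\<dots> = finsum (hom_space C P Y) (\<lambda>c. Scal C (\<beta> Y c (ap f b)) (pm Y c)) (B Y)"
        by (rule pm_expand[OF Y fb])
      also have "\<dots> \<otimes>\<^sub>a xm X (\<beta> X b) =
          finsum (hom_space C (W \<otimes>\<^sub>o X) Y) (\<lambda>c. Scal C (\<beta> Y c (ap f b)) (pm Y c) \<otimes>\<^sub>a xm X (\<beta> X b)) (B Y)"
        using TArr_finsum_left(2)[OF x P Y, of "\<lambda>c. Scal C (\<beta> Y c (ap f b)) (pm Y c)" "B Y"]
          Scal_Hom[OF \<beta>f[OF b] pm(1)[OF Y BV[OF Y]]] WX(2)[OF X] by (auto simp: strict Pi_iff)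
      also have "\<dots> = finsum (hom_space C (W \<otimes>\<^sub>o X) Y) (u b) (B Y)"
        using TArr_Scal_left[OF \<beta>f[OF b] pm(1)[OF Y BV[OF Y]] x] uc[OF b]
        by (intro H.M.finsum_cong') (auto simp: u_def)
      finally show "f \<cdot> (pm X b \<otimes>\<^sub>a xm X (\<beta> X b)) = finsum (hom_space C (W \<otimes>\<^sub>o X) Y) (u b) (B Y)" .
    qed (auto intro!: finsum_Hom[OF WX(1)[OF X] Y] u)
    also have "\<dots> = finsum (hom_space C (W \<otimes>\<^sub>o X) Y) (\<lambda>c. finsum (hom_space C (W \<otimes>\<^sub>o X) Y) (\<lambda>b. u b c) (B X)) (B Y)"
      using u by (intro H.M.finsum_swap[OF Bf[OF X] Bf[OF Y]]) simp
    also have "\<dots> = finsum (hom_space C (W \<otimes>\<^sub>o X) Y) (\<lambda>c. (pm Y c \<otimes>\<^sub>a xm Y (\<beta> Y c)) \<cdot> (ident W \<otimes>\<^sub>a f)) (B Y)"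
    proof (rule H.M.finsum_cong')
      fix c assume c: "c \<in> B Y"
      note p = pm[OF Y BV[OF Y c]] and x = xm[OF Y \<beta>[OF Y c]]
      let ?\<phi> = "\<lambda>v. \<beta> Y c (ap f v)"
      have \<phi>: "?\<phi> \<in> functionals K (vspace X)" by (rule Ef[OF \<beta>[OF Y c] f])
      have "(pm Y c \<otimes>\<^sub>a xm Y (\<beta> Y c)) \<cdot> (ident W \<otimes>\<^sub>a f) = pm Y c \<otimes>\<^sub>a (xm Y (\<beta> Y c) \<cdot> (ident ?E \<otimes>\<^sub>a f))"
        using interchange[of "ident P" "pm Y c" "ident ?E \<otimes>\<^sub>a f" "xm Y (\<beta> Y c)"] HomD[OF f] HomD[OF p(1)] HomD[OF x]
        by (simp add: W_def comp_ident typing strict)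
      also have "xm Y (\<beta> Y c) \<cdot> (ident ?E \<otimes>\<^sub>a f) = Ev C E \<cdot> (ident ?E \<otimes>\<^sub>a (em Y (\<beta> Y c) \<cdot> f))"
        using HomD[OF f] HomD[OF em(1)[OF Y \<beta>[OF Y c]]] HomD[OF E'(2)]
        by (simp add: xm_def comp_assoc interchange comp_ident typing)
      also have "em Y (\<beta> Y c) \<cdot> f = em X ?\<phi>"
        by (rule em_eqI[OF Comp_Hom[OF f em(1)[OF Y \<beta>[OF Y c]]] _ \<phi>])
          (simp add: ap_Comp[OF f em(1)[OF Y \<beta>[OF Y c]]] em(2)[OF Y \<beta>[OF Y c]] ap_closed[OF f])
      also have "Ev C E \<cdot> (ident ?E \<otimes>\<^sub>a em X ?\<phi>) =
          finsum (hom_space C (?E \<otimes>\<^sub>o X) \<I>) (\<lambda>b. Scal C (?\<phi> b) (xm X (\<beta> X b))) (B X)"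
        unfolding xm_def[symmetric] by (rule xm_expand[OF X \<phi>])
      also have "pm Y c \<otimes>\<^sub>a \<dots> =
          finsum (hom_space C (W \<otimes>\<^sub>o X) Y) (\<lambda>b. pm Y c \<otimes>\<^sub>a Scal C (?\<phi> b) (xm X (\<beta> X b))) (B X)"
        using TArr_finsum_right(2)[OF p(1) EX[OF X] Unit_Obj, of "\<lambda>b. Scal C (?\<phi> b) (xm X (\<beta> X b))" "B X"]
          Scal_Hom[OF \<beta>f[OF _ c] xm[OF X \<beta>[OF X]]] WX(2)[OF X] by (auto simp: strict Pi_iff)
      also have "\<dots> = finsum (hom_space C (W \<otimes>\<^sub>o X) Y) (\<lambda>b. u b c) (B X)"
        using TArr_Scal_right[OF \<beta>f[OF _ c] p(1) xm[OF X \<beta>[OF X]]] ub[OF c]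
        by (intro H.M.finsum_cong') (auto simp: u_def)
      finally show "finsum (hom_space C (W \<otimes>\<^sub>o X) Y) (\<lambda>b. u b c) (B X) =
          (pm Y c \<otimes>\<^sub>a xm Y (\<beta> Y c)) \<cdot> (ident W \<otimes>\<^sub>a f)" ..
    next
      show "(\<lambda>c. (pm Y c \<otimes>\<^sub>a xm Y (\<beta> Y c)) \<cdot> (ident W \<otimes>\<^sub>a f)) \<in> B Y \<rightarrow> carrier (hom_space C (W \<otimes>\<^sub>o X) Y)"
        using Comp_Hom[OF Wf] summand[OF Y] by auto
    qed simp
    also have "\<dots> = \<theta> Y \<cdot> (ident W \<otimes>\<^sub>a f)"
      unfolding \<theta>_def by (rule Comp_finsum_left(2)[OF Wf Y summand[OF Y], symmetric])
    finally show ?thesis .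
  qed
  have \<theta>Y: "\<theta> Y = \<theta> \<I> \<otimes>\<^sub>a ident Y"
    by (rule natural_at_counit_object[OF Z Y good W \<theta> natural])
  define r where "r = pm P (a \<odot>\<^bsub>V P\<^esub> g)"
  have ag: "a \<odot>\<^bsub>V P\<^esub> g \<in> carrier (V P)" using a(1) g by simp
  have r: "r \<in> Hom C P P" "ap r g = a \<odot>\<^bsub>V P\<^esub> g" unfolding r_def using pm[OF P ag] by auto
  have pm_r: "pm X n \<cdot> r = pm X (a \<odot>\<^bsub>V X\<^esub> n)" if X: "X \<in> Obj C" and n: "n \<in> carrier (V X)" for X n
    by (rule pm_eqI[OF Comp_Hom[OF r(1) pm(1)[OF X n]]])
      (simp add: ap_Comp[OF r(1) pm(1)[OF X n] g] r(2) module_homD(3)[OF ap_hom[OF pm(1)[OF X n]] a(1) g] pm(2)[OF X n])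
  have \<theta>r: "\<theta> X \<cdot> (r \<otimes>\<^sub>a ident (?E \<otimes>\<^sub>o X)) =
      finsum (hom_space C (W \<otimes>\<^sub>o X) X) (\<lambda>b. pm X (a \<odot>\<^bsub>V X\<^esub> b) \<otimes>\<^sub>a xm X (\<beta> X b)) (B X)"
    if X: "X \<in> Obj C" for X
  proof -
    interpret H: lin_space K "hom_space C (W \<otimes>\<^sub>o X) X" by (rule hom_space_lin_space[OF WX(1)[OF X] X])
    interpret X: alg_module K A "V X" by (rule V_alg_module[OF X])
    have rH: "r \<otimes>\<^sub>a ident (?E \<otimes>\<^sub>o X) \<in> Hom C (W \<otimes>\<^sub>o X) (W \<otimes>\<^sub>o X)"
      using TArr_Hom[OF r(1) ident_Hom[OF EX[OF X]]] WX(2)[OF X] by simp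
    have "\<theta> X \<cdot> (r \<otimes>\<^sub>a ident (?E \<otimes>\<^sub>o X)) =
        finsum (hom_space C (W \<otimes>\<^sub>o X) X) (\<lambda>b. (pm X b \<otimes>\<^sub>a xm X (\<beta> X b)) \<cdot> (r \<otimes>\<^sub>a ident (?E \<otimes>\<^sub>o X))) (B X)"
      unfolding \<theta>_def by (rule Comp_finsum_left(2)[OF rH X summand[OF X]])
    also have "\<dots> = finsum (hom_space C (W \<otimes>\<^sub>o X) X) (\<lambda>b. pm X (a \<odot>\<^bsub>V X\<^esub> b) \<otimes>\<^sub>a xm X (\<beta> X b)) (B X)"
    proof (rule H.M.finsum_cong')
      fix b assume b: "b \<in> B X"
      show "(pm X b \<otimes>\<^sub>a xm X (\<beta> X b)) \<cdot> (r \<otimes>\<^sub>a ident (?E \<otimes>\<^sub>o X)) = pm X (a \<odot>\<^bsub>V X\<^esub> b) \<otimes>\<^sub>a xm X (\<beta> X b)"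
        using interchange[of r "pm X b" "ident (?E \<otimes>\<^sub>o X)" "xm X (\<beta> X b)"] HomD[OF r(1)]
          HomD[OF pm(1)[OF X BV[OF X b]]] HomD[OF xm[OF X \<beta>[OF X b]]] pm_r[OF X BV[OF X b]] EX[OF X]
        by (simp add: comp_ident typing)
    next
      show "(\<lambda>b. pm X (a \<odot>\<^bsub>V X\<^esub> b) \<otimes>\<^sub>a xm X (\<beta> X b)) \<in> B X \<rightarrow> carrier (hom_space C (W \<otimes>\<^sub>o X) X)"
        using px[OF pm(1)[OF X X.act_closed[OF a(1) BV[OF X]]] xm[OF X \<beta>[OF X]] X] by auto
    qed simp
    finally show ?thesis .
  qed
  \<comment> \<open>Each summand now carries the arrow from \<open>P\<close> for the vector
    \<open>a b\<close>, which is zero at the unit object.\<close>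
  have zero1: "\<theta> \<I> \<cdot> (r \<otimes>\<^sub>a ident ?E) = Zer C W \<I>"
  proof -
    interpret H: lin_space K "hom_space C W \<I>" by (rule hom_space_lin_space[OF W Unit_Obj])
    have pm0: "pm \<I> \<zero>\<^bsub>V \<I>\<^esub> = Zer C P \<I>"
      by (rule pm_eqI[OF Zer_Hom[OF P Unit_Obj] ap_Zer[OF P Unit_Obj g], symmetric])
    have "\<theta> \<I> \<cdot> (r \<otimes>\<^sub>a ident ?E) = \<theta> \<I> \<cdot> (r \<otimes>\<^sub>a ident (?E \<otimes>\<^sub>o \<I>))" by (simp add: strict)
    also have "\<dots> = finsum (hom_space C W \<I>) (\<lambda>b. pm \<I> (a \<odot>\<^bsub>V \<I>\<^esub> b) \<otimes>\<^sub>a xm \<I> (\<beta> \<I> b)) (B \<I>)"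
      using \<theta>r[OF Unit_Obj] by (simp add: strict)
    also have "\<dots> = finsum (hom_space C W \<I>) (\<lambda>b. \<zero>\<^bsub>hom_space C W \<I>\<^esub>) (B \<I>)"
    proof (rule H.M.finsum_cong')
      fix b assume b: "b \<in> B \<I>"
      have "pm \<I> (a \<odot>\<^bsub>V \<I>\<^esub> b) = Zer C P \<I>" using a(2) BV[OF Unit_Obj b] pm0 by simp
      then show "pm \<I> (a \<odot>\<^bsub>V \<I>\<^esub> b) \<otimes>\<^sub>a xm \<I> (\<beta> \<I> b) = \<zero>\<^bsub>hom_space C W \<I>\<^esub>"
        using TArr_finsum_left(1)[OF xm[OF Unit_Obj \<beta>[OF Unit_Obj b]] P Unit_Obj] by (simp add: W_def strict Unit_Obj)
    qed (use H.M.zero_closed in auto)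
    also have "\<dots> = Zer C W \<I>" using H.M.finsum_zero by simp
    finally show ?thesis .
  qed
  have rE: "r \<otimes>\<^sub>a ident ?E \<in> Hom C W W" using TArr_Hom[OF r(1) ident_Hom[OF E'(1)]] by (simp add: W_def)
  have "\<theta> Y \<cdot> (r \<otimes>\<^sub>a ident (?E \<otimes>\<^sub>o Y)) = (\<theta> \<I> \<cdot> (r \<otimes>\<^sub>a ident ?E)) \<otimes>\<^sub>a ident Y"
    unfolding \<theta>Y using interchange[of "r \<otimes>\<^sub>a ident ?E" "\<theta> \<I>" "ident Y" "ident Y"]
      HomD[OF rE] HomD[OF \<theta>[OF Unit_Obj]] HomD[OF r(1)] Y
    by (simp add: comp_ident typing strict)
  also have "\<dots> = Zer C (W \<otimes>\<^sub>o Y) Y"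
    unfolding zero1 using TArr_finsum_left(1)[OF ident_Hom[OF Y] W Unit_Obj] Y by (simp add: strict)
  finally have vanish: "finsum (hom_space C (P \<otimes>\<^sub>o (?E \<otimes>\<^sub>o Y)) Y)
      (\<lambda>b. pm Y (a \<odot>\<^bsub>V Y\<^esub> b) \<otimes>\<^sub>a xm Y (\<beta> Y b)) (B Y) = Zer C (P \<otimes>\<^sub>o (?E \<otimes>\<^sub>o Y)) Y"
    using \<theta>r[OF Y] WX(2)[OF Y] by simp
  interpret Y: alg_module K A "V Y" by (rule V_alg_module[OF Y])
  have ab: "a \<odot>\<^bsub>V Y\<^esub> b \<in> carrier (V Y)" if "b \<in> B Y" for b using a(1) BV[OF Y that] by simp
  \<comment> \<open>Transposing a relation back along the duality of \<open>E\<close> gives a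
    relation among the arrows to \<open>E\<close>. Evaluated at the basis vector \<open>b0\<close>
    and read off by \<open>t\<close>, it leaves only the coefficient of \<open>b0\<close>.\<close>
  have indep: "\<forall>b\<in>B Y. c b = \<zero>\<^bsub>K\<^esub>"
    if c: "c \<in> B Y \<rightarrow> carrier K"
      and 0: "finsum (hom_space C (?E \<otimes>\<^sub>o Y) \<I>) (\<lambda>b. Scal C (c b) (xm Y (\<beta> Y b))) (B Y) = Zer C (?E \<otimes>\<^sub>o Y) \<I>" for c
  proof
    fix b0 assume b0: "b0 \<in> B Y"
    let ?s = "finsum (hom_space C Y E) (\<lambda>b. Scal C (c b) (em Y (\<beta> Y b))) (B Y)"
    have H: "(\<lambda>b. Scal C (c b) (em Y (\<beta> Y b))) \<in> B Y \<rightarrow> Hom C Y E"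
      using c em(1)[OF Y \<beta>[OF Y]] by (auto intro!: Scal_Hom)
    have sH: "?s \<in> Hom C Y E" by (rule finsum_Hom[OF Y E H])
    have "Ev C E \<cdot> (ident ?E \<otimes>\<^sub>a ?s) =
        finsum (hom_space C (?E \<otimes>\<^sub>o Y) \<I>) (\<lambda>b. Ev C E \<cdot> (ident ?E \<otimes>\<^sub>a Scal C (c b) (em Y (\<beta> Y b)))) (B Y)"
      by (rule xm_finsum[OF Y H])
    also have "\<dots> = finsum (hom_space C (?E \<otimes>\<^sub>o Y) \<I>) (\<lambda>b. Scal C (c b) (xm Y (\<beta> Y b))) (B Y)"
    proof (rule abelian_monoid.finsum_cong'[OF abelian_group.axioms(1)[OF hom_space_abelian_group[OF EX[OF Y] Unit_Obj]]])
      fix b assume b: "b \<in> B Y"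
      then have "c b \<in> carrier K" using c by auto
      then show "Ev C E \<cdot> (ident ?E \<otimes>\<^sub>a Scal C (c b) (em Y (\<beta> Y b))) = Scal C (c b) (xm Y (\<beta> Y b))"
        unfolding xm_def by (rule xm_Scal[OF _ em(1)[OF Y \<beta>[OF Y b]]])
    next
      show "(\<lambda>b. Scal C (c b) (xm Y (\<beta> Y b))) \<in> B Y \<rightarrow> carrier (hom_space C (?E \<otimes>\<^sub>o Y) \<I>)"
        using c xm[OF Y \<beta>[OF Y]] by (auto intro!: Scal_Hom)
    qed simp
    finally have s0: "Ev C E \<cdot> (ident ?E \<otimes>\<^sub>a ?s) = Ev C E \<cdot> (ident ?E \<otimes>\<^sub>a Zer C Y E)"
      using 0 TArr_finsum_right(1)[OF ident_Hom[OF E'(1)] Y E] Comp_finsum_right(1)[OF E'(2) EX[OF Y]] by simp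
    \<comment> \<open>Naturality of transposition and the zigzag identity of \<open>E\<close> undo
      the passage from \<open>em\<close> to \<open>xm\<close>.\<close>
    have recover: "(ident E \<otimes>\<^sub>a (Ev C E \<cdot> (ident ?E \<otimes>\<^sub>a h))) \<cdot> (Coev C E \<otimes>\<^sub>a ident Y) = h" if h: "h \<in> Hom C Y E" for h
    proof -
      have "((ident E \<otimes>\<^sub>a Ev C E) \<cdot> (Coev C E \<otimes>\<^sub>a ident E)) \<cdot> h =
          (ident E \<otimes>\<^sub>a (Ev C E \<cdot> (ident ?E \<otimes>\<^sub>a h))) \<cdot> (Coev C E \<otimes>\<^sub>a ident Y)"
        by (rule transpose_natural[OF left_dual[OF E] h E'(2)])
      then show ?thesis using zigzag(1)[OF E] ident_left[OF h] by simp
    qed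
    have "?s = Zer C Y E"
      using recover[OF sH] recover[OF Zer_Hom[OF Y E]] unfolding s0 by simp
    then have "t (ap ?s b0) = t \<zero>\<^bsub>V E\<^esub>" using ap_Zer[OF Y E BV[OF Y b0]] by simp
    also have "\<dots> = \<zero>\<^bsub>K\<^esub>" using E.KM.functional_zero[of t] t by (simp add: vspace_def)
    finally have t0: "t (ap ?s b0) = \<zero>\<^bsub>K\<^esub>" .
    have cl: "ap (Scal C (c b) (em Y (\<beta> Y b))) b0 \<in> carrier (V E)" if "b \<in> B Y" for b
      using H that ap_closed[OF _ BV[OF Y b0]] by blast
    have "t (ap ?s b0) = t (\<Oplus>\<^bsub>restrict_scalars A (V E)\<^esub>b\<in>B Y. ap (Scal C (c b) (em Y (\<beta> Y b))) b0)"
      using ap_finsum[OF Y E H BV[OF Y b0]] by simp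
    also have "\<dots> = (\<Oplus>\<^bsub>K\<^esub>b\<in>B Y. t (ap (Scal C (c b) (em Y (\<beta> Y b))) b0))"
      using t cl by (intro E.KM.functional_finsum) (auto simp: vspace_def)
    also have "\<dots> = (\<Oplus>\<^bsub>K\<^esub>b\<in>B Y. c b \<otimes>\<^bsub>K\<^esub> (if b0 = b then \<one>\<^bsub>K\<^esub> else \<zero>\<^bsub>K\<^esub>))"
    proof (rule K.finsum_cong')
      fix b assume b: "b \<in> B Y"
      note eb = em(1)[OF Y \<beta>[OF Y b]]
      have cb: "c b \<in> carrier K" using c b by auto
      have "t (ap (Scal C (c b) (em Y (\<beta> Y b))) b0) = c b \<otimes>\<^bsub>K\<^esub> t (ap (em Y (\<beta> Y b)) b0)"
        using ap_Scal[OF cb eb BV[OF Y b0]] tD(2)[OF ap_closed[OF eb BV[OF Y b0]] cb] by simp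
      then show "t (ap (Scal C (c b) (em Y (\<beta> Y b))) b0) = c b \<otimes>\<^bsub>K\<^esub> (if b0 = b then \<one>\<^bsub>K\<^esub> else \<zero>\<^bsub>K\<^esub>)"
        using em(2)[OF Y \<beta>[OF Y b] BV[OF Y b0]] delta[OF Y b b0] by auto
    qed (use c in auto)
    also have "\<dots> = c b0" by (rule E.KM.finsum_delta[OF Bf[OF Y] b0 c])
    finally show "c b0 = \<zero>\<^bsub>K\<^esub>" using t0 by simp
  qed
  \<comment> \<open>The summands separate, so each arrow from \<open>P\<close> is zero, and so is
    its value \<open>a b\<close> at \<open>g\<close>.\<close>
  have "\<forall>b\<in>B Y. pm Y (a \<odot>\<^bsub>V Y\<^esub> b) = Zer C P Y"
    by (rule tensor_independent[OF Bf[OF Y] P Y EX[OF Y] _ _ indep vanish])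
      (use pm(1)[OF Y ab] xm[OF Y \<beta>[OF Y]] in auto)
  then have ab0: "a \<odot>\<^bsub>V Y\<^esub> b = \<zero>\<^bsub>V Y\<^esub>" if "b \<in> B Y" for b
    using that pm(2)[OF Y ab[OF that]] ap_Zer[OF P Y g] by simp
  have "a \<odot>\<^bsub>V Y\<^esub> m = a \<odot>\<^bsub>V Y\<^esub> (\<Oplus>\<^bsub>V Y\<^esub>b\<in>B Y. sc Y (\<beta> Y b m) b)" by (rule arg_cong[OF expand[OF Y m]])
  also have "\<dots> = (\<Oplus>\<^bsub>V Y\<^esub>b\<in>B Y. a \<odot>\<^bsub>V Y\<^esub> sc Y (\<beta> Y b m) b)"
    using a(1) \<beta>K[OF Y _ m] BV[OF Y] by (intro Y.finsum_act) auto
  also have "\<dots> = (\<Oplus>\<^bsub>V Y\<^esub>b\<in>B Y. \<zero>\<^bsub>V Y\<^esub>)"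
  proof (rule Y.M.finsum_cong')
    fix b assume b: "b \<in> B Y"
    show "a \<odot>\<^bsub>V Y\<^esub> sc Y (\<beta> Y b m) b = \<zero>\<^bsub>V Y\<^esub>"
      using Y.scalar_act[OF \<beta>K[OF Y b m] a(1) BV[OF Y b]] ab0[OF b] \<beta>K[OF Y b m] by simp
  qed auto
  also have "\<dots> = \<zero>\<^bsub>V Y\<^esub>" by simp
  finally show ?thesis .
qed

text \<open>The annihilator of the unit object annihilates \<open>Y\<close>, which is the premise of
  the decomposition into copies of that simple object.\<close>

lemma counit_object_trivial:
  assumes "central_comonad C Z \<pi>" and Y: "Y \<in> Obj C"
    and "coaction_action (\<pi> \<I>) Y = comonad_counit C \<pi> \<I> \<otimes>\<^sub>a ident Y"
  shows "trivial_object C Y"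
proof -
  have "\<exists>n. is_direct_sum C n (\<lambda>_. \<I>) Y"
    by (rule isotypic_direct_sum[OF Y counit_object_annihilator[OF assms]])
  moreover have "isomorphic C Y Y"
    using ident_Hom[OF Y] ident_left[OF ident_Hom[OF Y]]
    unfolding isomorphic_def iso_arrow_def inverse_arrows_def by blast
  ultimately show ?thesis unfolding trivial_object_def by blast
qed

end

theorem lemma5p2:
  fixes K :: "'k ring" and C :: "('k, 'o, 'm) tcat"
    and Z :: "('o, 'm, 'o, 'm) fctr" and \<pi> :: "'o \<Rightarrow> 'o \<Rightarrow> 'm"
    and R :: "('o, 'm, 'o \<times> ('o \<Rightarrow> 'm), ('o \<times> ('o \<Rightarrow> 'm)) \<times> 'm \<times> ('o \<times> ('o \<Rightarrow> 'm))) fctr"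
    and \<alpha> :: 'o and \<Lambda> :: 'm and I :: "('o, 'm, 'o, 'm) fctr" and j :: "'o \<Rightarrow> 'm"
  assumes "algebraically_closed K"
    and "finite_tensor_category K C"
    and "central_comonad C Z \<pi>"
    and "right_adjoint (drinfeld_center C) C center_forget R"
    and "modular_object C R \<alpha>"
    and "left_integral C Z \<pi> \<alpha> \<Lambda>" and "\<Lambda> \<noteq> Zer C \<I>\<^bsub>C\<^esub> (OMap Z \<alpha>)"
    and "integration_functor C \<pi> \<alpha> \<Lambda> I j"
  shows "\<forall>X\<in>Obj C. trivial_object C (OMap I X)"
proof
  fix X assume X: "X \<in> Obj C"
  interpret T: finite_tensor_category K C by fact
  obtain A :: "('k, nat \<Rightarrow> 'k) module" and V :: "'o \<Rightarrow> (nat \<Rightarrow> 'k, nat \<Rightarrow> 'k) module" and ap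
    where "concrete_linear_category K C A V ap"
    using finite_abelian_category_concrete[OF T.finite_abelian] by blast
  \<comment> \<open>From here the category is treated as one of modules, with the unit object in the
    role of the simple object \<open>S\<close>.\<close>
  then interpret concrete_tensor_category K C A V ap
    using assms(1,2) T.simple_Unit
    by (intro concrete_tensor_category.intro simple_in_concrete.intro simple_in_concrete_axioms.intro)
  have \<alpha>: "\<alpha> \<in> Obj C"
    using assms(5) by (simp add: modular_object_def simple_object_def)
  from assms(8) X obtain c where c: "inverse_arrows C \<I>\<^bsub>C\<^esub> (\<alpha> \<otimes>\<^sub>o\<^bsub>C\<^esub> Dual C \<alpha>) (Coev C \<alpha>) c"
    and img: "is_image C (X \<otimes>\<^sub>o\<^bsub>C\<^esub> Dual C \<alpha>) X
      ((ident\<^bsub>C\<^esub> X \<otimes>\<^sub>a\<^bsub>C\<^esub> c) \<cdot>\<^bsub>C\<^esub> (integral_action C \<pi> \<alpha> \<Lambda> X \<otimes>\<^sub>a\<^bsub>C\<^esub> ident\<^bsub>C\<^esub> (Dual C \<alpha>))) (OMap I X) (j X)"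
    unfolding integration_functor_def by blast
  have cH: "c \<in> Hom C (\<alpha> \<otimes>\<^sub>o\<^bsub>C\<^esub> Dual C \<alpha>) \<I>\<^bsub>C\<^esub>" using c by (simp add: inverse_arrows_def)
  have "OMap I X \<in> Obj C" using img by (simp add: is_image_def)
  then show "trivial_object C (OMap I X)"
    by (rule counit_object_trivial[OF assms(3) _
          counit_on_image[OF assms(3) X img T.integral_projection_relation(2)[OF assms(3) \<alpha> assms(6) X cH]]])
qed

end
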